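(* For all integers $\nu\geq\nu_0$, $$\left\{\mathfrak p\in\mathrm{Proj}(R)\ :\ HP_{\pi_2^{-1}(\mathfrak p)}(\nu)=HP_{\mathbb P^2}(\nu)=\binom{\nu+2}{2}\right\}=\emptyset .$$
   Context: Let $k$ be a field, $S=k[s_0,s_1,s_2]$ and $R=k[x_0,x_1,x_2,x_3]$ (standard graded polynomial rings), $\mathfrak m=(s_0,s_1,s_2)\subset S$. Let $\phi:\mathbb P^2_k\dashrightarrow \mathbb P^3_k$ be a rational map given by four homogeneous polynomials $f_0,f_1,f_2,f_3\in S$ of the same degree $d$, let $I=(f_0,f_1,f_2,f_3)\subset S$, and let $\mathscr S\subset\mathbb P^3_k$ be the closure of the image of $\phi$. Standing assumptions: $\mathscr S$ is a surface, $\phi$ is birational onto $\mathscr S$, and $V(I)\subset\mathbb P^2_k$ is finite and locally a complete intersection. $\mathcal S_I:=\mathrm{Sym}_S(I)$ is the symmetric algebra of $I$, i.e. the quotient of $S[x_0,\dots,x_3]$ by the ideal generated by all $\sum_i g_ix_i$ with $g_i\in S$ and $\sum_i g_if_i=0$. It is graded with respect to the variables $s_j$ ($\deg s_j=1$, $\deg x_i=0$). For $\mathfrak p\in\mathrm{Proj}(R)$ put $\kappa(\mathfrak p)=R_\mathfrak p/\mathfrak pR_\mathfrak p$ and $\pi_2^{-1}(\mathfrak p):=\mathrm{Proj}(\mathcal S_I\otimes_R\kappa(\mathfrak p))\subset\mathbb P^2_{\kappa(\mathfrak p)}$. $HP_{\pi_2^{-1}(\mathfrak p)}$ denotes the Hilbert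 polynomial of this subscheme, i.e. of the graded module $\mathcal S_I\otimes_R\kappa(\mathfrak p)$ over $\kappa(\mathfrak p)[s_0,s_1,s_2]$. $I^{sat}$ is the saturation of $I$ with respect to $\mathfrak m$, $\mathrm{indeg}(N)$ is the smallest degree of a nonzero homogeneous element of a graded module $N$, and $\nu_0:=2d-2-\mathrm{indeg}(I^{sat})$.
   Formalization: The theorem assumes in addition ν ≥ 1: for ν = 0 the claim is false whenever ν₀ = 0, e.g. f = (s₁s₂, s₀s₂, s₀s₁, 0), where ν₀ = 0 and the fibre over (1:1:1:0) is one reduced point, so HP(0) = 1 = binom(2,2). *)

theory Defs
  imports
    "HOL-Library.Poly_Mapping"
    "HOL-Library.Numeral_Type"
    "HOL-Analysis.Abstract_Topology"
    "HOL-Algebra.Algebra"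
    "HOL-Computational_Algebra.Fraction_Field"
    "HOL-Computational_Algebra.Polynomial"
    "Jordan_Normal_Form.VS_Connect"
begin

text \<open>The polynomial ring with variables indexed by \<open>'v\<close>: a polynomial is the finitely supported
  function sending an exponent vector to its coefficient. The numeral types \<open>3\<close> and \<open>4\<close> have
  exactly three and four elements, so \<open>(3, 'k) mpol\<close> is \<open>S = k[s\<^sub>0, s\<^sub>1, s\<^sub>2]\<close> and
  \<open>(4, 'k) mpol\<close> is \<open>R = k[x\<^sub>0, x\<^sub>1, x\<^sub>2, x\<^sub>3]\<close>. All of these are regarded as
  HOL-Algebra rings via \<open>class_ring\<close>.\<close>

type_synonym ('v, 'k) mpol = "('v \<Rightarrow>\<^sub>0 nat) \<Rightarrow>\<^sub>0 'k"

definition Cst :: "'k::zero \<Rightarrow> ('v, 'k) mpol"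
  where "Cst c = Poly_Mapping.single 0 c"

definition Var :: "'v \<Rightarrow> ('v, 'k::zero_neq_one) mpol"
  where "Var i = Poly_Mapping.single (Poly_Mapping.single i 1) 1"

definition mdeg :: "('v::finite \<Rightarrow>\<^sub>0 nat) \<Rightarrow> nat"
  where "mdeg m = (\<Sum>i\<in>UNIV. Poly_Mapping.lookup m i)"

text \<open>The zero polynomial is homogeneous of every degree.\<close>

definition homog :: "nat \<Rightarrow> ('v::finite, 'k::zero) mpol \<Rightarrow> bool"
  where "homog n F \<longleftrightarrow> (\<forall>m\<in>Poly_Mapping.keys F. mdeg m = n)"

definition hcomp :: "nat \<Rightarrow> ('v::finite, 'k::comm_monoid_add) mpol \<Rightarrow> ('v, 'k) mpol"
  where "hcomp n F =
    (\<Sum>m\<in>{m \<in> Poly_Mapping.keys F. mdeg m = n}. Poly_Mapping.single m (Poly_Mapping.lookup F m))"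

definition subst :: "('w::finite \<Rightarrow> ('v, 'k::comm_semiring_1) mpol) \<Rightarrow> ('w, 'k) mpol \<Rightarrow> ('v, 'k) mpol"
  where "subst f F =
    (\<Sum>m\<in>Poly_Mapping.keys F. Cst (Poly_Mapping.lookup F m) * (\<Prod>i\<in>UNIV. f i ^ Poly_Mapping.lookup m i))"

definition indeg :: "('v::finite, 'k::zero) mpol set \<Rightarrow> nat"
  where "indeg N = (LEAST n. \<exists>g\<in>N. g \<noteq> 0 \<and> homog n g)"

definition irrelevant :: "('v::finite, 'k::comm_ring_1) mpol set"
  where "irrelevant = Idl\<^bsub>class_ring\<^esub> (range Var)"

definition ideal_power :: "('a, 'b) ring_scheme \<Rightarrow> 'a set \<Rightarrow> nat \<Rightarrow> 'a set"
  where "ideal_power A I n = (ideal_prod A I ^^ n) (carrier A)"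

definition saturation :: "('v::finite, 'k::comm_ring_1) mpol set \<Rightarrow> ('v, 'k) mpol set"
  where "saturation I = {g. \<exists>N. \<forall>h\<in>ideal_power class_ring irrelevant N. h * g \<in> I}"

definition Proj :: "('v::finite, 'k::comm_ring_1) mpol set set"
  where "Proj = {p. primeideal p class_ring \<and> (\<forall>F\<in>p. \<forall>n. hcomp n F \<in> p) \<and> \<not> irrelevant \<subseteq> p}"

definition Vplus :: "('v::finite, 'k::comm_ring_1) mpol set \<Rightarrow> ('v, 'k) mpol set set"
  where "Vplus E = {p \<in> Proj. E \<subseteq> p}"

definition zariski :: "('v::finite, 'k::comm_ring_1) mpol set topology"
  where "zariski = topology (\<lambda>U. \<exists>E. U = Proj - Vplus E)"

lemma Vplus_Un:
  fixes E F :: "('v::finite, 'k::comm_ring_1) mpol set"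
  shows "Vplus E \<union> Vplus F = Vplus ((\<lambda>(a, b). a * b) ` (E \<times> F))"
proof -
  let ?G = "(\<lambda>(a, b). a * b) ` (E \<times> F)"
  have "?G \<subseteq> p \<longleftrightarrow> E \<subseteq> p \<or> F \<subseteq> p" if "p \<in> Proj" for p :: "('v, 'k) mpol set"
  proof
    have P: "primeideal p class_ring" using that unfolding Proj_def by blast
    assume G: "?G \<subseteq> p"
    show "E \<subseteq> p \<or> F \<subseteq> p"
    proof (rule ccontr)
      assume "\<not> (E \<subseteq> p \<or> F \<subseteq> p)"
      then obtain a b where ab: "a \<in> E" "b \<in> F" "a \<notin> p" "b \<notin> p" by blast
      then have "a * b \<in> p" using G by (force intro: subsetD)
      then show False using primeideal.I_prime[OF P, of a b] ab(3,4) by (auto simp del: mult_cancel_left)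
    qed
  next
    have "ideal p class_ring"
      using that unfolding Proj_def by (blast dest: primeideal.axioms(1))
    then have I: "a * b \<in> p" if "a \<in> p \<or> b \<in> p" for a b
      using that ideal.I_l_closed[of p class_ring b a] ideal.I_r_closed[of p class_ring a b] by auto
    assume "E \<subseteq> p \<or> F \<subseteq> p"
    then show "?G \<subseteq> p"
      by (intro subsetI) (elim imageE, clarify, rule I, blast)
  qed
  then show ?thesis unfolding Vplus_def by blast
qed

lemma istopology_zariski:
  "istopology (\<lambda>U::('v::finite, 'k::comm_ring_1) mpol set set. \<exists>E. U = Proj - Vplus E)"
  unfolding istopology_def
proof (intro conjI allI impI)
  fix U V :: "('v, 'k) mpol set set"
  assume "\<exists>E. U = Proj - Vplus E" "\<exists>E. V = Proj - Vplus E"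
  then obtain E F where "U = Proj - Vplus E" "V = Proj - Vplus F" by (elim exE)
  then have "U \<inter> V = Proj - (Vplus E \<union> Vplus F)" by blast
  then show "\<exists>E. U \<inter> V = Proj - Vplus E" unfolding Vplus_Un by (rule exI)
next
  fix \<U> :: "('v, 'k) mpol set set set"
  assume "\<forall>U\<in>\<U>. \<exists>E. U = Proj - Vplus E"
  then obtain e where e: "\<And>U. U \<in> \<U> \<Longrightarrow> U = Proj - Vplus (e U)" by (elim bchoice[THEN exE]) blast
  have "\<Union>\<U> = (\<Union>U\<in>\<U>. Proj - Vplus (e U))"
    using SUP_cong[OF refl e, of \<U> "\<lambda>U. U"] by simp
  also have "\<dots> = Proj - Vplus (\<Union>U\<in>\<U>. e U)" unfolding Vplus_def by blast
  finally show "\<exists>E. \<Union>\<U> = Proj - Vplus E" by (rule exI)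
qed

lemma openin_zariski: "openin zariski U \<longleftrightarrow> (\<exists>E. U = Proj - Vplus E)"
  unfolding zariski_def by (simp add: topology_inverse'[OF istopology_zariski])

definition irred_closed :: "'a topology \<Rightarrow> 'a set \<Rightarrow> bool"
  where "irred_closed T C \<longleftrightarrow> closedin T C \<and> C \<noteq> {} \<and>
    (\<forall>A B. closedin T A \<and> closedin T B \<and> C \<subseteq> A \<union> B \<longrightarrow> C \<subseteq> A \<or> C \<subseteq> B)"

definition irred_chain :: "'a topology \<Rightarrow> nat \<Rightarrow> (nat \<Rightarrow> 'a set) \<Rightarrow> bool"
  where "irred_chain T n c \<longleftrightarrow> (\<forall>i\<le>n. irred_closed T (c i)) \<and> (\<forall>i<n. c i \<subset> c (Suc i))"

definition has_dimension :: "'a topology \<Rightarrow> nat \<Rightarrow> bool"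
  where "has_dimension T n \<longleftrightarrow> (\<exists>c. irred_chain T n c) \<and> \<not> (\<exists>c. irred_chain T (Suc n) c)"

definition fideal :: "(4 \<Rightarrow> (3, 'k::field) mpol) \<Rightarrow> (3, 'k) mpol set"
  where "fideal f = Idl\<^bsub>class_ring\<^esub> (range f)"

text \<open>The map on scheme points: it sends a homogeneous prime \<open>q\<close> of \<open>S\<close> not containing
  all the \<open>f\<^sub>i\<close> to its preimage under \<open>R \<rightarrow> S\<close>, \<open>x\<^sub>i \<mapsto> f\<^sub>i\<close>.\<close>

definition phi :: "(4 \<Rightarrow> (3, 'k::field) mpol) \<Rightarrow> (3, 'k) mpol set \<Rightarrow> (4, 'k) mpol set"
  where "phi f q = {F. subst f F \<in> q}"

definition image_closure :: "(4 \<Rightarrow> (3, 'k::field) mpol) \<Rightarrow> (4, 'k) mpol set set"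
  where "image_closure f = zariski closure_of (phi f ` (Proj - Vplus (fideal f)))"

definition is_surface :: "(4, 'k::field) mpol set set \<Rightarrow> bool"
  where "is_surface Y \<longleftrightarrow> has_dimension (subtopology zariski Y) 2"

text \<open>Birationality onto the (irreducible, reduced) closed subscheme \<open>Y\<close>, whose homogeneous ideal is
  the intersection of its points: there is a rational map \<open>(a\<^sub>0 : a\<^sub>1 : a\<^sub>2)\<close> from \<open>Y\<close> to the
  plane, given by forms of equal degree not all vanishing on \<open>Y\<close>, which is inverse to the given map.
  The first condition on \<open>i j\<close> says that the composite on the plane is the identity, the second that
  the composite on \<open>Y\<close> is; the non-vanishing clauses make the composites defined.\<close>

definition birational_onto :: "(4 \<Rightarrow> (3, 'k::field) mpol) \<Rightarrow> (4, 'k) mpol set set \<Rightarrow> bool"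
  where "birational_onto f Y \<longleftrightarrow>
    (\<exists>(a :: 3 \<Rightarrow> (4, 'k) mpol) e.
      (\<forall>i. homog e (a i)) \<and>
      (\<exists>i. a i \<notin> \<Inter>Y) \<and>
      (\<exists>i. subst f (a i) \<noteq> 0) \<and>
      (\<forall>i j. subst f (a i) * Var j = subst f (a j) * Var i) \<and>
      (\<exists>i. subst a (f i) \<notin> \<Inter>Y) \<and>
      (\<forall>i j. subst a (f i) * Var j - subst a (f j) * Var i \<in> \<Inter>Y))"

definition regular_seq :: "('a, 'b) ring_scheme \<Rightarrow> 'a list \<Rightarrow> bool"
  where "regular_seq A rs \<longleftrightarrow> set rs \<subseteq> carrier A \<and> Idl\<^bsub>A\<^esub> (set rs) \<noteq> carrier A \<and>
    (\<forall>i<length rs. \<forall>x\<in>carrier A.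
      rs ! i \<otimes>\<^bsub>A\<^esub> x \<in> Idl\<^bsub>A\<^esub> (set (take i rs)) \<longrightarrow> x \<in> Idl\<^bsub>A\<^esub> (set (take i rs)))"

text \<open>The local ring of the plane at \<open>q\<close> (degree-zero fractions with denominator outside \<open>q\<close>) and
  the stalk at \<open>q\<close> of the ideal sheaf associated with \<open>I\<close>.\<close>

definition plane_stalk :: "(3, 'k::field) mpol set \<Rightarrow> (3, 'k) mpol fract ring"
  where "plane_stalk q =
    class_ring\<lparr>carrier := {Fract a b | a b n. homog n a \<and> homog n b \<and> b \<notin> q}\<rparr>"

definition ideal_stalk :: "(3, 'k::field) mpol set \<Rightarrow> (3, 'k) mpol set \<Rightarrow> (3, 'k) mpol fract set"
  where "ideal_stalk I q = {Fract a b | a b n. a \<in> I \<and> homog n a \<and> homog n b \<and> b \<notin> q}"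

definition locally_ci :: "(3, 'k::field) mpol set \<Rightarrow> bool"
  where "locally_ci I \<longleftrightarrow> (\<forall>q\<in>Vplus I. \<exists>rs. regular_seq (plane_stalk q) rs \<and>
    Idl\<^bsub>plane_stalk q\<^esub> (set rs) = ideal_stalk I q)"

definition nu0 :: "nat \<Rightarrow> (4 \<Rightarrow> (3, 'k::field) mpol) \<Rightarrow> int"
  where "nu0 d f = 2 * int d - 2 - int (indeg (saturation (fideal f)))"

definition local_ring :: "(4, 'k::field) mpol set \<Rightarrow> (4, 'k) mpol fract ring"
  where "local_ring p = class_ring\<lparr>carrier := {Fract a b | a b. b \<notin> p}\<rparr>"

definition local_max :: "(4, 'k::field) mpol set \<Rightarrow> (4, 'k) mpol fract set"
  where "local_max p = Idl\<^bsub>local_ring p\<^esub> ((\<lambda>a. Fract a 1) ` p)"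

definition kappa :: "(4, 'k::field) mpol set \<Rightarrow> (4, 'k) mpol fract set ring"
  where "kappa p = local_ring p Quot local_max p"

definition to_kappa :: "(4, 'k::field) mpol set \<Rightarrow> (4, 'k) mpol \<Rightarrow> (4, 'k) mpol fract set"
  where "to_kappa p r = local_max p +>\<^bsub>local_ring p\<^esub> Fract r 1"

text \<open>For a module \<open>M\<close> over \<open>A\<close> and a ring homomorphism \<open>\<rho>\<close> from \<open>A\<close> to \<open>K\<close>, the tensor
  product of \<open>M\<close> and \<open>K\<close> over \<open>A\<close> is the free abelian group on the pairs modulo the usual
  relations; \<open>K\<close> acts on the second factor. The fields \<open>mult\<close> and \<open>one\<close> of the module record
  play no role.\<close>

definition tensor_rels ::
    "('r, 'a) ring_scheme \<Rightarrow> ('r, 'm, 'b) module_scheme \<Rightarrow> ('s, 'c) ring_scheme \<Rightarrow> ('r \<Rightarrow> 's)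
      \<Rightarrow> ('m \<times> 's \<Rightarrow>\<^sub>0 int) set"
  where "tensor_rels A M K \<rho> =
    {frag_of (x \<oplus>\<^bsub>M\<^esub> y, a) - frag_of (x, a) - frag_of (y, a) | x y a.
       x \<in> carrier M \<and> y \<in> carrier M \<and> a \<in> carrier K} \<union>
    {frag_of (x, a \<oplus>\<^bsub>K\<^esub> b) - frag_of (x, a) - frag_of (x, b) | x a b.
       x \<in> carrier M \<and> a \<in> carrier K \<and> b \<in> carrier K} \<union>
    {frag_of (r \<odot>\<^bsub>M\<^esub> x, a) - frag_of (x, \<rho> r \<otimes>\<^bsub>K\<^esub> a) | r x a.
       r \<in> carrier A \<and> x \<in> carrier M \<and> a \<in> carrier K}"

definition tensor_sub ::
    "('r, 'a) ring_scheme \<Rightarrow> ('r, 'm, 'b) module_scheme \<Rightarrow> ('s, 'c) ring_scheme \<Rightarrow> ('r \<Rightarrow> 's)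
      \<Rightarrow> ('m \<times> 's \<Rightarrow>\<^sub>0 int) set"
  where "tensor_sub A M K \<rho> =
    generate (free_Abelian_group (carrier M \<times> carrier K)) (tensor_rels A M K \<rho>)"

definition base_change ::
    "('r, 'a) ring_scheme \<Rightarrow> ('r, 'm, 'b) module_scheme \<Rightarrow> ('s, 'c) ring_scheme \<Rightarrow> ('r \<Rightarrow> 's)
      \<Rightarrow> ('s, ('m \<times> 's \<Rightarrow>\<^sub>0 int) set) module"
  where "base_change A M K \<rho> =
    (let G = free_Abelian_group (carrier M \<times> carrier K); H = tensor_sub A M K \<rho> in
     \<lparr>carrier = carrier (G Mod H), monoid.mult = undefined, monoid.one = undefined,
      ring.zero = \<one>\<^bsub>G Mod H\<^esub>, ring.add = (\<otimes>\<^bsub>G Mod H\<^esub>),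
      module.smult = (\<lambda>c U. \<Union>t\<in>U. H #>\<^bsub>G\<^esub> frag_extend (\<lambda>(x, a). frag_of (x, c \<otimes>\<^bsub>K\<^esub> a)) t)\<rparr>)"

text \<open>The image in the tensor product of the sums of \<open>x \<otimes> a\<close> with \<open>x\<close> in a subgroup \<open>N\<close> of \<open>M\<close>.\<close>

definition base_change_part ::
    "('r, 'a) ring_scheme \<Rightarrow> ('r, 'm, 'b) module_scheme \<Rightarrow> ('s, 'c) ring_scheme \<Rightarrow> ('r \<Rightarrow> 's)
      \<Rightarrow> 'm set \<Rightarrow> ('m \<times> 's \<Rightarrow>\<^sub>0 int) set set"
  where "base_change_part A M K \<rho> N =
    {tensor_sub A M K \<rho> #>\<^bsub>free_Abelian_group (carrier M \<times> carrier K)\<^esub> t | t.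
      t \<in> carrier (free_Abelian_group (N \<times> carrier K))}"

definition sym_ideal :: "(4 \<Rightarrow> (3, 'k::field) mpol) \<Rightarrow> (4, (3, 'k) mpol) mpol set"
  where "sym_ideal f =
    Idl\<^bsub>class_ring\<^esub> {\<Sum>i\<in>UNIV. Cst (g i) * Var i | g. (\<Sum>i\<in>UNIV. g i * f i) = 0}"

text \<open>The symmetric algebra, as a quotient of \<open>S[x\<^sub>0, \<dots>, x\<^sub>3]\<close>, with its structure of module
  over \<open>R\<close>, which acts through the coefficientwise inclusion of \<open>R\<close> in \<open>S[x\<^sub>0, \<dots>, x\<^sub>3]\<close>.\<close>

definition sym_alg :: "(4 \<Rightarrow> (3, 'k::field) mpol) \<Rightarrow> ((4, 'k) mpol, (4, (3, 'k) mpol) mpol set) module"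
  where "sym_alg f =
    (let Q = class_ring Quot sym_ideal f in
     \<lparr>carrier = carrier Q, monoid.mult = (\<otimes>\<^bsub>Q\<^esub>), monoid.one = \<one>\<^bsub>Q\<^esub>,
      ring.zero = \<zero>\<^bsub>Q\<^esub>, ring.add = (\<oplus>\<^bsub>Q\<^esub>),
      module.smult = (\<lambda>r U. (sym_ideal f +>\<^bsub>class_ring\<^esub> Poly_Mapping.map Cst r) \<otimes>\<^bsub>Q\<^esub> U)\<rparr>)"

text \<open>The grading has the \<open>s\<^sub>j\<close> in degree 1 and the \<open>x\<^sub>i\<close> in degree 0.\<close>

definition sym_part :: "(4 \<Rightarrow> (3, 'k::field) mpol) \<Rightarrow> nat \<Rightarrow> (4, (3, 'k) mpol) mpol set set"
  where "sym_part f n =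
    {sym_ideal f +>\<^bsub>class_ring\<^esub> b | b. \<forall>m. homog n (Poly_Mapping.lookup b m)}"

definition fibre_part ::
    "(4 \<Rightarrow> (3, 'k::field) mpol) \<Rightarrow> (4, 'k) mpol set \<Rightarrow> nat \<Rightarrow>
      ((4, 'k) mpol fract set, ((4, (3, 'k) mpol) mpol set \<times> (4, 'k) mpol fract set \<Rightarrow>\<^sub>0 int) set) module"
  where "fibre_part f p n =
    base_change class_ring (sym_alg f) (kappa p) (to_kappa p)
      \<lparr>carrier := base_change_part class_ring (sym_alg f) (kappa p) (to_kappa p) (sym_part f n)\<rparr>"

definition hilbert_poly :: "(nat \<Rightarrow> nat) \<Rightarrow> rat poly"
  where "hilbert_poly h = (THE P. \<forall>\<^sub>F n in sequentially. poly P (of_nat n) = of_nat (h n))"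

definition HP_fibre :: "(4 \<Rightarrow> (3, 'k::field) mpol) \<Rightarrow> (4, 'k) mpol set \<Rightarrow> rat poly"
  where "HP_fibre f p = hilbert_poly (\<lambda>n. vectorspace.dim (kappa p) (fibre_part f p n))"

definition plane_part :: "nat \<Rightarrow> ('k::field, (3, 'k) mpol) module"
  where "plane_part n =
    \<lparr>carrier = {F. homog n F}, monoid.mult = (*), monoid.one = 1, ring.zero = 0, ring.add = (+),
     module.smult = (\<lambda>c F. Cst c * F)\<rparr>"

definition HP_plane :: "'k::field itself \<Rightarrow> rat poly"
  where "HP_plane _ =
    hilbert_poly (\<lambda>n. vectorspace.dim class_ring (plane_part n :: ('k, (3, 'k) mpol) module))"

end

theory Submission
  imports Defs "Berlekamp_Zassenhaus.Unique_Factorization_Poly"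
begin

text \<open>
  Over the residue field at a point \<open>x\<close>, the fibre is cut out by the ideal \<open>J\<close> of all \<open>\<Sum> x\<^sub>i g\<^sub>i\<close> with
  \<open>g\<close> a syzygy of \<open>f\<close>, and \<open>J = U : f\<^sub>s\<close> where \<open>U\<close> is generated by the \<open>t\<^sub>i = f\<^sub>i - (x\<^sub>i / x\<^sub>s) f\<^sub>s\<close>.
  Writing \<open>t\<^sub>i = h k\<^sub>i\<close> with \<open>h\<close> the greatest common divisor, of degree \<open>e\<close>, one has \<open>J = h (K : f\<^sub>s)\<close>
  where \<open>K\<close> is generated by the \<open>k\<^sub>i\<close>, of degree \<open>a = d - e\<close>, and \<open>K : f\<^sub>s\<close> has a finite colength \<open>\<delta>\<close> in large degrees.
  Hence the Hilbert polynomial agrees with that of the plane at \<open>\<nu>\<close> exactly if \<open>2\<delta> = (m + 2)(m + 1)\<close>, \<open>m = \<nu> - e\<close>.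

  Two general members \<open>u\<close>, \<open>v\<close> of \<open>K\<close> are coprime, so \<open>\<delta>\<close> is bounded by liaison in the complete intersection
  \<open>(u, v)\<close>: the condition \<open>\<nu> \<ge> 2d - 2 - indeg I\<^sup>s\<^sup>a\<^sup>t\<close> makes a residual Hilbert function vanish and gives
  \<open>2\<delta> \<le> (m + 2)(m + 1)\<close>, with equality only for \<open>K = (u, v)\<close>. In that case the \<open>f\<^sub>i\<close> are linearly dependent, the
  surface is a plane, and birationality together with local complete intersection forces \<open>deg I \<ge> d\<^sup>2 - 1\<close>, that is
  \<open>\<delta> + a e \<le> 1\<close>, which contradicts the equality.
\<close>

section \<open>Dimensions of finite-dimensional subspaces\<close>

text \<open>Three obstacles shape the proof. The general members \<open>u\<close> and
  \<open>v\<close>, and the linear form that compares large degrees, exist only over an infinite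
  field, whereas a residue field may be finite; so the fibre is studied over the rational functions
  over it. No basis of a large field over a small one is ever fixed: each descent expands the
  finitely many scalars at hand in a finite independent family. Secondly, the local complete
  intersection hypothesis concerns primes over \<open>k\<close> but is needed at primes over an
  extension, from which it is reached by contraction. Thirdly, fibres are tensor products over a
  residue field that depends on a prime, while the algebra is done over types; since the theorem is
  proved by contradiction, one prime can be chosen for each \<open>k\<close> and its residue field
  made a type. The bound \<open>deg I \<ge> d\<^sup>2 - 1\<close> comes from the generic point of
  the image. Over the fraction field of \<open>S\<close> its fibre is the generic point of the
  plane, of length one, and for dependent forms this fibre is what remains of an intersection of two
  curves of degree \<open>d\<close> after \<open>V(I)\<close> is removed.\<close>

abbreviation mscale :: "'k \<Rightarrow> ('v, 'k::field) mpol \<Rightarrow> ('v::{finite,linorder}, 'k) mpol"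
  where "mscale \<equiv> \<lambda>c F. Cst c * F"

interpretation mvs: vector_space "mscale :: 'k::field \<Rightarrow> ('v::{finite,linorder}, 'k) mpol \<Rightarrow> _"
proof
  fix a b :: 'k and x y :: "('v, 'k) mpol"
  show "Cst (a + b) * x = Cst a * x + Cst b * x" by (simp add: Cst_def single_add distrib_right)
  show "Cst a * (Cst b * x) = Cst (a * b) * x"
    by (simp add: Cst_def mult_single mult.assoc[symmetric])
qed (simp_all add: Cst_def distrib_left)

text \<open>The space of all polynomials is infinite dimensional, and \<open>mvs.dim\<close> is the
  cardinality of a basis, hence 0 for an infinite one. Dimension is therefore monotone only inside a
  finitely spanned space.\<close>

definition fin_dim :: "('v::{finite,linorder}, 'k::field) mpol set \<Rightarrow> bool"
  where "fin_dim V \<longleftrightarrow> (\<exists>B. finite B \<and> V \<subseteq> mvs.span B)"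

lemma fin_dim_mono: "fin_dim W \<Longrightarrow> V \<subseteq> W \<Longrightarrow> fin_dim V"
  unfolding fin_dim_def by blast

lemma fin_dim_finite_independent:
  assumes "fin_dim V" "mvs.independent B" "B \<subseteq> V"
  shows "finite B"
proof -
  obtain C where "finite C" "V \<subseteq> mvs.span C" using assms(1) unfolding fin_dim_def by blast
  then show ?thesis using mvs.independent_span_bound[OF _ assms(2), of C] assms(3) by blast
qed

lemma dim_mono_fin_dim:
  assumes "fin_dim W" "V \<subseteq> W"
  shows "mvs.dim V \<le> mvs.dim W"
proof -
  obtain B where B: "B \<subseteq> V" "mvs.independent B" "V \<subseteq> mvs.span B" "card B = mvs.dim V"
    by (rule mvs.basis_exists)
  obtain C where C: "C \<subseteq> W" "mvs.independent C" "W \<subseteq> mvs.span C" "card C = mvs.dim W"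
    by (rule mvs.basis_exists)
  have "finite C" using fin_dim_finite_independent[OF assms(1) C(2,1)] .
  moreover have "B \<subseteq> mvs.span C" using B(1) assms(2) C(3) by blast
  ultimately show ?thesis using mvs.independent_span_bound[of C B] B C by simp
qed

lemma subspace_eq_if_dim_le:
  assumes "fin_dim W" "V \<subseteq> W" "mvs.subspace V" "mvs.dim W \<le> mvs.dim V"
  shows "V = W"
proof -
  obtain B where B: "B \<subseteq> V" "mvs.independent B" "V \<subseteq> mvs.span B" "card B = mvs.dim V"
    by (rule mvs.basis_exists)
  obtain C where C: "B \<subseteq> C" "C \<subseteq> W" "mvs.independent C" "W \<subseteq> mvs.span C"
    using mvs.maximal_independent_subset_extend[of B W] B(1,2) assms(2) by blast
  have fin: "finite C" using fin_dim_finite_independent[OF assms(1) C(3,2)] .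
  have "card C = mvs.dim W" using mvs.basis_card_eq_dim[OF C(2,4,3)] .
  then have "C = B" using card_seteq[OF fin C(1)] B(4) assms(4) by simp
  then have "W \<subseteq> V" using C(4) B(1) mvs.span_minimal[OF B(1) assms(3)] by blast
  then show ?thesis using assms(2) by blast
qed

text \<open>A basis \<open>B\<close> of the intersection is extended to bases \<open>C\<close> and
  \<open>D\<close>; the point is that \<open>C\<close> together with \<open>D - B\<close> stays
  independent.\<close>

lemma dim_sums_Int_fin_dim:
  assumes S: "mvs.subspace S" "fin_dim S" and T: "mvs.subspace T" "fin_dim T"
  shows "mvs.dim {x + y |x y. x \<in> S \<and> y \<in> T} + mvs.dim (S \<inter> T) = mvs.dim S + mvs.dim T"
proof -
  obtain B where B: "B \<subseteq> S \<inter> T" "mvs.independent B" "S \<inter> T \<subseteq> mvs.span B" "card B = mvs.dim (S \<inter> T)"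
    by (rule mvs.basis_exists)
  obtain C where C: "B \<subseteq> C" "C \<subseteq> S" "mvs.independent C" "S \<subseteq> mvs.span C"
    using mvs.maximal_independent_subset_extend[of B S] B(1,2) by blast
  obtain D where D: "B \<subseteq> D" "D \<subseteq> T" "mvs.independent D" "T \<subseteq> mvs.span D"
    using mvs.maximal_independent_subset_extend[of B T] B(1,2) by blast
  have fin: "finite C" "finite D"
    using fin_dim_finite_independent C D S T by blast+
  have spS: "mvs.span C = S" and spT: "mvs.span D = T"
    using mvs.span_subspace[OF C(2,4) S(1)] mvs.span_subspace[OF D(2,4) T(1)] by auto
  have ind: "mvs.independent (C \<union> E) \<and> C \<inter> E = {}" if "finite E" "E \<subseteq> D - B" for E
    using that
  proof (induction E)
    case empty
    show ?case using C(3) by simp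
  next
    case (insert e E)
    have IH: "mvs.independent (C \<union> E)" "C \<inter> E = {}" using insert by auto
    have "e \<notin> mvs.span (C \<union> E)"
    proof
      assume "e \<in> mvs.span (C \<union> E)"
      then obtain c y where cy: "e = c + y" "c \<in> mvs.span C" "y \<in> mvs.span E" unfolding mvs.span_Un by blast
      have "y \<in> mvs.span D" using cy(3) mvs.span_mono[of E D] insert(4) by blast
      moreover have "e \<in> mvs.span D" using insert(4) by (blast intro: mvs.span_base)
      \<comment> \<open>The part of \<open>e\<close> in the span of \<open>C\<close> is
        \<open>e - y\<close>. It lies in \<open>S\<close> and in \<open>T\<close>, hence in the span
        of \<open>B\<close>, and this would express \<open>e\<close> by other members of
        \<open>D\<close>.\<close>
      ultimately have "e - y \<in> T" using spT mvs.span_diff by blast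
      then have "c \<in> S \<inter> T" using cy spS by simp
      then have "c \<in> mvs.span B" using B(3) by blast
      then have "e \<in> mvs.span (B \<union> E)" using cy unfolding mvs.span_Un by blast
      moreover have "B \<union> E \<subseteq> D - {e}" using D(1) insert(2,4) by blast
      ultimately have "e \<in> mvs.span (D - {e})" using mvs.span_mono by blast
      then show False using D(3) insert(4) unfolding mvs.dependent_def by blast
    qed
    then show ?case using IH mvs.independent_insertI[of e "C \<union> E"] mvs.span_base[of e "C \<union> E"] by auto
  qed
  have ind: "mvs.independent (C \<union> (D - B))" "C \<inter> (D - B) = {}" using ind[of "D - B"] fin by auto
  have CD: "C \<union> (D - B) = C \<union> D" using C(1) D(1) by blast
  have "mvs.span (C \<union> D) = {x + y |x y. x \<in> S \<and> y \<in> T}"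
    unfolding mvs.span_Un spS spT ..
  then have "mvs.dim {x + y |x y. x \<in> S \<and> y \<in> T} = card (C \<union> (D - B))"
    using mvs.dim_span[of "C \<union> D"] mvs.dim_eq_card_independent[OF ind(1)] CD by simp
  also have "\<dots> = card C + (card D - card B)"
    using ind(2) fin D(1) by (simp add: card_Un_disjoint card_Diff_subset finite_subset)
  finally show ?thesis
    using B(4) mvs.basis_card_eq_dim[OF C(2,4,3)] mvs.basis_card_eq_dim[OF D(2,4,3)] card_mono[OF fin(2) D(1)]
    by simp
qed

lemma dim_image_inj_on_span:
  fixes f :: "('v::{finite,linorder}, 'k::field) mpol \<Rightarrow> ('v, 'k) mpol"
  assumes f: "Vector_Spaces.linear mscale mscale f" and "inj_on f (mvs.span V)"
  shows "mvs.dim (f ` V) = mvs.dim V"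
proof -
  interpret Vector_Spaces.linear mscale mscale f by fact
  obtain B where B: "B \<subseteq> V" "mvs.independent B" "V \<subseteq> mvs.span B" "card B = mvs.dim V"
    by (rule mvs.basis_exists)
  have inj: "inj_on f (mvs.span B)" using assms(2) mvs.span_mono[OF B(1)] inj_on_subset by blast
  have "mvs.independent (f ` B)" by (rule independent_inj_on_image[OF B(2) inj])
  moreover have "f ` V \<subseteq> mvs.span (f ` B)" using B(3) spans_image by blast
  ultimately have "card (f ` B) = mvs.dim (f ` V)"
    by (intro mvs.basis_card_eq_dim image_mono B(1))
  moreover have "card (f ` B) = card B"
    by (rule card_image) (rule inj_on_subset[OF inj mvs.span_superset])
  ultimately show ?thesis using B(4) by simp
qed

lemma fin_dim_sums:
  assumes "fin_dim S" "fin_dim T"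
  shows "fin_dim {x + y |x y. x \<in> S \<and> y \<in> T}"
proof -
  obtain B C where "finite B" "S \<subseteq> mvs.span B" "finite C" "T \<subseteq> mvs.span C"
    using assms unfolding fin_dim_def by blast
  then have "{x + y |x y. x \<in> S \<and> y \<in> T} \<subseteq> mvs.span (B \<union> C)" unfolding mvs.span_Un by blast
  then show ?thesis unfolding fin_dim_def using \<open>finite B\<close> \<open>finite C\<close> by (meson finite_UnI)
qed

text \<open>Realises the quotient of \<open>W\<close> by \<open>V\<close> inside the polynomials, as
  the image of an endomorphism with kernel \<open>V\<close>. A graded part of the fibre, which is an
  abstract quotient, is later compared with such an image.\<close>

lemma exists_projection:
  fixes V W :: "('v::{finite,linorder}, 'k::field) mpol set"
  assumes "mvs.subspace V" "V \<subseteq> W" "mvs.subspace W" "fin_dim W"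
  shows "\<exists>\<pi>. Vector_Spaces.linear mscale mscale \<pi> \<and> (\<forall>x\<in>W. \<pi> x = 0 \<longleftrightarrow> x \<in> V) \<and>
    \<pi> ` W \<subseteq> W \<and> mvs.dim (\<pi> ` W) = mvs.dim W - mvs.dim V"
proof -
  obtain B where B: "B \<subseteq> V" "mvs.independent B" "V \<subseteq> mvs.span B" "card B = mvs.dim V"
    by (rule mvs.basis_exists)
  obtain C where C: "B \<subseteq> C" "C \<subseteq> W" "mvs.independent C" "W \<subseteq> mvs.span C"
    using mvs.maximal_independent_subset_extend[of B W] B(1,2) assms(2) by blast
  have fin: "finite C" using fin_dim_finite_independent[OF assms(4) C(3,2)] .
  have spW: "mvs.span C = W" using mvs.span_subspace[OF C(2,4) assms(3)] .
  have spV: "mvs.span B = V" using mvs.span_subspace[OF B(1,3) assms(1)] .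
  have "vector_space_pair mscale mscale" by (simp add: vector_space_pair_def mvs.vector_space_axioms)
  then obtain \<pi> where lin: "Vector_Spaces.linear mscale mscale \<pi>"
    and \<pi>: "\<forall>x\<in>C. \<pi> x = (if x \<in> B then 0 else x)"
    using vector_space_pair.linear_independent_extend[OF _ C(3), of mscale "\<lambda>x. if x \<in> B then 0 else x"]
    by blast
  interpret Vector_Spaces.linear mscale mscale \<pi> by fact
  have im: "\<pi> ` W = mvs.span (C - B)"
  proof -
    have "\<pi> ` W = mvs.span (\<pi> ` C)" using span_image[of C] spW by simp
    also have "\<dots> = mvs.span (C - B)"
    proof (rule antisym; rule mvs.span_minimal[OF _ mvs.subspace_span])
      show "\<pi> ` C \<subseteq> mvs.span (C - B)" using \<pi> by (auto intro: mvs.span_base mvs.span_zero)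
      show "C - B \<subseteq> mvs.span (\<pi> ` C)"
      proof
        fix x assume "x \<in> C - B"
        then have "\<pi> x = x" "x \<in> C" using \<pi> by auto
        then show "x \<in> mvs.span (\<pi> ` C)" by (metis imageI mvs.span_base)
      qed
    qed
    finally show ?thesis .
  qed
  have ind: "mvs.independent (C - B)" using mvs.independent_mono[OF C(3)] by blast
  have id: "\<pi> x = x" if "x \<in> mvs.span (C - B)" for x
    using that
  proof (induction rule: mvs.span_induct_alt)
    case base then show ?case by simp
  next
    case (step c x y) then show ?case using \<pi> by (simp add: add scale)
  qed
  have zero: "\<pi> x = 0" if "x \<in> mvs.span B" for x
    using that
  proof (induction rule: mvs.span_induct_alt)
    case base then show ?case by simp
  next
    case (step c x y) then show ?case using \<pi> C(1) by (auto simp add: add scale)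
  qed
  have ker: "\<pi> x = 0 \<longleftrightarrow> x \<in> V" if "x \<in> W" for x
  proof
    assume "x \<in> V" then show "\<pi> x = 0" using zero spV by simp
  next
    assume 0: "\<pi> x = 0"
    have "C = B \<union> (C - B)" using C(1) by blast
    then have "x \<in> mvs.span (B \<union> (C - B))" using that spW by simp
    then obtain y z where "x = y + z" "y \<in> mvs.span B" "z \<in> mvs.span (C - B)" unfolding mvs.span_Un by blast
    then show "x \<in> V" using 0 id[of z] zero[of y] spV by (simp add: add)
  qed
  have "mvs.dim (\<pi> ` W) = card (C - B)"
    using im mvs.dim_span mvs.dim_eq_card_independent[OF ind] by metis
  also have "\<dots> = mvs.dim W - mvs.dim V"
    using fin C(1) B(4) mvs.basis_card_eq_dim[OF C(2,4,3)] by (simp add: card_Diff_subset finite_subset)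
  finally have "mvs.dim (\<pi> ` W) = mvs.dim W - mvs.dim V" .
  moreover have "\<pi> ` W \<subseteq> W"
    using im mvs.span_mono[of "C - B" C] spW by blast
  ultimately show ?thesis using lin ker by blast
qed


section \<open>Forms\<close>

text \<open>The ring as a module over itself: \<open>mul.subspace\<close> then means ideal and
  \<open>mul.span\<close> generated ideal, so the theory of spans serves for ideals.\<close>

interpretation mul: Modules.module "(*) :: 'a::comm_ring_1 \<Rightarrow> 'a \<Rightarrow> 'a"
  by standard (simp_all add: algebra_simps)

declare mul.scale_scale [simp del] mvs.scale_scale [simp del]

abbreviation coef :: "('v, 'k::zero) mpol \<Rightarrow> ('v \<Rightarrow>\<^sub>0 nat) \<Rightarrow> 'k"
  where "coef \<equiv> Poly_Mapping.lookup"

abbreviation mon :: "('v \<Rightarrow>\<^sub>0 nat) \<Rightarrow> ('v, 'k::zero_neq_one) mpol"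
  where "mon m \<equiv> Poly_Mapping.single m 1"

lemma mon_inject [simp]: "mon m = (mon m' :: ('v, 'k::zero_neq_one) mpol) \<longleftrightarrow> m = m'"
  by (metis keys_single singleton_inject zero_neq_one)

definition forms :: "nat \<Rightarrow> ('v::finite, 'k::zero) mpol set"
  where "forms n = {F. homog n F}"

lemma Cst_0 [simp]: "Cst 0 = 0" and Cst_1 [simp]: "Cst 1 = 1"
  by (simp_all add: Cst_def)

lemma Cst_add: "Cst (a + b) = Cst a + Cst b"
  by (simp add: Cst_def single_add)

lemma Cst_mult: "Cst (a * b) = Cst a * (Cst b :: ('v, 'k::comm_ring_1) mpol)"
  by (simp add: Cst_def mult_single)

lemma Cst_uminus: "Cst (- a) = - (Cst a :: ('v, 'k::comm_ring_1) mpol)"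
  by (simp add: Cst_def single_uminus)

lemma Cst_diff: "Cst (a - b) = Cst a - (Cst b :: ('v, 'k::comm_ring_1) mpol)"
  by (simp add: Cst_def single_diff)

lemma Cst_eq_0_iff [simp]: "(Cst a :: ('v, 'k::zero) mpol) = 0 \<longleftrightarrow> a = 0"
proof
  assume "(Cst a :: ('v, 'k) mpol) = 0"
  then have "coef (Cst a :: ('v, 'k) mpol) 0 = 0" by simp
  then show "a = 0" by (simp add: Cst_def)
qed simp

lemma Cst_power: "Cst (a ^ n) = (Cst a :: ('v, 'k::comm_ring_1) mpol) ^ n"
  by (induction n) (simp_all add: Cst_mult)

lemma Cst_sum: "Cst (sum g A) = (\<Sum>x\<in>A. Cst (g x) :: ('v, 'k::comm_ring_1) mpol)"
  by (induction A rule: infinite_finite_induct) (simp_all add: Cst_add)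

lemma Cst_inverse:
  assumes "(c :: 'k::field) \<noteq> 0"
  shows "Cst (inverse c) * (Cst c * F) = (F :: ('v, 'k) mpol)"
  unfolding mult.assoc[symmetric] Cst_mult[symmetric] using assms by simp

lemma coef_Cst_mult [simp]: "coef (Cst c * F) m = c * coef (F :: ('v, 'k::comm_ring_1) mpol) m"
  unfolding Cst_def mult_map_scale_conv_mult[symmetric] by (simp add: map.rep_eq when_def)

lemma mdeg_0 [simp]: "mdeg 0 = 0"
  by (simp add: mdeg_def)

lemma mdeg_add: "mdeg (m + m') = mdeg m + mdeg m'"
  by (simp add: mdeg_def lookup_add sum.distrib)

lemma mdeg_single [simp]: "mdeg (Poly_Mapping.single i n) = n"
  by (simp add: mdeg_def lookup_single when_def)

lemma mdeg_eq_0_iff: "mdeg m = 0 \<longleftrightarrow> m = 0"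
  by (auto simp: mdeg_def intro!: poly_mapping_eqI)

lemma homogI: "(\<And>m. coef F m \<noteq> 0 \<Longrightarrow> mdeg m = n) \<Longrightarrow> homog n F"
  by (auto simp: homog_def in_keys_iff)

lemma homogD: "homog n F \<Longrightarrow> coef F m \<noteq> 0 \<Longrightarrow> mdeg m = n"
  by (auto simp: homog_def in_keys_iff)

lemma homog_0 [simp]: "homog n 0"
  by (simp add: homog_def)

lemma homog_single: "homog (mdeg m) (Poly_Mapping.single m c)"
  by (simp add: homog_def)

lemma homog_Cst [simp]: "homog 0 (Cst c)"
  by (simp add: homog_def Cst_def)

lemma homog_1 [simp]: "homog 0 1"
  by (simp add: homog_def)

lemma homog_Var [simp]: "homog (Suc 0) (Var i)"
  by (simp add: homog_def Var_def)

lemma homog_add: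
  "homog n F \<Longrightarrow> homog n G \<Longrightarrow> homog n (F + G :: ('v::finite, 'k::comm_monoid_add) mpol)"
  using keys_add[of F G] unfolding homog_def by blast

lemma homog_uminus: "homog n F \<Longrightarrow> homog n (- F :: ('v::finite, 'k::ab_group_add) mpol)"
  by (auto intro!: homogI dest: homogD)

lemma homog_diff:
  "homog n F \<Longrightarrow> homog n G \<Longrightarrow> homog n (F - G :: ('v::finite, 'k::ab_group_add) mpol)"
  using homog_add[of n F "- G"] homog_uminus[of n G] by simp

lemma homog_sum:
  "(\<And>x. x \<in> A \<Longrightarrow> homog n (F x)) \<Longrightarrow> homog n (\<Sum>x\<in>A. F x :: ('v::finite, 'k::comm_monoid_add) mpol)"
  by (induction A rule: infinite_finite_induct) (auto intro: homog_add)

lemma homog_mult: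
  assumes "homog a F" "homog b G"
  shows "homog (a + b) (F * G :: ('v::finite, 'k::semiring_0) mpol)"
proof -
  have "mdeg m = a + b" if "m \<in> Poly_Mapping.keys (F * G)" for m
    using that keys_mult[of F G] assms by (fastforce simp: homog_def mdeg_add)
  then show ?thesis by (simp add: homog_def)
qed

lemma homog_Cst_mult: "homog n F \<Longrightarrow> homog n (Cst c * F :: ('v::finite, 'k::comm_ring_1) mpol)"
  using homog_mult[OF homog_Cst, of n F c] by simp

lemma homog_power: "homog a F \<Longrightarrow> homog (a * n) (F ^ n :: ('v::finite, 'k::comm_semiring_1) mpol)"
  by (induction n) (auto dest: homog_mult simp: algebra_simps)

lemma homog_prod:
  "(\<And>x. x \<in> A \<Longrightarrow> homog (a x) (F x)) \<Longrightarrow>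
    homog (\<Sum>x\<in>A. a x) (\<Prod>x\<in>A. F x :: ('v::finite, 'k::comm_semiring_1) mpol)"
  by (induction A rule: infinite_finite_induct) (auto intro: homog_mult)

lemma homog_unique:
  assumes "homog a F" "homog b F" "F \<noteq> 0" shows "a = b"
proof -
  obtain m where "coef F m \<noteq> 0" using assms(3) by (metis lookup_zero poly_mapping_eqI)
  then show ?thesis using assms(1,2) homogD by metis
qed

lemma homog_0_iff_Cst: "homog 0 F \<longleftrightarrow> (\<exists>c. F = Cst c)"
proof
  assume "homog 0 F"
  then have "F = Cst (coef F 0)"
    using homogD[of 0 F] mdeg_eq_0_iff
    by (intro poly_mapping_eqI) (auto simp: Cst_def lookup_single when_def)
  then show "\<exists>c. F = Cst c" ..
qed auto

lemma coef_hcomp: "coef (hcomp n F) m = (if mdeg m = n then coef F m else 0)"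
proof -
  have fin: "finite {m \<in> Poly_Mapping.keys F. mdeg m = n}" by simp
  have "coef (hcomp n F) m =
      (\<Sum>m'\<in>{m \<in> Poly_Mapping.keys F. mdeg m = n}. if m' = m then coef F m' else 0)"
    unfolding hcomp_def lookup_sum lookup_single when_def ..
  also have "\<dots> = (if m \<in> {m \<in> Poly_Mapping.keys F. mdeg m = n} then coef F m else 0)"
    using sum.delta[OF fin, of m "coef F"] by presburger
  finally show ?thesis by (auto simp: in_keys_iff)
qed

lemma homog_hcomp [simp]: "homog n (hcomp n F)"
  by (auto intro!: homogI simp: coef_hcomp split: if_splits)

lemma hcomp_add: "hcomp n (F + G) = hcomp n F + hcomp n G"
  by (rule poly_mapping_eqI) (simp add: coef_hcomp lookup_add)

lemma hcomp_0 [simp]: "hcomp n 0 = 0"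
  by (rule poly_mapping_eqI) (simp add: coef_hcomp)

lemma hcomp_sum: "hcomp n (sum g A) = (\<Sum>x\<in>A. hcomp n (g x))"
  by (induction A rule: infinite_finite_induct) (simp_all add: hcomp_add)

lemma hcomp_homog: "homog a F \<Longrightarrow> hcomp n F = (if n = a then F else 0)"
  by (rule poly_mapping_eqI) (auto simp: coef_hcomp dest: homogD)

lemma hcomp_Cst_mult: "hcomp n (Cst c * F) = Cst c * hcomp n (F :: ('v::finite, 'k::comm_ring_1) mpol)"
  by (rule poly_mapping_eqI) (simp add: coef_hcomp)

definition deg_bound :: "('v::finite, 'k::zero) mpol \<Rightarrow> nat"
  where "deg_bound F = Max (insert 0 (mdeg ` Poly_Mapping.keys F))"

lemma mdeg_le_deg_bound: "coef F m \<noteq> 0 \<Longrightarrow> mdeg m \<le> deg_bound F"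
  unfolding deg_bound_def by (rule Max_ge) (auto simp: in_keys_iff)

lemma sum_hcomp:
  assumes "deg_bound F \<le> N" shows "(\<Sum>n\<le>N. hcomp n F) = F"
proof (rule poly_mapping_eqI)
  fix m
  have "coef (\<Sum>n\<le>N. hcomp n F) m = (\<Sum>n\<le>N. if mdeg m = n then coef F m else 0)"
    by (simp add: lookup_sum coef_hcomp)
  also have "\<dots> = (if mdeg m \<le> N then coef F m else 0)" by (simp add: sum.delta')
  also have "\<dots> = coef F m"
    using mdeg_le_deg_bound[of F m] assms by (cases "coef F m = 0") simp_all
  finally show "coef (\<Sum>n\<le>N. hcomp n F) m = coef F m" .
qed

lemma hcomp_nonzero: "F \<noteq> 0 \<Longrightarrow> \<exists>n. hcomp n F \<noteq> 0"
  using sum_hcomp[of F "deg_bound F"] by (metis order_refl sum.neutral)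

lemma hcomp_mult:
  "hcomp n (F * G) = (\<Sum>i\<le>n. hcomp i F * hcomp (n - i) (G :: ('v::finite, 'k::comm_ring_1) mpol))"
proof -
  define N where "N = deg_bound F + deg_bound G + n"
  have "F * G = (\<Sum>i\<le>N. hcomp i F) * (\<Sum>j\<le>N. hcomp j G)"
    using sum_hcomp[of F N] sum_hcomp[of G N] by (simp add: N_def)
  also have "\<dots> = (\<Sum>i\<le>N. \<Sum>j\<le>N. hcomp i F * hcomp j G)"
    by (simp add: sum_product)
  finally have "hcomp n (F * G) = (\<Sum>i\<le>N. \<Sum>j\<le>N. if n = i + j then hcomp i F * hcomp j G else 0)"
    by (simp add: hcomp_sum hcomp_homog[OF homog_mult[OF homog_hcomp homog_hcomp]])
  also have "\<dots> = (\<Sum>i\<le>N. if i \<le> n then hcomp i F * hcomp (n - i) G else 0)"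
  proof (rule sum.cong[OF refl])
    fix i
    have "(\<Sum>j\<le>N. if n = i + j then hcomp i F * hcomp j G else 0) =
        (\<Sum>j\<le>N. if j = n - i \<and> i \<le> n then hcomp i F * hcomp j G else 0)"
      by (rule sum.cong) auto
    also have "\<dots> = (if i \<le> n then hcomp i F * hcomp (n - i) G else 0)"
      by (auto simp: sum.delta N_def)
    finally show "(\<Sum>j\<le>N. if n = i + j then hcomp i F * hcomp j G else 0) =
      (if i \<le> n then hcomp i F * hcomp (n - i) G else 0)" .
  qed
  also have "\<dots> = (\<Sum>i\<in>{i\<in>{..N}. i \<le> n}. hcomp i F * hcomp (n - i) G)"
    by (rule sum.inter_filter[symmetric]) simp
  also have "{i\<in>{..N}. i \<le> n} = {..n}" by (auto simp: N_def)
  finally show ?thesis .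
qed

lemma hcomp_homog_mult:
  assumes "homog a (G :: ('v::finite, 'k::comm_ring_1) mpol)"
  shows "hcomp n (G * F) = (if a \<le> n then G * hcomp (n - a) F else 0)"
proof -
  have "hcomp n (G * F) = (\<Sum>i\<le>n. if i = a then G * hcomp (n - i) F else 0)"
    unfolding hcomp_mult using hcomp_homog[OF assms] by (intro sum.cong) auto
  then show ?thesis by (simp)
qed

text \<open>In a domain the lowest components of \<open>F\<close> and \<open>G\<close> multiply to a
  nonzero component of the product, and so do the highest ones. Both products sit in degree
  \<open>n\<close>, so lowest and highest degree agree in each factor.\<close>

lemma homog_factors:
  fixes F G :: "('v::{finite,linorder}, 'k::idom) mpol"
  assumes "homog n (F * G)" "F * G \<noteq> 0"
  shows "\<exists>a b. homog a F \<and> homog b G \<and> a + b = n"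
proof -
  let ?D = "\<lambda>F :: ('v, 'k) mpol. {i. hcomp i F \<noteq> 0}"
  have fin: "finite (?D H)" for H :: "('v, 'k) mpol"
  proof (rule finite_subset[of _ "mdeg ` Poly_Mapping.keys H"])
    show "?D H \<subseteq> mdeg ` Poly_Mapping.keys H"
    proof
      fix i assume "i \<in> ?D H"
      then obtain m where "coef (hcomp i H) m \<noteq> 0" by (metis (mono_tags) lookup_zero mem_Collect_eq poly_mapping_eqI)
      then have "mdeg m = i \<and> coef H m \<noteq> 0" by (auto simp: coef_hcomp split: if_splits)
      then show "i \<in> mdeg ` Poly_Mapping.keys H" by (auto simp: in_keys_iff)
    qed
  qed simp
  have ne: "?D F \<noteq> {}" "?D G \<noteq> {}" using assms(2) hcomp_nonzero by fastforce+
  define a b a' b' where "a = Min (?D F)" "b = Min (?D G)" "a' = Max (?D F)" "b' = Max (?D G)"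
  have D: "a \<in> ?D F" "a' \<in> ?D F" "b \<in> ?D G" "b' \<in> ?D G"
    unfolding a_b_a'_b'_def using Min_in Max_in fin ne by blast+
  have le: "a \<le> i" "i \<le> a'" if "hcomp i F \<noteq> 0" for i
    unfolding a_b_a'_b'_def using fin that by auto
  have le': "b \<le> i" "i \<le> b'" if "hcomp i G \<noteq> 0" for i
    unfolding a_b_a'_b'_def using fin that by auto
  have "hcomp (a + b) (F * G) = hcomp a F * hcomp b G"
  proof -
    have "hcomp (a + b) (F * G) = (\<Sum>i\<le>a + b. if i = a then hcomp a F * hcomp b G else 0)"
      unfolding hcomp_mult
    proof (intro sum.cong refl)
      fix i assume "i \<in> {..a + b}"
      then have "i < a \<or> a + b - i < b \<or> i = a" by auto
      then show "hcomp i F * hcomp (a + b - i) G = (if i = a then hcomp a F * hcomp b G else 0)"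
        using le(1)[of i] le'(1)[of "a + b - i"]
        by (metis add_diff_cancel_left' leD mult_zero_left mult_zero_right)
    qed
    then show ?thesis by (simp)
  qed
  then have "hcomp (a + b) (F * G) \<noteq> 0" using D by simp
  then have ab: "a + b = n" using hcomp_homog[OF assms(1)] by metis
  have "hcomp (a' + b') (F * G) = hcomp a' F * hcomp b' G"
  proof -
    have "hcomp (a' + b') (F * G) = (\<Sum>i\<le>a' + b'. if i = a' then hcomp a' F * hcomp b' G else 0)"
      unfolding hcomp_mult
    proof (intro sum.cong refl)
      fix i assume "i \<in> {..a' + b'}"
      then have "i > a' \<or> a' + b' - i > b' \<or> i = a'" by auto
      then show "hcomp i F * hcomp (a' + b' - i) G = (if i = a' then hcomp a' F * hcomp b' G else 0)"
        using le(2)[of i] le'(2)[of "a' + b' - i"]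
        by (metis add_diff_cancel_left' leD mult_zero_left mult_zero_right)
    qed
    then show ?thesis by (simp)
  qed
  then have "hcomp (a' + b') (F * G) \<noteq> 0" using D by simp
  then have "a' + b' = n" using hcomp_homog[OF assms(1)] by metis
  moreover have "a \<le> a'" "b \<le> b'" using le(1)[of a'] le'(1)[of b'] D by auto
  ultimately have eq: "a = a'" "b = b'" using ab by auto
  have e: "hcomp i F = (if i = a then hcomp a F else 0)" "hcomp i G = (if i = b then hcomp b G else 0)" for i
    using le[of i] le'[of i] eq by (metis le_antisym)+
  have "(\<Sum>n\<le>deg_bound F + a. hcomp n F) = (\<Sum>n\<le>deg_bound F + a. if n = a then hcomp a F else 0)"
    "(\<Sum>n\<le>deg_bound G + b. hcomp n G) = (\<Sum>n\<le>deg_bound G + b. if n = b then hcomp b G else 0)"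
    by (rule sum.cong[OF refl e(1)], rule sum.cong[OF refl e(2)])
  then have "F = hcomp a F" "G = hcomp b G"
    using sum_hcomp[of F "deg_bound F + a"] sum_hcomp[of G "deg_bound G + b"] by simp_all
  then show ?thesis using ab homog_hcomp by metis
qed

lemma subspace_forms: "mvs.subspace (forms n)"
  by (auto simp: forms_def intro!: mvs.subspaceI homog_add homog_Cst_mult)

lemma mono_decomp: "F = (\<Sum>m\<in>Poly_Mapping.keys F. Cst (coef F m) * (mon m :: ('v, 'k::comm_ring_1) mpol))"
proof (rule poly_mapping_eqI)
  fix m
  have "coef (\<Sum>m\<in>Poly_Mapping.keys F. Cst (coef F m) * (mon m :: ('v, 'k) mpol)) m =
      (\<Sum>m'\<in>Poly_Mapping.keys F. if m' = m then coef F m' else 0)"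
    unfolding lookup_sum by (intro sum.cong) (auto simp: lookup_single when_def)
  then show "coef F m = coef (\<Sum>m\<in>Poly_Mapping.keys F. Cst (coef F m) * (mon m :: ('v, 'k) mpol)) m"
    by (simp add: sum.delta in_keys_iff)
qed

lemma span_mono_forms:
  "mvs.span (mon ` {m. mdeg m = n}) = (forms n :: ('v::{finite,linorder}, 'k::field) mpol set)"
proof
  show "mvs.span (mon ` {m. mdeg m = n}) \<subseteq> (forms n :: ('v, 'k) mpol set)"
    by (intro mvs.span_minimal subspace_forms) (auto simp: forms_def intro: homog_single)
next
  show "forms n \<subseteq> mvs.span (mon ` {m :: 'v \<Rightarrow>\<^sub>0 nat. mdeg m = n} :: ('v, 'k) mpol set)"
  proof
    fix F :: "('v, 'k) mpol" assume F: "F \<in> forms n"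
    have "(\<Sum>m\<in>Poly_Mapping.keys F. Cst (coef F m) * mon m) \<in> mvs.span (mon ` {m. mdeg m = n})"
      using F by (intro mvs.span_sum mvs.span_scale mvs.span_base) (auto simp: forms_def homog_def)
    then show "F \<in> mvs.span (mon ` {m. mdeg m = n})" using mono_decomp[of F] by simp
  qed
qed

lemma independent_mono_image:
  assumes "finite M"
  shows "mvs.independent (mon ` M :: ('v::{finite,linorder}, 'k::field) mpol set)"
proof (rule mvs.independent_if_scalars_zero)
  show "finite (mon ` M :: ('v, 'k) mpol set)" using assms by simp
next
  fix c :: "('v, 'k) mpol \<Rightarrow> 'k" and x :: "('v, 'k) mpol"
  assume 0: "(\<Sum>x\<in>mon ` M. Cst (c x) * x) = 0" and "x \<in> mon ` M"
  then obtain m where m: "x = mon m" "m \<in> M" by blast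
  have inj: "inj_on (mon :: _ \<Rightarrow> ('v, 'k) mpol) M" by (rule inj_onI) simp
  have "0 = coef (\<Sum>m\<in>M. Cst (c (mon m)) * mon m) m"
    using 0 by (simp add: sum.reindex[OF inj])
  also have "\<dots> = (\<Sum>m'\<in>M. if m' = m then c (mon m') else 0)"
    unfolding lookup_sum by (intro sum.cong) (auto simp: lookup_single when_def)
  also have "\<dots> = c x" using assms m by (simp)
  finally show "c x = 0" by simp
qed

lemma finite_mdeg: "finite {m :: 'v::finite \<Rightarrow>\<^sub>0 nat. mdeg m = n}"
proof (rule finite_imageD)
  show "inj_on Poly_Mapping.lookup {m :: 'v \<Rightarrow>\<^sub>0 nat. mdeg m = n}"
    by (rule inj_onI) (rule poly_mapping_eqI, simp)
  have "Poly_Mapping.lookup ` {m :: 'v \<Rightarrow>\<^sub>0 nat. mdeg m = n} \<subseteq> (UNIV :: 'v set) \<rightarrow>\<^sub>E {..n}"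
  proof clarify
    fix m :: "'v \<Rightarrow>\<^sub>0 nat" assume "n = mdeg m"
    then have "Poly_Mapping.lookup m i \<le> n" for i
      unfolding mdeg_def by (simp add: member_le_sum)
    then show "Poly_Mapping.lookup m \<in> UNIV \<rightarrow>\<^sub>E {..mdeg m}" using \<open>n = mdeg m\<close> by auto
  qed
  then show "finite (Poly_Mapping.lookup ` {m :: 'v \<Rightarrow>\<^sub>0 nat. mdeg m = n})"
    by (rule finite_subset) (simp add: finite_PiE)
qed

lemma fin_dim_forms: "fin_dim (forms n :: ('v::{finite,linorder}, 'k::field) mpol set)"
  unfolding fin_dim_def span_mono_forms[symmetric]
  using finite_imageI[OF finite_mdeg] by blast

lemma dim_forms_card:
  "mvs.dim (forms n :: ('v::{finite,linorder}, 'k::field) mpol set) = card {m :: 'v \<Rightarrow>\<^sub>0 nat. mdeg m = n}"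
proof -
  have "mvs.dim (mvs.span (mon ` {m :: 'v \<Rightarrow>\<^sub>0 nat. mdeg m = n}) :: ('v, 'k) mpol set) =
      card (mon ` {m :: 'v \<Rightarrow>\<^sub>0 nat. mdeg m = n} :: ('v, 'k) mpol set)"
    by (intro mvs.dim_span_eq_card_independent independent_mono_image finite_mdeg)
  also have "\<dots> = card {m :: 'v \<Rightarrow>\<^sub>0 nat. mdeg m = n}"
    by (intro card_image inj_onI) simp
  finally show ?thesis unfolding span_mono_forms .
qed

lemma UNIV_3: "(UNIV :: 3 set) = {0, 1, 2}"
proof (rule card_seteq[symmetric])
  have "(0::3) \<noteq> 1" "(0::3) \<noteq> 2" "(1::3) \<noteq> 2" by simp_all
  then show "card (UNIV :: 3 set) \<le> card {0, 1, 2 :: 3}" by simp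
qed simp_all

lemma mdeg_3: "mdeg (m :: 3 \<Rightarrow>\<^sub>0 nat) = Poly_Mapping.lookup m 0 + Poly_Mapping.lookup m 1 + Poly_Mapping.lookup m 2"
  unfolding mdeg_def UNIV_3 by (simp add: add.assoc)

lemma card_mdeg_3: "card {m :: 3 \<Rightarrow>\<^sub>0 nat. mdeg m = n} = (n + 2) choose 2"
proof -
  let ?e = "\<lambda>(i, j). Poly_Mapping.single (0::3) i + Poly_Mapping.single 1 j + Poly_Mapping.single 2 (n - i - j)"
  have "bij_betw ?e (SIGMA i:{..n}. {..n - i}) {m :: 3 \<Rightarrow>\<^sub>0 nat. mdeg m = n}"
  proof (rule bij_betwI[where g = "\<lambda>m. (Poly_Mapping.lookup m 0, Poly_Mapping.lookup m 1)"])
    fix m :: "3 \<Rightarrow>\<^sub>0 nat" assume m: "m \<in> {m. mdeg m = n}"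
    have "Poly_Mapping.lookup (?e (Poly_Mapping.lookup m 0, Poly_Mapping.lookup m 1)) x = Poly_Mapping.lookup m x" for x
      using UNIV_I[of x] m unfolding UNIV_3 by (auto simp: lookup_add lookup_single when_def mdeg_3)
    then show "?e (Poly_Mapping.lookup m 0, Poly_Mapping.lookup m 1) = m" by (rule poly_mapping_eqI)
  qed (auto simp: mdeg_3 lookup_add lookup_single when_def)
  then have "card {m :: 3 \<Rightarrow>\<^sub>0 nat. mdeg m = n} = card (SIGMA i:{..n}. {..n - i})"
    by (simp add: bij_betw_same_card)
  also have "\<dots> = (\<Sum>i\<le>n. n - i + 1)" by simp
  also have "\<dots> = (\<Sum>i\<le>n. i + 1)" by (rule sum.reindex_bij_witness[of _ "\<lambda>i. n - i" "\<lambda>i. n - i"]) auto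
  also have "\<dots> = (n + 2) choose 2"
    by (induction n) (simp_all add: numeral_2_eq_2)
  finally show ?thesis .
qed

lemma dim_forms_3: "mvs.dim (forms n :: (3, 'k::field) mpol set) = (n + 2) choose 2"
  by (simp add: dim_forms_card card_mdeg_3)

lemma int_choose_2: "2 * int ((n + 2) choose 2) = (int n + 2) * (int n + 1)"
proof -
  have "2 * ((n + 2) choose 2) = (n + 2) * (n + 1)"
    by (induction n) (simp_all add: numeral_2_eq_2)
  then have "int (2 * ((n + 2) choose 2)) = int ((n + 2) * (n + 1))" by simp
  then show ?thesis by (simp add: algebra_simps)
qed

section \<open>Graded ideals and projective points\<close>

definition graded_ideal :: "('v::finite, 'k::comm_ring_1) mpol set \<Rightarrow> bool"
  where "graded_ideal A \<longleftrightarrow> mul.subspace A \<and> (\<forall>F\<in>A. \<forall>n. hcomp n F \<in> A)"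

definition colon :: "'a::comm_ring_1 set \<Rightarrow> 'a \<Rightarrow> 'a set"
  where "colon A g = {y. g * y \<in> A}"

lemma mul_scale: "mul.subspace A \<Longrightarrow> x \<in> A \<Longrightarrow> x * c \<in> A" for x :: "'a::comm_ring_1"
  using mul.subspace_scale[of A x c] by (simp add: mult.commute)

lemma ideal_class_ring_iff: "ideal A class_ring \<longleftrightarrow> mul.subspace (A :: 'a::comm_ring_1 set)"
proof
  assume "ideal A class_ring"
  then interpret ideal A "class_ring :: 'a ring" .
  show "mul.subspace A"
    using zero_closed a_closed I_l_closed by (intro mul.subspaceI) auto
next
  assume A: "mul.subspace A"
  show "ideal A class_ring"
  proof (rule idealI)
    show "ring (class_ring :: 'a ring)" ..
    show "subgroup A (add_monoid class_ring)"
    proof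
      fix x y assume "x \<in> A" "y \<in> A"
      then show "x \<otimes>\<^bsub>add_monoid class_ring\<^esub> y \<in> A" using mul.subspace_add[OF A] by simp
    next
      show "\<one>\<^bsub>add_monoid class_ring\<^esub> \<in> A" using mul.subspace_0[OF A] by simp
    next
      fix x assume x: "x \<in> A"
      have "inv\<^bsub>add_monoid class_ring\<^esub> x = - x"
        by (rule comm_monoid.comm_inv_char) (auto simp: comm_monoid_def monoid_def comm_monoid_axioms_def algebra_simps)
      then show "inv\<^bsub>add_monoid class_ring\<^esub> x \<in> A" using mul.subspace_neg[OF A x] by simp
    qed simp
  next
    fix a x assume "a \<in> A"
    then show "x \<otimes>\<^bsub>class_ring\<^esub> a \<in> A" "a \<otimes>\<^bsub>class_ring\<^esub> x \<in> A"
      using mul.subspace_scale[OF A] mul_scale[OF A] by auto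
  qed
qed

lemma genideal_class_ring: "Idl\<^bsub>class_ring\<^esub> E = mul.span (E :: 'a::comm_ring_1 set)"
  unfolding genideal_def ideal_class_ring_iff
  by (intro antisym Inter_lower Inter_greatest)
    (auto simp: mul.span_superset dest: mul.span_minimal)

lemma primeideal_class_ring_iff:
  "primeideal p class_ring \<longleftrightarrow> mul.subspace (p :: 'a::comm_ring_1 set) \<and> 1 \<notin> p \<and>
    (\<forall>a b. a * b \<in> p \<longrightarrow> a \<in> p \<or> b \<in> p)"
proof
  assume P: "primeideal p class_ring"
  have S: "mul.subspace p" using P by (simp add: primeideal_def ideal_class_ring_iff)
  moreover have "1 \<notin> p"
    using primeideal.I_notcarr[OF P] mul_scale[OF S, of 1] by auto
  ultimately show "mul.subspace p \<and> 1 \<notin> p \<and> (\<forall>a b. a * b \<in> p \<longrightarrow> a \<in> p \<or> b \<in> p)"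
    using primeideal.I_prime[OF P] by auto
next
  assume "mul.subspace p \<and> 1 \<notin> p \<and> (\<forall>a b. a * b \<in> p \<longrightarrow> a \<in> p \<or> b \<in> p)"
  moreover have "cring (class_ring :: 'a ring)" by unfold_locales (auto simp: algebra_simps)
  ultimately show "primeideal p class_ring"
    by (intro primeidealI) (auto simp: ideal_class_ring_iff)
qed

lemma irrelevant_subset_iff:
  fixes p :: "('a::finite, 'b::comm_ring_1) mpol set"
  assumes S: "mul.subspace p"
  shows "irrelevant \<subseteq> p \<longleftrightarrow> (\<forall>i. Var i \<in> p)"
  unfolding irrelevant_def genideal_class_ring
proof -
  have "mul.span (range Var) \<subseteq> p \<longleftrightarrow> range Var \<subseteq> p"
    using mul.span_minimal[OF _ S, of "range Var"] mul.span_superset[of "range Var :: ('a, 'b) mpol set"] by auto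
  then show "mul.span (range Var) \<subseteq> p \<longleftrightarrow> (\<forall>i. Var i \<in> p)" by auto
qed

lemma Proj_iff:
  "p \<in> Proj \<longleftrightarrow> graded_ideal p \<and> 1 \<notin> p \<and> (\<forall>a b. a * b \<in> p \<longrightarrow> a \<in> p \<or> b \<in> p) \<and> (\<exists>i. Var i \<notin> p)"
  unfolding Proj_def primeideal_class_ring_iff graded_ideal_def
  using irrelevant_subset_iff[of p] by auto

lemma Proj_graded: "p \<in> Proj \<Longrightarrow> graded_ideal p"
  by (simp add: Proj_iff)

lemma Proj_subspace: "p \<in> Proj \<Longrightarrow> mul.subspace p"
  by (simp add: Proj_iff graded_ideal_def)

lemma Proj_mult_iff: "p \<in> Proj \<Longrightarrow> a * b \<in> p \<longleftrightarrow> a \<in> p \<or> b \<in> p"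
  using mul.subspace_scale[OF Proj_subspace, of p b a] mul_scale[OF Proj_subspace, of p a b]
  by (auto simp: Proj_iff)

lemma Proj_one: "p \<in> Proj \<Longrightarrow> 1 \<notin> p"
  by (simp add: Proj_iff)

lemma Proj_power_iff:
  assumes "p \<in> Proj"
  shows "a ^ n \<in> p \<longleftrightarrow> a \<in> p \<and> n > 0"
proof (induction n)
  case 0 then show ?case using Proj_one[OF assms] by simp
next
  case (Suc n) then show ?case using Proj_mult_iff[OF assms, of a "a ^ n"] by auto
qed

lemma Proj_prod_iff:
  assumes "p \<in> Proj" "finite A"
  shows "(\<Prod>x\<in>A. g x) \<in> p \<longleftrightarrow> (\<exists>x\<in>A. g x \<in> p)"
  using assms(2)
proof (induction A rule: finite_induct)
  case empty show ?case using assms(1) by (simp add: Proj_iff)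
next
  case (insert x A) then show ?case using assms(1) by (simp add: Proj_mult_iff)
qed

lemma graded_span:
  assumes "\<And>F. F \<in> E \<Longrightarrow> \<exists>n. homog n F"
  shows "graded_ideal (mul.span (E :: ('v::finite, 'k::comm_ring_1) mpol set))"
  unfolding graded_ideal_def
proof (intro conjI ballI allI)
  fix F n assume "F \<in> mul.span E"
  then show "hcomp n F \<in> mul.span E"
  proof (induction rule: mul.span_induct_alt)
    case base show ?case by (simp add: mul.span_zero)
  next
    case (step c x y)
    obtain a where "homog a x" using assms step(1) by blast
    then have "hcomp n (c * x) = (if a \<le> n then hcomp (n - a) c * x else 0)"
      using hcomp_homog_mult[of a x n c] by (simp add: mult.commute)
    then have "hcomp n (c * x) \<in> mul.span E"
      using mul.span_scale[OF mul.span_base[OF step(1)]] mul.span_zero[of E] by simp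
    then show ?case using step by (simp add: hcomp_add mul.span_add)
  qed
qed simp

text \<open>\<open>A\<close> is replaced by its homogeneous elements, which generate the same ideal,
  so that \<open>graded_span\<close> applies.\<close>

lemma graded_span_insert:
  assumes A: "graded_ideal A" and g: "homog r g"
  shows "graded_ideal (mul.span (insert g A))"
proof -
  have "mul.span (insert g A) = mul.span (insert g {F \<in> A. \<exists>n. homog n F})"
  proof (intro antisym mul.span_minimal mul.subspace_span mul.span_mono)
    show "insert g A \<subseteq> mul.span (insert g {F \<in> A. \<exists>n. homog n F})"
    proof
      fix F assume "F \<in> insert g A"
      then consider "F = g" | "F \<in> A" by blast
      then show "F \<in> mul.span (insert g {F \<in> A. \<exists>n. homog n F})"
      proof cases
        case 1 then show ?thesis by (simp add: mul.span_base)
      next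
        case 2
        have "(\<Sum>n\<le>deg_bound F. hcomp n F) \<in> mul.span (insert g {F \<in> A. \<exists>n. homog n F})"
          using A 2 homog_hcomp unfolding graded_ideal_def by (intro mul.span_sum mul.span_base) blast
        then show ?thesis using sum_hcomp[of F "deg_bound F"] by simp
      qed
    qed
    show "insert g {F \<in> A. \<exists>n. homog n F} \<subseteq> mul.span (insert g A)"
      by (auto intro: mul.span_base)
  qed
  then show ?thesis using graded_span[of "insert g {F \<in> A. \<exists>n. homog n F}"] g by auto
qed

lemma graded_colon:
  assumes A: "graded_ideal A" and g: "homog r g"
  shows "graded_ideal (colon A g)"
proof -
  have S: "mul.subspace A" using A by (simp add: graded_ideal_def)
  have "mul.subspace (colon A g)"
  proof (rule mul.subspaceI)
    show "0 \<in> colon A g" using mul.subspace_0[OF S] by (simp add: colon_def)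
    show "x + y \<in> colon A g" if "x \<in> colon A g" "y \<in> colon A g" for x y
      using that mul.subspace_add[OF S] by (simp add: colon_def distrib_left)
    show "c * x \<in> colon A g" if "x \<in> colon A g" for c x
      using that mul.subspace_scale[OF S, of "g * x" c] unfolding colon_def mem_Collect_eq mult.left_commute[of g c x] by blast
  qed
  moreover have "hcomp n F \<in> colon A g" if "F \<in> colon A g" for F n
  proof -
    have "hcomp (n + r) (g * F) \<in> A" using that A unfolding colon_def graded_ideal_def by blast
    then show ?thesis using hcomp_homog_mult[OF g, of "n + r" F] by (simp add: colon_def)
  qed
  ultimately show ?thesis by (simp add: graded_ideal_def)
qed

lemma graded_inter: "graded_ideal A \<Longrightarrow> graded_ideal B \<Longrightarrow> graded_ideal (A \<inter> B)"
  by (auto simp: graded_ideal_def intro: mul.subspace_inter)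

lemma product_expansion:
  "(q + F * c) * (q' + G * c') = q * (q' + G * c') + q' * (F * c) + F * G * (c * c' :: 'a::comm_ring_1)"
  by (simp add: algebra_simps)

lemma quadratic_difference:
  "u + x * v + x ^ 2 * w - (u + y * v + y ^ 2 * w) = (x - y) * (v + (x + y) * w :: 'a::comm_ring_1)"
  by (simp add: algebra_simps power2_eq_square)

lemma hcomp_outside:
  assumes "mul.subspace A" "F \<notin> A"
  shows "\<exists>n. hcomp n F \<notin> (A :: ('v::finite, 'k::comm_ring_1) mpol set)"
proof (rule ccontr)
  assume "\<not> (\<exists>n. hcomp n F \<notin> A)"
  then have "(\<Sum>n\<le>deg_bound F. hcomp n F) \<in> A" by (intro mul.subspace_sum[OF assms(1)]) blast
  then show False using sum_hcomp[of F "deg_bound F"] assms(2) by simp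
qed

lemma in_span_insert_mult: "x \<in> mul.span (insert g A) \<Longrightarrow> mul.subspace A \<Longrightarrow> \<exists>a\<in>A. \<exists>c. x = a + g * c"
  for x :: "'a::comm_ring_1"
  using mul.span_breakdown_eq[of x g A] mul.span_eq_iff[of A]
  by (metis add_diff_cancel_left' diff_add_cancel mult.commute add.commute)

lemma mon_mult: "mon m * mon m' = (mon (m + m') :: ('v, 'k::comm_ring_1) mpol)"
  by (simp add: mult_single)

lemma Var_power: "(Var i :: ('v, 'k::comm_ring_1) mpol) ^ n = mon (Poly_Mapping.single i n)"
  by (induction n) (simp_all add: Var_def mult_single single_add[symmetric])

lemma mon_divisible:
  assumes "n \<le> Poly_Mapping.lookup m i"
  shows "\<exists>m'. mon m = Var i ^ n * (mon m' :: ('v, 'k::comm_ring_1) mpol)"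
proof -
  have "m = Poly_Mapping.single i n + (m - Poly_Mapping.single i n)"
    using assms by (intro poly_mapping_eqI) (auto simp: lookup_add lookup_minus lookup_single when_def)
  then show ?thesis using mon_mult[of "Poly_Mapping.single i n" "m - Poly_Mapping.single i n"] Var_power
    by metis
qed

lemma mpol_in_ideal_if_mons:
  assumes "mul.subspace A" "\<And>m. coef F m \<noteq> 0 \<Longrightarrow> mon m \<in> A"
  shows "F \<in> (A :: ('v, 'k::comm_ring_1) mpol set)"
proof -
  have "(\<Sum>m\<in>Poly_Mapping.keys F. Cst (coef F m) * mon m) \<in> A"
    using assms by (intro mul.subspace_sum mul.subspace_scale) (auto simp: in_keys_iff)
  then show ?thesis using mono_decomp[of F] by simp
qed

lemma positive_degree_in_ideal:
  assumes "mul.subspace A" "\<And>i. Var i \<in> A" "homog e F" "e > 0"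
  shows "F \<in> (A :: ('v::finite, 'k::comm_ring_1) mpol set)"
proof (rule mpol_in_ideal_if_mons[OF assms(1)])
  fix m assume "coef F m \<noteq> 0"
  then have "mdeg m > 0" using assms(3,4) homogD by metis
  then obtain i where "Suc 0 \<le> Poly_Mapping.lookup m i"
    unfolding mdeg_def by (meson less_not_refl2 not_less_eq_eq sum_nonpos le0 le_antisym linorder_not_less less_eq_Suc_le sum.neutral)
  then obtain m' where "mon m = Var i ^ Suc 0 * (mon m' :: ('v, 'k) mpol)" using mon_divisible by metis
  then show "mon m \<in> A" using mul_scale[OF assms(1) assms(2)] by simp
qed

text \<open>Let \<open>i\<close> and \<open>j\<close> be the lowest degrees in which
  \<open>F\<close> and \<open>G\<close> have components outside \<open>p\<close>. In degree
  \<open>i + j\<close> of \<open>F * G\<close> every other term has a factor in \<open>p\<close>, so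
  the product of these two components is in \<open>p\<close>.\<close>

lemma graded_primeI:
  assumes p: "graded_ideal p"
    and prime: "\<And>a b F G. homog a F \<Longrightarrow> homog b G \<Longrightarrow> F * G \<in> p \<Longrightarrow> F \<in> p \<or> G \<in> p"
    and FG: "F * G \<in> (p :: ('v::finite, 'k::comm_ring_1) mpol set)"
  shows "F \<in> p \<or> G \<in> p"
proof (rule ccontr)
  have S: "mul.subspace p" using p by (simp add: graded_ideal_def)
  assume "\<not> (F \<in> p \<or> G \<in> p)"
  then have "\<exists>n. hcomp n F \<notin> p" "\<exists>n. hcomp n G \<notin> p" using hcomp_outside[OF S] by auto
  then obtain i j where i: "hcomp i F \<notin> p" "\<And>k. k < i \<Longrightarrow> hcomp k F \<in> p"
    and j: "hcomp j G \<notin> p" "\<And>k. k < j \<Longrightarrow> hcomp k G \<in> p"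
    unfolding exists_least_iff[of "\<lambda>n. hcomp n F \<notin> p"] exists_least_iff[of "\<lambda>n. hcomp n G \<notin> p"]
    by auto
  have "hcomp (i + j) (F * G) =
      hcomp i F * hcomp j G + (\<Sum>k\<in>{..i + j} - {i}. hcomp k F * hcomp (i + j - k) G)"
    unfolding hcomp_mult by (subst sum.remove[of _ i]) auto
  moreover have "(\<Sum>k\<in>{..i + j} - {i}. hcomp k F * hcomp (i + j - k) G) \<in> p"
  proof (rule mul.subspace_sum[OF S])
    fix k assume "k \<in> {..i + j} - {i}"
    then have "k < i \<or> i + j - k < j" by auto
    then show "hcomp k F * hcomp (i + j - k) G \<in> p"
      using i(2) j(2) mul.subspace_scale[OF S] mul_scale[OF S] by blast
  qed
  moreover have "hcomp (i + j) (F * G) \<in> p" using FG p by (simp add: graded_ideal_def)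
  ultimately have "hcomp i F * hcomp j G \<in> p"
    using mul.subspace_diff[OF S, of "hcomp (i + j) (F * G)"] by fastforce
  then show False using prime[OF homog_hcomp homog_hcomp] i(1) j(1) by blast
qed

text \<open>A graded ideal that is maximal among those containing \<open>A\<close> and no power of
  \<open>y\<close> is prime. It belongs to \<open>Proj\<close> because \<open>y\<close> has positive
  degree: an ideal with all the variables would contain \<open>y\<close>.\<close>

lemma graded_nullstellensatz:
  fixes A :: "('v::finite, 'k::comm_ring_1) mpol set"
  assumes A: "graded_ideal A" and y: "homog e y" "e > 0" and V: "\<And>p. p \<in> Proj \<Longrightarrow> A \<subseteq> p \<Longrightarrow> y \<in> p"
  shows "\<exists>N. y ^ N \<in> A"
proof (rule ccontr)
  assume no: "\<not> (\<exists>N. y ^ N \<in> A)"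
  define \<A> where "\<A> = {B. graded_ideal B \<and> A \<subseteq> B \<and> (\<forall>N. y ^ N \<notin> B)}"
  have "\<exists>M\<in>\<A>. \<forall>E\<in>\<A>. M \<subseteq> E \<longrightarrow> E = M"
  proof (rule subset_Zorn_nonempty)
    show "\<A> \<noteq> {}" using A no by (auto simp: \<A>_def)
  next
    fix C assume C: "C \<noteq> {}" "subset.chain \<A> C"
    then obtain B0 where B0: "B0 \<in> C" "C \<subseteq> \<A>" by (auto simp: subset.chain_def)
    have sub: "mul.subspace B" if "B \<in> C" for B using that B0(2) by (auto simp: \<A>_def graded_ideal_def)
    have "mul.subspace (\<Union>C)"
    proof (rule mul.subspaceI)
      show "0 \<in> \<Union>C" using B0 sub mul.subspace_0 by blast
      show "x + z \<in> \<Union>C" if xz: "x \<in> \<Union>C" "z \<in> \<Union>C" for x z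
      proof -
        obtain E Z where XZ: "E \<in> C" "x \<in> E" "Z \<in> C" "z \<in> Z" using xz by blast
        then have "E \<subseteq> Z \<or> Z \<subseteq> E" using C(2) by (auto simp: subset.chain_def)
        then show ?thesis using XZ sub mul.subspace_add by blast
      qed
      show "c * x \<in> \<Union>C" if "x \<in> \<Union>C" for c x using that sub mul.subspace_scale by blast
    qed
    moreover have "hcomp n F \<in> \<Union>C" if "F \<in> \<Union>C" for F n
      using that B0(2) unfolding \<A>_def graded_ideal_def by blast
    ultimately show "\<Union>C \<in> \<A>" using B0 unfolding \<A>_def graded_ideal_def by blast
  qed
  then obtain P where PA: "P \<in> \<A>" "\<forall>E\<in>\<A>. P \<subseteq> E \<longrightarrow> E = P" by blast
  then have P: "graded_ideal P" "A \<subseteq> P" "\<And>N. y ^ N \<notin> P" by (auto simp: \<A>_def)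
  have max: "\<exists>N. y ^ N \<in> E" if "graded_ideal E" "P \<subseteq> E" "E \<noteq> P" for E
    using PA(2) that P(2) unfolding \<A>_def by auto
  have S: "mul.subspace P" using P(1) by (simp add: graded_ideal_def)
  have ext: "\<exists>N. \<exists>q\<in>P. \<exists>c. y ^ N = q + F * c" if "homog a F" "F \<notin> P" for a F
  proof -
    have "mul.span (insert F P) \<noteq> P" using that(2) mul.span_base[of F "insert F P"] by blast
    moreover have "P \<subseteq> mul.span (insert F P)" using mul.span_superset[of "insert F P"] by blast
    moreover have "graded_ideal (mul.span (insert F P))" by (rule graded_span_insert[OF P(1) that(1)])
    ultimately have "\<exists>N. y ^ N \<in> mul.span (insert F P)" using max[of "mul.span (insert F P)"] by simp
    then show ?thesis using in_span_insert_mult[OF _ S] by blast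
  qed
  have prime: "F \<in> P \<or> G \<in> P" if FG: "homog a F" "homog b G" "F * G \<in> P" for a b F G
  proof (rule ccontr)
    assume "\<not> (F \<in> P \<or> G \<in> P)"
    then obtain N q c M q' c' where e: "q \<in> P" "y ^ N = q + F * c" "q' \<in> P" "y ^ M = q' + G * c'"
      using ext[OF FG(1)] ext[OF FG(2)] by blast
    have "y ^ (N + M) = q * (q' + G * c') + q' * (F * c) + F * G * (c * c')"
      unfolding power_add e by (rule product_expansion)
    then have "y ^ (N + M) \<in> P"
      using e(1,3) FG(3) by (simp add: mul.subspace_add[OF S] mul_scale[OF S])
    then show False using P(3) by blast
  qed
  have "P \<in> Proj"
    unfolding Proj_iff
  proof (intro conjI allI impI)
    show "1 \<notin> P" using P(3)[of 0] by simp
    show "a \<in> P \<or> b \<in> P" if "a * b \<in> P" for a b by (rule graded_primeI[OF P(1) prime that])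
    show "\<exists>i. Var i \<notin> P"
      using positive_degree_in_ideal[OF S _ y] P(3)[of 1] by auto
  qed (rule P(1))
  then show False using V P(2) P(3)[of 1] by auto
qed

text \<open>Some power \<open>N i\<close> of each variable lies in \<open>A\<close>, and a monomial
  whose degree is at least the sum of the \<open>N i\<close> is divisible by one of these
  powers.\<close>

lemma forms_subset_if_Vplus_empty:
  fixes A :: "('v::finite, 'k::comm_ring_1) mpol set"
  assumes A: "graded_ideal A" and V: "\<And>p. p \<in> Proj \<Longrightarrow> \<not> A \<subseteq> p"
  shows "\<exists>N. \<forall>n\<ge>N. forms n \<subseteq> A"
proof -
  have S: "mul.subspace A" using A by (simp add: graded_ideal_def)
  have "\<exists>N. (Var i :: ('v, 'k) mpol) ^ N \<in> A" for i
    using graded_nullstellensatz[OF A homog_Var] V by blast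
  then obtain N where N: "\<And>i. (Var i :: ('v, 'k) mpol) ^ N i \<in> A" by metis
  have "F \<in> A" if F: "F \<in> forms n" "n \<ge> (\<Sum>i\<in>UNIV. N i)" for F n
  proof (rule mpol_in_ideal_if_mons[OF S])
    fix m assume "coef F m \<noteq> 0"
    then have "mdeg m = n" using F homogD by (auto simp: forms_def)
    then have "\<not> (\<Sum>i\<in>UNIV. Poly_Mapping.lookup m i) < (\<Sum>i\<in>UNIV. N i)" using F by (simp add: mdeg_def)
    then have "\<not> (\<forall>i\<in>UNIV. Poly_Mapping.lookup m i < N i)"
      using sum_strict_mono[of UNIV "Poly_Mapping.lookup m" N] by auto
    then obtain i where "N i \<le> Poly_Mapping.lookup m i" by (auto simp: not_less)
    then obtain m' where "mon m = Var i ^ N i * (mon m' :: ('v, 'k) mpol)" using mon_divisible[of "N i" m i] by auto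
    then show "mon m \<in> A" using mul_scale[OF S N] by simp
  qed
  then show ?thesis by blast
qed

lemma homogeneous_element_outside:
  assumes "graded_ideal q" "mul.subspace p" "\<not> q \<subseteq> p"
  shows "\<exists>F n. homog n F \<and> F \<in> q \<and> F \<notin> (p :: ('v::finite, 'k::comm_ring_1) mpol set)"
proof -
  obtain F where F: "F \<in> q" "F \<notin> p" using assms(3) by blast
  then obtain n where "hcomp n F \<notin> p" using hcomp_outside[OF assms(2)] by auto
  then show ?thesis using F(1) assms(1) homog_hcomp unfolding graded_ideal_def by blast
qed

lemma homogeneous_product_outside:
  assumes "finite Q" "p \<in> Proj" "\<And>q. q \<in> Q \<Longrightarrow> graded_ideal q \<and> \<not> q \<subseteq> p"
  shows "\<exists>F n. homog n F \<and> F \<notin> p \<and> (\<forall>q\<in>Q. F \<in> (q :: ('v::finite, 'k::comm_ring_1) mpol set))"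
proof -
  have "\<forall>q\<in>Q. \<exists>F n. homog n F \<and> F \<in> q \<and> F \<notin> p"
    using homogeneous_element_outside[OF _ Proj_subspace[OF assms(2)]] assms(3) by blast
  then obtain F n where F: "\<And>q. q \<in> Q \<Longrightarrow> homog (n q) (F q) \<and> F q \<in> q \<and> F q \<notin> p" by metis
  have "homog (\<Sum>q\<in>Q. n q) (\<Prod>q\<in>Q. F q)" using F by (intro homog_prod) blast
  moreover have "(\<Prod>q\<in>Q. F q) \<notin> p" using Proj_prod_iff[OF assms(2,1)] F by blast
  moreover have "(\<Prod>q\<in>Q. F q) \<in> q" if "q \<in> Q" for q
  proof -
    have "mul.subspace q" using assms(3) that by (simp add: graded_ideal_def)
    then show ?thesis using F that mul_scale by (subst prod.remove[OF assms(1) that]) blast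
  qed
  ultimately show ?thesis by blast
qed

text \<open>No supply of scalars is assumed. A form \<open>g\<close> that avoids \<open>Q\<close>
  but lies in \<open>p\<close> is corrected by a power of a form outside \<open>p\<close> that lies
  in all members of \<open>Q\<close> not contained in \<open>p\<close>.\<close>

lemma homogeneous_prime_avoidance:
  assumes "finite Q" "Q \<subseteq> Proj"
  shows "\<exists>g e. homog e g \<and> e > 0 \<and> (\<forall>p\<in>Q. g \<notin> (p :: ('v::finite, 'k::comm_ring_1) mpol set))"
  using assms
proof (induction Q rule: finite_induct)
  case empty
  have "homog (Suc 0) (Var undefined :: ('v, 'k) mpol)" by simp
  then show ?case by blast
next
  case (insert p Q)
  then obtain g e where g: "homog e g" "e > 0" "\<And>q. q \<in> Q \<Longrightarrow> g \<notin> q" by auto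
  have p: "p \<in> Proj" and Q: "Q \<subseteq> Proj" using insert by auto
  show ?case
  proof (cases "g \<in> p")
    case False then show ?thesis using g by blast
  next
    case True
    obtain i where i: "Var i \<notin> p" using p by (auto simp: Proj_iff)
    have "graded_ideal q \<and> \<not> q \<subseteq> p" if "q \<in> {q \<in> Q. \<not> q \<subseteq> p}" for q
        using that Q Proj_graded[of q] by auto
    then have "\<exists>F n. homog n F \<and> F \<notin> p \<and> (\<forall>q\<in>{q \<in> Q. \<not> q \<subseteq> p}. F \<in> q)"
      using insert(1) by (intro homogeneous_product_outside[OF _ p]) simp_all
    then obtain x n where "homog n x" "x \<notin> p" "\<forall>q\<in>{q \<in> Q. \<not> q \<subseteq> p}. x \<in> q" by (elim exE conjE)
    then have x: "homog n x" "x \<notin> p" "\<And>q. q \<in> Q \<Longrightarrow> \<not> q \<subseteq> p \<Longrightarrow> x \<in> q" by simp_all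
    \<comment> \<open>The variable makes the degree \<open>Suc n\<close> positive, so that
      \<open>g ^ Suc n\<close> and \<open>g' ^ e\<close> have equal degrees with both exponents
      positive.\<close>
    define g' where "g' = Var i * x"
    have g': "homog (Suc n) g'" using homog_mult[OF homog_Var x(1)] by (simp add: g'_def)
    have g'p: "g' \<notin> p" using i x p by (simp add: g'_def Proj_mult_iff)
    let ?h = "g ^ Suc n + g' ^ e"
    have "homog (e * Suc n) ?h"
      using homog_power[OF g(1), of "Suc n"] homog_power[OF g', of e] by (simp add: homog_add mult.commute)
    moreover have "?h \<notin> q" if "q \<in> insert p Q" for q
    proof
      assume h: "?h \<in> q"
      have q: "q \<in> Proj" using that p Q by blast
      note S = mul.subspace_diff[OF Proj_subspace[OF q] h]
      show False
      proof (cases "q \<subseteq> p")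
        case True
        then have "?h \<in> p" using h by blast
        moreover have "g ^ Suc n \<in> p" using \<open>g \<in> p\<close> p Proj_power_iff by blast
        ultimately have "g' ^ e \<in> p" using mul.subspace_diff[OF Proj_subspace[OF p]] by fastforce
        then show False using g'p Proj_power_iff[OF p] by blast
      next
        case False
        then have "q \<in> Q" using that by blast
        then have "g' \<in> q" using x(3) False mul.subspace_scale[OF Proj_subspace[OF q]] by (simp add: g'_def)
        then have "g' ^ e \<in> q" using g(2) Proj_power_iff[OF q] by blast
        then have "g ^ Suc n \<in> q" using S by fastforce
        then show False using g(3)[OF \<open>q \<in> Q\<close>] Proj_power_iff[OF q] by blast
      qed
    qed
    ultimately show ?thesis using g(2) by (metis nat_0_less_mult_iff zero_less_Suc)
  qed
qed

section \<open>Hilbert functions\<close>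

text \<open>The Hilbert function of the quotient by \<open>A\<close>. The subtraction never
  truncates, by \<open>dim_part_le\<close>.\<close>

definition hfun :: "('v::{finite,linorder}, 'k::field) mpol set \<Rightarrow> nat \<Rightarrow> nat"
  where "hfun A n = mvs.dim (forms n :: ('v, 'k) mpol set) - mvs.dim (A \<inter> forms n)"

lemma subspace_mvs: "mul.subspace A \<Longrightarrow> mvs.subspace A"
  by (auto intro!: mvs.subspaceI simp: mul.subspace_0 mul.subspace_add mul.subspace_scale)

lemma subspace_part: "mul.subspace A \<Longrightarrow> mvs.subspace (A \<inter> forms n)"
  by (intro mvs.subspace_inter subspace_mvs subspace_forms)

lemma fin_dim_part: "fin_dim (A \<inter> forms n)"
  using fin_dim_mono[OF fin_dim_forms] by blast

lemma dim_part_le: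
  fixes A :: "('v::{finite,linorder}, 'k::field) mpol set"
  shows "mvs.dim (A \<inter> forms n) \<le> mvs.dim (forms n :: ('v, 'k) mpol set)"
  by (rule dim_mono_fin_dim[OF fin_dim_forms]) simp

lemma hfun_dim:
  fixes A :: "('v::{finite,linorder}, 'k::field) mpol set"
  shows "hfun A n + mvs.dim (A \<inter> forms n) = mvs.dim (forms n :: ('v, 'k) mpol set)"
  using dim_part_le[of A n] by (simp add: hfun_def)

lemma hfun_antimono: "A \<inter> forms n \<subseteq> B \<Longrightarrow> hfun B n \<le> hfun A n"
  unfolding hfun_def
  by (intro diff_le_mono2 dim_mono_fin_dim[OF fin_dim_part]) blast

lemma hfun_eq_0_iff: "mul.subspace A \<Longrightarrow> hfun A n = 0 \<longleftrightarrow> forms n \<subseteq> A"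
  using subspace_eq_if_dim_le[OF fin_dim_forms _ subspace_part, of A n n] dim_part_le[of A n]
  by (auto simp: hfun_def Int_absorb1)

lemma hfun_zero: "hfun ({0} :: ('v, 'k) mpol set) n = mvs.dim (forms n :: ('v::{finite,linorder}, 'k::field) mpol set)"
proof -
  have "{0} \<inter> (forms n :: ('v, 'k) mpol set) = mvs.span {}" by (auto simp: forms_def)
  then have "mvs.dim ({0} \<inter> (forms n :: ('v, 'k) mpol set)) = mvs.dim (mvs.span ({} :: ('v, 'k) mpol set))"
    by (simp only:)
  also have "\<dots> = 0"
    unfolding mvs.dim_span using mvs.dim_eq_card_independent[OF mvs.independent_empty] by simp
  finally have "mvs.dim ({0} \<inter> (forms n :: ('v, 'k) mpol set)) = 0" .
  then show ?thesis by (simp add: hfun_def)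
qed

lemma dim_mult_image:
  fixes g :: "('v::{finite,linorder}, 'k::field) mpol"
  assumes "g \<noteq> 0"
  shows "mvs.dim ((*) g ` V) = mvs.dim V"
proof (rule dim_image_inj_on_span)
  show "Vector_Spaces.linear mscale mscale ((*) g)"
    unfolding Vector_Spaces.linear_iff using mvs.vector_space_axioms
    by (simp add: distrib_left mult.left_commute)
  show "inj_on ((*) g) (mvs.span V)" using assms by (auto intro: inj_onI)
qed

text \<open>Additivity of the Hilbert function along
  \<open>0 \<rightarrow> (S/(A : g))(-r) \<rightarrow> S/A \<rightarrow> S/(A + (g)) \<rightarrow> 0\<close>.\<close>

lemma hfun_exact:
  fixes g :: "('v::{finite,linorder}, 'k::field) mpol"
  assumes A: "graded_ideal A" and g: "homog r g" "g \<noteq> 0"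
  shows "hfun A (n + r) = hfun (mul.span (insert g A)) (n + r) + hfun (colon A g) n"
proof -
  have S: "mul.subspace A" using A by (simp add: graded_ideal_def)
  let ?B = "mul.span (insert g A)" and ?m = "n + r"
  let ?G = "(*) g ` forms n"
  have G: "mvs.subspace ?G"
  proof (rule mvs.subspaceI)
    show "0 \<in> ?G" using mvs.subspace_0[OF subspace_forms] by (metis image_eqI mult_zero_right)
    show "x + y \<in> ?G" if xy: "x \<in> ?G" "y \<in> ?G" for x y
    proof -
      obtain x' y' where "x = g * x'" "y = g * y'" "x' \<in> forms n" "y' \<in> forms n" using xy by blast
      then show ?thesis using mvs.subspace_add[OF subspace_forms, of x' n y']
        by (metis distrib_left image_eqI)
    qed
    show "Cst c * x \<in> ?G" if "x \<in> ?G" for c x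
      using that mvs.subspace_scale[OF subspace_forms, of _ n c] by (auto simp: mult.left_commute intro!: image_eqI)
  qed
  have G_forms: "?G \<subseteq> forms ?m" using homog_mult[OF g(1)] by (auto simp: forms_def add.commute)
  have Gfin: "fin_dim ?G" by (rule fin_dim_mono[OF fin_dim_forms G_forms])
  have B: "?B \<inter> forms ?m = {x + y |x y. x \<in> A \<inter> forms ?m \<and> y \<in> ?G}"
  proof (intro antisym subsetI)
    fix F assume F: "F \<in> ?B \<inter> forms ?m"
    then obtain a c where ac: "a \<in> A" "F = a + g * c" using in_span_insert_mult[OF _ S] by blast
    have "F = hcomp ?m F" using F hcomp_homog[of ?m F ?m] by (simp add: forms_def)
    also have "\<dots> = hcomp ?m a + g * hcomp n c" using ac(2) hcomp_homog_mult[OF g(1)] by (simp add: hcomp_add)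
    finally show "F \<in> {x + y |x y. x \<in> A \<inter> forms ?m \<and> y \<in> ?G}"
      using ac(1) A homog_hcomp by (fastforce simp: forms_def graded_ideal_def)
  next
    fix F assume "F \<in> {x + y |x y. x \<in> A \<inter> forms ?m \<and> y \<in> ?G}"
    then obtain x c where xc: "F = x + g * c" "x \<in> A" "x \<in> forms ?m" "c \<in> forms n" by blast
    then have "F \<in> forms ?m" using G_forms mvs.subspace_add[OF subspace_forms] by blast
    moreover have "F \<in> ?B" unfolding xc(1)
      using xc(2) mul.span_scale[OF mul.span_base[of g "insert g A"], of c]
      by (intro mul.span_add) (auto simp: mult.commute intro: mul.span_base)
    ultimately show "F \<in> ?B \<inter> forms ?m" by blast
  qed
  \<comment> \<open>The dimension formula for sums is applied to the parts of \<open>A\<close> and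
    of \<open>(g)\<close>: their sum is the part of \<open>A + (g)\<close>, and their intersection
    is \<open>g\<close> times the part of the colon ideal.\<close>
  have I: "(A \<inter> forms ?m) \<inter> ?G = (*) g ` (colon A g \<inter> forms n)"
    using G_forms by (auto simp: colon_def)
  have "mvs.dim (?B \<inter> forms ?m) + mvs.dim (colon A g \<inter> forms n) = mvs.dim (A \<inter> forms ?m) + mvs.dim (forms n :: ('v, 'k) mpol set)"
    using dim_sums_Int_fin_dim[OF subspace_part[OF S] fin_dim_part G Gfin, of ?m]
    unfolding B[symmetric] I dim_mult_image[OF g(2)] by simp
  then show ?thesis using hfun_dim[of A ?m] hfun_dim[of ?B ?m] hfun_dim[of "colon A g" n] by linarith
qed

text \<open>If \<open>g\<close> of degree \<open>r\<close> avoids the finitely many points,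
  \<open>A + (g)\<close> contains all forms of large degree, and exactness gives
  \<open>hfun A (n + r) \<le> hfun A n\<close> from some degree on.\<close>

lemma hfun_bounded_if_Vplus_finite:
  fixes A :: "('v::{finite,linorder}, 'k::field) mpol set"
  assumes A: "graded_ideal A" and fin: "finite {p \<in> Proj. A \<subseteq> p}"
  shows "\<exists>B. \<forall>n. hfun A n \<le> B"
proof -
  have S: "mul.subspace A" using A by (simp add: graded_ideal_def)
  obtain g r where g: "homog r g" "r > 0" "\<And>p. p \<in> Proj \<Longrightarrow> A \<subseteq> p \<Longrightarrow> g \<notin> p"
    using homogeneous_prime_avoidance[OF fin] by auto
  let ?B = "mul.span (insert g A)"
  have "\<not> ?B \<subseteq> p" if "p \<in> Proj" for p
    using g(3)[OF that] mul.span_superset[of "insert g A"] by blast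
  then obtain N where N: "\<And>n. n \<ge> N \<Longrightarrow> forms n \<subseteq> ?B"
    using forms_subset_if_Vplus_empty[OF graded_span_insert[OF A g(1)]] by blast
  have step: "hfun A (n + r) \<le> hfun A n" if "n \<ge> N" for n
  proof (cases "g = 0")
    \<comment> \<open>The zero form avoids every point only if there is none; then \<open>A\<close>
      itself contains the forms of large degree.\<close>
    case True
    have "insert g A = A" using True mul.subspace_0[OF S] by blast
    then have "?B = A" using S mul.span_eq_iff by simp
    then show ?thesis using N[of "n + r"] that hfun_eq_0_iff[OF S, of "n + r"] by simp
  next
    case False
    have "A \<subseteq> colon A g" using mul.subspace_scale[OF S] by (auto simp: colon_def)
    then have "hfun (colon A g) n \<le> hfun A n" by (intro hfun_antimono) blast
    moreover have "hfun ?B (n + r) = 0"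
      using N[of "n + r"] that hfun_eq_0_iff[OF mul.subspace_span, of "insert g A" "n + r"] by simp
    ultimately show ?thesis using hfun_exact[OF A g(1) False, of n] by simp
  qed
  have "hfun A n \<le> Max (hfun A ` {..N + r})" for n
  proof (induction n rule: less_induct)
    case (less n)
    show ?case
    proof (cases "n \<le> N + r")
      case True then show ?thesis by (intro Max_ge) auto
    next
      case False
      then have "hfun A n \<le> hfun A (n - r)" using step[of "n - r"] by simp
      then show ?thesis using less[of "n - r"] False g(2) by simp
    qed
  qed
  then show ?thesis by blast
qed

lemma hfun_pos_Proj:
  assumes "p \<in> Proj" shows "0 < hfun (p :: ('v::{finite,linorder}, 'k::field) mpol set) n"
proof -
  obtain i where "Var i \<notin> p" using assms by (auto simp: Proj_iff)
  then have "(Var i) ^ n \<notin> p" using assms Proj_power_iff by blast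
  moreover have "(Var i) ^ n \<in> (forms n :: ('v, 'k) mpol set)"
    using homog_power[OF homog_Var[of i], of n] by (simp add: forms_def)
  ultimately show ?thesis using hfun_eq_0_iff[OF Proj_subspace[OF assms], of n] by auto
qed

lemma colon_prime: "p \<in> Proj \<Longrightarrow> g \<notin> p \<Longrightarrow> colon p g = p"
  by (auto simp: colon_def Proj_mult_iff)

text \<open>A form of degree \<open>r\<close> in \<open>q\<close> but not in \<open>p\<close> is a
  nonzerodivisor modulo \<open>p\<close>; by exactness the Hilbert function of \<open>p\<close>
  would grow by at least one every \<open>r\<close> degrees.\<close>

lemma Proj_incomparable_if_hfun_bounded:
  fixes p q :: "('v::{finite,linorder}, 'k::field) mpol set"
  assumes p: "p \<in> Proj" and q: "q \<in> Proj" and "p \<subseteq> q" and B: "\<And>n. hfun p n \<le> B"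
  shows "p = q"
proof (rule ccontr)
  assume "p \<noteq> q"
  then have "\<not> q \<subseteq> p" using assms by blast
  then obtain g r where g: "homog r g" "g \<in> q" "g \<notin> p"
    using homogeneous_element_outside[OF Proj_graded[OF q] Proj_subspace[OF p]] by blast
  have g0: "g \<noteq> 0" using g(3) mul.subspace_0[OF Proj_subspace[OF p]] by blast
  have "mul.span (insert g p) \<subseteq> q"
    using g(2) assms(3) by (intro mul.span_minimal Proj_subspace[OF q]) auto
  then have le: "hfun q (n + r) \<le> hfun (mul.span (insert g p)) (n + r)" for n
    by (intro hfun_antimono) blast
  have step: "Suc (hfun p n) \<le> hfun p (n + r)" for n
    using hfun_exact[OF Proj_graded[OF p] g(1) g0, of n] hfun_pos_Proj[OF q, of "n + r"] le[of n]
    unfolding colon_prime[OF p g(3)] by linarith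
  have "n \<le> hfun p (n * r)" for n
  proof (induction n)
    case (Suc n)
    then show ?case using step[of "n * r"] by (simp add: add.commute)
  qed simp
  then show False using B[of "Suc B * r"] by (metis Suc_n_not_le_n le_trans)
qed

text \<open>Every point adds at least one to the Hilbert function in large degrees, so
  \<open>B + 1\<close> points would exceed the bound.\<close>

lemma Vplus_finite_if_hfun_bounded:
  fixes A :: "('v::{finite,linorder}, 'k::field) mpol set"
  assumes B: "\<And>n. hfun A n \<le> B"
  shows "finite {p \<in> Proj. A \<subseteq> p}"
proof (rule ccontr)
  assume "infinite {p \<in> Proj. A \<subseteq> p}"
  then obtain Q where Q: "finite Q" "card Q = Suc B" "Q \<subseteq> {p \<in> Proj. A \<subseteq> p}"
    using infinite_arbitrarily_large by blast
  have bd: "hfun p n \<le> B" if "p \<in> Q" for p n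
    using that Q(3) hfun_antimono[of A n p] B[of n] by (metis (no_types, lifting) inf.coboundedI1 le_trans mem_Collect_eq subsetD)
  have "\<exists>N. \<forall>n\<ge>N. card Q' \<le> hfun (\<Inter>Q') n \<and> graded_ideal (\<Inter>Q')" if "Q' \<subseteq> Q" for Q'
    using finite_subset[OF that Q(1)] that
  proof (induction Q' rule: finite_induct)
    case empty
    show ?case by (auto simp: graded_ideal_def)
  next
    case (insert p Q')
    then obtain N where N: "\<And>n. n \<ge> N \<Longrightarrow> card Q' \<le> hfun (\<Inter>Q') n" and gr: "graded_ideal (\<Inter>Q')" by auto
    have p: "p \<in> Proj" "p \<in> Q" using insert Q(3) by auto
    have "\<not> q \<subseteq> p" if "q \<in> Q'" for q
    proof
      assume "q \<subseteq> p"
      moreover have "q \<in> Q" "q \<in> Proj" using that insert(4) Q(3) by auto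
      ultimately have "q = p" using Proj_incomparable_if_hfun_bounded[OF _ p(1), of q B] bd[of q] by blast
      then show False using that insert(2) by blast
    qed
    then obtain g r where g: "homog r g" "g \<notin> p" "g \<in> \<Inter>Q'"
    proof -
      have "graded_ideal q" if "q \<in> Q'" for q using that insert(4) Q(3) Proj_graded[of q] by auto
      then have "\<exists>F n. homog n F \<and> F \<notin> p \<and> (\<forall>q\<in>Q'. F \<in> q)"
        using \<open>\<And>q. q \<in> Q' \<Longrightarrow> \<not> q \<subseteq> p\<close> by (intro homogeneous_product_outside[OF insert(1) p(1)]) blast
      then show ?thesis using that by blast
    qed
    have g0: "g \<noteq> 0" using g(2) mul.subspace_0[OF Proj_subspace[OF p(1)]] by blast
    let ?A = "p \<inter> \<Inter>Q'"
    have grA: "graded_ideal ?A" using graded_inter[OF Proj_graded[OF p(1)] gr] .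
    have sub: "mul.subspace (\<Inter>Q')" using gr by (simp add: graded_ideal_def)
    \<comment> \<open>\<open>g\<close> lies in all the earlier primes but not in \<open>p\<close>,
      so dividing by it leaves exactly \<open>p\<close>. Exactness along \<open>g\<close> then
      separates the contribution of \<open>p\<close> from that of the others.\<close>
    have col: "colon ?A g = p"
      using g(2,3) mul_scale[OF sub g(3)] by (auto simp: colon_def Proj_mult_iff[OF p(1)])
    have "mul.span (insert g ?A) \<subseteq> \<Inter>Q'" using g(3) by (intro mul.span_minimal sub) auto
    then have "hfun (\<Inter>Q') (n + r) \<le> hfun (mul.span (insert g ?A)) (n + r)" for n
      by (intro hfun_antimono) blast
    then have le: "hfun (\<Inter>Q') (n + r) + hfun p n \<le> hfun ?A (n + r)" for n
      unfolding hfun_exact[OF grA g(1) g0, of n] col by simp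
    have A: "Suc (card Q') \<le> hfun ?A (n + r)" if "n \<ge> N" for n
      using hfun_pos_Proj[OF p(1), of n] le[of n] N[of "n + r"] that by linarith
    have "Suc (card Q') \<le> hfun ?A n" if "n \<ge> N + r" for n
      using A[of "n - r"] that by simp
    then show ?case using insert(1,2) grA by (intro exI[of _ "N + r"]) simp
  qed
  then obtain N where "\<And>n. n \<ge> N \<Longrightarrow> card Q \<le> hfun (\<Inter>Q) n" by blast
  then have "Suc B \<le> hfun (\<Inter>Q) N" using Q(2) by simp
  also have "\<dots> \<le> hfun A N" using Q(3) by (intro hfun_antimono) blast
  finally show False using B[of N] by simp
qed

text \<open>The forms \<open>l c\<close> have coefficients on a conic, so any three of them are
  independent (Vandermonde), and a prime with three of them would contain every variable. Each point
  therefore excludes at most two values of \<open>c\<close>.\<close>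

lemma exists_linear_form_outside:
  fixes Q :: "(3, 'k::field) mpol set set"
  assumes "finite Q" "Q \<subseteq> Proj" "infinite (UNIV :: 'k set)"
  shows "\<exists>l. homog (Suc 0) l \<and> l \<noteq> 0 \<and> (\<forall>p\<in>Q. l \<notin> p)"
proof -
  define l where "l c = Var 0 + Cst c * Var 1 + Cst (c ^ 2) * (Var 2 :: (3, 'k) mpol)" for c
  have lin: "homog (Suc 0) (l c)" for c
    by (simp add: l_def homog_add homog_Cst_mult)
  have nz: "l c \<noteq> 0" for c
  proof -
    have "Poly_Mapping.single i (Suc 0) = Poly_Mapping.single j (Suc 0) \<longleftrightarrow> i = j" for i j :: 3
      by (metis keys_single nat.simps(3) singleton_inject)
    then have "coef (l c) (Poly_Mapping.single 0 1) = 1"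
      by (simp add: l_def lookup_add Var_def lookup_single when_def)
    then show ?thesis by auto
  qed
  have fin: "finite {c. l c \<in> p}" if "p \<in> Q" for p
  proof (rule ccontr)
    assume "infinite {c. l c \<in> p}"
    then obtain C where C: "finite C" "card C = 3" "C \<subseteq> {c. l c \<in> p}"
      using infinite_arbitrarily_large by blast
    then obtain a b c where abc: "a \<noteq> b" "b \<noteq> c" "a \<noteq> c" "l a \<in> p" "l b \<in> p" "l c \<in> p"
      by (auto simp: card_3_iff)
    have p: "p \<in> Proj" using that assms(2) by blast
    note S = Proj_subspace[OF p]
    have cancel: "F \<in> p" if "Cst x * F \<in> p" "x \<noteq> 0" for x F
      using mul.subspace_scale[OF S that(1), of "Cst (inverse x)"] unfolding Cst_inverse[OF that(2)] .
    have d: "Var 1 + Cst (x + y) * Var 2 \<in> p" if "l x \<in> p" "l y \<in> p" "x \<noteq> y" for x y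
    proof (rule cancel)
      have "l x - l y = Cst (x - y) * (Var 1 + Cst (x + y) * Var 2)"
        unfolding l_def Cst_add Cst_diff Cst_power by (rule quadratic_difference)
      then show "Cst (x - y) * (Var 1 + Cst (x + y) * Var 2) \<in> p"
        using mul.subspace_diff[OF S that(1,2)] by simp
    qed (use that in simp)
    have "(Var 1 + Cst (a + b) * Var 2) - (Var 1 + Cst (c + b) * Var 2) = Cst (a - c) * (Var 2 :: (3, 'k) mpol)"
      by (simp add: Cst_add Cst_diff algebra_simps)
    then have 2: "Var 2 \<in> p"
      using mul.subspace_diff[OF S d[of a b] d[of c b]] abc cancel[of "a - c" "Var 2"] by simp
    then have 1: "Var 1 \<in> p"
      using mul.subspace_diff[OF S d[of a b] mul.subspace_scale[OF S 2, of "Cst (a + b)"]] abc by simp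
    have "l a - (Cst a * Var 1 + Cst (a ^ 2) * Var 2) \<in> p"
      by (intro mul.subspace_diff[OF S] mul.subspace_add[OF S] mul.subspace_scale[OF S] 1 2 abc)
    then have 0: "Var 0 \<in> p" by (simp add: l_def)
    have "Var i \<in> p" for i
      using 0 1 2 UNIV_I[of i] unfolding UNIV_3 by auto
    then show False using p by (simp add: Proj_iff)
  qed
  have "finite (\<Union>p\<in>Q. {c. l c \<in> p})" using fin assms(1) by blast
  then obtain c where "c \<notin> (\<Union>p\<in>Q. {c. l c \<in> p})" using assms(3) by (metis ex_new_if_finite)
  then show ?thesis using lin nz by blast
qed

lemma exists_linear_parameter:
  fixes A :: "(3, 'k::field) mpol set"
  assumes A: "graded_ideal A" and "\<And>n. hfun A n \<le> B" and "infinite (UNIV :: 'k set)"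
  shows "\<exists>l. homog (Suc 0) l \<and> l \<noteq> 0 \<and> (\<forall>p\<in>Proj. A \<subseteq> p \<longrightarrow> l \<notin> p)"
  using exists_linear_form_outside[OF Vplus_finite_if_hfun_bounded[OF assms(2)] _ assms(3)] by blast

text \<open>Once \<open>A + (l)\<close> contains all forms, exactness makes the Hilbert function
  nonincreasing, and a nonincreasing sequence of natural numbers stabilises.\<close>

lemma hfun_eventually_constant:
  fixes A :: "(3, 'k::field) mpol set"
  assumes A: "graded_ideal A" and l: "homog (Suc 0) l" "l \<noteq> 0" "\<And>p. p \<in> Proj \<Longrightarrow> A \<subseteq> p \<Longrightarrow> l \<notin> p"
  shows "\<exists>N D. \<forall>n\<ge>N. hfun A n = D"
proof -
  have S: "mul.subspace A" using A by (simp add: graded_ideal_def)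
  let ?B = "mul.span (insert l A)"
  have "\<not> ?B \<subseteq> p" if "p \<in> Proj" for p
    using l(3)[OF that] mul.span_superset[of "insert l A"] by blast
  then obtain N where N: "\<And>n. n \<ge> N \<Longrightarrow> forms n \<subseteq> ?B"
    using forms_subset_if_Vplus_empty[OF graded_span_insert[OF A l(1)]] by blast
  have "A \<subseteq> colon A l" using mul.subspace_scale[OF S] by (auto simp: colon_def)
  then have "hfun (colon A l) n \<le> hfun A n" for n by (intro hfun_antimono) blast
  then have dec: "hfun A (Suc n) \<le> hfun A n" if "n \<ge> N" for n
    using hfun_exact[OF A l(1,2), of n] N[of "Suc n"] that hfun_eq_0_iff[OF mul.subspace_span, of _ "Suc n"]
    by (metis Suc_eq_plus1 add_0 le_Suc_eq)
  define D where "D = (LEAST D. \<exists>n\<ge>N. hfun A n = D)"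
  have "\<exists>n\<ge>N. hfun A n = D" unfolding D_def by (rule LeastI[of _ "hfun A N"]) auto
  then obtain n0 where n0: "n0 \<ge> N" "hfun A n0 = D" by blast
  have min: "D \<le> hfun A n" if "n \<ge> N" for n unfolding D_def by (rule Least_le) (use that in auto)
  have "hfun A n \<le> D" if "n \<ge> n0" for n
    using that
  proof (induction n rule: dec_induct)
    case base then show ?case using n0 by simp
  next
    case (step n) then show ?case using dec[of n] n0(1) by simp
  qed
  then have "hfun A n = D" if "n \<ge> n0" for n using that min n0(1) by (meson le_antisym le_trans)
  then show ?thesis by blast
qed

section \<open>Evaluation homomorphisms\<close>

definition mev :: "('k::comm_ring_1 \<Rightarrow> 'r::comm_ring_1) \<Rightarrow> ('v::finite \<Rightarrow> 'r) \<Rightarrow> ('v, 'k) mpol \<Rightarrow> 'r"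
  where "mev \<sigma> x F =
    (\<Sum>m\<in>Poly_Mapping.keys F. \<sigma> (coef F m) * (\<Prod>i\<in>UNIV. x i ^ Poly_Mapping.lookup m i))"

lemma subst_eq_mev: "subst f = mev Cst f"
  by (simp add: subst_def mev_def fun_eq_iff)

context comm_ring_hom
begin

lemma mev_superset:
  assumes "finite M" "Poly_Mapping.keys F \<subseteq> M"
  shows "mev hom x F = (\<Sum>m\<in>M. hom (coef F m) * (\<Prod>i\<in>UNIV. x i ^ Poly_Mapping.lookup m i))"
  unfolding mev_def using assms by (intro sum.mono_neutral_left) (auto simp: in_keys_iff)

lemma mev_single:
  "mev hom x (Poly_Mapping.single m c) = hom c * (\<Prod>i\<in>UNIV. x i ^ Poly_Mapping.lookup m i)"
  by (subst mev_superset[of "{m}"]) auto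

lemma mev_add: "mev hom x (F + G) = mev hom x F + mev hom x G"
proof -
  let ?M = "Poly_Mapping.keys F \<union> Poly_Mapping.keys G"
  have "mev hom x F = (\<Sum>m\<in>?M. hom (coef F m) * (\<Prod>i\<in>UNIV. x i ^ Poly_Mapping.lookup m i))"
    "mev hom x G = (\<Sum>m\<in>?M. hom (coef G m) * (\<Prod>i\<in>UNIV. x i ^ Poly_Mapping.lookup m i))"
    "mev hom x (F + G) = (\<Sum>m\<in>?M. hom (coef (F + G) m) * (\<Prod>i\<in>UNIV. x i ^ Poly_Mapping.lookup m i))"
    using keys_add[of F G] by (intro mev_superset; auto)+
  then show ?thesis by (simp add: lookup_add hom_add distrib_right sum.distrib)
qed

lemma mev_0: "mev hom x 0 = 0"
  by (simp add: mev_def)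

lemma mev_sum: "mev hom x (sum g A) = (\<Sum>a\<in>A. mev hom x (g a))"
  by (induction A rule: infinite_finite_induct) (simp_all add: mev_0 mev_add)

lemma mev_mult:
  fixes F G :: "('v::finite, 'a) mpol"
  shows "mev hom x (F * G) = mev hom x F * mev hom x G"
proof -
  let ?s = "\<lambda>F m. Poly_Mapping.single m (coef F m)"
  have decomp: "F = (\<Sum>m\<in>Poly_Mapping.keys F. ?s F m)" for F :: "('v, 'a) mpol"
    using mono_decomp[of F] by (simp add: Cst_def mult_single)
  have "F * G = (\<Sum>m\<in>Poly_Mapping.keys F. \<Sum>n\<in>Poly_Mapping.keys G. ?s F m * ?s G n)"
    by (subst decomp[of F], subst decomp[of G]) (simp add: sum_product)
  also have "mev hom x \<dots> =
      (\<Sum>m\<in>Poly_Mapping.keys F. \<Sum>n\<in>Poly_Mapping.keys G. mev hom x (?s F m) * mev hom x (?s G n))"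
    by (simp add: mev_sum mult_single mev_single hom_mult lookup_add power_add prod.distrib mult_ac)
  also have "\<dots> = mev hom x (\<Sum>m\<in>Poly_Mapping.keys F. ?s F m) * mev hom x (\<Sum>n\<in>Poly_Mapping.keys G. ?s G n)"
    by (simp add: mev_sum sum_product)
  finally show ?thesis using decomp[of F] decomp[of G] by simp
qed

lemma mev_Cst: "mev hom x (Cst c) = hom c"
  by (simp add: Cst_def mev_single)

lemma mev_Var: "mev hom x (Var i) = x i"
proof -
  have "(\<Prod>j\<in>UNIV. x j ^ Poly_Mapping.lookup (Poly_Mapping.single i 1) j) = (\<Prod>j\<in>UNIV. if j = i then x j else 1)"
    by (intro prod.cong) (auto simp: lookup_single when_def)
  also have "\<dots> = x i" by simp
  finally show ?thesis by (simp add: Var_def mev_single)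
qed

lemma comm_ring_hom_mev: "comm_ring_hom (mev hom x)"
  by unfold_locales (simp_all add: mev_0 mev_add mev_mult flip: Cst_1 add: mev_Cst)

end

lemma mon_prod: "mon m = (\<Prod>i\<in>UNIV. Var i ^ Poly_Mapping.lookup m i :: ('v::finite, 'k::comm_ring_1) mpol)"
proof -
  have prod: "(\<Prod>i\<in>A. mon (e i)) = (mon (\<Sum>i\<in>A. e i) :: ('v, 'k) mpol)" for A e
    by (induction A rule: infinite_finite_induct) (simp_all add: mon_mult)
  have "(\<Sum>i\<in>UNIV. Poly_Mapping.single i (Poly_Mapping.lookup m i)) = m"
  proof (rule poly_mapping_eqI)
    fix j
    have "Poly_Mapping.lookup (\<Sum>i\<in>UNIV. Poly_Mapping.single i (Poly_Mapping.lookup m i)) j =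
        (\<Sum>i\<in>UNIV. if i = j then Poly_Mapping.lookup m i else 0)"
      unfolding lookup_sum by (intro sum.cong) (auto simp: lookup_single when_def)
    then show "Poly_Mapping.lookup (\<Sum>i\<in>UNIV. Poly_Mapping.single i (Poly_Mapping.lookup m i)) j = Poly_Mapping.lookup m j"
      by simp
  qed
  then show ?thesis by (simp add: Var_power prod)
qed

lemma mpol_hom_eq:
  assumes "comm_ring_hom h" "comm_ring_hom h'"
    and "\<And>c. h (Cst c) = h' (Cst c)" "\<And>i. h (Var i) = h' (Var i)"
  shows "h (F :: ('v::finite, 'k::comm_ring_1) mpol) = h' F"
proof -
  interpret h: comm_ring_hom h by fact
  interpret h': comm_ring_hom h' by fact
  have "h (\<Sum>m\<in>Poly_Mapping.keys F. Cst (coef F m) * mon m) =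
    h' (\<Sum>m\<in>Poly_Mapping.keys F. Cst (coef F m) * mon m)"
    by (simp add: h.hom_sum h'.hom_sum h.hom_mult h'.hom_mult mon_prod h.hom_prod h'.hom_prod
        h.hom_power h'.hom_power assms(3,4))
  then show ?thesis using mono_decomp[of F] by simp
qed

lemma comm_ring_hom_Cst: "comm_ring_hom (Cst :: 'k::comm_ring_1 \<Rightarrow> ('v, 'k) mpol)"
  by unfold_locales (simp_all add: Cst_add Cst_mult)

lemma comm_ring_hom_comp: "comm_ring_hom h \<Longrightarrow> comm_ring_hom g \<Longrightarrow> comm_ring_hom (\<lambda>x. h (g x))"
proof -
  assume "comm_ring_hom h" "comm_ring_hom g"
  then interpret h: comm_ring_hom h + g: comm_ring_hom g by simp_all
  show ?thesis by unfold_locales (simp_all add: h.hom_add g.hom_add h.hom_mult g.hom_mult)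
qed

lemma comm_ring_hom_subst: "comm_ring_hom (subst f)"
  unfolding subst_eq_mev by (rule comm_ring_hom.comm_ring_hom_mev[OF comm_ring_hom_Cst])

lemma subst_Cst: "subst f (Cst c) = Cst (c :: 'k::comm_ring_1)"
  unfolding subst_eq_mev by (rule comm_ring_hom.mev_Cst[OF comm_ring_hom_Cst])

lemma subst_Var: "subst f (Var i) = (f i :: ('v, 'k::comm_ring_1) mpol)"
  unfolding subst_eq_mev by (rule comm_ring_hom.mev_Var[OF comm_ring_hom_Cst])

section \<open>Unique factorisation\<close>

text \<open>An isomorphic copy of \<open>S\<close> whose unique factorisation comes with its type.
  \<open>'k fract\<close> is the field \<open>'k\<close> again; the wrapper supplies the class
  instances required of the coefficients.\<close>

definition poly3 :: "(3, 'k::field) mpol \<Rightarrow> 'k fract poly poly poly"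
  where "poly3 F = mev (\<lambda>c. [:[:[:to_fract c:]:]:]) (\<lambda>i. if i = 0 then [:[:[:0, 1:]:]:] else if i = 1 then [:[:0, 1:]:] else [:0, 1:]) F"

lemma comm_ring_hom_const3: "comm_ring_hom (\<lambda>c :: 'k::field. [:[:[:to_fract c:]:]:])"
  by unfold_locales (simp_all add: pCons_one)

lemma comm_ring_hom_poly3: "comm_ring_hom poly3"
  unfolding poly3_def[abs_def] by (rule comm_ring_hom.comm_ring_hom_mev[OF comm_ring_hom_const3])

interpretation poly3: comm_ring_hom poly3
  by (rule comm_ring_hom_poly3)

lemma poly3_Cst: "poly3 (Cst c) = [:[:[:to_fract c:]:]:]"
  unfolding poly3_def by (rule comm_ring_hom.mev_Cst[OF comm_ring_hom_const3])

lemma poly3_Var: "poly3 (Var 0) = [:[:[:0, 1:]:]:]" "poly3 (Var 1) = [:[:0, 1:]:]" "poly3 (Var 2) = [:0, 1:]"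
  unfolding poly3_def by (simp_all add: comm_ring_hom.mev_Var[OF comm_ring_hom_const3])

lemma X_power: "pCons 0 1 ^ n = (monom 1 n :: 'a::comm_ring_1 poly)"
  by (simp add: monom_altdef pCons_one)

lemma const_poly_power: "[:c:] ^ n = [:c ^ n :: 'a::comm_ring_1:]"
  by (induction n) (simp_all add: pCons_one)

lemma coeff_poly3:
  "coeff (coeff (coeff (poly3 F) (Poly_Mapping.lookup m 2)) (Poly_Mapping.lookup m 1)) (Poly_Mapping.lookup m 0) =
    to_fract (coef F m)"
proof -
  have single: "poly3 (Poly_Mapping.single m' (c :: 'a)) =
      monom (monom (monom (to_fract c) (Poly_Mapping.lookup m' 0)) (Poly_Mapping.lookup m' 1)) (Poly_Mapping.lookup m' 2)"
    for m' c
  proof -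
    have "poly3 (Poly_Mapping.single m' c) = [:[:[:to_fract c:]:]:] * ([:[:[:0, 1:]:]:] ^ Poly_Mapping.lookup m' 0 *
      ([:[:0, 1:]:] ^ Poly_Mapping.lookup m' 1 * [:0, 1:] ^ Poly_Mapping.lookup m' 2))"
      unfolding poly3_def comm_ring_hom.mev_single[OF comm_ring_hom_const3] UNIV_3 by simp
    also have "\<dots> = monom (monom (monom (to_fract c) (Poly_Mapping.lookup m' 0)) (Poly_Mapping.lookup m' 1)) (Poly_Mapping.lookup m' 2)"
      by (simp add: const_poly_power X_power smult_monom)
    finally show ?thesis .
  qed
  have "poly3 F = (\<Sum>m'\<in>Poly_Mapping.keys F. poly3 (Poly_Mapping.single m' (coef F m')))"
    using mono_decomp[of F] poly3.hom_sum by (metis (no_types, lifting) Cst_def add_0 mult.right_neutral mult_single sum.cong)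
  then have "coeff (coeff (coeff (poly3 F) (Poly_Mapping.lookup m 2)) (Poly_Mapping.lookup m 1)) (Poly_Mapping.lookup m 0) =
     (\<Sum>m'\<in>Poly_Mapping.keys F. coeff (coeff (coeff (poly3 (Poly_Mapping.single m' (coef F m'))) (Poly_Mapping.lookup m 2)) (Poly_Mapping.lookup m 1)) (Poly_Mapping.lookup m 0))"
    by (simp add: coeff_sum)
  also have "\<dots> = (\<Sum>m'\<in>Poly_Mapping.keys F. if m' = m then to_fract (coef F m') else 0)"
  proof (rule sum.cong[OF refl])
    fix m'
    have "m' = m" if "Poly_Mapping.lookup m' 0 = Poly_Mapping.lookup m 0"
      "Poly_Mapping.lookup m' 1 = Poly_Mapping.lookup m 1" "Poly_Mapping.lookup m' 2 = Poly_Mapping.lookup m 2"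
    proof (rule poly_mapping_eqI)
      fix i show "Poly_Mapping.lookup m' i = Poly_Mapping.lookup m i"
        using that UNIV_I[of i] unfolding UNIV_3 by auto
    qed
    then show "coeff (coeff (coeff (poly3 (Poly_Mapping.single m' (coef F m'))) (Poly_Mapping.lookup m 2)) (Poly_Mapping.lookup m 1)) (Poly_Mapping.lookup m 0)
      = (if m' = m then to_fract (coef F m') else 0)"
      unfolding single coeff_monom by (auto simp: coeff_monom)
  qed
  also have "\<dots> = to_fract (coef F m)" by (simp add: in_keys_iff)
  finally show ?thesis .
qed

lemma poly3_inject: "poly3 F = poly3 G \<Longrightarrow> F = G"
proof (rule poly_mapping_eqI)
  fix m assume "poly3 F = poly3 G"
  then have "to_fract (coef F m) = to_fract (coef G m)" using coeff_poly3[of F m] coeff_poly3[of G m] by simp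
  then show "coef F m = coef G m" by simp
qed

lemma poly3_surj: "\<exists>F. poly3 F = P"
proof -
  have 1: "\<exists>F. poly3 F = [:[:P:]:]" for P :: "'a fract poly"
  proof (induction P)
    case 0 show ?case by (rule exI[of _ 0]) simp
  next
    case (pCons a P)
    then obtain F where "poly3 F = [:[:P:]:]" by blast
    moreover obtain a' b' where a: "a = Fract a' b'" "b' \<noteq> 0" by (cases a) auto
    have "a = to_fract (a' / b')" unfolding a(1) to_fract_def using a(2) by (simp add: eq_fract)
    ultimately have "poly3 (Cst (a' / b') + Var 0 * F) = [:[:pCons a P:]:]"
      by (simp add: poly3.hom_add poly3.hom_mult poly3_Cst poly3_Var)
    then show ?case by blast
  qed
  have 2: "\<exists>F. poly3 F = [:P:]" for P :: "'a fract poly poly"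
  proof (induction P)
    case 0 show ?case by (rule exI[of _ 0]) simp
  next
    case (pCons a P)
    then obtain F G where "poly3 F = [:P:]" "poly3 G = [:[:a:]:]" using 1 by blast
    then have "poly3 (G + Var 1 * F) = [:pCons a P:]"
      by (simp add: poly3.hom_add poly3.hom_mult poly3_Var)
    then show ?case by blast
  qed
  show ?thesis
  proof (induction P)
    case 0 show ?case by (rule exI[of _ 0]) simp
  next
    case (pCons a P)
    then obtain F G where "poly3 F = P" "poly3 G = [:a:]" using 2 by blast
    then have "poly3 (G + Var 2 * F) = pCons a P"
      by (simp add: poly3.hom_add poly3.hom_mult poly3_Var)
    then show ?case by blast
  qed
qed

lemma poly3_dvd_iff: "poly3 F dvd poly3 G \<longleftrightarrow> F dvd G"
proof
  assume "poly3 F dvd poly3 G"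
  then obtain P where P: "poly3 G = poly3 F * P" by (elim dvdE)
  obtain H where "poly3 H = P" using poly3_surj by blast
  then have "poly3 G = poly3 (F * H)" using P by (simp add: poly3.hom_mult)
  then have "G = F * H" by (rule poly3_inject)
  then show "F dvd G" by simp
next
  assume "F dvd G"
  then show "poly3 F dvd poly3 G" by (auto simp: dvd_def poly3.hom_mult)
qed

text \<open>Coprimality in the form in which colon ideals use it: \<open>b\<close> is a
  nonzerodivisor modulo \<open>a\<close>.\<close>

definition rel_prime :: "'a::comm_ring_1 \<Rightarrow> 'a \<Rightarrow> bool"
  where "rel_prime a b \<longleftrightarrow> (\<forall>x. a dvd b * x \<longrightarrow> a dvd x)"

lemma rel_primeD: "rel_prime a b \<Longrightarrow> a dvd b * x \<Longrightarrow> a dvd x"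
  unfolding rel_prime_def by blast

lemma rel_prime_if_coprime_poly3:
  assumes "algebraic_semidom_class.coprime (poly3 a) (poly3 b)"
  shows "rel_prime a b"
  unfolding rel_prime_def poly3_dvd_iff[symmetric]
  using assms by (simp add: poly3.hom_mult coprime_dvd_mult_right_iff)

lemma gcd_factorisation:
  fixes a b :: "(3, 'k::field) mpol"
  assumes "a \<noteq> 0 \<or> b \<noteq> 0"
  shows "\<exists>g a' b'. a = g * a' \<and> b = g * b' \<and> rel_prime a' b' \<and> rel_prime b' a'"
proof -
  have "poly3 a \<noteq> 0 \<or> poly3 b \<noteq> 0" using assms poly3_inject[of _ 0] by fastforce
  then have "gcd (poly3 a) (poly3 b) \<noteq> 0" by simp
  obtain A B where AB: "poly3 a = A * gcd (poly3 a) (poly3 b)" "poly3 b = B * gcd (poly3 a) (poly3 b)" "algebraic_semidom_class.coprime A B"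
    using gcd_coprime_exists[OF \<open>gcd (poly3 a) (poly3 b) \<noteq> 0\<close>] by (elim exE conjE)
  obtain g a' b' where g: "poly3 g = gcd (poly3 a) (poly3 b)" and a': "poly3 a' = A" and b': "poly3 b' = B"
    using poly3_surj by metis
  have "poly3 a = poly3 (g * a')" "poly3 b = poly3 (g * b')"
    using AB g a' b' by (simp_all add: poly3.hom_mult mult.commute)
  then have "a = g * a'" "b = g * b'" using poly3_inject by blast+
  moreover have "rel_prime a' b'" "rel_prime b' a'"
    using AB(3) rel_prime_if_coprime_poly3[of a' b'] rel_prime_if_coprime_poly3[of b' a']
    unfolding a' b' by (simp_all add: algebraic_semidom_class.coprime_commute)
  ultimately show ?thesis by blast
qed

text \<open>Only finitely many primes divide \<open>a\<close>. If every \<open>b + t c\<close>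
  shared one with \<open>a\<close>, the same prime would serve for two values of \<open>t\<close>;
  it would then divide \<open>c\<close>, hence \<open>b\<close>, as well as \<open>a\<close>,
  against \<open>unit\<close>.\<close>

lemma exists_rel_prime_combination:
  fixes a b c :: "(3, 'k::field) mpol"
  assumes inf: "infinite (UNIV :: 'k set)" and "a \<noteq> 0"
    and unit: "\<And>g. g dvd a \<Longrightarrow> g dvd b \<Longrightarrow> g dvd c \<Longrightarrow> g dvd 1"
  shows "\<exists>t. rel_prime a (b + Cst t * c)"
proof (rule ccontr)
  assume no: "\<not> (\<exists>t. rel_prime a (b + Cst t * c))"
  let ?P = "{p. normalization_semidom_class.prime p \<and> p dvd poly3 a}"
  have a0: "poly3 a \<noteq> 0" using assms(2) poly3_inject[of a 0] by auto
  then have fin: "finite ?P" by (rule finite_prime_divisors)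
  have "\<exists>p\<in>?P. p dvd poly3 (b + Cst t * c)" for t
  proof -
    have "\<not> algebraic_semidom_class.coprime (poly3 a) (poly3 (b + Cst t * c))" using no rel_prime_if_coprime_poly3 by blast
    then obtain q where q: "q dvd poly3 a" "q dvd poly3 (b + Cst t * c)" "\<not> is_unit q" by (rule not_coprimeE)
    then have "q \<noteq> 0" using a0 by auto
    then obtain p where "p dvd q" "normalization_semidom_class.prime p" using prime_divisor_exists q(3) by blast
    then show ?thesis using q dvd_trans by blast
  qed
  then have "\<forall>t. \<exists>p. p \<in> ?P \<and> p dvd poly3 (b + Cst t * c)" by blast
  from choice[OF this] obtain \<pi> where "\<forall>t. \<pi> t \<in> ?P \<and> \<pi> t dvd poly3 (b + Cst t * c)" ..
  then have \<pi>: "\<And>t. \<pi> t \<in> ?P" "\<And>t. \<pi> t dvd poly3 (b + Cst t * c)" by blast+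
  have "\<not> inj \<pi>" using inf fin \<pi>(1) finite_subset[of "range \<pi>" ?P] finite_imageD[of \<pi> UNIV] by blast
  then obtain s t where st: "\<pi> s = \<pi> t" "s \<noteq> t" by (auto simp: inj_def)
  define p where "p = \<pi> t"
  obtain g where g: "poly3 g = p" using poly3_surj by blast
  have "p dvd poly3 ((b + Cst s * c) - (b + Cst t * c))"
    using \<pi>(2)[of s] \<pi>(2)[of t] st(1) unfolding p_def poly3.hom_minus by (simp add: dvd_diff)
  then have "g dvd (b + Cst s * c) - (b + Cst t * c)" unfolding g[symmetric] poly3_dvd_iff .
  moreover have "(b + Cst s * c) - (b + Cst t * c) = Cst (s - t) * c" by (simp add: Cst_diff algebra_simps)
  ultimately have "g dvd Cst (s - t) * c" by simp
  then have "g dvd Cst (inverse (s - t)) * (Cst (s - t) * c)" by (rule dvd_mult)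
  moreover have "Cst (inverse (s - t)) * (Cst (s - t) * c) = c" by (rule Cst_inverse) (use st in simp)
  ultimately have gc: "g dvd c" by (simp only:)
  have "g dvd b + Cst t * c" using \<pi>(2)[of t] unfolding p_def[symmetric] g[symmetric] poly3_dvd_iff .
  then have "g dvd b" using dvd_diff[OF _ dvd_mult[OF gc, of "Cst t"]] by fastforce
  moreover have "g dvd a" using \<pi>(1)[of t] unfolding p_def[symmetric] g[symmetric] mem_Collect_eq poly3_dvd_iff by (rule conjunct2)
  ultimately have "g dvd 1" using unit gc by blast
  then have "poly3 g dvd poly3 1" unfolding poly3_dvd_iff .
  then have "is_unit p" using g by simp
  then show False using \<pi>(1)[of t] unfolding p_def by auto
qed

section \<open>Base change\<close>

lemma span_range:
  fixes F :: "'i::finite \<Rightarrow> 'a::comm_ring_1"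
  shows "mul.span (range F) = {\<Sum>i\<in>UNIV. g i * F i | g. True}"
proof (intro antisym subsetI)
  fix x assume "x \<in> mul.span (range F)"
  then show "x \<in> {\<Sum>i\<in>UNIV. g i * F i | g. True}"
  proof (induction rule: mul.span_induct_alt)
    case base
    show ?case by (rule CollectI, rule exI[of _ "\<lambda>_. 0"]) simp
  next
    case (step c x y)
    then obtain j g where jg: "x = F j" "y = (\<Sum>i\<in>UNIV. g i * F i)" by blast
    have "(\<Sum>i\<in>UNIV. ((if i = j then c else 0) + g i) * F i) = c * x + y"
      unfolding jg by (simp add: distrib_right sum.distrib if_distrib[of "\<lambda>z. z * _"] cong: if_cong)
    then show ?case by (intro CollectI exI[of _ "\<lambda>i. (if i = j then c else 0) + g i"]) simp
  qed
next
  fix x assume "x \<in> {\<Sum>i\<in>UNIV. g i * F i | g. True}"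
  then obtain g where x: "x = (\<Sum>i\<in>UNIV. g i * F i)" by blast
  show "x \<in> mul.span (range F)"
    unfolding x by (intro mul.span_sum mul.span_scale mul.span_base) blast
qed

text \<open>The second ideal contains the equations of the fibre over \<open>x\<close>, the first is the \<open>U\<close> of the introduction.\<close>

definition point_ideal :: "('i::finite \<Rightarrow> 'k::field) \<Rightarrow> ('i \<Rightarrow> (3, 'k) mpol) \<Rightarrow> (3, 'k) mpol set"
  where "point_ideal x F = {\<Sum>i\<in>UNIV. c i * F i | c. (\<Sum>i\<in>UNIV. Cst (x i) * c i) = 0}"

definition spec_ideal :: "('i::finite \<Rightarrow> 'k::field) \<Rightarrow> ('i \<Rightarrow> (3, 'k) mpol) \<Rightarrow> (3, 'k) mpol set"
  where "spec_ideal x F = {\<Sum>i\<in>UNIV. Cst (x i) * G i | G. (\<Sum>i\<in>UNIV. G i * F i) = 0}"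

lemma sum_delta_mult:
  fixes F :: "'i::finite \<Rightarrow> 'a::comm_ring_1"
  shows "(\<Sum>i\<in>UNIV. (if i = j then y else 0) * F i) = y * F j"
    and "(\<Sum>i\<in>UNIV. F i * (if i = j then y else 0)) = F j * y"
  by (simp_all add: if_distrib[of "\<lambda>z. z * _"] if_distrib[of "\<lambda>z. _ * z"] cong: if_cong)

text \<open>Both inclusions are one substitution: the coefficients \<open>c\<close> and the syzygy
  \<open>G\<close> determine each other by \<open>c = y e_j - x_j G\<close>, with \<open>e_j\<close>
  the unit vector and \<open>x_j\<close> invertible.\<close>

lemma colon_point_ideal:
  assumes "x j \<noteq> 0"
  shows "colon (point_ideal x F) (F j) = spec_ideal x F"
proof (intro antisym subsetI)
  fix y assume "y \<in> colon (point_ideal x F) (F j)"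
  then obtain c where c: "F j * y = (\<Sum>i\<in>UNIV. c i * F i)" "(\<Sum>i\<in>UNIV. Cst (x i) * c i) = 0"
    unfolding colon_def point_ideal_def by blast
  define G where "G i = Cst (inverse (x j)) * ((if i = j then y else 0) - c i)" for i
  have "(\<Sum>i\<in>UNIV. G i * F i) = Cst (inverse (x j)) * ((\<Sum>i\<in>UNIV. (if i = j then y else 0) * F i) - (\<Sum>i\<in>UNIV. c i * F i))"
    unfolding G_def sum_subtractf[symmetric] sum_distrib_left
    by (intro sum.cong refl) (simp add: algebra_simps)
  then have "(\<Sum>i\<in>UNIV. G i * F i) = 0" using c(1) by (simp add: sum_delta_mult mult.commute)
  moreover have "(\<Sum>i\<in>UNIV. Cst (x i) * G i) = Cst (inverse (x j)) * ((\<Sum>i\<in>UNIV. Cst (x i) * (if i = j then y else 0)) - (\<Sum>i\<in>UNIV. Cst (x i) * c i))"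
    unfolding G_def sum_subtractf[symmetric] sum_distrib_left
    by (intro sum.cong refl) (simp add: algebra_simps)
  then have "(\<Sum>i\<in>UNIV. Cst (x i) * G i) = y"
    unfolding c(2) sum_delta_mult using Cst_inverse[OF assms, of y] by simp
  ultimately show "y \<in> spec_ideal x F" unfolding spec_ideal_def by blast
next
  fix y assume "y \<in> spec_ideal x F"
  then obtain G where G: "y = (\<Sum>i\<in>UNIV. Cst (x i) * G i)" "(\<Sum>i\<in>UNIV. G i * F i) = 0"
    unfolding spec_ideal_def by blast
  define c where "c i = (if i = j then y else 0) - Cst (x j) * G i" for i
  have "(\<Sum>i\<in>UNIV. c i * F i) = (\<Sum>i\<in>UNIV. (if i = j then y else 0) * F i) - Cst (x j) * (\<Sum>i\<in>UNIV. G i * F i)"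
    unfolding c_def sum_distrib_left sum_subtractf[symmetric]
    by (intro sum.cong refl) (simp add: algebra_simps)
  then have "(\<Sum>i\<in>UNIV. c i * F i) = F j * y" using G(2) by (simp add: sum_delta_mult mult.commute)
  moreover have "(\<Sum>i\<in>UNIV. Cst (x i) * c i) = (\<Sum>i\<in>UNIV. Cst (x i) * (if i = j then y else 0)) - Cst (x j) * (\<Sum>i\<in>UNIV. Cst (x i) * G i)"
    unfolding c_def sum_distrib_left sum_subtractf[symmetric]
    by (intro sum.cong refl) (simp add: algebra_simps)
  then have "(\<Sum>i\<in>UNIV. Cst (x i) * c i) = 0" using G(1) by (simp add: sum_delta_mult)
  ultimately show "y \<in> colon (point_ideal x F) (F j)"
    unfolding colon_def point_ideal_def by (metis (mono_tags, lifting) mem_Collect_eq)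
qed

text \<open>The condition on \<open>c\<close> is one linear equation in which \<open>c j\<close> has
  an invertible coefficient, so \<open>c j\<close> can be eliminated.\<close>

lemma point_ideal_eq_span:
  fixes F :: "'i::finite \<Rightarrow> (3, 'k::field) mpol"
  assumes "x j \<noteq> 0"
  shows "point_ideal x F = mul.span ((\<lambda>i. F i - Cst (x i / x j) * F j) ` (- {j}))"
proof (intro antisym subsetI)
  fix y assume "y \<in> point_ideal x F"
  then obtain c where c: "y = (\<Sum>i\<in>UNIV. c i * F i)" "(\<Sum>i\<in>UNIV. Cst (x i) * c i) = 0"
    unfolding point_ideal_def by blast
  have "(\<Sum>i\<in>UNIV. c i * (F i - Cst (x i / x j) * F j)) =
      y - Cst (inverse (x j)) * (\<Sum>i\<in>UNIV. Cst (x i) * c i) * F j"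
    unfolding c(1) sum_distrib_left sum_distrib_right sum_subtractf[symmetric]
    by (intro sum.cong refl) (simp add: algebra_simps divide_inverse Cst_mult)
  then have "y = (\<Sum>i\<in>UNIV. c i * (F i - Cst (x i / x j) * F j))" using c(2) by simp
  also have "\<dots> = (\<Sum>i\<in>-{j}. c i * (F i - Cst (x i / x j) * F j))"
    using assms by (intro sum.mono_neutral_right) auto
  also have "\<dots> \<in> mul.span ((\<lambda>i. F i - Cst (x i / x j) * F j) ` (- {j}))"
    by (intro mul.span_sum mul.span_scale mul.span_base) auto
  finally show "y \<in> mul.span ((\<lambda>i. F i - Cst (x i / x j) * F j) ` (- {j}))" .
next
  have sub: "mul.subspace (point_ideal x F)"
  proof (rule mul.subspaceI)
    show "0 \<in> point_ideal x F"
      unfolding point_ideal_def by (rule CollectI, rule exI[of _ "\<lambda>_. 0"]) simp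
    show "y + z \<in> point_ideal x F" if yz: "y \<in> point_ideal x F" "z \<in> point_ideal x F" for y z
    proof -
      obtain c c' where "y = (\<Sum>i\<in>UNIV. c i * F i)" "(\<Sum>i\<in>UNIV. Cst (x i) * c i) = 0"
        "z = (\<Sum>i\<in>UNIV. c' i * F i)" "(\<Sum>i\<in>UNIV. Cst (x i) * c' i) = 0"
        using yz unfolding point_ideal_def by blast
      then have "y + z = (\<Sum>i\<in>UNIV. (c i + c' i) * F i) \<and> (\<Sum>i\<in>UNIV. Cst (x i) * (c i + c' i)) = 0"
        by (simp add: distrib_left distrib_right sum.distrib)
      then show ?thesis unfolding point_ideal_def
        by (intro CollectI exI[of _ "\<lambda>i. c i + c' i"])
    qed
    show "r * y \<in> point_ideal x F" if y: "y \<in> point_ideal x F" for r y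
    proof -
      obtain c where c: "y = (\<Sum>i\<in>UNIV. c i * F i)" "(\<Sum>i\<in>UNIV. Cst (x i) * c i) = 0"
        using y unfolding point_ideal_def by blast
      have "r * y = (\<Sum>i\<in>UNIV. (r * c i) * F i)" unfolding c(1) by (simp add: sum_distrib_left mult.assoc)
      moreover have "(\<Sum>i\<in>UNIV. Cst (x i) * (r * c i)) = r * (\<Sum>i\<in>UNIV. Cst (x i) * c i)"
        by (simp add: sum_distrib_left mult.left_commute)
      ultimately show ?thesis using c(2) unfolding point_ideal_def
        by (intro CollectI exI[of _ "\<lambda>i. r * c i"]) simp
    qed
  qed
  fix y assume "y \<in> mul.span ((\<lambda>i. F i - Cst (x i / x j) * F j) ` (- {j}))"
  moreover have "(\<lambda>i. F i - Cst (x i / x j) * F j) ` (- {j}) \<subseteq> point_ideal x F"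
  proof (rule image_subsetI)
    fix i assume "i \<in> - {j}"
    define c where "c k = (if k = i then 1 else 0) - (if k = j then Cst (x i / x j) else 0 :: (3, 'k) mpol)" for k
    have "F i - Cst (x i / x j) * F j = (\<Sum>k\<in>UNIV. c k * F k)"
      by (simp add: c_def left_diff_distrib sum_subtractf sum_delta_mult)
    moreover have "(\<Sum>k\<in>UNIV. Cst (x k) * c k) = Cst (x i) - Cst (x j) * Cst (x i / x j)"
      by (simp add: c_def right_diff_distrib sum_subtractf sum_delta_mult)
    then have "(\<Sum>k\<in>UNIV. Cst (x k) * c k) = 0" using assms by (simp flip: Cst_mult)
    ultimately show "F i - Cst (x i / x j) * F j \<in> point_ideal x F" unfolding point_ideal_def by blast
  qed
  ultimately show "y \<in> point_ideal x F" using mul.span_minimal[OF _ sub] by blast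
qed

lemma graded_range:
  assumes "\<And>i. homog d (F i)" shows "graded_ideal (mul.span (range F))"
  using assms by (intro graded_span) auto

lemma graded_point_ideal:
  fixes F :: "'i::finite \<Rightarrow> (3, 'k::field) mpol"
  assumes "x j \<noteq> 0" "\<And>i. homog d (F i)" shows "graded_ideal (point_ideal x F)"
  unfolding point_ideal_eq_span[where F = F and x = x and j = j, OF assms(1)]
  by (intro graded_span) (auto intro!: exI[of _ d] homog_diff homog_Cst_mult assms(2))

lemma graded_spec_ideal:
  fixes F :: "'i::finite \<Rightarrow> (3, 'k::field) mpol"
  assumes "x j \<noteq> 0" "\<And>i. homog d (F i)" shows "graded_ideal (spec_ideal x F)"
  using graded_colon[OF graded_point_ideal[where F = F and x = x and j = j, OF assms] assms(2)[of j]] colon_point_ideal[where F = F and x = x and j = j, OF assms(1)] by simp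

lemma span_insert_point_ideal:
  fixes F :: "'i::finite \<Rightarrow> (3, 'k::field) mpol"
  assumes "x j \<noteq> 0"
  shows "mul.span (insert (F j) (point_ideal x F)) = mul.span (range F)"
proof (intro antisym mul.span_minimal mul.subspace_span)
  show "insert (F j) (point_ideal x F) \<subseteq> mul.span (range F)"
  proof
    fix y assume "y \<in> insert (F j) (point_ideal x F)"
    then consider "y = F j" | c where "y = (\<Sum>i\<in>UNIV. c i * F i)" unfolding point_ideal_def by blast
    then show "y \<in> mul.span (range F)"
    proof cases
      case 1 then show ?thesis by (simp add: mul.span_base)
    next
      case 2
      then show ?thesis unfolding span_range by blast
    qed
  qed
  show "range F \<subseteq> mul.span (insert (F j) (point_ideal x F))"
  proof clarify
    fix i
    have "F i - Cst (x i / x j) * F j \<in> point_ideal x F"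
    proof (cases "i = j")
      case True
      then show ?thesis unfolding point_ideal_eq_span[where F = F and x = x and j = j, OF assms] using assms by (simp add: mul.span_zero)
    next
      case False
      then show ?thesis unfolding point_ideal_eq_span[where F = F and x = x and j = j, OF assms] by (auto intro: mul.span_base)
    qed
    then have "(F i - Cst (x i / x j) * F j) + Cst (x i / x j) * F j \<in> mul.span (insert (F j) (point_ideal x F))"
      by (intro mul.span_add mul.span_scale mul.span_base) auto
    then show "F i \<in> mul.span (insert (F j) (point_ideal x F))" by simp
  qed
qed

text \<open>The basic count of the proof: exactness along \<open>F j\<close> links the ideal of the
  \<open>t_i\<close>, the ideal of all the forms and the fibre over \<open>x\<close>.\<close>

lemma hfun_point_ideal:
  fixes F :: "'i::finite \<Rightarrow> (3, 'k::field) mpol"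
  assumes "x j \<noteq> 0" "F j \<noteq> 0" "\<And>i. homog d (F i)"
  shows "hfun (point_ideal x F) (n + d) = hfun (mul.span (range F)) (n + d) + hfun (spec_ideal x F) n"
  using hfun_exact[OF graded_point_ideal[where F = F and x = x and j = j, OF assms(1,3)] assms(3)[of j] assms(2), of n]
  unfolding span_insert_point_ideal[where F = F and x = x and j = j, OF assms(1)] colon_point_ideal[where F = F and x = x and j = j, OF assms(1)] .

section \<open>Extension of the base field\<close>

context field_hom
begin

definition ext :: "('v::finite, 'a) mpol \<Rightarrow> ('v, 'b) mpol"
  where "ext = mev (\<lambda>c. Cst (hom c)) Var"

lemma comm_ring_hom_Cst_hom: "comm_ring_hom (\<lambda>c. Cst (hom c))"
  by (rule comm_ring_hom_comp[OF comm_ring_hom_Cst comm_ring_hom_axioms])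

lemma comm_ring_hom_ext: "comm_ring_hom ext"
  unfolding ext_def by (rule comm_ring_hom.comm_ring_hom_mev[OF comm_ring_hom_Cst_hom])

sublocale ext: comm_ring_hom ext
  by (rule comm_ring_hom_ext)

lemma ext_Cst: "ext (Cst c) = Cst (hom c)"
  unfolding ext_def by (rule comm_ring_hom.mev_Cst[OF comm_ring_hom_Cst_hom])

lemma ext_Var: "ext (Var i) = Var i"
  unfolding ext_def by (rule comm_ring_hom.mev_Var[OF comm_ring_hom_Cst_hom])

lemma coef_ext: "coef (ext F) m = hom (coef F m)"
proof -
  have "ext F = (\<Sum>m'\<in>Poly_Mapping.keys F. Cst (hom (coef F m')) * mon m')"
    unfolding ext_def mev_def mon_prod ..
  then have "coef (ext F) m = (\<Sum>m'\<in>Poly_Mapping.keys F. if m' = m then hom (coef F m') else 0)"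
    by (simp only:) (simp add: lookup_sum lookup_single when_def if_distrib[of "\<lambda>z. _ * z"] cong: if_cong)
  then show ?thesis by (simp add: in_keys_iff)
qed

lemma ext_inject [simp]: "ext F = ext G \<longleftrightarrow> F = G"
proof
  assume "ext F = ext G"
  then have "hom (coef F m) = hom (coef G m)" for m using coef_ext by metis
  then show "F = G" by (intro poly_mapping_eqI) simp
qed simp

lemma ext_eq_0_iff [simp]: "ext F = 0 \<longleftrightarrow> F = 0"
  using ext_inject[of F 0] ext.hom_zero by simp

lemma homog_ext [simp]: "homog n (ext F) \<longleftrightarrow> homog n F"
  by (auto simp: homog_def in_keys_iff coef_ext)

lemma hcomp_ext: "hcomp n (ext F) = ext (hcomp n F)"
  by (rule poly_mapping_eqI) (simp add: coef_hcomp coef_ext)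

lemma ext_mon: "ext (mon m) = mon m"
  by (rule poly_mapping_eqI) (simp add: coef_ext lookup_single when_def)

lemma ext_subst: "ext (subst f F) = mev (\<lambda>c. Cst (hom c)) (\<lambda>i. ext (f i)) F"
proof (rule mpol_hom_eq[where h = "\<lambda>F. ext (subst f F)" and h' = "mev (\<lambda>c. Cst (hom c)) (\<lambda>i. ext (f i))"])
  show "comm_ring_hom (\<lambda>F. ext (subst f F))" by (rule comm_ring_hom_comp[OF comm_ring_hom_ext comm_ring_hom_subst])
  show "comm_ring_hom (mev (\<lambda>c. Cst (hom c)) (\<lambda>i. ext (f i)))"
    by (rule comm_ring_hom.comm_ring_hom_mev[OF comm_ring_hom_Cst_hom])
qed (simp_all add: subst_Cst ext_Cst subst_Var comm_ring_hom.mev_Cst[OF comm_ring_hom_Cst_hom]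
      comm_ring_hom.mev_Var[OF comm_ring_hom_Cst_hom])

sublocale kv: vector_space "\<lambda>c x. hom c * x"
  by unfold_locales (simp_all add: hom_add hom_mult algebra_simps)

text \<open>Plays the role of a basis of the large field over the small one: an argument involves
  finitely many scalars, so a finite independent family suffices. It may prolong a given family
  \<open>E0\<close>, which allows two expansions to be compared.\<close>

lemma scalar_decomposition:
  assumes "finite C" "finite E0" "kv.independent E0"
  shows "\<exists>E r. finite E \<and> E0 \<subseteq> E \<and> kv.independent E \<and> (\<forall>c\<in>C. c = (\<Sum>b\<in>E. hom (r c b) * b))"
proof -
  obtain E where E: "E0 \<subseteq> E" "E \<subseteq> E0 \<union> C" "kv.independent E" "E0 \<union> C \<subseteq> kv.span E"
    using kv.maximal_independent_subset_extend[of E0 "E0 \<union> C"] assms(3) by blast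
  have fin: "finite E" using E(2) assms finite_subset by blast
  have "\<forall>c\<in>C. \<exists>r. c = (\<Sum>b\<in>E. hom (r b) * b)"
    using E(4) unfolding kv.span_finite[OF fin] by auto
  then show ?thesis using E fin by metis
qed

text \<open>Flatness of the extension in usable form: a relation over the large field splits,
  coefficient by coefficient, into relations over the small one.\<close>

lemma ext_independent:
  assumes "finite E" "kv.independent E" "(\<Sum>b\<in>E. Cst b * ext (g b)) = 0" "b \<in> E"
  shows "g b = 0"
proof (rule poly_mapping_eqI)
  fix m
  have "(\<Sum>b\<in>E. hom (coef (g b) m) * b) = coef (\<Sum>b\<in>E. Cst b * ext (g b)) m"
    by (simp add: lookup_sum coef_ext mult.commute)
  then have "(\<Sum>b\<in>E. hom (coef (g b) m) * b) = 0" using assms(3) by simp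
  then show "coef (g b) m = coef 0 m" using kv.independentD[OF assms(2,1) order_refl _ assms(4)] by simp
qed

lemma ext_decomposition:
  fixes P :: "'i \<Rightarrow> ('v::finite, 'b) mpol"
  assumes "finite I" "finite E0" "kv.independent E0"
  shows "\<exists>E g. finite E \<and> E0 \<subseteq> E \<and> kv.independent E \<and> (\<forall>i\<in>I. P i = (\<Sum>b\<in>E. Cst b * ext (g i b)))"
proof -
  define C where "C = (\<Union>i\<in>I. coef (P i) ` Poly_Mapping.keys (P i))"
  have "finite C" using assms(1) by (simp add: C_def)
  from scalar_decomposition[OF this assms(2,3)]
  obtain E r where E: "finite E" "E0 \<subseteq> E" "kv.independent E" "\<forall>c\<in>C. c = (\<Sum>b\<in>E. hom (r c b) * b)"
    by (elim exE conjE)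
  define g where "g i b = (\<Sum>m\<in>Poly_Mapping.keys (P i). Poly_Mapping.single m (r (coef (P i) m) b))" for i b
  have coef_g: "coef (g i b) m = (if m \<in> Poly_Mapping.keys (P i) then r (coef (P i) m) b else 0)" for i b m
  proof -
    have "coef (g i b) m = (\<Sum>m'\<in>Poly_Mapping.keys (P i). if m' = m then r (coef (P i) m') b else 0)"
      unfolding g_def lookup_sum by (intro sum.cong) (auto simp: lookup_single when_def)
    then show ?thesis by simp
  qed
  have "P i = (\<Sum>b\<in>E. Cst b * ext (g i b))" if "i \<in> I" for i
  proof (rule poly_mapping_eqI)
    fix m
    show "coef (P i) m = coef (\<Sum>b\<in>E. Cst b * ext (g i b)) m"
    proof (cases "m \<in> Poly_Mapping.keys (P i)")
      case True
      then have "coef (P i) m \<in> C" using that by (auto simp: C_def)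
      then show ?thesis using E(4)[rule_format, of "coef (P i) m"] True by (simp add: lookup_sum coef_ext coef_g mult.commute)
    next
      case False
      then show ?thesis by (simp add: lookup_sum coef_ext coef_g in_keys_iff)
    qed
  qed
  then show ?thesis using E by blast
qed

lemma independent_image_ext:
  assumes "finite B" "mvs.independent B"
  shows "mvs.independent (ext ` (B :: ('v::{finite,linorder}, 'a) mpol set))"
proof (rule mvs.independent_if_scalars_zero)
  show "finite (ext ` B)" using assms(1) by simp
next
  fix c and y :: "('v, 'b) mpol"
  assume 0: "(\<Sum>y\<in>ext ` B. Cst (c y) * y) = 0" and "y \<in> ext ` B"
  then obtain x0 where x0: "x0 \<in> B" "y = ext x0" by blast
  have "kv.independent {}" by (rule kv.independent_empty)
  then obtain E r where E: "finite E" "kv.independent E"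
    "\<And>d. d \<in> (\<lambda>x. c (ext x)) ` B \<Longrightarrow> d = (\<Sum>b\<in>E. hom (r d b) * b)"
    using scalar_decomposition[of "(\<lambda>x. c (ext x)) ` B" "{}"] assms(1) by auto
  define s where "s x b = r (c (ext x)) b" for x b
  have s: "c (ext x) = (\<Sum>b\<in>E. hom (s x b) * b)" if "x \<in> B" for x
    using E(3)[of "c (ext x)"] that by (simp add: s_def)
  have inj: "inj_on ext B" by (auto intro: inj_onI)
  have "0 = (\<Sum>x\<in>B. Cst (c (ext x)) * ext x)" using 0 by (simp add: sum.reindex[OF inj])
  also have "\<dots> = (\<Sum>x\<in>B. \<Sum>b\<in>E. Cst b * ext (Cst (s x b) * x))"
  proof (rule sum.cong[OF refl])
    fix x assume "x \<in> B"
    have "Cst (c (ext x)) * ext x = (\<Sum>b\<in>E. Cst (hom (s x b) * b)) * ext x"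
      unfolding s[OF \<open>x \<in> B\<close>] Cst_sum ..
    also have "\<dots> = (\<Sum>b\<in>E. Cst b * ext (Cst (s x b) * x))"
      unfolding sum_distrib_right by (intro sum.cong refl) (simp add: ext.hom_mult ext_Cst Cst_mult mult_ac)
    finally show "Cst (c (ext x)) * ext x = (\<Sum>b\<in>E. Cst b * ext (Cst (s x b) * x))" .
  qed
  also have "\<dots> = (\<Sum>b\<in>E. Cst b * ext (\<Sum>x\<in>B. Cst (s x b) * x))"
    by (subst sum.swap) (simp add: ext.hom_sum sum_distrib_left)
  finally have z: "(\<Sum>b\<in>E. Cst b * ext (\<Sum>x\<in>B. Cst (s x b) * x)) = 0" by (rule sym)
  have "(\<Sum>x\<in>B. Cst (s x b) * x) = 0" if "b \<in> E" for b by (rule ext_independent[OF E(1,2) z that])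
  then have "s x0 b = 0" if "b \<in> E" for b
    using mvs.independentD[OF assms(2,1) order_refl, of "\<lambda>x. s x b"] x0(1) that by blast
  then show "c y = 0" using s[OF x0(1)] x0(2) by simp
qed

lemma dim_image_ext:
  assumes "fin_dim V"
  shows "mvs.dim (ext ` (V :: ('v::{finite,linorder}, 'a) mpol set)) = mvs.dim V"
proof -
  obtain B where B: "B \<subseteq> V" "mvs.independent B" "V \<subseteq> mvs.span B" "card B = mvs.dim V"
    by (rule mvs.basis_exists)
  have fin: "finite B" by (rule fin_dim_finite_independent[OF assms B(2,1)])
  have "ext x \<in> mvs.span (ext ` B)" if "x \<in> mvs.span B" for x
    using that
  proof (induction rule: mvs.span_induct_alt)
    case base show ?case by (simp add: mvs.span_zero)
  next
    case (step c x y)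
    then show ?case
      by (simp add: ext.hom_add ext.hom_mult ext_Cst mvs.span_add mvs.span_scale mvs.span_base)
  qed
  then have "ext ` V \<subseteq> mvs.span (ext ` B)" using B(3) by blast
  then have "card (ext ` B) = mvs.dim (ext ` V)"
    using mvs.basis_card_eq_dim[OF image_mono[OF B(1)] _ independent_image_ext[OF fin B(2)]] by blast
  moreover have "card (ext ` B) = card B" by (intro card_image inj_onI) simp
  ultimately show ?thesis using B(4) by simp
qed

text \<open>The multipliers that witness membership are expanded in a family that prolongs
  \<open>E\<close>; then the coordinates at \<open>b\<close> are compared.\<close>

lemma ideal_descent:
  fixes F :: "'i::finite \<Rightarrow> ('v::finite, 'a) mpol"
  assumes E: "finite E" "kv.independent E" and y: "(\<Sum>b\<in>E. Cst b * ext (y b)) \<in> mul.span (range (\<lambda>i. ext (F i)))"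
    and "b \<in> E"
  shows "y b \<in> mul.span (range F)"
proof -
  obtain G where G: "(\<Sum>b\<in>E. Cst b * ext (y b)) = (\<Sum>i\<in>UNIV. G i * ext (F i))"
    using y unfolding span_range by blast
  obtain E' g where E': "finite E'" "E \<subseteq> E'" "kv.independent E'" "\<forall>i\<in>UNIV. G i = (\<Sum>b\<in>E'. Cst b * ext (g i b))"
    using ext_decomposition[OF _ E, of UNIV G] by auto
  define z where "z b = (if b \<in> E then y b else 0) - (\<Sum>i\<in>UNIV. g i b * F i)" for b
  have "(\<Sum>b\<in>E'. Cst b * ext (if b \<in> E then y b else 0)) = (\<Sum>b\<in>E. Cst b * ext (y b))"
    using E' by (intro sum.mono_neutral_cong_right) auto
  moreover have "(\<Sum>b\<in>E'. Cst b * ext (\<Sum>i\<in>UNIV. g i b * F i)) = (\<Sum>i\<in>UNIV. G i * ext (F i))"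
  proof -
    have "(\<Sum>b\<in>E'. Cst b * ext (\<Sum>i\<in>UNIV. g i b * F i)) = (\<Sum>b\<in>E'. \<Sum>i\<in>UNIV. Cst b * ext (g i b) * ext (F i))"
      by (simp add: ext.hom_sum ext.hom_mult sum_distrib_left mult.assoc)
    also have "\<dots> = (\<Sum>i\<in>UNIV. G i * ext (F i))"
      using E'(4) by (subst sum.swap) (simp add: sum_distrib_right)
    finally show ?thesis .
  qed
  ultimately have "(\<Sum>b\<in>E'. Cst b * ext (z b)) = 0"
    unfolding z_def ext.hom_minus right_diff_distrib sum_subtractf using G by simp
  then have "z b = 0" using ext_independent[OF E'(1,3)] E'(2) \<open>b \<in> E\<close> by blast
  then have "y b = (\<Sum>i\<in>UNIV. g i b * F i)" using \<open>b \<in> E\<close> by (simp add: z_def)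
  then show ?thesis unfolding span_range by (intro CollectI exI[of _ "\<lambda>i. g i b"]) simp
qed

lemma ideal_ext_forms:
  fixes F :: "'i::finite \<Rightarrow> (3, 'a) mpol"
  assumes "\<And>i. homog d (F i)"
  shows "mul.span (range (\<lambda>i. ext (F i))) \<inter> forms n = mvs.span (ext ` (mul.span (range F) \<inter> forms n))"
proof (intro antisym subsetI)
  fix Y assume Y: "Y \<in> mul.span (range (\<lambda>i. ext (F i))) \<inter> forms n"
  obtain E g where E: "finite E" "kv.independent E" "\<forall>i\<in>{()}. Y = (\<Sum>b\<in>E. Cst b * ext (g i b))"
    using ext_decomposition[of "{()}" "{}" "\<lambda>_. Y"] kv.independent_empty by auto
  have "g () b \<in> mul.span (range F)" if "b \<in> E" for b
    using ideal_descent[OF E(1,2), of "g ()" F b] E(3) Y that by simp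
  then have g: "hcomp n (g () b) \<in> mul.span (range F) \<inter> forms n" if "b \<in> E" for b
    using that graded_range[where F = F, OF assms] by (simp add: graded_ideal_def forms_def)
  have "Y = hcomp n Y" using Y hcomp_homog[of n Y n] by (simp add: forms_def)
  also have "\<dots> = (\<Sum>b\<in>E. Cst b * ext (hcomp n (g () b)))"
    using E(3) by (simp add: hcomp_sum hcomp_Cst_mult hcomp_ext)
  also have "\<dots> \<in> mvs.span (ext ` (mul.span (range F) \<inter> forms n))"
    using g by (intro mvs.span_sum mvs.span_scale mvs.span_base) blast
  finally show "Y \<in> mvs.span (ext ` (mul.span (range F) \<inter> forms n))" .
next
  have "ext x \<in> mul.span (range (\<lambda>i. ext (F i))) \<inter> forms n" if x: "x \<in> mul.span (range F) \<inter> forms n" for x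
  proof -
    obtain g where "x = (\<Sum>i\<in>UNIV. g i * F i)" using x unfolding span_range by blast
    then have "ext x = (\<Sum>i\<in>UNIV. ext (g i) * ext (F i))" by (simp add: ext.hom_sum ext.hom_mult)
    then have "ext x \<in> mul.span (range (\<lambda>i. ext (F i)))"
      unfolding span_range by (intro CollectI exI[of _ "\<lambda>i. ext (g i)"]) simp
    then show ?thesis using x by (simp add: forms_def)
  qed
  then have "mvs.span (ext ` (mul.span (range F) \<inter> forms n)) \<subseteq> mul.span (range (\<lambda>i. ext (F i))) \<inter> forms n"
    by (intro mvs.span_minimal subspace_part mul.subspace_span) blast
  then show "Y \<in> mul.span (range (\<lambda>i. ext (F i))) \<inter> forms n" if "Y \<in> mvs.span (ext ` (mul.span (range F) \<inter> forms n))" for Y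
    using that by blast
qed

lemma hfun_ext:
  fixes F :: "'i::finite \<Rightarrow> (3, 'a) mpol"
  assumes "\<And>i. homog d (F i)"
  shows "hfun (mul.span (range (\<lambda>i. ext (F i)))) n = hfun (mul.span (range F)) n"
  unfolding hfun_def ideal_ext_forms[where F = F, OF assms] mvs.dim_span dim_image_ext[OF fin_dim_part] dim_forms_3 ..

text \<open>Syzygies over the large field are combinations of syzygies over the small one, and by
  homogeneity their components of degree \<open>n\<close> are syzygies again. This ties the ideal of
  the fibre to \<open>sym_ideal\<close>, which is built from syzygies over \<open>k\<close>.\<close>

lemma spec_ideal_forms:
  fixes F :: "'i::finite \<Rightarrow> (3, 'a) mpol"
  assumes F: "\<And>i. homog d (F i)" and x: "x j \<noteq> 0"
  shows "spec_ideal x (\<lambda>i. ext (F i)) \<inter> forms n =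
    mvs.span {\<Sum>i\<in>UNIV. Cst (x i) * ext (g i) | g. (\<Sum>i\<in>UNIV. g i * F i) = 0 \<and> (\<forall>i. homog n (g i))}"
    (is "?J \<inter> _ = mvs.span ?W")
proof (intro antisym subsetI)
  fix y assume y: "y \<in> ?J \<inter> forms n"
  then obtain G where G: "y = (\<Sum>i\<in>UNIV. Cst (x i) * G i)" "(\<Sum>i\<in>UNIV. G i * ext (F i)) = 0"
    unfolding spec_ideal_def by blast
  obtain E g where E: "finite E" "kv.independent E" "\<forall>i\<in>UNIV. G i = (\<Sum>b\<in>E. Cst b * ext (g i b))"
    using ext_decomposition[of UNIV "{}" G] kv.independent_empty by auto
  have "(\<Sum>b\<in>E. Cst b * ext (\<Sum>i\<in>UNIV. g i b * F i)) = (\<Sum>i\<in>UNIV. G i * ext (F i))"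
  proof -
    have "(\<Sum>b\<in>E. Cst b * ext (\<Sum>i\<in>UNIV. g i b * F i)) = (\<Sum>b\<in>E. \<Sum>i\<in>UNIV. Cst b * ext (g i b) * ext (F i))"
      by (simp add: ext.hom_sum ext.hom_mult sum_distrib_left mult.assoc)
    also have "\<dots> = (\<Sum>i\<in>UNIV. G i * ext (F i))"
      using E(3) by (subst sum.swap) (simp add: sum_distrib_right)
    finally show ?thesis .
  qed
  then have z: "(\<Sum>b\<in>E. Cst b * ext (\<Sum>i\<in>UNIV. g i b * F i)) = 0" using G(2) by (simp only:)
  have syz: "(\<Sum>i\<in>UNIV. g i b * F i) = 0" if "b \<in> E" for b by (rule ext_independent[OF E(1,2) z that])
  have "hcomp (n + d) (h * F i) = hcomp n h * F i" for h i
    using hcomp_homog_mult[OF F[of i], of "n + d" h] by (simp add: mult.commute)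
  then have "hcomp (n + d) (\<Sum>i\<in>UNIV. g i b * F i) = (\<Sum>i\<in>UNIV. hcomp n (g i b) * F i)" for b
    unfolding hcomp_sum by simp
  then have syz': "(\<Sum>i\<in>UNIV. hcomp n (g i b) * F i) = 0" if "b \<in> E" for b
    using syz[OF that] by (metis hcomp_0)
  have "y = hcomp n y" using y hcomp_homog[of n y n] by (simp add: forms_def)
  also have "\<dots> = (\<Sum>i\<in>UNIV. \<Sum>b\<in>E. Cst b * (Cst (x i) * ext (hcomp n (g i b))))"
    using E(3) unfolding G(1) by (simp add: hcomp_sum hcomp_Cst_mult hcomp_ext sum_distrib_left mult.left_commute)
  also have "\<dots> = (\<Sum>b\<in>E. Cst b * (\<Sum>i\<in>UNIV. Cst (x i) * ext (hcomp n (g i b))))"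
    by (subst sum.swap) (simp add: sum_distrib_left)
  also have "\<dots> \<in> mvs.span ?W"
  proof (rule mvs.span_sum)
    fix b assume "b \<in> E"
    then have "(\<Sum>i\<in>UNIV. Cst (x i) * ext (hcomp n (g i b))) \<in> ?W"
      using syz' by (intro CollectI exI[of _ "\<lambda>i. hcomp n (g i b)"]) simp
    then show "Cst b * (\<Sum>i\<in>UNIV. Cst (x i) * ext (hcomp n (g i b))) \<in> mvs.span ?W"
      by (rule mvs.span_scale[OF mvs.span_base])
  qed
  finally show "y \<in> mvs.span ?W" .
next
  have "?W \<subseteq> ?J \<inter> forms n"
  proof
    fix y assume "y \<in> ?W"
    then obtain g where g: "y = (\<Sum>i\<in>UNIV. Cst (x i) * ext (g i))" "(\<Sum>i\<in>UNIV. g i * F i) = 0" "\<And>i. homog n (g i)"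
      by blast
    have "(\<Sum>i\<in>UNIV. ext (g i) * ext (F i)) = ext (\<Sum>i\<in>UNIV. g i * F i)" by (simp add: ext.hom_sum ext.hom_mult)
    then have "y \<in> ?J" using g unfolding spec_ideal_def by auto
    moreover have "y \<in> forms n" unfolding g(1) forms_def using g(3) by (auto intro!: homog_sum homog_Cst_mult)
    ultimately show "y \<in> ?J \<inter> forms n" by blast
  qed
  moreover have "mul.subspace ?J"
    using graded_spec_ideal[of x j d "\<lambda>i. ext (F i)"] F x by (simp add: graded_ideal_def)
  ultimately have "mvs.span ?W \<subseteq> ?J \<inter> forms n" by (intro mvs.span_minimal subspace_part)
  then show "y \<in> ?J \<inter> forms n" if "y \<in> mvs.span ?W" for y using that by blast
qed

text \<open>Carries the vanishing of the saturation in degree \<open>n\<close> from the small field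
  to the large one: the coordinates of \<open>y\<close> in an independent family satisfy the
  premises of \<open>zero\<close>.\<close>

lemma form_zero_descent:
  fixes F :: "'i::finite \<Rightarrow> (3, 'a) mpol"
  assumes y: "y \<in> forms n" "\<And>m. mdeg m = N \<Longrightarrow> mon m * y \<in> mul.span (range (\<lambda>i. ext (F i)))"
    and F: "\<And>i. homog d (F i)"
    and zero: "\<And>z. z \<in> forms n \<Longrightarrow> (\<And>m. mdeg m = N \<Longrightarrow> mon m * z \<in> mul.span (range F)) \<Longrightarrow> z = 0"
  shows "y = 0"
proof -
  obtain E g where E: "finite E" "kv.independent E" "\<forall>i\<in>{()}. y = (\<Sum>b\<in>E. Cst b * ext (g i b))"
    using ext_decomposition[of "{()}" "{}" "\<lambda>_. y"] kv.independent_empty by auto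
  have "y = hcomp n y" using y hcomp_homog[of n y n] by (simp add: forms_def)
  also have "\<dots> = (\<Sum>b\<in>E. Cst b * ext (hcomp n (g () b)))"
    using E(3) by (simp add: hcomp_sum hcomp_Cst_mult hcomp_ext)
  finally have y': "y = (\<Sum>b\<in>E. Cst b * ext (hcomp n (g () b)))" .
  have "hcomp n (g () b) = 0" if "b \<in> E" for b
  proof (rule zero)
    show "hcomp n (g () b) \<in> forms n" by (simp add: forms_def)
    fix m :: "3 \<Rightarrow>\<^sub>0 nat" assume "mdeg m = N"
    have "mon m * y = (\<Sum>b\<in>E. Cst b * ext (mon m * hcomp n (g () b)))"
      by (subst y') (simp add: sum_distrib_left ext.hom_mult ext_mon mult.left_commute)
    then show "mon m * hcomp n (g () b) \<in> mul.span (range F)"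
      using ideal_descent[OF E(1,2), of "\<lambda>b. mon m * hcomp n (g () b)" F b] y(2)[OF \<open>mdeg m = N\<close>] that by simp
  qed
  then show ?thesis using y' by simp
qed

lemma linear_relation_descent:
  fixes F :: "'i::finite \<Rightarrow> ('v::finite, 'a) mpol"
  assumes c: "(\<Sum>i\<in>UNIV. Cst (c i) * ext (F i)) = 0" "c j \<noteq> 0"
  shows "\<exists>r. r j \<noteq> 0 \<and> (\<Sum>i\<in>UNIV. Cst (r i) * F i) = 0"
proof -
  obtain E r where E: "finite E" "kv.independent E" "\<And>d. d \<in> range c \<Longrightarrow> d = (\<Sum>b\<in>E. hom (r d b) * b)"
    using scalar_decomposition[of "range c" "{}"] kv.independent_empty by auto
  have "0 = (\<Sum>i\<in>UNIV. \<Sum>b\<in>E. Cst b * ext (Cst (r (c i) b) * F i))"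
  proof -
    have "Cst (c i) * ext (F i) = (\<Sum>b\<in>E. Cst b * ext (Cst (r (c i) b) * F i))" for i
    proof -
      have "Cst (c i) * ext (F i) = (\<Sum>b\<in>E. Cst (hom (r (c i) b) * b)) * ext (F i)"
        using E(3)[of "c i"] by (simp flip: Cst_sum)
      also have "\<dots> = (\<Sum>b\<in>E. Cst b * ext (Cst (r (c i) b) * F i))"
        unfolding sum_distrib_right by (intro sum.cong refl) (simp add: ext.hom_mult ext_Cst Cst_mult mult_ac)
      finally show ?thesis .
    qed
    then show ?thesis using c(1) by simp
  qed
  also have "\<dots> = (\<Sum>b\<in>E. Cst b * ext (\<Sum>i\<in>UNIV. Cst (r (c i) b) * F i))"
    by (subst sum.swap) (simp add: ext.hom_sum sum_distrib_left)
  finally have z: "(\<Sum>b\<in>E. Cst b * ext (\<Sum>i\<in>UNIV. Cst (r (c i) b) * F i)) = 0" by (rule sym)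
  have rel: "(\<Sum>i\<in>UNIV. Cst (r (c i) b) * F i) = 0" if "b \<in> E" for b
    by (rule ext_independent[OF E(1,2) z that])
  have "\<exists>b\<in>E. r (c j) b \<noteq> 0"
  proof (rule ccontr)
    assume "\<not> (\<exists>b\<in>E. r (c j) b \<noteq> 0)"
    then have "(\<Sum>b\<in>E. hom (r (c j) b) * b) = 0" by (intro sum.neutral) simp
    then show False using E(3)[of "c j"] c(2) by simp
  qed
  then obtain b where "b \<in> E" "r (c j) b \<noteq> 0" by blast
  then show ?thesis using rel[of b] by (intro exI[of _ "\<lambda>i. r (c i) b"]) simp
qed

end

text \<open>In each degree both ideals are spanned by specialised syzygies over the smallest field,
  and \<open>\<tau>\<close> carries one spanning set onto the other.\<close>

lemma hfun_spec_ideal_ext: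
  fixes F :: "'i::finite \<Rightarrow> (3, 'k::field) mpol" and x :: "'i \<Rightarrow> 'l::field"
  assumes \<sigma>: "field_hom (\<sigma> :: 'k \<Rightarrow> 'l)" and \<tau>: "field_hom (\<tau> :: 'l \<Rightarrow> 'm::field)"
    and F: "\<And>i. homog d (F i)" and x: "x j \<noteq> 0"
  shows "hfun (spec_ideal (\<lambda>i. \<tau> (x i)) (\<lambda>i. field_hom.ext (\<lambda>c. \<tau> (\<sigma> c)) (F i))) n =
    hfun (spec_ideal x (\<lambda>i. field_hom.ext \<sigma> (F i))) n"
proof -
  interpret \<sigma>: field_hom \<sigma> by fact
  interpret \<tau>: field_hom \<tau> by fact
  interpret \<rho>: field_hom "\<lambda>c. \<tau> (\<sigma> c)"
    by unfold_locales (simp_all add: \<sigma>.hom_add \<sigma>.hom_mult \<tau>.hom_add \<tau>.hom_mult)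
  have ext: "\<rho>.ext G = \<tau>.ext (\<sigma>.ext G)" for G :: "(3, 'k) mpol"
    by (rule poly_mapping_eqI) (simp add: \<rho>.coef_ext \<tau>.coef_ext \<sigma>.coef_ext)
  let ?W = "{\<Sum>i\<in>UNIV. Cst (x i) * \<sigma>.ext (g i) | g. (\<Sum>i\<in>UNIV. g i * F i) = 0 \<and> (\<forall>i. homog n (g i))}"
  have "spec_ideal (\<lambda>i. \<tau> (x i)) (\<lambda>i. \<rho>.ext (F i)) \<inter> forms n =
    mvs.span {\<Sum>i\<in>UNIV. Cst (\<tau> (x i)) * \<rho>.ext (g i) | g. (\<Sum>i\<in>UNIV. g i * F i) = 0 \<and> (\<forall>i. homog n (g i))}"
    using x by (intro \<rho>.spec_ideal_forms[OF F, of _ j]) simp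
  also have "{\<Sum>i\<in>UNIV. Cst (\<tau> (x i)) * \<rho>.ext (g i) | g. (\<Sum>i\<in>UNIV. g i * F i) = 0 \<and> (\<forall>i. homog n (g i))} = \<tau>.ext ` ?W"
  proof -
    have "(\<Sum>i\<in>UNIV. Cst (\<tau> (x i)) * \<rho>.ext (g i)) = \<tau>.ext (\<Sum>i\<in>UNIV. Cst (x i) * \<sigma>.ext (g i))"
      for g :: "'i \<Rightarrow> (3, 'k) mpol"
      by (simp add: \<tau>.ext.hom_sum \<tau>.ext.hom_mult \<tau>.ext_Cst ext)
    then show ?thesis by (auto simp: image_iff)
  qed
  finally have "mvs.dim (spec_ideal (\<lambda>i. \<tau> (x i)) (\<lambda>i. \<rho>.ext (F i)) \<inter> forms n) = mvs.dim (\<tau>.ext ` ?W)"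
    by simp
  also have "\<dots> = mvs.dim ?W"
  proof (rule \<tau>.dim_image_ext)
    have "?W \<subseteq> forms n" by (auto simp: forms_def intro!: homog_sum homog_Cst_mult)
    then show "fin_dim ?W" using fin_dim_mono[OF fin_dim_forms] by blast
  qed
  also have "\<dots> = mvs.dim (spec_ideal x (\<lambda>i. \<sigma>.ext (F i)) \<inter> forms n)"
    unfolding \<sigma>.spec_ideal_forms[where F = F and x = x, OF F x] mvs.dim_span ..
  finally show ?thesis unfolding hfun_def dim_forms_3 by simp
qed

text \<open>Every monomial of an element of the \<open>N\<close>-th power of the irrelevant ideal
  has degree at least \<open>N\<close>, so it is divisible by a monomial of degree exactly
  \<open>N\<close>.\<close>

lemma saturation_memI:
  fixes I :: "('v::finite, 'k::comm_ring_1) mpol set"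
  assumes I: "mul.subspace I" and y: "\<And>m. mdeg m = N \<Longrightarrow> mon m * y \<in> I"
  shows "y \<in> saturation I"
proof -
  have split: "\<exists>m' m''. m = m' + m'' \<and> mdeg m' = n" if "n \<le> mdeg m" for m :: "'v \<Rightarrow>\<^sub>0 nat" and n
    using that
  proof (induction n)
    case 0 show ?case by (rule exI[of _ 0]) simp
  next
    case (Suc n)
    then obtain m' m'' where m: "m = m' + m''" "mdeg m' = n" by auto
    then have "mdeg m'' \<noteq> 0" using Suc(2) by (simp add: mdeg_add)
    then obtain i where i: "Poly_Mapping.lookup m'' i \<noteq> 0" unfolding mdeg_def by (meson sum.neutral)
    have "m'' = Poly_Mapping.single i 1 + (m'' - Poly_Mapping.single i 1)"
      using i by (intro poly_mapping_eqI) (auto simp: lookup_add lookup_minus lookup_single when_def)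
    then have "m = (m' + Poly_Mapping.single i 1) + (m'' - Poly_Mapping.single i 1)"
      using m(1) by (metis add.assoc)
    moreover have "mdeg (m' + Poly_Mapping.single i 1) = Suc n" using m(2) by (simp add: mdeg_add)
    ultimately show ?case by blast
  qed
  have power: "mdeg m \<ge> n" if "h \<in> ideal_power class_ring irrelevant n" "coef h m \<noteq> 0" for n and h :: "('v, 'k) mpol" and m
    using that
  proof (induction n arbitrary: h m)
    case (Suc n)
    have irr: "mdeg m \<ge> 1" if "h \<in> irrelevant" "coef h m \<noteq> 0" for h :: "('v, 'k) mpol" and m
    proof -
      have "h \<in> mul.span (range Var)" using that(1) by (simp add: irrelevant_def genideal_class_ring)
      then have "coef h 0 = 0"
      proof (induction rule: mul.span_induct_alt)
        case base show ?case by simp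
      next
        case (step c x y)
        then obtain i where "x = Var i" by blast
        then have "hcomp 0 (c * x) = 0" using hcomp_homog_mult[OF homog_Var, of 0 i c] by (simp add: mult.commute)
        then have "coef (c * x) 0 = 0" using coef_hcomp[of 0 "c * x" 0] by simp
        then show ?case using step by (simp add: lookup_add)
      qed
      then have "m \<noteq> 0" using that(2) by metis
      then show ?thesis using mdeg_eq_0_iff[of m] by simp
    qed
    have "h \<in> ideal_prod class_ring irrelevant (ideal_power class_ring irrelevant n)"
      using Suc(2) by (simp add: ideal_power_def)
    then show ?case using Suc(3)
    proof (induction h arbitrary: m rule: ideal_prod.induct)
      case (prod i j)
      then have "m \<in> Poly_Mapping.keys (i * j)" by (simp add: in_keys_iff)
      then obtain m1 m2 where m: "m = m1 + m2" "coef i m1 \<noteq> 0" "coef j m2 \<noteq> 0"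
        using keys_mult[of i j] by (auto simp: in_keys_iff)
      have "mdeg m1 \<ge> 1" by (rule irr[OF prod(1) m(2)])
      moreover have "mdeg m2 \<ge> n" by (rule Suc.IH[OF prod(2) m(3)])
      ultimately show ?case by (simp add: m(1) mdeg_add)
    next
      case (sum s1 s2)
      then have "coef s1 m \<noteq> 0 \<or> coef s2 m \<noteq> 0" by (auto simp: lookup_add)
      then show ?case using sum by blast
    qed
  qed simp
  have "h * y \<in> I" if h: "h \<in> ideal_power class_ring irrelevant N" for h
  proof -
    have "(\<Sum>m\<in>Poly_Mapping.keys h. Cst (coef h m) * (mon m * y)) \<in> I"
    proof (rule mul.subspace_sum[OF I])
      fix m assume "m \<in> Poly_Mapping.keys h"
      then have "N \<le> mdeg m" using power[OF h] by (simp add: in_keys_iff)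
      then obtain m' m'' where m: "m = m' + m''" "mdeg m' = N" using split by blast
      have "mon m * y = mon m'' * (mon m' * y)" unfolding m(1) mon_mult[symmetric] by (simp add: mult_ac)
      then have "mon m * y \<in> I" using mul.subspace_scale[OF I y[OF m(2)]] by simp
      then show "Cst (coef h m) * (mon m * y) \<in> I" by (rule mul.subspace_scale[OF I])
    qed
    moreover have "(\<Sum>m\<in>Poly_Mapping.keys h. Cst (coef h m) * (mon m * y)) = h * y"
      by (subst mono_decomp[of h]) (simp add: sum_distrib_right mult.assoc)
    ultimately show ?thesis by simp
  qed
  then show ?thesis unfolding saturation_def by blast
qed

lemma saturation_form_zero:
  assumes "mul.subspace I" "\<And>m. mdeg m = N \<Longrightarrow> mon m * y \<in> I" "homog n y" "n < indeg (saturation I)"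
  shows "y = (0 :: ('v::finite, 'k::comm_ring_1) mpol)"
  using saturation_memI[OF assms(1,2)] not_less_Least[of n "\<lambda>n. \<exists>g\<in>saturation I. g \<noteq> 0 \<and> homog n g"] assms(3,4)
  unfolding indeg_def by blast

section \<open>Complete intersections and residual schemes\<close>

abbreviation cc :: "nat \<Rightarrow> nat" where "cc n \<equiv> (n + 2) choose 2"

lemma span_insert_span: "mul.span (insert g (mul.span E)) = mul.span (insert g E)" for g :: "'a::comm_ring_1"
proof (intro antisym mul.span_minimal mul.subspace_span)
  show "insert g (mul.span E) \<subseteq> mul.span (insert g E)"
    using mul.span_mono[of E "insert g E"] mul.span_base[of g "insert g E"] by blast
  show "insert g E \<subseteq> mul.span (insert g (mul.span E))"
    using mul.span_superset[of E] mul.span_superset[of "insert g (mul.span E)"] by blast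
qed

lemma in_span_single: "x \<in> mul.span {u} \<longleftrightarrow> u dvd x" for u :: "'a::comm_ring_1"
  by (auto simp: mul.span_singleton dvd_def mult.commute)

lemma in_span_pair: "x \<in> mul.span {u, v} \<longleftrightarrow> (\<exists>a b. x = a * u + b * v)" for u :: "'a::comm_ring_1"
proof
  assume "x \<in> mul.span {u, v}"
  then obtain a where "x - a * u \<in> mul.span {v}" using mul.span_breakdown_eq[of x u "{v}"] by blast
  then obtain b where "x - a * u = b * v" by (auto simp: mul.span_singleton)
  then have "x = a * u + b * v" by (simp add: algebra_simps)
  then show "\<exists>a b. x = a * u + b * v" by blast
next
  assume "\<exists>a b. x = a * u + b * v"
  then show "x \<in> mul.span {u, v}"
    by (auto intro!: mul.span_add mul.span_scale intro: mul.span_base)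
qed

lemma rel_prime_sym:
  fixes a b :: "'a::idom"
  assumes "rel_prime a b" "a \<noteq> 0"
  shows "rel_prime b a"
  unfolding rel_prime_def
proof (intro allI impI)
  fix x assume "b dvd a * x"
  then obtain z where z: "a * x = b * z" by (elim dvdE)
  then have "a dvd b * z" by (metis dvd_triv_left)
  then have "a dvd z" by (rule rel_primeD[OF assms(1)])
  then obtain w where "z = a * w" by (elim dvdE)
  then have "a * x = a * (b * w)" using z by (simp add: mult.left_commute)
  then have "x = b * w" using assms(2) by simp
  then show "b dvd x" by simp
qed

lemma hfun_principal:
  fixes g :: "(3, 'k::field) mpol"
  assumes g: "homog r g" "g \<noteq> 0"
  shows "hfun (mul.span {g}) (n + r) + cc n = cc (n + r)"
proof -
  have z: "mul.span {} = ({0} :: (3, 'k) mpol set)" by simp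
  have gr: "graded_ideal ({0} :: (3, 'k) mpol set)" by (simp add: graded_ideal_def)
  have col: "colon {0} g = {0}" using g(2) by (auto simp: colon_def)
  have "mul.span (insert g {0}) = mul.span {g}" using span_insert_span[of g "{}"] unfolding z .
  then show ?thesis using hfun_exact[OF gr g, of n] unfolding col hfun_zero dim_forms_3 by simp
qed

text \<open>The Hilbert function of the plane is quadratic, so its mixed second difference is
  constant; this is the source of Bezout's number \<open>a b\<close>.\<close>

lemma second_difference:
  "int (cc (n + a + b)) - int (cc (n + a)) - int (cc (n + b)) + int (cc n) = int a * int b"
proof -
  have "2 * (int (cc (n + a + b)) - int (cc (n + a)) - int (cc (n + b)) + int (cc n)) = 2 * (int a * int b)"
    using int_choose_2[of "n + a + b"] int_choose_2[of "n + a"] int_choose_2[of "n + b"] int_choose_2[of n]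
    by (simp add: algebra_simps)
  then show ?thesis by simp
qed

lemma graded_span_pair:
  assumes "homog a u" "homog b v" shows "graded_ideal (mul.span {u, v})"
  using assms by (intro graded_span) auto

text \<open>The colon of \<open>(u)\<close> by \<open>v\<close> always contains \<open>(u)\<close>,
  whence the inequality, and equals it for coprime \<open>u\<close> and \<open>v\<close>. The
  inequality alone serves later for two generators that may share a factor.\<close>

lemma hfun_pair_ge:
  fixes u v :: "(3, 'k::field) mpol"
  assumes u: "homog a u" "u \<noteq> 0" and v: "homog b v" "v \<noteq> 0"
  shows "a * b \<le> hfun (mul.span {u, v}) (n + a + b)"
    and "rel_prime u v \<Longrightarrow> hfun (mul.span {u, v}) (n + a + b) = a * b"
proof -
  have gr: "graded_ideal (mul.span {u})" using u by (intro graded_span) auto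
  have ex: "hfun (mul.span {u}) (n + a + b) = hfun (mul.span {u, v}) (n + a + b) + hfun (colon (mul.span {u}) v) (n + a)"
    using hfun_exact[OF gr v, of "n + a"] unfolding span_insert_span by (simp add: insert_commute)
  have sub: "mul.span {u} \<subseteq> colon (mul.span {u}) v"
    using mul.span_scale[of _ "{u}" v] by (auto simp: colon_def)
  have le: "hfun (colon (mul.span {u}) v) (n + a) \<le> hfun (mul.span {u}) (n + a)"
    using sub by (intro hfun_antimono) blast
  have h: "int (hfun (mul.span {u}) (n + a + b)) = int (cc (n + a + b)) - int (cc (n + b))"
    "int (hfun (mul.span {u}) (n + a)) = int (cc (n + a)) - int (cc n)"
    using hfun_principal[OF u, of "n + b"] hfun_principal[OF u, of n] by (simp_all add: add_ac)
  have d: "int (hfun (mul.span {u}) (n + a + b)) - int (hfun (mul.span {u}) (n + a)) = int a * int b"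
    using h second_difference[of n a b] by linarith
  have "int (a * b) \<le> int (hfun (mul.span {u, v}) (n + a + b))"
    using ex le d by simp
  then show "a * b \<le> hfun (mul.span {u, v}) (n + a + b)" by linarith
  assume "rel_prime u v"
  then have "colon (mul.span {u}) v = mul.span {u}"
    using sub by (auto simp: colon_def in_span_single dest: rel_primeD)
  then have "int (hfun (mul.span {u, v}) (n + a + b)) = int (a * b)" using ex d by simp
  then show "hfun (mul.span {u, v}) (n + a + b) = a * b" by linarith
qed

lemma hfun_pair_bounded:
  fixes u v :: "(3, 'k::field) mpol"
  assumes u: "homog a u" "u \<noteq> 0" and v: "homog b v" "v \<noteq> 0" and "rel_prime u v"
  shows "hfun (mul.span {u, v}) n \<le> a * b + cc (a + b)"
proof (cases "n \<ge> a + b")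
  case True
  then have "n = (n - a - b) + a + b" by simp
  then have "hfun (mul.span {u, v}) n = a * b" using hfun_pair_ge(2)[OF assms(1-4) assms(5), of "n - a - b"] by simp
  then show ?thesis by simp
next
  case False
  have "hfun (mul.span {u, v}) n \<le> mvs.dim (forms n :: (3, 'k) mpol set)" by (simp add: hfun_def)
  also have "\<dots> \<le> cc (a + b)" unfolding dim_forms_3 using False by (intro binomial_right_mono) simp_all
  finally show ?thesis by simp
qed

section \<open>Saturatedness of a complete intersection of two curves\<close>

definition kill :: "'v set \<Rightarrow> ('v::finite, 'k::comm_ring_1) mpol \<Rightarrow> ('v, 'k) mpol"
  where "kill Z = mev Cst (\<lambda>i. if i \<in> Z then 0 else Var i)"

lemma comm_ring_hom_kill: "comm_ring_hom (kill Z)"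
  unfolding kill_def by (rule comm_ring_hom.comm_ring_hom_mev[OF comm_ring_hom_Cst])

lemma kill_Var: "kill Z (Var i) = (if i \<in> Z then 0 else Var i)"
  unfolding kill_def by (rule comm_ring_hom.mev_Var[OF comm_ring_hom_Cst])

lemma kill_Cst: "kill Z (Cst c) = Cst c"
  unfolding kill_def by (rule comm_ring_hom.mev_Cst[OF comm_ring_hom_Cst])

text \<open>A monomial is either divisible by a variable of \<open>Z\<close> or fixed by
  \<open>kill Z\<close>, so \<open>F - kill Z F\<close> always lies in the ideal of these
  variables.\<close>

lemma span_Var_iff_kill:
  "F \<in> mul.span (Var ` Z) \<longleftrightarrow> kill Z F = (0 :: ('v::finite, 'k::comm_ring_1) mpol)"
proof
  interpret kill: comm_ring_hom "kill Z :: ('v, 'k) mpol \<Rightarrow> _" by (rule comm_ring_hom_kill)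
  assume "F \<in> mul.span (Var ` Z)"
  then show "kill Z F = 0"
  proof (induction rule: mul.span_induct_alt)
    case base show ?case by simp
  next
    case (step c x y) then show ?case by (auto simp: kill.hom_add kill.hom_mult kill_Var)
  qed
next
  interpret kill: comm_ring_hom "kill Z :: ('v, 'k) mpol \<Rightarrow> _" by (rule comm_ring_hom_kill)
  assume 0: "kill Z F = 0"
  have mon: "mon m - kill Z (mon m) \<in> mul.span (Var ` Z :: ('v, 'k) mpol set)" for m
  proof (cases "\<exists>i\<in>Z. Poly_Mapping.lookup m i \<noteq> 0")
    case True
    then obtain i where i: "i \<in> Z" "Suc 0 \<le> Poly_Mapping.lookup m i" by force
    then obtain m' where m': "mon m = Var i ^ Suc 0 * (mon m' :: ('v, 'k) mpol)" using mon_divisible[OF i(2)] by blast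
    then have "mon m = mon m' * (Var i :: ('v, 'k) mpol)" unfolding power_Suc0_right by (simp only: mult.commute[of "Var i"])
    moreover have "mon m' * (Var i :: ('v, 'k) mpol) \<in> mul.span (Var ` Z)"
      using i(1) by (intro mul.span_scale mul.span_base imageI)
    moreover have "kill Z (mon m :: ('v, 'k) mpol) = 0" unfolding m' using i(1) by (simp add: kill.hom_mult kill_Var)
    ultimately show ?thesis by simp
  next
    case False
    have "kill Z (mon m :: ('v, 'k) mpol) = mon m"
      unfolding mon_prod kill.hom_prod kill.hom_power kill_Var using False by (intro prod.cong) auto
    then show ?thesis by (simp add: mul.span_zero)
  qed
  have "F - kill Z F = (\<Sum>m\<in>Poly_Mapping.keys F. Cst (coef F m) * (mon m - kill Z (mon m)))"
  proof -
    have "kill Z F = (\<Sum>m\<in>Poly_Mapping.keys F. Cst (coef F m) * kill Z (mon m))"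
      by (subst mono_decomp[of F]) (simp add: kill.hom_sum kill.hom_mult kill_Cst)
    then show ?thesis using mono_decomp[of F] by (simp add: right_diff_distrib sum_subtractf)
  qed
  also have "\<dots> \<in> mul.span (Var ` Z)" by (intro mul.span_sum mul.span_scale mon)
  finally show "F \<in> mul.span (Var ` Z)" using 0 by simp
qed

lemma Var_dvd_mult_Var:
  assumes "Var i dvd Var j * (F :: ('v::{finite,linorder}, 'k::field) mpol)" "i \<noteq> j"
  shows "Var i dvd F"
proof -
  interpret kill: comm_ring_hom "kill {i} :: ('v, 'k) mpol \<Rightarrow> _" by (rule comm_ring_hom_kill)
  have "kill {i} (Var j * F) = 0" using assms(1) span_Var_iff_kill[of "Var j * F" "{i}"] by (simp add: in_span_single)
  then have "Var j * kill {i} F = 0" using assms(2) by (simp add: kill.hom_mult kill_Var)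
  moreover have "Var j \<noteq> (0 :: ('v, 'k) mpol)"
    unfolding Var_def by (metis lookup_single_eq lookup_zero zero_neq_one)
  ultimately have "kill {i} F = 0" by simp
  then show ?thesis using span_Var_iff_kill[of F "{i}"] by (simp add: in_span_single)
qed

lemma Var_nonzero: "Var i \<noteq> (0 :: ('v, 'k::zero_neq_one) mpol)"
  unfolding Var_def by (metis lookup_single_eq lookup_zero zero_neq_one)

lemma koszul_shift: "a * u + b * v = (a - v * r) * u + (b + u * r) * (v :: 'a::comm_ring_1)"
  by (simp add: algebra_simps)

text \<open>A Koszul argument. Comparing two expressions for \<open>Var i * Var j * y\<close> yields
  \<open>q i j\<close>. Once \<open>q 0 1\<close> is known to lie in the ideal of
  \<open>Var 0\<close> and \<open>Var 1\<close>, a Koszul syzygy corrects the coefficients of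
  \<open>Var 0 * y\<close> so that both become divisible by \<open>Var 0\<close>.\<close>

lemma pair_saturated_step:
  fixes u v y :: "(3, 'k::field) mpol"
  assumes uv: "rel_prime v u" "u \<noteq> 0" "v \<noteq> 0" and y: "\<And>i. Var i * y \<in> mul.span {u, v}"
  shows "y \<in> mul.span {u, v}"
proof -
  interpret kill: comm_ring_hom "kill {0, 1} :: (3, 'k) mpol \<Rightarrow> _" by (rule comm_ring_hom_kill)
  obtain \<alpha> \<beta> where ab: "\<And>i. Var i * y = \<alpha> i * u + \<beta> i * v"
    using y unfolding in_span_pair by metis
  have rel: "u * (\<alpha> i * Var j - \<alpha> j * Var i) = v * (\<beta> j * Var i - \<beta> i * Var j)" for i j
  proof -
    have "Var j * (Var i * y) = Var i * (Var j * y)" by (simp add: mult.left_commute)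
    then show ?thesis unfolding ab by (simp add: algebra_simps)
  qed
  have "v dvd \<alpha> i * Var j - \<alpha> j * Var i" for i j
    by (rule rel_primeD[OF uv(1)]) (simp add: rel)
  then obtain q where q: "\<And>i j. \<alpha> i * Var j - \<alpha> j * Var i = v * q i j" unfolding dvd_def by metis
  have q': "\<beta> j * Var i - \<beta> i * Var j = u * q i j" for i j
  proof -
    have "v * (\<beta> j * Var i - \<beta> i * Var j) = v * (u * q i j)"
      unfolding rel[of i j, symmetric] q[of i j] by (rule mult.left_commute)
    then show ?thesis using mult_left_cancel[OF uv(3)] by blast
  qed
  \<comment> \<open>The expansion of a vanishing determinant. After \<open>v\<close> is cancelled it
    puts \<open>Var 2 * q 0 1\<close> into the ideal of \<open>Var 0\<close> and
    \<open>Var 1\<close>, modulo which \<open>Var 2\<close> is a nonzerodivisor.\<close>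
  have "Var 2 * (\<alpha> 0 * Var 1 - \<alpha> 1 * Var 0) =
      Var 1 * (\<alpha> 0 * Var 2 - \<alpha> 2 * Var 0) - Var 0 * (\<alpha> 1 * Var 2 - \<alpha> 2 * Var 1)"
    by (simp add: algebra_simps)
  then have "Var 2 * (v * q 0 1) = Var 1 * (v * q 0 2) - Var 0 * (v * q 1 2)" unfolding q .
  then have "v * (Var 2 * q 0 1) = v * (Var 1 * q 0 2 - Var 0 * q 1 2)"
    by (simp only: right_diff_distrib mult.left_commute[of v])
  then have "Var 2 * q 0 1 = Var 1 * q 0 2 - Var 0 * q 1 2" using mult_left_cancel[OF uv(3)] by blast
  also have "\<dots> \<in> mul.span (Var ` {0, 1})"
    by (intro mul.span_diff mul_scale[OF mul.subspace_span] mul.span_base imageI) simp_all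
  finally have "kill {0, 1} (Var 2 * q 0 1) = 0" unfolding span_Var_iff_kill .
  then have "Var 2 * kill {0, 1} (q 0 1) = 0" by (simp add: kill.hom_mult kill_Var)
  then have "kill {0, 1} (q 0 1) = 0" using Var_nonzero[of "2 :: 3", where ?'k = 'k] by simp
  then have "q 0 1 \<in> mul.span {Var 0, Var 1}" using span_Var_iff_kill[of "q 0 1" "{0, 1}"] by simp
  then obtain r1 r0 where r: "q 0 1 = r1 * Var 0 + r0 * Var 1" unfolding in_span_pair by blast
  have "Var 1 * (\<alpha> 0 - v * r0) = Var 0 * (\<alpha> 1 + v * r1)"
  proof -
    have "\<alpha> 0 * Var 1 = \<alpha> 1 * Var 0 + v * q 0 1" using q[of 0 1] by (simp add: algebra_simps)
    then show ?thesis unfolding r by (simp add: algebra_simps)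
  qed
  then have "Var 0 dvd Var 1 * (\<alpha> 0 - v * r0)" by (metis dvd_triv_left)
  then have "Var 0 dvd \<alpha> 0 - v * r0" by (rule Var_dvd_mult_Var) simp
  then obtain \<eta> where \<eta>: "\<alpha> 0 - v * r0 = Var 0 * \<eta>" by (elim dvdE)
  have "Var 1 * (\<beta> 0 + u * r0) = Var 0 * (\<beta> 1 - u * r1)"
  proof -
    have "\<beta> 0 * Var 1 = \<beta> 1 * Var 0 - u * q 0 1" using q'[of 1 0] by (simp add: algebra_simps)
    then show ?thesis unfolding r by (simp add: algebra_simps)
  qed
  then have "Var 0 dvd Var 1 * (\<beta> 0 + u * r0)" by (metis dvd_triv_left)
  then have "Var 0 dvd \<beta> 0 + u * r0" by (rule Var_dvd_mult_Var) simp
  then obtain \<theta> where \<theta>: "\<beta> 0 + u * r0 = Var 0 * \<theta>" by (elim dvdE)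
  have "Var 0 * y = (\<alpha> 0 - v * r0) * u + (\<beta> 0 + u * r0) * v"
    unfolding ab by (rule koszul_shift)
  then have "Var 0 * y = Var 0 * (\<eta> * u + \<theta> * v)" unfolding \<eta> \<theta> by (simp only: distrib_left mult.assoc)
  then have "y = \<eta> * u + \<theta> * v" using mult_left_cancel[OF Var_nonzero[of "0 :: 3", where ?'k = 'k]] by blast
  then show ?thesis unfolding in_span_pair by blast
qed

lemma pair_saturated:
  fixes u v y :: "(3, 'k::field) mpol"
  assumes uv: "rel_prime v u" "u \<noteq> 0" "v \<noteq> 0" and "\<And>m. mdeg m = M \<Longrightarrow> mon m * y \<in> mul.span {u, v}"
  shows "y \<in> mul.span {u, v}"
  using assms(4)
proof (induction M arbitrary: y)
  case 0
  then show ?case using 0[of 0] by simp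
next
  case (Suc M)
  have "mon m * y \<in> mul.span {u, v}" if "mdeg m = M" for m
  proof (rule pair_saturated_step[OF uv])
    fix i
    have "mdeg (Poly_Mapping.single i 1 + m) = Suc M" using that by (simp add: mdeg_add)
    then have "mon (Poly_Mapping.single i 1 + m) * y \<in> mul.span {u, v}" by (rule Suc.prems)
    then show "Var i * (mon m * y) \<in> mul.span {u, v}"
      by (simp add: Var_def mult_single flip: mult.assoc)
  qed
  then show ?case by (rule Suc.IH)
qed

lemma part_eq_if_hfun_le:
  assumes "mul.subspace A" "A \<subseteq> B" "hfun A n \<le> hfun B n"
  shows "A \<inter> forms n = B \<inter> (forms n :: (3, 'k::field) mpol set)"
proof (rule subspace_eq_if_dim_le[OF fin_dim_part _ subspace_part[OF assms(1)]])
  show "mvs.dim (B \<inter> forms n) \<le> mvs.dim (A \<inter> forms n)"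
    using hfun_dim[of A n] hfun_dim[of B n] assms(3) by linarith
qed (use assms(2) in blast)

text \<open>Covers the case in which \<open>2a - 3 - m\<close> is negative, so that there is no
  degree \<open>j\<close> to argue with and the Bezout bound alone must suffice.\<close>

lemma quadratic_bound_1:
  fixes m a :: int
  assumes "a \<ge> 1" "m \<ge> 2 * a - 2"
  shows "2 * a ^ 2 \<le> (m + 2) * (m + 1)"
proof -
  have "(2 * a) * (2 * a - 1) \<le> (m + 2) * (m + 1)"
    using assms by (intro mult_mono) auto
  moreover have "a * 1 \<le> a * a" using assms(1) by (intro mult_left_mono) auto
  ultimately show ?thesis by (simp add: algebra_simps power2_eq_square)
qed

text \<open>The difference of the two sides is twice the product of the consecutive integers
  \<open>a - j - 1\<close> and \<open>a - j - 2\<close>, hence never negative.\<close>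

lemma quadratic_bound_2:
  fixes a j :: int
  shows "2 * a ^ 2 \<le> (j + 2) * (j + 1) + ((2 * a - 3 - j) + 2) * ((2 * a - 3 - j) + 1)"
proof -
  have "0 \<le> (a - j - 1) * (a - j - 2)"
    by (cases "a - j \<ge> 2") (auto intro: mult_nonneg_nonneg mult_nonpos_nonpos)
  moreover have "(j + 2) * (j + 1) + ((2 * a - 3 - j) + 2) * ((2 * a - 3 - j) + 1) = 2 * a ^ 2 + 2 * ((a - j - 1) * (a - j - 2))"
    by (simp add: algebra_simps power2_eq_square)
  ultimately show ?thesis by linarith
qed

text \<open>Let \<open>Z\<close> be the complete intersection of two curves of degree \<open>a\<close> through \<open>V(K)\<close>. Forms of degree
  \<open>j = 2a - 3 - m\<close> inject into the coordinate ring of \<open>V(A)\<close> as soon as the saturation of \<open>A\<close> vanishes in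
  degree \<open>j\<close>; this bounds from below the degree of \<open>V(A)\<close>, hence from above the degree of the residual
  scheme \<open>V(K : w)\<close>.\<close>

lemma residual_bound:
  fixes u v w :: "(3, 'k::field) mpol" and m :: int
  assumes inf: "infinite (UNIV :: 'k set)"
    and u: "homog a u" "u \<noteq> 0" and v: "homog a v" "v \<noteq> 0" and rp: "rel_prime u v" and a: "a \<ge> 1"
    and K: "graded_ideal K" "u \<in> K" "v \<in> K" and w: "homog d w" "w \<noteq> 0"
    and sat: "\<And>j y N. int j + m = 2 * int a - 3 \<Longrightarrow> homog j y \<Longrightarrow>
      (\<And>\<mu>. mdeg \<mu> = N \<Longrightarrow> mon \<mu> * y \<in> mul.span (insert w K)) \<Longrightarrow> y = 0"
  obtains N \<delta> where "\<And>n. n \<ge> N \<Longrightarrow> hfun (colon K w) n = \<delta>" "2 * int \<delta> \<le> (m + 2) * (m + 1)"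
    "2 * int \<delta> = (m + 2) * (m + 1) \<Longrightarrow> \<forall>t\<in>K. t \<in> mul.span {u, v}"
proof -
  let ?B = "mul.span {u, v}" and ?A = "mul.span (insert w K)"
  have SK: "mul.subspace K" using K(1) by (simp add: graded_ideal_def)
  have grB: "graded_ideal ?B" by (rule graded_span_pair[OF u(1) v(1)])
  have BK: "?B \<subseteq> K" using K by (intro mul.span_minimal SK) auto
  obtain l where l: "homog (Suc 0) l" "l \<noteq> 0" "\<And>p. p \<in> Proj \<Longrightarrow> ?B \<subseteq> p \<Longrightarrow> l \<notin> p"
    using exists_linear_parameter[OF grB hfun_pair_bounded[OF u v rp] inf] by blast
  have "?B \<subseteq> colon K w" using BK mul.subspace_scale[OF SK] by (auto simp: colon_def)
  then have "l \<notin> p" if "p \<in> Proj" "colon K w \<subseteq> p" for p using l(3) that by blast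
  then obtain N0 \<delta> where \<delta>: "\<And>n. n \<ge> N0 \<Longrightarrow> hfun (colon K w) n = \<delta>"
    using hfun_eventually_constant[OF graded_colon[OF K(1) w(1)] l(1,2)] by blast
  have grA: "graded_ideal ?A" by (rule graded_span_insert[OF K(1) w(1)])
  \<comment> \<open>Multiplication by \<open>l ^ r\<close> is injective from the forms of degree
    \<open>j\<close> to the quotient by \<open>K + (w)\<close>: a form that it kills is a saturation
    element, and \<open>sat\<close> makes it zero.\<close>
  have low: "cc j \<le> hfun ?A (j + r)" if j: "int j + m = 2 * int a - 3" for j r
  proof -
    let ?C = "mul.span (insert (l ^ r) ?B)"
    have lr: "homog r (l ^ r)" using homog_power[OF l(1), of r] by simp
    have zero: "y = 0" if y: "homog j y" "l ^ r * y \<in> ?A" for y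
    proof (cases "r = 0")
      case True
      then show ?thesis using sat[OF j y(1), of 0] y(2) mul.subspace_scale[OF mul.subspace_span] by auto
    next
      case False
      have "\<not> ?C \<subseteq> p" if p: "p \<in> Proj" for p
      proof
        assume C: "?C \<subseteq> p"
        then have "l ^ r \<in> p" "?B \<subseteq> p" using mul.span_superset[of "insert (l ^ r) ?B"] by blast+
        then show False using l(3)[OF p] Proj_power_iff[OF p] by blast
      qed
      \<comment> \<open>The line \<open>l\<close> misses the common zeros of \<open>u\<close> and
        \<open>v\<close>, so all forms of some degree \<open>M\<close> lie in
        \<open>(u, v, l ^ r)\<close>. If \<open>l ^ r * y\<close> is in \<open>?A\<close>, all
        products of \<open>y\<close> with monomials of degree \<open>M\<close> are too.\<close>
      then obtain M where M: "forms M \<subseteq> ?C"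
        using forms_subset_if_Vplus_empty[OF graded_span_insert[OF grB lr]] by blast
      show ?thesis
      proof (rule sat[OF j y(1)])
        fix \<mu> :: "3 \<Rightarrow>\<^sub>0 nat" assume "mdeg \<mu> = M"
        then have "mon \<mu> \<in> ?C" using M homog_single[of \<mu> 1] by (auto simp: forms_def)
        then obtain b c where bc: "b \<in> ?B" "mon \<mu> = b + l ^ r * c"
          using in_span_insert_mult[OF _ mul.subspace_span] by blast
        have "mon \<mu> * y = y * b + c * (l ^ r * y)" unfolding bc(2) by (simp add: algebra_simps)
        moreover have "b \<in> ?A" using bc(1) BK mul.span_superset[of "insert w K"] by blast
        ultimately show "mon \<mu> * y \<in> ?A" using y(2) by (simp add: mul.span_add mul.span_scale)
      qed
    qed
    have "colon ?A (l ^ r) \<inter> forms j \<subseteq> {0}" using zero by (auto simp: colon_def forms_def)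
    then have "hfun ({0} :: (3, 'k) mpol set) j \<le> hfun (colon ?A (l ^ r)) j" by (rule hfun_antimono)
    then have "cc j \<le> hfun (colon ?A (l ^ r)) j" unfolding hfun_zero dim_forms_3 .
    then show ?thesis using hfun_exact[OF grA lr, of j] l(2) by simp
  qed
  have ex: "hfun K (n + d) = hfun ?A (n + d) + \<delta>" if "n \<ge> N0" for n
    using hfun_exact[OF K(1) w, of n] \<delta>[OF that] by simp
  have KB: "hfun K n \<le> a * a" if "n \<ge> 2 * a" for n
  proof -
    have "hfun K n \<le> hfun ?B n" using BK by (intro hfun_antimono) blast
    also have "\<dots> = a * a" using hfun_pair_ge(2)[OF u v rp, of "n - 2 * a"] that by (simp add: mult_2[symmetric])
    finally show ?thesis .
  qed
  define N where "N = N0 + 2 * a + nat (2 * int a - 3 - m)"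
  \<comment> \<open>The defect \<open>a\<^sup>2 - hfun K\<close> is kept in the estimate: equality
    in the final bound leaves no room for it, so \<open>K\<close> and \<open>(u, v)\<close> then
    agree in large degrees.\<close>
  have bound: "2 * int \<delta> + 2 * (int (a * a) - int (hfun K (n + d))) \<le> (m + 2) * (m + 1)" if n: "n \<ge> N" for n
  proof (cases "2 * int a - 3 - m \<ge> 0")
    case True
    define j where "j = nat (2 * int a - 3 - m)"
    have j: "int j + m = 2 * int a - 3" using True by (simp add: j_def)
    then have m: "m = 2 * int a - 3 - int j" by simp
    have "cc j \<le> hfun ?A (n + d)" using low[OF j, of "n + d - j"] n by (simp add: N_def j_def)
    then have "int (cc j) + int \<delta> \<le> int (hfun K (n + d))" using ex[of n] n by (simp add: N_def)
    then show ?thesis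
      using int_choose_2[of j] quadratic_bound_2[of "int a" "int j"] unfolding m by (simp add: power2_eq_square)
  next
    case False
    have "2 * int \<delta> + 2 * (int (a * a) - int (hfun K (n + d))) \<le> 2 * (int a)\<^sup>2"
      using ex[of n] n by (simp add: power2_eq_square N_def)
    then show ?thesis using quadratic_bound_1[of "int a" m] False a by simp
  qed
  have arith: "2 * z \<le> w" "2 * z = w \<Longrightarrow> y \<le> x" if "2 * z + 2 * (y - x) \<le> w" "x \<le> y \<or> 2 * z = w" for x y z w :: int
    using that by presburger+
  show ?thesis
  proof (rule that)
    show "hfun (colon K w) n = \<delta>" if "n \<ge> N0" for n using \<delta> that .
    show "2 * int \<delta> \<le> (m + 2) * (m + 1)"
    proof -
      have "int (hfun K (N + d)) \<le> int (a * a)" using KB[of "N + d"] unfolding of_nat_le_iff by (simp add: N_def)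
      then show ?thesis using bound[OF order_refl] arith(1) by blast
    qed
    assume eq: "2 * int \<delta> = (m + 2) * (m + 1)"
    have eqB: "?B \<inter> forms (n + d) = K \<inter> forms (n + d)" if n: "n \<ge> N" for n
    proof -
      have "int (a * a) \<le> int (hfun K (n + d))" using bound[OF n] eq arith(2) by blast
      then have "a * a \<le> hfun K (n + d)" unfolding of_nat_le_iff .
      moreover have "hfun ?B (n + d) = a * a"
        using hfun_pair_ge(2)[OF u v rp, of "n + d - 2 * a"] n by (simp add: mult_2[symmetric] N_def)
      ultimately show ?thesis
        using part_eq_if_hfun_le[OF mul.subspace_span BK, of "n + d"] by simp
    qed
    have KB_eq: "F \<in> ?B" if "F \<in> K" "homog k F" "k \<ge> N + d" for F k
    proof -
      have "?B \<inter> forms k = K \<inter> forms k" using eqB[of "k - d"] that(3) by simp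
      then show ?thesis using that by (auto simp: forms_def)
    qed
    show "\<forall>t\<in>K. t \<in> ?B"
    proof
      fix t assume t: "t \<in> K"
      have "hcomp b t \<in> ?B" for b
      \<comment> \<open>Agreement in large degrees passes to all degrees because
        \<open>(u, v)\<close> is saturated.\<close>
      proof (rule pair_saturated[OF rel_prime_sym[OF rp u(2)] u(2) v(2), of "N + d"])
        fix \<mu> :: "3 \<Rightarrow>\<^sub>0 nat" assume \<mu>: "mdeg \<mu> = N + d"
        show "mon \<mu> * hcomp b t \<in> ?B"
        proof (rule KB_eq)
          show "mon \<mu> * hcomp b t \<in> K"
            using K(1) t mul.subspace_scale[OF SK] by (simp add: graded_ideal_def)
          show "homog (mdeg \<mu> + b) (mon \<mu> * hcomp b t)" by (intro homog_mult homog_single homog_hcomp)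
        qed (simp add: \<mu>)
      qed
      then show "t \<in> ?B" using hcomp_outside[OF mul.subspace_span, of t] by blast
    qed
  qed
qed

section \<open>Forms without a common factor\<close>

lemma homog_dvd:
  fixes c F :: "('v::{finite,linorder}, 'k::idom) mpol"
  assumes "c dvd F" "homog n F" "F \<noteq> 0"
  shows "\<exists>e\<le>n. homog e c"
proof -
  obtain G where "F = c * G" using assms(1) by (elim dvdE)
  then obtain a b where "homog a c" "a + b = n" using homog_factors[of n c G] assms(2,3) by blast
  then show ?thesis by (intro exI[of _ a]) simp
qed

lemma homog_0_unit:
  assumes "homog 0 c" "c \<noteq> (0 :: ('v::finite, 'k::field) mpol)"
  shows "c dvd 1"
proof -
  obtain z where z: "c = Cst z" using assms(1) homog_0_iff_Cst by blast
  then have "c * Cst (inverse z) = Cst (z * inverse z)" by (simp add: Cst_mult)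
  also have "\<dots> = 1" using assms(2) z by simp
  finally show ?thesis by (metis dvd_triv_left)
qed

text \<open>With a common divisor of degree \<open>e > 0\<close> the Hilbert function would dominate
  that of a plane curve, which already exceeds \<open>B\<close> in degree
  \<open>B + e\<close>.\<close>

lemma common_divisor_unit:
  fixes F :: "'i::finite \<Rightarrow> (3, 'k::field) mpol"
  assumes F: "\<And>i. homog d (F i)" "F j \<noteq> 0" and B: "\<And>n. hfun (mul.span (range F)) n \<le> B"
    and c: "\<And>i. c dvd F i"
  shows "c dvd 1"
proof -
  have c0: "c \<noteq> 0" using c[of j] F(2) by auto
  obtain e where e: "homog e c" using homog_dvd[OF c[of j] F(1) F(2)] by blast
  have "e = 0"
  proof (rule ccontr)
    assume "e \<noteq> 0"
    have "mul.span (range F) \<subseteq> mul.span {c}"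
      using c by (intro mul.span_minimal mul.subspace_span) (auto simp: in_span_single)
    then have "hfun (mul.span {c}) (B + e) \<le> hfun (mul.span (range F)) (B + e)" by (intro hfun_antimono) blast
    then have "hfun (mul.span {c}) (B + e) \<le> B" using B[of "B + e"] by linarith
    then have "cc (B + e) \<le> B + cc B" using hfun_principal[OF e c0, of B] by linarith
    moreover have "cc (B + 1) \<le> cc (B + e)" using \<open>e \<noteq> 0\<close> by (intro binomial_right_mono) simp_all
    moreover have "2 * int (cc (B + 1)) = 2 * int (cc B) + 2 * (int B + 2)"
      using int_choose_2[of "B + 1"] int_choose_2[of B] by (simp add: algebra_simps)
    moreover have False if "r \<le> B + p" "q \<le> r" "2 * int q = 2 * int p + 2 * (int B + 2)" for p q r
      using that by presburger
    ultimately show False by blast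
  qed
  then show ?thesis using homog_0_unit e c0 by blast
qed

section \<open>Birational maps are not contained in a pencil\<close>

text \<open>Binary forms of degree \<open>n\<close> evaluated at \<open>p\<close> and
  \<open>q\<close>. What matters is that they span at most \<open>n + 1\<close> dimensions, a number
  linear in \<open>n\<close>.\<close>

definition pencil_forms :: "(3, 'k::field) mpol \<Rightarrow> (3, 'k) mpol \<Rightarrow> nat \<Rightarrow> (3, 'k) mpol set"
  where "pencil_forms p q n = mvs.span ((\<lambda>s. p ^ s * q ^ (n - s)) ` {..n})"

lemma pencil_forms_base: "p ^ s * q ^ t \<in> pencil_forms p q (s + t)"
  unfolding pencil_forms_def by (intro mvs.span_base image_eqI[of _ _ s]) simp_all

lemma pencil_forms_mult:
  assumes "x \<in> pencil_forms p q n" "y \<in> pencil_forms p q m"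
  shows "x * y \<in> pencil_forms p q (n + m)"
proof -
  have 1: "p ^ s * q ^ (n - s) * y \<in> pencil_forms p q (n + m)" if "s \<le> n" for s
    using assms(2) unfolding pencil_forms_def[of p q m]
  proof (induction rule: mvs.span_induct_alt)
    case base show ?case by (simp add: pencil_forms_def mvs.span_zero)
  next
    case (step c z y)
    then obtain t where t: "t \<le> m" "z = p ^ t * q ^ (m - t)" by blast
    have "p ^ s * q ^ (n - s) * z = p ^ (s + t) * q ^ (n + m - (s + t))"
    proof -
      have "n + m - (s + t) = (n - s) + (m - t)" using that t(1) by simp
      then show ?thesis unfolding t(2) by (simp add: power_add mult_ac)
    qed
    then have "p ^ s * q ^ (n - s) * z \<in> pencil_forms p q (n + m)"
      using pencil_forms_base[of p "s + t" q "n + m - (s + t)"] that t(1) by simp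
    then have "Cst c * (p ^ s * q ^ (n - s) * z) + p ^ s * q ^ (n - s) * y \<in> pencil_forms p q (n + m)"
      using step(2) unfolding pencil_forms_def by (intro mvs.span_add mvs.span_scale)
    then show ?case by (simp add: distrib_left mult_ac)
  qed
  show ?thesis
    using assms(1) unfolding pencil_forms_def[of p q n]
  proof (induction rule: mvs.span_induct_alt)
    case base show ?case by (simp add: pencil_forms_def mvs.span_zero)
  next
    case (step c z x)
    then have "z * y \<in> pencil_forms p q (n + m)" using 1 by blast
    then have "Cst c * (z * y) + x * y \<in> pencil_forms p q (n + m)"
      using step(2) unfolding pencil_forms_def by (intro mvs.span_add mvs.span_scale)
    then show ?case by (simp add: distrib_right mult.assoc)
  qed
qed

lemma pencil_forms_power: "x \<in> pencil_forms p q n \<Longrightarrow> x ^ k \<in> pencil_forms p q (n * k)"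
proof (induction k)
  case 0 then show ?case using pencil_forms_base[of p 0 q 0] by simp
next
  case (Suc k)
  then show ?case using pencil_forms_mult[of x p q n "x ^ k" "n * k"] by (simp add: algebra_simps)
qed

lemma pencil_forms_prod:
  "finite A \<Longrightarrow> (\<And>i. i \<in> A \<Longrightarrow> x i \<in> pencil_forms p q (n i)) \<Longrightarrow>
    (\<Prod>i\<in>A. x i) \<in> pencil_forms p q (\<Sum>i\<in>A. n i)"
proof (induction A rule: finite_induct)
  case empty then show ?case using pencil_forms_base[of p 0 q 0] by simp
next
  case (insert i A) then show ?case by (simp add: pencil_forms_mult)
qed

text \<open>In a pencil the image would lie on a line, too small for an inverse. The
  \<open>G i\<close> are proportional to the variables and are binary forms in \<open>p\<close> and
  \<open>q\<close>; so \<open>G 0 ^ N\<close> times the forms of degree \<open>N\<close>, of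
  quadratic dimension, would fit into a space of dimension at most \<open>N e + 1\<close>.\<close>

lemma not_in_pencil:
  fixes F :: "'i::finite \<Rightarrow> (3, 'l::field) mpol" and G :: "3 \<Rightarrow> (3, 'l) mpol"
    and a :: "3 \<Rightarrow> ('i, 'k::field) mpol"
  assumes a: "\<And>i. homog e (a i)"
    and G: "\<And>i. G i = mev (\<lambda>c. Cst (\<sigma> c)) F (a i)"
    and inv: "\<And>i j. G i * Var j = G j * Var i" and nz: "\<exists>i. G i \<noteq> 0"
  shows "\<not> (\<exists>p q \<alpha> \<beta>. \<forall>i. F i = Cst (\<alpha> i) * p + Cst (\<beta> i) * q)"
proof
  assume "\<exists>p q \<alpha> \<beta>. \<forall>i. F i = Cst (\<alpha> i) * p + Cst (\<beta> i) * q"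
  then obtain p q \<alpha> \<beta> where F: "\<And>i. F i = Cst (\<alpha> i) * p + Cst (\<beta> i) * q" by blast
  have "F i \<in> pencil_forms p q 1" for i
    using pencil_forms_base[of p 1 q 0] pencil_forms_base[of p 0 q 1] unfolding F pencil_forms_def
    by (intro mvs.span_add mvs.span_scale) simp_all
  then have prodF: "(\<Prod>i\<in>UNIV. F i ^ Poly_Mapping.lookup m i) \<in> pencil_forms p q (mdeg m)" for m
    unfolding mdeg_def using pencil_forms_power[of _ p q 1] by (intro pencil_forms_prod) auto
  have Ge: "G i \<in> pencil_forms p q e" for i
    unfolding G mev_def pencil_forms_def
  proof (rule mvs.span_sum)
    fix m assume "m \<in> Poly_Mapping.keys (a i)"
    then have "mdeg m = e" using a[of i] by (simp add: homog_def)
    then show "Cst (\<sigma> (coef (a i) m)) * (\<Prod>j\<in>UNIV. F j ^ Poly_Mapping.lookup m j)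
        \<in> mvs.span ((\<lambda>s. p ^ s * q ^ (e - s)) ` {..e})"
      using prodF[of m] unfolding pencil_forms_def by (intro mvs.span_scale) simp
  qed
  have G0: "G 0 \<noteq> 0"
  proof
    assume "G 0 = 0"
    then have "G i * Var 0 = 0" for i using inv[of i 0] by simp
    then show False using nz Var_nonzero[of "0 :: 3", where ?'k = 'l] by simp
  qed
  \<comment> \<open>Large enough for the quadratic dimension to win: twice the dimension of the
    forms of degree \<open>N\<close> exceeds \<open>2 (N e + 1)\<close> by
    \<open>8 e + 4\<close>.\<close>
  define N where "N = 2 * e + 1"
  let ?V = "pencil_forms p q (N * e)"
  have mon_in: "G 0 ^ N * mon m \<in> (*) (Var 0 ^ N) ` ?V" if "mdeg m = N" for m
  proof -
    have "G 0 ^ N * mon m = (\<Prod>i\<in>UNIV. (G 0 * Var i) ^ Poly_Mapping.lookup m i)"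
      unfolding mon_prod that[symmetric] mdeg_def by (simp add: power_mult_distrib prod.distrib power_sum)
    also have "\<dots> = (\<Prod>i\<in>UNIV. (G i * Var 0) ^ Poly_Mapping.lookup m i)" using inv[of 0] by simp
    also have "\<dots> = Var 0 ^ N * (\<Prod>i\<in>UNIV. G i ^ Poly_Mapping.lookup m i)"
      unfolding that[symmetric] mdeg_def by (simp add: power_mult_distrib prod.distrib power_sum mult.commute)
    finally have "G 0 ^ N * mon m = Var 0 ^ N * (\<Prod>i\<in>UNIV. G i ^ Poly_Mapping.lookup m i)" .
    moreover have "(\<Prod>i\<in>UNIV. G i ^ Poly_Mapping.lookup m i) \<in> ?V"
    proof -
      have "(\<Prod>i\<in>UNIV. G i ^ Poly_Mapping.lookup m i) \<in> pencil_forms p q (\<Sum>i\<in>UNIV. e * Poly_Mapping.lookup m i)"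
        by (intro pencil_forms_prod pencil_forms_power Ge) simp
      then show ?thesis using that by (simp add: mdeg_def sum_distrib_left[symmetric] mult.commute)
    qed
    ultimately show ?thesis by blast
  qed
  have V_fin: "fin_dim ?V" and V_dim: "mvs.dim ?V \<le> N * e + 1"
  proof -
    let ?B = "(\<lambda>s. p ^ s * q ^ (N * e - s)) ` {..N * e}"
    have "finite ?B" by simp
    then show "fin_dim ?V" unfolding pencil_forms_def fin_dim_def by blast
    have "mvs.dim ?V \<le> card ?B" unfolding pencil_forms_def by (rule mvs.dim_le_card) simp_all
    also have "\<dots> \<le> N * e + 1" using card_image_le[of "{..N * e}" "\<lambda>s. p ^ s * q ^ (N * e - s)"] by simp
    finally show "mvs.dim ?V \<le> N * e + 1" .
  qed
  obtain B where B: "finite B" "?V \<subseteq> mvs.span B" using V_fin unfolding fin_dim_def by blast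
  have lin: "Vector_Spaces.linear mscale mscale ((*) H)" for H :: "(3, 'l) mpol"
    unfolding Vector_Spaces.linear_iff using mvs.vector_space_axioms by (simp add: distrib_left mult.left_commute)
  interpret lin: Vector_Spaces.linear mscale mscale "(*) (Var 0 ^ N :: (3, 'l) mpol)" by (rule lin)
  have sub: "mvs.subspace ((*) (Var 0 ^ N) ` ?V)" by (rule lin.subspace_image) (simp add: pencil_forms_def)
  have fin: "fin_dim ((*) (Var 0 ^ N) ` ?V)"
    using lin.spans_image[OF B(2)] B(1) unfolding fin_dim_def by (meson finite_imageI)
  have "(*) (G 0 ^ N) ` forms N \<subseteq> (*) (Var 0 ^ N) ` ?V"
  proof (rule image_subsetI)
    fix H :: "(3, 'l) mpol" assume H: "H \<in> forms N"
    have "G 0 ^ N * H = (\<Sum>m\<in>Poly_Mapping.keys H. Cst (coef H m) * (G 0 ^ N * mon m))"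
      by (subst mono_decomp[of H]) (simp add: sum_distrib_left mult.left_commute)
    also have "\<dots> \<in> (*) (Var 0 ^ N) ` ?V"
    proof (rule mvs.subspace_sum[OF sub])
      fix m assume "m \<in> Poly_Mapping.keys H"
      then have "mdeg m = N" using H by (simp add: forms_def homog_def)
      then show "Cst (coef H m) * (G 0 ^ N * mon m) \<in> (*) (Var 0 ^ N) ` ?V"
        by (intro mvs.subspace_scale[OF sub] mon_in)
    qed
    finally show "G 0 ^ N * H \<in> (*) (Var 0 ^ N) ` ?V" .
  qed
  then have "mvs.dim ((*) (G 0 ^ N) ` forms N) \<le> mvs.dim ((*) (Var 0 ^ N) ` ?V)"
    by (rule dim_mono_fin_dim[OF fin])
  moreover have nz: "G 0 ^ N \<noteq> 0" "Var 0 ^ N \<noteq> (0 :: (3, 'l) mpol)"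
    using G0 Var_nonzero[of "0 :: 3", where ?'k = 'l] by simp_all
  ultimately have "cc N \<le> mvs.dim ?V"
    unfolding dim_mult_image[OF nz(1)] dim_mult_image[OF nz(2)] dim_forms_3 by simp
  then have "cc N \<le> N * e + 1" using V_dim by (rule order_trans)
  then have "int (cc N) \<le> int (N * e + 1)" unfolding of_nat_le_iff .
  then have "(int N + 2) * (int N + 1) \<le> 2 * (int N * int e + 1)" using int_choose_2[of N] by simp
  moreover have "(int N + 2) * (int N + 1) = 2 * (int N * int e + 1) + (8 * int e + 4)"
    unfolding N_def by (simp add: algebra_simps)
  ultimately show False by simp
qed

section \<open>Local complete intersections in the plane\<close>

lemma fract_add_same: "b \<noteq> 0 \<Longrightarrow> Fract a b + Fract c b = Fract (a + c) (b :: 'a::idom)"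
  by (simp add: eq_fract distrib_right mult.assoc)

lemma fract_mult_cancel:
  "b \<noteq> 0 \<Longrightarrow> d \<noteq> 0 \<Longrightarrow> Fract a b * Fract (c * b) d = Fract (a * c) (d :: 'a::idom)"
  by (simp add: eq_fract mult_ac)

lemma fract_mult_cancel_left: "c \<noteq> 0 \<Longrightarrow> b \<noteq> 0 \<Longrightarrow> Fract (c * a) (c * b) = Fract a (b :: 'a::idom)"
  by (simp add: eq_fract mult_ac)

lemma fract_ring_simps [simp]:
  "carrier (plane_stalk q) = {Fract a b | a b n. homog n a \<and> homog n b \<and> b \<notin> q}"
  "\<one>\<^bsub>plane_stalk q\<^esub> = 1" "\<zero>\<^bsub>plane_stalk q\<^esub> = 0"
  "x \<otimes>\<^bsub>plane_stalk q\<^esub> y = x * y" "x \<oplus>\<^bsub>plane_stalk q\<^esub> y = x + y"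
  by (simp_all add: plane_stalk_def)

context
  fixes q :: "(3, 'k::field) mpol set"
  assumes q: "q \<in> Proj"
begin

lemma nonzero_outside: "b \<notin> q \<Longrightarrow> b \<noteq> 0"
  using mul.subspace_0[OF Proj_subspace[OF q]] by blast

lemma mult_outside: "a \<notin> q \<Longrightarrow> b \<notin> q \<Longrightarrow> a * b \<notin> q"
  using Proj_mult_iff[OF q] by blast

lemma plane_stalk_memI: "homog n a \<Longrightarrow> homog n b \<Longrightarrow> b \<notin> q \<Longrightarrow> Fract a b \<in> carrier (plane_stalk q)"
  by auto

lemma plane_stalk_closed:
  assumes "x \<in> carrier (plane_stalk q)" "y \<in> carrier (plane_stalk q)"
  shows "x + y \<in> carrier (plane_stalk q)" "x * y \<in> carrier (plane_stalk q)" "- x \<in> carrier (plane_stalk q)"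
proof -
  obtain a b n where x: "x = Fract a b" "homog n a" "homog n b" "b \<notin> q" using assms(1) by auto
  obtain c d m where y: "y = Fract c d" "homog m c" "homog m d" "d \<notin> q" using assms(2) by auto
  have "b \<noteq> 0" "d \<noteq> 0" using x y nonzero_outside by auto
  then have e: "x + y = Fract (a * d + c * b) (b * d)" "x * y = Fract (a * c) (b * d)" "- x = Fract (- a) b"
    unfolding x(1) y(1) by simp_all
  show "x + y \<in> carrier (plane_stalk q)" unfolding e
    using x y homog_mult[of n a m d] homog_mult[of m c n b] homog_mult[of n b m d]
    by (intro plane_stalk_memI[of "n + m"] homog_add mult_outside) (simp_all add: add.commute)
  show "x * y \<in> carrier (plane_stalk q)" unfolding e
    using x y homog_mult[of n a m c] homog_mult[of n b m d]
    by (intro plane_stalk_memI[of "n + m"] mult_outside) simp_all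
  show "- x \<in> carrier (plane_stalk q)" unfolding e
    using x by (intro plane_stalk_memI[of n] homog_uminus) simp_all
qed

lemma plane_stalk_1: "1 \<in> carrier (plane_stalk q)" and plane_stalk_0: "0 \<in> carrier (plane_stalk q)"
proof -
  have "Fract 1 1 \<in> carrier (plane_stalk q)" "Fract 0 1 \<in> carrier (plane_stalk q)"
    by (intro plane_stalk_memI[of 0]; simp add: Proj_one[OF q])+
  then show "1 \<in> carrier (plane_stalk q)" "0 \<in> carrier (plane_stalk q)"
    by (simp_all only: One_fract_def Zero_fract_def)
qed

lemma plane_stalk_cring: "cring (plane_stalk q)"
proof (rule cringI)
  show "abelian_group (plane_stalk q)"
  proof (rule abelian_groupI)
    fix x assume x: "x \<in> carrier (plane_stalk q)"
    have "- x \<in> carrier (plane_stalk q)" by (rule plane_stalk_closed(3)[OF x x])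
    then show "\<exists>y\<in>carrier (plane_stalk q). y \<oplus>\<^bsub>plane_stalk q\<^esub> x = \<zero>\<^bsub>plane_stalk q\<^esub>"
      by (intro bexI[of _ "- x"]) (simp_all del: fract_ring_simps(1))
  qed (simp_all del: fract_ring_simps(1) add: plane_stalk_closed plane_stalk_0 add_ac)
  show "comm_monoid (plane_stalk q)"
    by (rule comm_monoidI) (simp_all del: fract_ring_simps(1) add: plane_stalk_closed plane_stalk_1 mult_ac)
qed (simp_all del: fract_ring_simps(1) add: distrib_right)

text \<open>The stalk of \<open>A\<close> at \<open>q\<close>. The multiplier \<open>z\<close> may
  be inhomogeneous, so its degree need not be tracked.\<close>

definition local_ideal :: "(3, 'k) mpol set \<Rightarrow> (3, 'k) mpol fract set"
  where "local_ideal A = {Fract a b | a b n. homog n a \<and> homog n b \<and> b \<notin> q \<and> (\<exists>z. z \<notin> q \<and> z * a \<in> A)}"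

lemma local_ideal_memI:
  assumes "homog n a" "homog n b" "b \<notin> q" "z \<notin> q" "z * a \<in> A"
  shows "Fract a b \<in> local_ideal A"
  unfolding local_ideal_def using assms by blast

lemma local_ideal_is_ideal:
  assumes A: "mul.subspace A"
  shows "ideal (local_ideal A) (plane_stalk q)"
proof -
  interpret R: cring "plane_stalk q" by (rule plane_stalk_cring)
  have sub: "local_ideal A \<subseteq> carrier (plane_stalk q)" by (auto simp: local_ideal_def)
  have add: "x + y \<in> local_ideal A" if xy: "x \<in> local_ideal A" "y \<in> local_ideal A" for x y
  proof -
    obtain a b n z where x: "x = Fract a b" "homog n a" "homog n b" "b \<notin> q" "z \<notin> q" "z * a \<in> A"
      using xy(1) unfolding local_ideal_def by blast
    obtain c d m z' where y: "y = Fract c d" "homog m c" "homog m d" "d \<notin> q" "z' \<notin> q" "z' * c \<in> A"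
      using xy(2) unfolding local_ideal_def by blast
    have "b \<noteq> 0" "d \<noteq> 0" using x y nonzero_outside by auto
    then have "x + y = Fract (a * d + c * b) (b * d)" unfolding x(1) y(1) by simp
    moreover have "homog (n + m) (a * d + c * b)" "homog (n + m) (b * d)"
      using x y homog_mult[of n a m d] homog_mult[of m c n b] homog_mult[of n b m d]
      by (simp_all add: homog_add add.commute)
    moreover have "(z * z') * (a * d + c * b) = (z' * d) * (z * a) + (z * b) * (z' * c)" by (simp add: algebra_simps)
    then have "(z * z') * (a * d + c * b) \<in> A"
      using mul.subspace_add[OF A mul.subspace_scale[OF A x(6)] mul.subspace_scale[OF A y(6)]] by simp
    ultimately show ?thesis
      using local_ideal_memI[OF _ _ mult_outside[OF x(4) y(4)] mult_outside[OF x(5) y(5)]] by simp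
  qed
  have mult: "r * x \<in> local_ideal A" if rx: "r \<in> carrier (plane_stalk q)" "x \<in> local_ideal A" for r x
  proof -
    obtain a b n z where x: "x = Fract a b" "homog n a" "homog n b" "b \<notin> q" "z \<notin> q" "z * a \<in> A"
      using rx(2) unfolding local_ideal_def by blast
    obtain c d m where r: "r = Fract c d" "homog m c" "homog m d" "d \<notin> q" using rx(1) by auto
    have "r * x = Fract (c * a) (d * b)" unfolding x(1) r(1) by simp
    moreover have "homog (m + n) (c * a)" "homog (m + n) (d * b)" using x r homog_mult by blast+
    moreover have "z * (c * a) \<in> A" using mul.subspace_scale[OF A x(6), of c] by (simp add: mult.left_commute)
    ultimately show ?thesis
      using local_ideal_memI[OF _ _ mult_outside[OF r(4) x(4)] x(5)] by simp
  qed
  have zero: "0 \<in> local_ideal A"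
  proof -
    have "Fract 0 1 \<in> local_ideal A"
      using mul.subspace_0[OF A] Proj_one[OF q] by (intro local_ideal_memI[of 0 _ _ 1]) simp_all
    then show ?thesis by (simp only: Zero_fract_def)
  qed
  have neg: "- x \<in> local_ideal A" if "x \<in> local_ideal A" for x
    using mult[OF plane_stalk_closed(3)[OF plane_stalk_1 plane_stalk_1] that] by simp
  show ?thesis
  proof (rule idealI)
    show "ring (plane_stalk q)" by (rule R.ring_axioms)
    show "subgroup (local_ideal A) (add_monoid (plane_stalk q))"
    proof (rule group.subgroupI)
      show "Group.group (add_monoid (plane_stalk q))" by (rule R.add.group_axioms)
      show "local_ideal A \<noteq> {}" using zero by blast
      fix x assume x: "x \<in> local_ideal A"
      have xc: "x \<in> carrier (plane_stalk q)" using x sub by blast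
      have "\<ominus>\<^bsub>plane_stalk q\<^esub> x = - x"
        by (rule R.minus_equality) (use xc plane_stalk_closed(3)[OF xc xc] in \<open>simp_all del: fract_ring_simps(1)\<close>)
      then show "inv\<^bsub>add_monoid (plane_stalk q)\<^esub> x \<in> local_ideal A"
        using neg[OF x] by (simp add: a_inv_def)
    qed (use sub add in \<open>auto simp del: fract_ring_simps(1)\<close>)
    fix a x assume "a \<in> local_ideal A" "x \<in> carrier (plane_stalk q)"
    then show "x \<otimes>\<^bsub>plane_stalk q\<^esub> a \<in> local_ideal A" "a \<otimes>\<^bsub>plane_stalk q\<^esub> x \<in> local_ideal A"
      using mult[of x a] by (simp_all only: fract_ring_simps mult.commute[of a x])
  qed
qed

lemma genideal_subset_local_ideal:
  assumes "mul.subspace A" "E \<subseteq> local_ideal A"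
  shows "Idl\<^bsub>plane_stalk q\<^esub> E \<subseteq> local_ideal A"
  using local_ideal_is_ideal[OF assms(1)] assms(2) unfolding genideal_def by blast

lemma local_idealD:
  assumes "Fract a b \<in> local_ideal A" "b \<notin> q" "mul.subspace A"
  shows "\<exists>z. z \<notin> q \<and> z * a \<in> A"
proof -
  obtain a' b' z where a': "Fract a b = Fract a' b'" "b' \<notin> q" "z \<notin> q" "z * a' \<in> A"
    using assms(1) unfolding local_ideal_def by blast
  have "a * b' = a' * b" using a'(1,2) assms(2) nonzero_outside by (simp add: eq_fract)
  have "(z * b') * a = z * (a * b')" by (simp only: mult_ac)
  also have "\<dots> = b * (z * a')" unfolding \<open>a * b' = a' * b\<close> by (simp only: mult_ac)
  finally have "(z * b') * a = b * (z * a')" .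
  have "(z * b') * a \<in> A"
    unfolding \<open>(z * b') * a = b * (z * a')\<close> by (rule mul.subspace_scale[OF assms(3) a'(4)])
  then show ?thesis using mult_outside[OF a'(3,2)] by blast
qed

lemma local_idealI:
  assumes "homog n a" "homog n b" "b \<notin> q" "a \<in> A"
  shows "Fract a b \<in> local_ideal A"
  using assms Proj_one[OF q] by (intro local_ideal_memI[of n _ _ 1]) simp_all

lemma genideal_mult:
  assumes "r \<in> E" "E \<subseteq> carrier (plane_stalk q)" "y \<in> carrier (plane_stalk q)"
  shows "r * y \<in> Idl\<^bsub>plane_stalk q\<^esub> E"
proof -
  interpret R: cring "plane_stalk q" by (rule plane_stalk_cring)
  have "r \<in> Idl\<^bsub>plane_stalk q\<^esub> E" using R.genideal_self[OF assms(2)] assms(1) by blast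
  then show ?thesis using ideal.I_r_closed[OF R.genideal_ideal[OF assms(2)] _ assms(3)] by simp
qed

text \<open>The plane has dimension two. For three regular elements, the numerators of the first two
  are coprime up to a factor outside \<open>q\<close>, so they have finitely many common zeros. Near
  \<open>q\<close> a power of the third numerator lies in their ideal, and regularity of the third
  element strips this power down to 1.\<close>

lemma regular_seq_length:
  assumes reg: "regular_seq (plane_stalk q) rs"
    and gen: "\<And>r. r \<in> set rs \<Longrightarrow> \<exists>a b n. r = Fract a b \<and> a \<in> q \<and> homog n a \<and> homog n b \<and> b \<notin> q"
  shows "length rs \<le> 2"
proof (rule ccontr)
  assume "\<not> length rs \<le> 2"
  then have len: "length rs > 2" by simp
  let ?O = "plane_stalk q"
  interpret R: cring ?O by (rule plane_stalk_cring)
  define r0 where "r0 = rs ! 0"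
  define r1 where "r1 = rs ! 1"
  define r2 where "r2 = rs ! 2"
  have l: "0 < length rs" "1 < length rs" "2 < length rs" using len by auto
  have mem: "r0 \<in> set rs" "r1 \<in> set rs" "r2 \<in> set rs"
    unfolding r0_def r1_def r2_def using nth_mem[OF l(1)] nth_mem[OF l(2)] nth_mem[OF l(3)] by blast+
  have take: "set (take 0 rs) = {}" "set (take 1 rs) = {r0}" "set (take 2 rs) = {r0, r1}"
    using l take_Suc_conv_app_nth[of 0 rs] take_Suc_conv_app_nth[of 1 rs] unfolding r0_def r1_def
    by (simp_all add: numeral_2_eq_2)
  have carr: "set rs \<subseteq> carrier ?O" and proper: "Idl\<^bsub>?O\<^esub> (set rs) \<noteq> carrier ?O"
    and step: "\<And>i x. i < length rs \<Longrightarrow> x \<in> carrier ?O \<Longrightarrow> rs ! i * x \<in> Idl\<^bsub>?O\<^esub> (set (take i rs)) \<Longrightarrow> x \<in> Idl\<^bsub>?O\<^esub> (set (take i rs))"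
    using reg unfolding regular_seq_def fract_ring_simps(4) by blast+
  have one: "1 \<notin> Idl\<^bsub>?O\<^esub> E" if "E \<subseteq> set rs" for E
  proof
    assume "1 \<in> Idl\<^bsub>?O\<^esub> E"
    moreover have "Idl\<^bsub>?O\<^esub> E \<subseteq> Idl\<^bsub>?O\<^esub> (set rs)"
      using that carr R.genideal_self[OF carr] R.genideal_ideal[OF carr] by (intro R.genideal_minimal) auto
    ultimately have "\<one>\<^bsub>?O\<^esub> \<in> Idl\<^bsub>?O\<^esub> (set rs)" by auto
    then show False using ideal.one_imp_carrier[OF R.genideal_ideal[OF carr]] proper by blast
  qed
  have reg0: "x \<in> Idl\<^bsub>?O\<^esub> {}" if "x \<in> carrier ?O" "r0 * x \<in> Idl\<^bsub>?O\<^esub> {}" for x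
    using step[OF l(1) that(1)] that(2) unfolding take r0_def[symmetric] by blast
  have reg1: "x \<in> Idl\<^bsub>?O\<^esub> {r0}" if "x \<in> carrier ?O" "r1 * x \<in> Idl\<^bsub>?O\<^esub> {r0}" for x
    using step[OF l(2) that(1)] that(2) unfolding take r1_def[symmetric] by blast
  have reg2: "x \<in> Idl\<^bsub>?O\<^esub> {r0, r1}" if "x \<in> carrier ?O" "r2 * x \<in> Idl\<^bsub>?O\<^esub> {r0, r1}" for x
    using step[OF l(3) that(1)] that(2) unfolding take r2_def[symmetric] by blast
  obtain F0 b0 n0 where r0: "r0 = Fract F0 b0" "F0 \<in> q" "homog n0 F0" "homog n0 b0" "b0 \<notin> q" using gen[OF mem(1)] by blast
  obtain F1 b1 n1 where r1: "r1 = Fract F1 b1" "F1 \<in> q" "homog n1 F1" "homog n1 b1" "b1 \<notin> q" using gen[OF mem(2)] by blast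
  obtain F2 b2 n2 where r2: "r2 = Fract F2 b2" "F2 \<in> q" "homog n2 F2" "homog n2 b2" "b2 \<notin> q" using gen[OF mem(3)] by blast
  have zero: "0 \<in> Idl\<^bsub>?O\<^esub> E" if "E \<subseteq> set rs" for E
    using additive_subgroup.zero_closed[OF ideal.axioms(1)[OF R.genideal_ideal]] that carr by fastforce
  have F0: "F0 \<noteq> 0"
  proof
    assume "F0 = 0"
    then have "r0 * 1 \<in> Idl\<^bsub>?O\<^esub> {}" using zero[of "{}"] r0(1) by (simp add: Zero_fract_def[symmetric] fract_collapse)
    then show False using reg0[OF plane_stalk_1] one[of "{}"] by blast
  qed
  have F1: "F1 \<noteq> 0"
  proof
    assume "F1 = 0"
    then have "r1 * 1 \<in> Idl\<^bsub>?O\<^esub> {r0}" using zero[of "{r0}"] r1(1) mem by (simp add: Zero_fract_def[symmetric] fract_collapse)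
    then show False using reg1[OF plane_stalk_1] one[of "{r0}"] mem by blast
  qed
  obtain g F0' F1' where g: "F0 = g * F0'" "F1 = g * F1'" "rel_prime F0' F1'"
    using gcd_factorisation[of F0 F1] F0 by blast
  obtain \<gamma> k0 where h0: "homog \<gamma> g" "homog k0 F0'" "\<gamma> + k0 = n0" using homog_factors[of n0 g F0'] r0(3) F0 g by auto
  obtain \<gamma>' k1 where h1: "homog \<gamma>' g" "homog k1 F1'" "\<gamma>' + k1 = n1" using homog_factors[of n1 g F1'] r1(3) F1 g by auto
  have nz: "g \<noteq> 0" "F0' \<noteq> 0" "F1' \<noteq> 0" using F0 F1 g by auto
  have \<gamma>: "\<gamma>' = \<gamma>" using homog_unique[OF h1(1) h0(1) nz(1)] .
  obtain j where j: "Var j \<notin> q" using q by (auto simp: Proj_iff)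
  \<comment> \<open>\<open>r1\<close> sends the element with numerator \<open>F0'\<close> into
    \<open>(r0)\<close>, so regularity puts that element itself into \<open>(r0)\<close>; cancelling
    \<open>F0'\<close> shows that \<open>g\<close> divides something outside
    \<open>q\<close>.\<close>
  have gq: "g \<notin> q"
  proof
    assume gq: "g \<in> q"
    let ?s = "(Var j :: (3, 'k) mpol) ^ k0"
    have s: "?s \<notin> q" "homog k0 ?s" using j Proj_power_iff[OF q] homog_power[OF homog_Var[of j], of k0] by auto
    define y where "y = Fract (F1' * b0) (b1 * ?s)"
    have deg: "k1 + n0 = n1 + k0" using h0(3) h1(3) \<gamma> by simp
    have y: "y \<in> carrier ?O"
      unfolding y_def using homog_mult[OF h1(2) r0(4)] homog_mult[OF r1(4) s(2)] unfolding deg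
      by (intro plane_stalk_memI[of "n1 + k0"] mult_outside r1(5) s(1))
    have bs: "b1 * ?s \<noteq> 0" by (intro nonzero_outside mult_outside r1(5) s(1))
    have "r0 * y = Fract (F0 * F1') (b1 * ?s)"
      unfolding r0(1) y_def by (rule fract_mult_cancel[OF nonzero_outside[OF r0(5)] bs])
    moreover have "F1 * F0' = F0 * F1'" unfolding g(1,2) by (simp only: mult_ac)
    then have "r1 * Fract F0' ?s = Fract (F0 * F1') (b1 * ?s)" unfolding r1(1) mult_fract by (simp only:)
    ultimately have r1y: "r1 * Fract F0' ?s = r0 * y" by (rule trans[OF _ sym, rotated])
    have c0: "{r0} \<subseteq> carrier ?O" using mem(1) carr by blast
    have "r1 * Fract F0' ?s \<in> Idl\<^bsub>?O\<^esub> {r0}" unfolding r1y by (rule genideal_mult[OF singletonI c0 y])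
    then have "Fract F0' ?s \<in> Idl\<^bsub>?O\<^esub> {r0}" by (rule reg1[OF plane_stalk_memI[OF h0(2) s(2) s(1)]])
    moreover have "r0 \<in> local_ideal (mul.span {F0})"
      unfolding r0(1) by (rule local_idealI[OF r0(3-5)]) (simp add: mul.span_base)
    ultimately have "Fract F0' ?s \<in> local_ideal (mul.span {F0})"
      using genideal_subset_local_ideal[OF mul.subspace_span, of "{r0}" "{F0}"] by blast
    then obtain z where z: "z \<notin> q" "z * F0' \<in> mul.span {F0}"
      using local_idealD[OF _ s(1) mul.subspace_span] by blast
    then obtain y' where "z * F0' = F0 * y'" by (auto simp: in_span_single dvd_def)
    then have "F0' * z = F0' * (g * y')" unfolding g(1) by (simp only: mult_ac)
    then have "z = g * y'" using nz(2) by simp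
    then show False using z(1) gq Proj_mult_iff[OF q] by blast
  qed
  have F'q: "F0' \<in> q" "F1' \<in> q" using r0(2) r1(2) gq unfolding g Proj_mult_iff[OF q] by auto
  let ?E = "mul.span {F0', F1'}"
  have bd: "hfun ?E n \<le> k0 * k1 + cc (k0 + k1)" for n
    by (rule hfun_pair_bounded[OF h0(2) nz(2) h1(2) nz(3) g(3)])
  have fin: "finite {p \<in> Proj. ?E \<subseteq> p}" by (rule Vplus_finite_if_hfun_bounded[OF bd])
  have "\<exists>x n. homog n x \<and> x \<notin> q \<and> (\<forall>p\<in>{p \<in> Proj. ?E \<subseteq> p} - {q}. x \<in> p)"
  proof (rule homogeneous_product_outside[OF _ q])
    fix p assume p: "p \<in> {p \<in> Proj. ?E \<subseteq> p} - {q}"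
    have "hfun p n \<le> k0 * k1 + cc (k0 + k1)" for n
      using order_trans[OF hfun_antimono bd[of n]] p by blast
    then have "\<not> p \<subseteq> q" using Proj_incomparable_if_hfun_bounded[OF _ q] p by blast
    then show "graded_ideal p \<and> \<not> p \<subseteq> q" using p Proj_graded by blast
  qed (use fin in simp)
  then obtain x n where x: "homog n x" "x \<notin> q" "\<And>p. p \<in> Proj \<Longrightarrow> ?E \<subseteq> p \<Longrightarrow> p \<noteq> q \<Longrightarrow> x \<in> p" by blast
  \<comment> \<open>\<open>x\<close> vanishes at all common zeros other than \<open>q\<close>, and
    \<open>F2\<close> vanishes at \<open>q\<close>. The factor \<open>Var j\<close>, which is
    outside \<open>q\<close>, secures a positive degree for the Nullstellensatz.\<close>
  let ?y = "Var j * x * F2"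
  have hy: "homog (Suc n + n2) ?y" using homog_mult[OF homog_mult[OF homog_Var x(1)] r2(3)] by simp
  have "\<exists>N. ?y ^ N \<in> ?E"
  proof (rule graded_nullstellensatz[OF graded_span_pair[OF h0(2) h1(2)] hy])
    fix p assume "p \<in> Proj" "?E \<subseteq> p"
    then show "?y \<in> p" using x(3)[of p] r2(2) Proj_mult_iff[of p] by blast
  qed simp
  then obtain N where N: "?y ^ N \<in> ?E" ..
  define \<zeta> where "\<zeta> = g * (Var j * x) ^ N"
  define D where "D = \<gamma> + Suc n * N + n2 * N"
  have \<zeta>q: "\<zeta> \<notin> q" unfolding \<zeta>_def using gq j x(2) Proj_power_iff[OF q] Proj_mult_iff[OF q] by blast
  have h\<zeta>: "homog (\<gamma> + Suc n * N) \<zeta>"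
    unfolding \<zeta>_def using homog_mult[OF h0(1) homog_power[OF homog_mult[OF homog_Var x(1)], of N]] by simp
  obtain \<alpha> \<beta> where "?y ^ N = \<alpha> * F0' + \<beta> * F1'" using N unfolding in_span_pair by blast
  have "\<zeta> * F2 ^ N = g * ?y ^ N" unfolding \<zeta>_def by (simp only: power_mult_distrib mult_ac)
  also have "\<dots> = F0 * \<alpha> + F1 * \<beta>"
    unfolding \<open>?y ^ N = \<alpha> * F0' + \<beta> * F1'\<close> g(1,2) by (simp only: distrib_left mult_ac)
  finally have ab: "\<zeta> * F2 ^ N = F0 * \<alpha> + F1 * \<beta>" .
  \<comment> \<open>Cuts the multipliers down to the degrees that contribute to degree
    \<open>D\<close>, so that they define elements of the stalk. The guard covers a generator whose
    degree exceeds \<open>D\<close>.\<close>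
  define \<alpha>' where "\<alpha>' = (if n0 \<le> D then hcomp (D - n0) \<alpha> else 0)"
  define \<beta>' where "\<beta>' = (if n1 \<le> D then hcomp (D - n1) \<beta> else 0)"
  have hD: "homog D (\<zeta> * F2 ^ N)"
    unfolding D_def using homog_mult[OF h\<zeta> homog_power[OF r2(3), of N]] by simp
  have ab': "\<zeta> * F2 ^ N = F0 * \<alpha>' + F1 * \<beta>'"
  proof -
    have "\<zeta> * F2 ^ N = hcomp D (\<zeta> * F2 ^ N)" using hcomp_homog[OF hD, of D] by simp
    also have "\<dots> = F0 * \<alpha>' + F1 * \<beta>'"
      unfolding ab hcomp_add hcomp_homog_mult[OF r0(3)] hcomp_homog_mult[OF r1(3)] \<alpha>'_def \<beta>'_def by simp
    finally show ?thesis .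
  qed
  have h': "homog D (\<alpha>' * b0)" "homog D (\<beta>' * b1)"
    unfolding \<alpha>'_def \<beta>'_def using homog_mult[OF homog_hcomp r0(4), of "D - n0" \<alpha>] homog_mult[OF homog_hcomp r1(4), of "D - n1" \<beta>]
    by auto
  let ?b = "\<zeta> * b2 ^ N"
  have b: "?b \<notin> q" using \<zeta>q r2(5) Proj_power_iff[OF q] Proj_mult_iff[OF q] by blast
  have hb: "homog D ?b" unfolding D_def using homog_mult[OF h\<zeta> homog_power[OF r2(4), of N]] by simp
  have pw: "r2 ^ n = Fract (F2 ^ n) (b2 ^ n)" for n
    unfolding r2(1) by (induction n) (simp_all add: One_fract_def)
  have "r2 ^ N = Fract (\<zeta> * F2 ^ N) ?b"
    unfolding pw
    by (rule fract_mult_cancel_left[symmetric, OF nonzero_outside[OF \<zeta>q]])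
      (simp add: nonzero_outside[OF r2(5)])
  also have "\<dots> = r0 * Fract (\<alpha>' * b0) ?b + r1 * Fract (\<beta>' * b1) ?b"
    unfolding ab' r0(1) r1(1) fract_mult_cancel[OF nonzero_outside[OF r0(5)] nonzero_outside[OF b]]
      fract_mult_cancel[OF nonzero_outside[OF r1(5)] nonzero_outside[OF b]]
    by (rule fract_add_same[symmetric, OF nonzero_outside[OF b]])
  finally have eq: "r2 ^ N = r0 * Fract (\<alpha>' * b0) ?b + r1 * Fract (\<beta>' * b1) ?b" .
  have c01: "{r0, r1} \<subseteq> carrier ?O" using mem carr by blast
  have "r2 ^ N \<in> Idl\<^bsub>?O\<^esub> {r0, r1}"
    unfolding eq
    using additive_subgroup.a_closed[OF ideal.axioms(1)[OF R.genideal_ideal[OF c01]]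
        genideal_mult[OF _ c01 plane_stalk_memI[OF h'(1) hb b], of r0]
        genideal_mult[OF _ c01 plane_stalk_memI[OF h'(2) hb b], of r1]]
    by simp
  then have "1 \<in> Idl\<^bsub>?O\<^esub> {r0, r1}"
  proof (induction N)
    case 0 then show ?case by simp
  next
    case (Suc N)
    have "b2 ^ N \<notin> q" using r2(5) Proj_power_iff[OF q] by blast
    then have "Fract (F2 ^ N) (b2 ^ N) \<in> carrier ?O"
      by (rule plane_stalk_memI[OF homog_power[OF r2(3), of N] homog_power[OF r2(4), of N]])
    then have car: "r2 ^ N \<in> carrier ?O" by (rule pw[of N, THEN ssubst])
    have "r2 ^ N \<in> Idl\<^bsub>?O\<^esub> {r0, r1}" using Suc.prems unfolding power_Suc by (rule reg2[OF car])
    then show ?case by (rule Suc.IH)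
  qed
  then show False using one[of "{r0, r1}"] mem by blast
qed

end

text \<open>A regular sequence in the stalk has at most two members, and shorter ones are padded.
  \<open>z\<close> is the product of the multipliers that bring the four forms into the ideal of the
  two numerators.\<close>

lemma locally_ci_two_generators:
  fixes f :: "4 \<Rightarrow> (3, 'k::field) mpol"
  assumes ci: "locally_ci (fideal f)" and f: "\<And>i. homog d (f i)" and q: "q \<in> Proj" "\<And>i. f i \<in> q"
  shows "\<exists>F1 F2 z. F1 \<in> mul.span (range f) \<and> F2 \<in> mul.span (range f) \<and> z \<notin> q \<and> (\<forall>i. z * f i \<in> mul.span {F1, F2})"
proof -
  let ?I = "mul.span (range f)"
  have I: "fideal f = ?I" by (simp add: fideal_def genideal_class_ring)
  have Iq: "?I \<subseteq> q" using q(2) by (intro mul.span_minimal Proj_subspace[OF q(1)]) auto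
  then obtain rs where rs: "regular_seq (plane_stalk q) rs" "Idl\<^bsub>plane_stalk q\<^esub> (set rs) = ideal_stalk ?I q"
    using ci q(1) unfolding locally_ci_def I Vplus_def by blast
  interpret R: cring "plane_stalk q" by (rule plane_stalk_cring[OF q(1)])
  have "set rs \<subseteq> ideal_stalk ?I q"
    using R.genideal_self[of "set rs"] rs unfolding regular_seq_def by blast
  then have num: "\<exists>a b n. r = Fract a b \<and> a \<in> ?I \<and> homog n a \<and> homog n b \<and> b \<notin> q" if "r \<in> set rs" for r
    using that unfolding ideal_stalk_def by blast
  have len: "length rs \<le> 2"
  proof (rule regular_seq_length[OF q(1) rs(1)])
    fix r assume "r \<in> set rs"
    then show "\<exists>a b n. r = Fract a b \<and> a \<in> q \<and> homog n a \<and> homog n b \<and> b \<notin> q"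
      using num[of r] Iq by blast
  qed
  have "\<exists>F1 F2. F1 \<in> ?I \<and> F2 \<in> ?I \<and> set rs \<subseteq> local_ideal q (mul.span {F1, F2})"
  proof -
    have loc: "r \<in> local_ideal q (mul.span {F1, F2})"
      if "r = Fract a b" "homog n a" "homog n b" "b \<notin> q" "a = F1 \<or> a = F2" for r a b n F1 F2
      unfolding that(1) by (rule local_idealI[OF q(1) that(2-4)]) (use that(5) in \<open>auto intro: mul.span_base\<close>)
    consider "rs = []" | r where "rs = [r]" | r r' where "rs = [r, r']"
      using len by (cases rs; cases "tl rs"; cases "tl (tl rs)") auto
    then show ?thesis
    proof cases
      case 1
      then show ?thesis using mul.span_zero[of "range f"] by auto
    next
      case (2 r)
      then obtain a b n where a: "r = Fract a b" "a \<in> ?I" "homog n a" "homog n b" "b \<notin> q" using num[of r] by auto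
      then have "set rs \<subseteq> local_ideal q (mul.span {a, a})" using 2 loc[OF a(1,3-5), of a a] by simp
      then show ?thesis using a(2) by blast
    next
      case (3 r r')
      obtain a b n where "r = Fract a b" "a \<in> ?I" "homog n a" "homog n b" "b \<notin> q" using num[of r] 3 by auto
      moreover obtain a' b' n' where "r' = Fract a' b'" "a' \<in> ?I" "homog n' a'" "homog n' b'" "b' \<notin> q" using num[of r'] 3 by auto
      ultimately show ?thesis using 3 loc by (intro exI[of _ a] exI[of _ a']) auto
    qed
  qed
  then obtain F1 F2 where F: "F1 \<in> ?I" "F2 \<in> ?I" "set rs \<subseteq> local_ideal q (mul.span {F1, F2})" by blast
  have sub: "ideal_stalk ?I q \<subseteq> local_ideal q (mul.span {F1, F2})"
    using genideal_subset_local_ideal[OF q(1) mul.subspace_span F(3)] rs(2) by simp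
  obtain j where j: "Var j \<notin> q" using q(1) by (auto simp: Proj_iff)
  have "\<exists>z. z \<notin> q \<and> z * f i \<in> mul.span {F1, F2}" for i
  proof (rule local_idealD[OF q(1) _ _ mul.subspace_span])
    show s: "Var j ^ d \<notin> q" using j Proj_power_iff[OF q(1)] by blast
    have "Fract (f i) (Var j ^ d) \<in> ideal_stalk ?I q"
      unfolding ideal_stalk_def using f[of i] homog_power[OF homog_Var[of j], of d] s mul.span_base[of "f i" "range f"] by fastforce
    then show "Fract (f i) (Var j ^ d) \<in> local_ideal q (mul.span {F1, F2})" using sub by blast
  qed
  then obtain z where z: "\<And>i. z i \<notin> q" "\<And>i. z i * f i \<in> mul.span {F1, F2}" by metis
  have "(\<Prod>i\<in>UNIV. z i) \<notin> q" using z(1) Proj_prod_iff[OF q(1), of UNIV z] by simp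
  moreover have "(\<Prod>i\<in>UNIV. z i) * f i \<in> mul.span {F1, F2}" for i
  proof -
    have "(\<Prod>i\<in>UNIV. z i) = (\<Prod>k\<in>UNIV - {i}. z k) * z i"
      by (subst prod.remove[of _ i]) (simp_all only: finite UNIV_I mult.commute)
    then have "(\<Prod>i\<in>UNIV. z i) * f i = (\<Prod>k\<in>UNIV - {i}. z k) * (z i * f i)" by (simp only: mult.assoc)
    then show ?thesis using mul.span_scale[OF z(2)] by (simp only:)
  qed
  ultimately show ?thesis using F(1,2) by blast
qed

section \<open>Linearly dependent forms\<close>

text \<open>Nakayama's lemma for three generators where two suffice. If none of \<open>u\<close>,
  \<open>v\<close>, \<open>w\<close> were redundant at \<open>q\<close>, all coefficients in
  relations among them would lie in \<open>q\<close>. The matrix that expresses \<open>Z u\<close>,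
  \<open>Z v\<close>, \<open>Z w\<close> through \<open>u\<close>, \<open>v\<close>,
  \<open>w\<close> would then have diagonal outside \<open>q\<close> and vanish above it modulo
  \<open>q\<close>; but it factors through two elements, so its determinant is zero.\<close>

lemma redundant_generator:
  fixes q :: "'a::comm_ring_1 set"
  assumes q: "mul.subspace q" "\<And>a b. a * b \<in> q \<Longrightarrow> a \<in> q \<or> b \<in> q" and Z: "Z \<notin> q"
    and Zu: "Z * u \<in> mul.span {A, B}" "Z * v \<in> mul.span {A, B}" "Z * w \<in> mul.span {A, B}"
    and AB: "A = a1 * u + a2 * v + a3 * w" "B = b1 * u + b2 * v + b3 * w"
  shows "\<exists>z. z \<notin> q \<and> (z * w \<in> mul.span {u, v} \<or> z * v \<in> mul.span {u, w} \<or> z * u \<in> mul.span {v, w})"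
proof (rule ccontr)
  assume contr: "\<not> ?thesis"
  obtain x1 y1 x2 y2 x3 y3 where xy: "Z * u = x1 * A + y1 * B" "Z * v = x2 * A + y2 * B" "Z * w = x3 * A + y3 * B"
    using Zu unfolding in_span_pair by blast
  have u: "z \<in> q" if "z * u = s * v + t * w" for z s t
    using contr that unfolding in_span_pair by blast
  have v: "z \<in> q" if "z * v = s * u + t * w" for z s t
    using contr that unfolding in_span_pair by blast
  have w: "z \<in> q" if "z * w = s * u + t * v" for z s t
    using contr that unfolding in_span_pair by blast
  define p11 p12 p13 where "p11 = x1 * a1 + y1 * b1" "p12 = x1 * a2 + y1 * b2" "p13 = x1 * a3 + y1 * b3"
  define p21 p22 p23 where "p21 = x2 * a1 + y2 * b1" "p22 = x2 * a2 + y2 * b2" "p23 = x2 * a3 + y2 * b3"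
  define p31 p32 p33 where "p31 = x3 * a1 + y3 * b1" "p32 = x3 * a2 + y3 * b2" "p33 = x3 * a3 + y3 * b3"
  note defs = p11_p12_p13_def p21_p22_p23_def p31_p32_p33_def
  have e1: "Z * u = p11 * u + p12 * v + p13 * w" unfolding xy AB defs by (simp add: algebra_simps)
  have e2: "Z * v = p21 * u + p22 * v + p23 * w" unfolding xy AB defs by (simp add: algebra_simps)
  have e3: "Z * w = p31 * u + p32 * v + p33 * w" unfolding xy AB defs by (simp add: algebra_simps)
  have n11: "Z - p11 \<in> q" using e1 by (intro u[of _ p12 p13]) (simp add: algebra_simps)
  have n12: "p12 \<in> q" using e1 by (intro v[of _ "Z - p11" "- p13"]) (simp add: algebra_simps)
  have n13: "p13 \<in> q" using e1 by (intro w[of _ "Z - p11" "- p12"]) (simp add: algebra_simps)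
  have n22: "Z - p22 \<in> q" using e2 by (intro v[of _ p21 p23]) (simp add: algebra_simps)
  have n23: "p23 \<in> q" using e2 by (intro w[of _ "- p21" "Z - p22"]) (simp add: algebra_simps)
  have n33: "Z - p33 \<in> q" using e3 by (intro w[of _ p31 p32]) (simp add: algebra_simps)
  have out: "p \<notin> q" if "Z - p \<in> q" for p
    using mul.subspace_add[OF q(1) that, of p] Z by auto
  \<comment> \<open>The vanishing determinant solved for the diagonal term; every other term
    contains an entry above the diagonal.\<close>
  have "p11 * (p22 * p33) = p23 * (p11 * p32) + p12 * (p21 * p33) - p12 * (p23 * p31) - p13 * (p21 * p32) + p13 * (p22 * p31)"
    unfolding defs by (simp add: algebra_simps)
  also have "\<dots> \<in> q"
    by (intro mul.subspace_add[OF q(1)] mul.subspace_diff[OF q(1)] mul_scale[OF q(1)] n12 n13 n23)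
  finally show False using q(2) out[OF n11] out[OF n22] out[OF n33] by blast
qed

text \<open>Once \<open>z\<close> is inverted, \<open>y\<close> is congruent to \<open>c w^e\<close>
  modulo \<open>u\<close> and \<open>\<beta> w^e\<close>. The error term keeps the factor
  \<open>w^e\<close>: congruences for different exponents can be multiplied, and \<open>w^e\<close>
  can later be divided out modulo \<open>u\<close>.\<close>

definition power_cong :: "'a::comm_ring_1 \<Rightarrow> 'a \<Rightarrow> 'a \<Rightarrow> 'a \<Rightarrow> nat \<Rightarrow> 'a \<Rightarrow> 'a \<Rightarrow> bool"
  where "power_cong u \<beta> w z e y c \<longleftrightarrow> (\<exists>x s. z ^ e * y = z ^ e * c * w ^ e + u * x + \<beta> * w ^ e * s)"

lemma power_cong_product:
  fixes u :: "'a::comm_ring_1"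
  assumes "Z * y = Z * c * W + u * x + \<beta> * W * s" "Z' * y' = Z' * c' * W' + u * x' + \<beta> * W' * s'"
  shows "(Z * Z') * (y * y') = (Z * Z') * (c * c') * (W * W') + u * (x * (Z' * y') + Z * c * W * x' + \<beta> * W * s * x') +
    \<beta> * (W * W') * (Z * c * s' + s * (Z' * c' + \<beta> * s'))"
proof -
  have "(Z * Z') * (y * y') = (Z * y) * (Z' * y')" by (simp only: mult_ac)
  also have "\<dots> = Z * c * W * (Z' * y') + u * x * (Z' * y') + \<beta> * W * s * (Z' * y')"
    unfolding assms(1) by (simp only: distrib_right)
  also have "\<dots> = Z * c * W * (Z' * c' * W' + u * x' + \<beta> * W' * s') + u * x * (Z' * y') + \<beta> * W * s * (Z' * c' * W' + u * x' + \<beta> * W' * s')"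
    unfolding assms(2) by (simp only:)
  also have "\<dots> = (Z * Z') * (c * c') * (W * W') + u * (x * (Z' * y') + Z * c * W * x' + \<beta> * W * s * x') +
    \<beta> * (W * W') * (Z * c * s' + s * (Z' * c' + \<beta> * s'))" by (simp add: algebra_simps)
  finally show ?thesis .
qed

lemma power_cong_mult:
  assumes "power_cong u \<beta> w z e y c" "power_cong u \<beta> w z e' y' c'"
  shows "power_cong u \<beta> w z (e + e') (y * y') (c * c')"
proof -
  obtain x s x' s' where "z ^ e * y = z ^ e * c * w ^ e + u * x + \<beta> * w ^ e * s"
    "z ^ e' * y' = z ^ e' * c' * w ^ e' + u * x' + \<beta> * w ^ e' * s'"
    using assms unfolding power_cong_def by blast
  from power_cong_product[OF this] show ?thesis unfolding power_cong_def power_add by blast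
qed

lemma power_cong_0: "power_cong u \<beta> w z 0 y y"
  unfolding power_cong_def by (rule exI[of _ 0], rule exI[of _ 0]) simp

lemma power_cong_power: "power_cong u \<beta> w z 1 y c \<Longrightarrow> power_cong u \<beta> w z n (y ^ n) (c ^ n)"
proof (induction n)
  case (Suc n)
  from power_cong_mult[OF Suc.prems Suc.IH[OF Suc.prems]] show ?case by simp
qed (simp add: power_cong_0)

lemma power_cong_prod:
  assumes "finite A" "\<And>i. i \<in> A \<Longrightarrow> power_cong u \<beta> w z (n i) (y i) (c i)"
  shows "power_cong u \<beta> w z (\<Sum>i\<in>A. n i) (\<Prod>i\<in>A. y i) (\<Prod>i\<in>A. c i)"
  using assms by (induction rule: finite_induct) (auto intro!: power_cong_mult power_cong_0)

lemma power_cong_scale: "power_cong u \<beta> w z n y c \<Longrightarrow> power_cong u \<beta> w z n (b * y) (b * c)"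
  using power_cong_mult[OF power_cong_0[of u \<beta> w z b]] by simp

lemma power_cong_add:
  assumes "power_cong u \<beta> w z n y c" "power_cong u \<beta> w z n y' c'"
  shows "power_cong u \<beta> w z n (y + y') (c + c')"
proof -
  obtain x s x' s' where "z ^ n * y = z ^ n * c * w ^ n + u * x + \<beta> * w ^ n * s"
    "z ^ n * y' = z ^ n * c' * w ^ n + u * x' + \<beta> * w ^ n * s'"
    using assms unfolding power_cong_def by blast
  then have "z ^ n * (y + y') = z ^ n * (c + c') * w ^ n + u * (x + x') + \<beta> * w ^ n * (s + s')"
    by (simp add: algebra_simps)
  then show ?thesis unfolding power_cong_def by blast
qed

lemma power_cong_sum:
  assumes "\<And>i. i \<in> A \<Longrightarrow> power_cong u \<beta> w z n (y i) (c i)"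
  shows "power_cong u \<beta> w z n (\<Sum>i\<in>A. y i) (\<Sum>i\<in>A. c i)"
proof -
  have z: "power_cong u \<beta> w z n 0 0" unfolding power_cong_def by (rule exI[of _ 0], rule exI[of _ 0]) simp
  show ?thesis using assms by (induction A rule: infinite_finite_induct) (auto intro!: power_cong_add z)
qed

lemma power_cong_mev:
  assumes "\<And>i. power_cong u \<beta> w z 1 (F i) (c i)" "homog e G"
  shows "power_cong u \<beta> w z e (mev h F G) (mev h c G)"
  unfolding mev_def
proof (intro power_cong_sum power_cong_scale)
  fix m assume "m \<in> Poly_Mapping.keys G"
  then have "mdeg m = e" using assms(2) by (simp add: homog_def)
  then show "power_cong u \<beta> w z e (\<Prod>i\<in>UNIV. F i ^ Poly_Mapping.lookup m i) (\<Prod>i\<in>UNIV. c i ^ Poly_Mapping.lookup m i)"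
    using power_cong_prod[of UNIV u \<beta> w z "Poly_Mapping.lookup m", OF _ power_cong_power[OF assms(1)]]
    unfolding mdeg_def by simp
qed

text \<open>An element killing the generic fibre outside its single point is read off the inverse map: modulo \<open>u\<close> and
  \<open>v\<close> the forms \<open>F\<^sub>i\<close> are proportional to \<open>w\<close>, hence the \<open>a\<^sub>i(F)\<close> are proportional to constants.\<close>

lemma inverse_relation:
  fixes u v w z z' \<alpha> \<beta> :: "'a::comm_ring_1"
  assumes cong: "power_cong u \<beta> w z e y c" "power_cong u \<beta> w z e y' c'" and eq: "y * p1 = y' * p2"
    and zv: "z * v = \<alpha> * u + \<beta> * w"
    and reg: "\<And>x. u dvd w * x \<Longrightarrow> u dvd z' * x"
  shows "z' ^ e * z ^ e * ((c * p1 - c' * p2) * w) \<in> mul.span {u, v}"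
proof -
  obtain x s x' s' where x: "z ^ e * y = z ^ e * c * w ^ e + u * x + \<beta> * w ^ e * s"
    "z ^ e * y' = z ^ e * c' * w ^ e + u * x' + \<beta> * w ^ e * s'"
    using cong unfolding power_cong_def by blast
  let ?s = "s * p1 - s' * p2" and ?D = "c * p1 - c' * p2"
  have "0 = z ^ e * (y * p1 - y' * p2)" unfolding eq by simp
  also have "\<dots> = (z ^ e * y) * p1 - (z ^ e * y') * p2" by (simp add: algebra_simps)
  also have "\<dots> = w ^ e * (z ^ e * ?D + \<beta> * ?s) + u * (x * p1 - x' * p2)" unfolding x by (simp add: algebra_simps)
  finally have "w ^ e * (z ^ e * ?D + \<beta> * ?s) = u * (x' * p2 - x * p1)" by (simp add: algebra_simps)
  then have d: "u dvd w ^ e * (z ^ e * ?D + \<beta> * ?s)" by simp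
  \<comment> \<open>The factor \<open>w ^ n\<close> is traded for \<open>z' ^ n\<close>, with one
    use of \<open>reg\<close> for each power.\<close>
  have "u dvd z' ^ n * t" if "u dvd w ^ n * t" for n t
    using that
  proof (induction n arbitrary: t)
    case (Suc n)
    have "u dvd z' * (w ^ n * t)" using Suc.prems by (intro reg) (simp add: mult.assoc)
    then have "u dvd w ^ n * (z' * t)" by (simp only: mult_ac)
    from Suc.IH[OF this] show ?case by (simp only: power_Suc2 mult.assoc)
  qed simp
  from this[OF d] obtain r where r: "z' ^ e * (z ^ e * ?D + \<beta> * ?s) = u * r" by (auto simp: dvd_def)
  have "z' ^ e * z ^ e * (?D * w) = w * (z' ^ e * (z ^ e * ?D + \<beta> * ?s)) - z' ^ e * ?s * (\<beta> * w)" by (simp add: algebra_simps)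
  \<comment> \<open>The extra factor \<open>w\<close> turns the error term into a multiple of
    \<open>\<beta> * w\<close>, which lies in the ideal of \<open>u\<close> and
    \<open>v\<close>.\<close>
  also have "\<beta> * w = z * v - \<alpha> * u" unfolding zv by simp
  also have "w * (z' ^ e * (z ^ e * ?D + \<beta> * ?s)) - z' ^ e * ?s * (z * v - \<alpha> * u) =
      (w * r + z' ^ e * ?s * \<alpha>) * u + (- (z' ^ e * ?s * z)) * v"
    unfolding r by (simp add: algebra_simps)
  finally show ?thesis unfolding in_span_pair by blast
qed

text \<open>\<open>z'\<close> is a greatest common divisor \<open>G\<close> of \<open>u\<close> and
  \<open>w\<close>. As \<open>z v\<close> is a multiple of \<open>G\<close>, and \<open>u\<close>,
  \<open>v\<close>, \<open>w\<close> have no common factor, \<open>G\<close> divides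
  \<open>z\<close>, so it is outside \<open>q\<close> with \<open>z\<close>.\<close>

lemma local_regularity:
  fixes u v w :: "(3, 'k::field) mpol"
  assumes q: "q \<in> Proj" and z: "z \<notin> q" "z * v = \<alpha> * u + \<beta> * w" and u: "u \<noteq> 0"
    and unit: "\<And>D. D dvd u \<Longrightarrow> D dvd v \<Longrightarrow> D dvd w \<Longrightarrow> D dvd 1"
  shows "\<exists>z'. z' \<notin> q \<and> (\<forall>x. u dvd w * x \<longrightarrow> u dvd z' * x)"
proof -
  obtain G u' w' where G: "u = G * u'" "w = G * w'" "rel_prime u' w'" using gcd_factorisation[of u w] u by blast
  have G0: "G \<noteq> 0" using u G by auto
  have "G \<notin> q"
  proof
    assume Gq: "G \<in> q"
    obtain D G' v' where D: "G = D * G'" "v = D * v'" "rel_prime G' v'" using gcd_factorisation[of G v] G0 by blast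
    have D0: "D \<noteq> 0" using G0 D by auto
    have "D dvd 1" 
    proof (rule unit)
      show "D dvd u" unfolding G(1) D(1) mult.assoc by (rule dvd_triv_left)
      show "D dvd v" unfolding D(2) by (rule dvd_triv_left)
      show "D dvd w" unfolding G(2) D(1) mult.assoc by (rule dvd_triv_left)
    qed
    have "D * (v' * z) = z * v" unfolding D(2) by (simp only: mult_ac)
    also have "\<dots> = \<alpha> * (D * G' * u') + \<beta> * (D * G' * w')" unfolding z(2) G(1,2) D(1) ..
    also have "\<dots> = D * (G' * (u' * \<alpha> + w' * \<beta>))" by (simp only: distrib_left mult_ac)
    finally have "v' * z = G' * (u' * \<alpha> + w' * \<beta>)" using D0 by simp
    then have "G' dvd z" by (rule rel_primeD[OF D(3) dvdI])
    then obtain r where r: "z = G' * r" by (rule dvdE)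
    obtain D' where "1 = D * D'" using \<open>D dvd 1\<close> by (rule dvdE)
    have "z = (D * D') * (G' * r)" unfolding \<open>1 = D * D'\<close>[symmetric] r by simp
    also have "\<dots> = G * (D' * r)" unfolding D(1) by (simp only: mult_ac)
    finally have "z = G * (D' * r)" .
    then show False using z(1) Gq Proj_mult_iff[OF q] by blast
  qed
  moreover have "u dvd G * x" if "u dvd w * x" for x
  proof -
    from that obtain t where "G * w' * x = G * u' * t" unfolding G(1,2) dvd_def by (elim exE)
    then have "G * (w' * x) = G * (u' * t)" unfolding mult.assoc .
    then have "w' * x = u' * t" using G0 by simp
    then have "u' dvd x" by (rule rel_primeD[OF G(3) dvdI])
    then show ?thesis unfolding G(1) by (rule mult_dvd_mono[OF dvd_refl])
  qed
  ultimately show ?thesis by blast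
qed

text \<open>Modulo \<open>J\<close>, any other variable in a monomial of degree \<open>Suc n\<close>
  can be exchanged for a multiple of \<open>Var i\<close>, so a single power of \<open>Var i\<close>
  spans the quotient. The relations are the equations of the point \<open>\<tau>\<close>.\<close>

lemma hfun_le_1:
  fixes J :: "(3, 'k::field) mpol set"
  assumes J: "mul.subspace J" and \<tau>: "\<tau> i \<noteq> 0"
    and rel: "\<And>j y. y \<in> forms n \<Longrightarrow> (Cst (\<tau> i) * Var j - Cst (\<tau> j) * Var i) * y \<in> J"
  shows "hfun J (Suc n) \<le> 1"
proof -
  let ?b = "mon (Poly_Mapping.single i (Suc n)) :: (3, 'k) mpol"
  let ?S = "J \<inter> forms (Suc n)" and ?T = "mvs.span {?b}"
  let ?V = "{x + y |x y. x \<in> ?S \<and> y \<in> ?T}"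
  have S: "mvs.subspace ?S" "fin_dim ?S" by (rule subspace_part[OF J], rule fin_dim_part)
  have T: "mvs.subspace ?T" "fin_dim ?T" unfolding fin_dim_def by (rule mvs.subspace_span, blast)
  have V: "mvs.subspace ?V" by (rule mvs.subspace_sums[OF S(1) T(1)])
  have SV: "?S \<subseteq> ?V" using mvs.span_zero[of "{?b}"] by force
  have mon: "mon m \<in> ?V" if "mdeg m = Suc n" for m
    using that
  proof (induction "Suc n - Poly_Mapping.lookup m i" arbitrary: m rule: less_induct)
    case less
    show ?case
    proof (cases "\<exists>j. j \<noteq> i \<and> Poly_Mapping.lookup m j \<noteq> 0")
      case False
      then have "m = Poly_Mapping.single i (Poly_Mapping.lookup m i)"
        by (intro poly_mapping_eqI) (auto simp: lookup_single when_def)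
      then have "m = Poly_Mapping.single i (Suc n)" using less.prems by (metis mdeg_single)
      then have "mon m \<in> ?T" by (auto intro: mvs.span_base)
      moreover have "0 \<in> ?S" using mvs.subspace_0[OF S(1)] .
      ultimately show ?thesis by force
    next
      case True
      then obtain j where j: "j \<noteq> i" "Poly_Mapping.lookup m j \<noteq> 0" by blast
      define m' where "m' = m - Poly_Mapping.single j 1"
      have m: "m = m' + Poly_Mapping.single j 1" using j unfolding m'_def
        by (intro poly_mapping_eqI) (auto simp: lookup_add lookup_minus lookup_single when_def)
      have deg: "mdeg m' = n" using less.prems unfolding m mdeg_add by simp
      let ?m = "m' + Poly_Mapping.single i 1"
      have "Poly_Mapping.lookup ?m i = Suc (Poly_Mapping.lookup m i)"
        unfolding m using j(1) by (simp add: lookup_add lookup_single)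
      moreover have "Poly_Mapping.lookup ?m i \<le> mdeg ?m" unfolding mdeg_def by (rule member_le_sum) auto
      moreover have deg': "mdeg ?m = Suc n" using deg by (simp add: mdeg_add)
      ultimately have IH: "mon ?m \<in> ?V" by (intro less.hyps) auto
      let ?y = "(Cst (\<tau> i) * Var j - Cst (\<tau> j) * Var i) * (mon m' :: (3, 'k) mpol)"
      have "homog (Suc 0 + n) ?y"
        using homog_single[of m' "1 :: 'k"] unfolding deg
        by (intro homog_mult homog_diff homog_Cst_mult homog_Var)
      moreover have "?y \<in> J" using homog_single[of m' "1 :: 'k"] unfolding deg by (intro rel) (simp add: forms_def)
      ultimately have y: "?y \<in> ?V" using SV by (auto simp: forms_def)
      have "Cst (\<tau> i) * mon m = ?y + Cst (\<tau> j) * (mon ?m :: (3, 'k) mpol)"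
        unfolding m mon_mult[symmetric] Var_def by (simp add: algebra_simps)
      also have "\<dots> \<in> ?V" by (rule mvs.subspace_add[OF V y mvs.subspace_scale[OF V IH]])
      finally have "Cst (inverse (\<tau> i)) * (Cst (\<tau> i) * mon m) \<in> ?V" by (rule mvs.subspace_scale[OF V])
      then show ?thesis unfolding Cst_inverse[OF \<tau>] .
    qed
  qed
  have "forms (Suc n) \<subseteq> ?V"
    using mvs.span_minimal[OF _ V, of "mon ` {m. mdeg m = Suc n}"] mon unfolding span_mono_forms by blast
  then have "mvs.dim (forms (Suc n) :: (3, 'k) mpol set) \<le> mvs.dim ?V"
    by (rule dim_mono_fin_dim[OF fin_dim_sums[OF S(2) T(2)]])
  also have "\<dots> \<le> mvs.dim ?S + mvs.dim ?T" using dim_sums_Int_fin_dim[OF S T] by linarith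
  also have "mvs.dim ?T \<le> 1" using mvs.dim_le_card[of ?T "{?b}"] by simp
  finally show ?thesis unfolding hfun_def by simp
qed

lemma four_elements:
  assumes "s \<noteq> (l :: 4)"
  obtains j1 j2 where "UNIV = {s, l, j1, j2}" "j1 \<noteq> j2" "j1 \<noteq> s" "j1 \<noteq> l" "j2 \<noteq> s" "j2 \<noteq> l"
proof -
  have "card (UNIV - {s, l}) = 2" using assms by (simp add: card_Diff_subset)
  then obtain j1 j2 where j: "UNIV - {s, l} = {j1, j2}" "j1 \<noteq> j2" by (auto simp: card_2_iff)
  then have "UNIV = {s, l, j1, j2}" "j1 \<notin> {s, l}" "j2 \<notin> {s, l}" by blast+
  then show ?thesis using that j(2) by blast
qed

lemma field_hom_to_fract_Cst: "field_hom (\<lambda>c :: 'k::field. to_fract (Cst c :: ('v::{finite,linorder}, 'k) mpol))"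
  by unfold_locales (simp_all add: Cst_add Cst_mult)

lemma comm_ring_hom_to_fract: "comm_ring_hom (to_fract :: 'a::idom \<Rightarrow> _)"
  by unfold_locales simp_all

text \<open>Brings a point over the large field down to the small one, where the local complete
  intersection hypothesis is stated.\<close>

lemma (in field_hom) Proj_contraction:
  fixes q :: "('v::finite, 'b) mpol set"
  assumes q: "q \<in> Proj"
  shows "{G. ext G \<in> q} \<in> Proj"
proof -
  have S: "mul.subspace q" and "graded_ideal q" using q Proj_subspace Proj_graded by blast+
  have "mul.subspace {G. ext G \<in> q}"
    using mul.subspace_0[OF S] mul.subspace_add[OF S] mul.subspace_scale[OF S]
    by (auto simp: mul.subspace_def ext.hom_zero ext.hom_add ext.hom_mult)
  then have "graded_ideal {G. ext G \<in> q}"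
    using \<open>graded_ideal q\<close> by (auto simp: graded_ideal_def hcomp_ext[symmetric])
  then show ?thesis
    using q unfolding Proj_iff by (auto simp: ext.hom_mult ext_Var)
qed

lemma (in field_hom) ext_span_pair: "x \<in> mul.span {F, G} \<Longrightarrow> ext x \<in> mul.span {ext F, ext G}"
  unfolding in_span_pair by (elim exE) (intro exI, simp add: ext.hom_add ext.hom_mult)

lemma sum_combination:
  fixes u :: "'a::comm_ring_1"
  shows "(\<Sum>i\<in>A. g i * (c1 i * u + c2 i * v + c3 i * w)) =
    (\<Sum>i\<in>A. g i * c1 i) * u + (\<Sum>i\<in>A. g i * c2 i) * v + (\<Sum>i\<in>A. g i * c3 i) * w"
  by (simp add: sum.distrib sum_distrib_right distrib_left mult.assoc)

text \<open>For three generators the residual scheme of the generic point of the image is that point itself, which has length one.\<close>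

lemma degree_bound_planar:
  fixes f :: "4 \<Rightarrow> (3, 'k::field) mpol"
  assumes f: "\<And>i. homog d (f i)" and ci: "locally_ci (fideal f)"
    and bd: "\<And>n. hfun (mul.span (range f)) n \<le> B"
    and a: "\<And>i. homog e (a i)" and nz: "\<exists>i. subst f (a i) \<noteq> 0"
    and inv: "\<And>i j. subst f (a i) * Var j = subst f (a j) * Var i"
    and r: "(\<Sum>i\<in>UNIV. Cst (r i) * f i) = 0" "r l \<noteq> 0"
  shows "\<exists>N. \<forall>n\<ge>N. d * d \<le> hfun (mul.span (range f)) n + 1"
proof -
  \<comment> \<open>The scalars are the rational functions on \<open>S\<close>. Over them
    \<open>P\<close> is the generic point of the image, and \<open>\<tau>\<close>, the inverse map
    applied to \<open>P\<close>, is the generic point of the plane, since its coordinates are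
    proportional to the variables.\<close>
  define \<sigma> :: "'k \<Rightarrow> (3, 'k) mpol fract" where "\<sigma> c = to_fract (Cst c)" for c
  interpret \<sigma>: field_hom \<sigma> unfolding \<sigma>_def by (rule field_hom_to_fract_Cst)
  define F where "F i = \<sigma>.ext (f i)" for i
  define P where "P i = to_fract (f i)" for i
  define \<tau> where "\<tau> i = to_fract (subst f (a i))" for i
  have "\<not> (\<exists>p q \<alpha> \<beta>. \<forall>i. F i = Cst (\<alpha> i) * p + Cst (\<beta> i) * q)"
  proof (rule not_in_pencil[of e a "\<lambda>i. \<sigma>.ext (subst f (a i))" \<sigma>])
    show "\<sigma>.ext (subst f (a i)) = mev (\<lambda>c. Cst (\<sigma> c)) F (a i)" for i
      unfolding \<sigma>.ext_subst F_def ..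
    show "\<sigma>.ext (subst f (a i)) * Var j = \<sigma>.ext (subst f (a j)) * Var i" for i j
      using arg_cong[OF inv[of i j], of \<sigma>.ext] unfolding \<sigma>.ext.hom_mult \<sigma>.ext_Var .
  qed (use a nz in auto)
  then have np: False if "\<And>i. F i = Cst (\<alpha> i) * p + Cst (\<beta> i) * q" for \<alpha> \<beta> p q
    using that by blast
  \<comment> \<open>The coordinate \<open>s\<close> used for dehomogenising has to differ from
    \<open>l\<close>, because the relation \<open>r\<close> will eliminate
    \<open>t l\<close>.\<close>
  have "\<exists>s. s \<noteq> l \<and> f s \<noteq> 0"
  proof (rule ccontr)
    assume *: "\<not> ?thesis"
    then have F0: "F i = 0" if "i \<noteq> l" for i using that unfolding F_def by auto
    have "F i = Cst (if i = l then 1 else 0) * F l + Cst 0 * 0" for i using F0 by auto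
    then show False by (rule np)
  qed
  then obtain s where s: "s \<noteq> l" "f s \<noteq> 0" by blast
  have Ps: "P s \<noteq> 0" and Fs: "F s \<noteq> 0" using s(2) unfolding P_def F_def by auto
  have hF: "homog d (F i)" for i unfolding F_def using f by simp
  define w where "w = Cst (inverse (P s)) * F s"
  define t where "t i = F i - Cst (P i) * w" for i
  have Fsw: "F s = Cst (P s) * w" unfolding w_def using Cst_inverse[of "inverse (P s)" "F s"] Ps by simp
  have hw: "homog d w" unfolding w_def by (intro homog_Cst_mult hF)
  have ts: "t s = 0" unfolding t_def Fsw[symmetric] by simp
  have ht: "homog d (t i)" for i unfolding t_def by (intro homog_diff homog_Cst_mult hF hw)
  \<comment> \<open>The relation holds for the forms \<open>F i\<close> and also for the scalars
    \<open>P i\<close>, hence for the \<open>t i\<close>. Since \<open>t s = 0\<close>, two of the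
    \<open>t i\<close> then span all of them.\<close>
  have relt: "(\<Sum>i\<in>UNIV. Cst (\<sigma> (r i)) * t i) = 0"
  proof -
    have "(\<Sum>i\<in>UNIV. Cst (\<sigma> (r i)) * F i) = \<sigma>.ext (\<Sum>i\<in>UNIV. Cst (r i) * f i)"
      by (simp add: \<sigma>.ext.hom_sum \<sigma>.ext.hom_mult \<sigma>.ext_Cst F_def)
    moreover have "(\<Sum>i\<in>UNIV. Cst (\<sigma> (r i)) * Cst (P i) :: (3, (3, 'k) mpol fract) mpol) = Cst (to_fract (\<Sum>i\<in>UNIV. Cst (r i) * f i))"
      by (simp add: to_fract_sum Cst_sum Cst_mult \<sigma>_def P_def)
    ultimately show ?thesis unfolding t_def r(1)
      by (simp add: right_diff_distrib sum_subtractf mult.assoc[symmetric] sum_distrib_right[symmetric])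
  qed
  obtain j1 j2 where j: "UNIV = {s, l, j1, j2}" "j1 \<noteq> j2" "j1 \<noteq> s" "j1 \<noteq> l" "j2 \<noteq> s" "j2 \<noteq> l"
    by (rule four_elements[OF s(1)])
  define u where "u = t j1"
  define v where "v = t j2"
  define k where "k i = - inverse (\<sigma> (r l)) * \<sigma> (r i)" for i
  have tl: "t l = Cst (k j1) * u + Cst (k j2) * v"
  proof -
    have "Cst (\<sigma> (r l)) * t l + (Cst (\<sigma> (r j1)) * u + Cst (\<sigma> (r j2)) * v) = 0"
      using relt s(1) j(2-) unfolding j(1) u_def v_def by (simp add: ts)
    then have "Cst (\<sigma> (r l)) * t l = - (Cst (\<sigma> (r j1)) * u + Cst (\<sigma> (r j2)) * v)" by (rule eq_neg_iff_add_eq_0[THEN iffD2])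
    then have "t l = Cst (inverse (\<sigma> (r l))) * - (Cst (\<sigma> (r j1)) * u + Cst (\<sigma> (r j2)) * v)"
      using Cst_inverse[of "\<sigma> (r l)" "t l"] r(2) by simp
    also have "\<dots> = Cst (k j1) * u + Cst (k j2) * v"
      unfolding k_def Cst_mult Cst_uminus by (simp add: algebra_simps)
    finally show ?thesis .
  qed
  have "\<exists>\<alpha> \<beta>. t i = Cst \<alpha> * u + Cst \<beta> * v" for i
  proof -
    consider "i = s" | "i = l" | "i = j1" | "i = j2" using j(1) by blast
    then show ?thesis
    proof cases
      case 1 then show ?thesis using ts by (intro exI[of _ 0]) simp
    next
      case 2 then show ?thesis using tl by blast
    next
      case 3 then show ?thesis by (intro exI[of _ 1] exI[of _ 0]) (simp add: u_def)
    next
      case 4 then show ?thesis by (intro exI[of _ 0] exI[of _ 1]) (simp add: v_def)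
    qed
  qed
  then obtain \<kappa>1 \<kappa>2 where tk: "\<And>i. t i = Cst (\<kappa>1 i) * u + Cst (\<kappa>2 i) * v" by metis
  have Fk: "F i = Cst (\<kappa>1 i) * u + Cst (\<kappa>2 i) * v + Cst (P i) * w" for i
    using tk[of i] unfolding t_def by (simp add: algebra_simps)
  have u0: "u \<noteq> 0"
  proof
    assume "u = 0"
    then have "F i = Cst (\<kappa>2 i) * v + Cst (P i) * w" for i using Fk by simp
    then show False by (rule np)
  qed
  have v0: "v \<noteq> 0"
  proof
    assume "v = 0"
    then have "F i = Cst (\<kappa>1 i) * u + Cst (P i) * w" for i using Fk by simp
    then show False by (rule np)
  qed
  have hu: "homog d u" and hv: "homog d v" unfolding u_def v_def by (rule ht)+
  let ?U = "mul.span {u, v}" and ?J = "spec_ideal P F"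
  have U: "mul.subspace ?U" by (rule mul.subspace_span)
  have PU: "point_ideal P F = ?U"
  proof -
    have eq: "F i - Cst (P i / P s) * F s = t i" for i
      unfolding t_def w_def divide_inverse Cst_mult by (simp only: mult.assoc)
    have "t i \<in> ?U" for i unfolding in_span_pair using tk by blast
    moreover have "{u, v} \<subseteq> t ` (- {s})" unfolding u_def v_def using j(3,5) by blast
    ultimately show ?thesis
      unfolding point_ideal_eq_span[of P s, OF Ps] eq
      by (intro antisym mul.span_mono mul.span_minimal[OF _ U]) auto
  qed
  have bdF: "hfun (mul.span (range F)) n = hfun (mul.span (range f)) n" for n
    unfolding F_def by (rule \<sigma>.hfun_ext[OF f])
  have unit: "D dvd 1" if "D dvd u" "D dvd v" "D dvd w" for D
  proof (rule common_divisor_unit[of d F s B])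
    show "D dvd F i" for i unfolding Fk[of i] by (intro dvd_add dvd_mult that)
  qed (use hF Fs bdF bd in auto)
  \<comment> \<open>The linear forms that vanish at the point \<open>\<tau>\<close>.\<close>
  let ?\<Lambda> = "\<lambda>i j. Cst (\<tau> i) * Var j - Cst (\<tau> j) * Var i :: (3, (3, 'k) mpol fract) mpol"
  have \<tau>mev: "mev (\<lambda>c. Cst (\<sigma> c)) (\<lambda>i. Cst (P i)) (a i) = (Cst (\<tau> i) :: (3, (3, 'k) mpol fract) mpol)" for i
    unfolding \<tau>_def
  proof (rule mpol_hom_eq[of "mev (\<lambda>c. Cst (\<sigma> c)) (\<lambda>i. Cst (P i))" "\<lambda>G. Cst (to_fract (subst f G))" "a i"])
    show "comm_ring_hom (mev (\<lambda>c. Cst (\<sigma> c)) (\<lambda>i. Cst (P i) :: (3, (3, 'k) mpol fract) mpol))"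
      by (rule comm_ring_hom.comm_ring_hom_mev[OF \<sigma>.comm_ring_hom_Cst_hom])
    show "comm_ring_hom (\<lambda>G. Cst (to_fract (subst f G)) :: (3, (3, 'k) mpol fract) mpol)"
      by (rule comm_ring_hom_comp[OF comm_ring_hom_Cst comm_ring_hom_comp[OF comm_ring_hom_to_fract comm_ring_hom_subst]])
    show "mev (\<lambda>c. Cst (\<sigma> c)) (\<lambda>i. Cst (P i)) (Cst c) = (Cst (to_fract (subst f (Cst c))) :: (3, (3, 'k) mpol fract) mpol)" for c
      unfolding comm_ring_hom.mev_Cst[OF \<sigma>.comm_ring_hom_Cst_hom] subst_Cst by (simp only: \<sigma>_def)
    show "mev (\<lambda>c. Cst (\<sigma> c)) (\<lambda>i. Cst (P i)) (Var i) = (Cst (to_fract (subst f (Var i))) :: (3, (3, 'k) mpol fract) mpol)" for i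
      unfolding comm_ring_hom.mev_Var[OF \<sigma>.comm_ring_hom_Cst_hom] subst_Var by (simp only: P_def)
  qed
  \<comment> \<open>Stated for an arbitrary pair \<open>u0\<close>, \<open>v0\<close>, so that the
    roles of \<open>u\<close> and \<open>v\<close> can be exchanged.\<close>
  have key: "z' ^ e * z ^ e * (?\<Lambda> i j * w) \<in> mul.span {u0, v0}"
    if zv: "z * v0 = \<alpha> * u0 + \<beta> * w" and reg: "\<And>x. u0 dvd w * x \<Longrightarrow> u0 dvd z' * x"
      and F0: "\<And>i. F i = Cst (\<mu>1 i) * u0 + Cst (\<mu>2 i) * v0 + Cst (P i) * w" for i j z z' u0 v0 \<alpha> \<beta> \<mu>1 \<mu>2
  proof -
    have "power_cong u0 \<beta> w z 1 (F i) (Cst (P i))" for i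
    proof -
      have "z * F i = z * Cst (P i) * w + u0 * (Cst (\<mu>1 i) * z) + Cst (\<mu>2 i) * (z * v0)" unfolding F0[of i] by (simp add: algebra_simps)
      also have "\<dots> = z * Cst (P i) * w + u0 * (Cst (\<mu>1 i) * z + Cst (\<mu>2 i) * \<alpha>) + \<beta> * w * Cst (\<mu>2 i)"
        unfolding zv by (simp add: algebra_simps)
      finally show ?thesis unfolding power_cong_def power_one_right by blast
    qed
    then have "power_cong u0 \<beta> w z e (mev (\<lambda>c. Cst (\<sigma> c)) F (a i)) (mev (\<lambda>c. Cst (\<sigma> c)) (\<lambda>i. Cst (P i)) (a i))" for i
      by (rule power_cong_mev[OF _ a])
    then have cong: "power_cong u0 \<beta> w z e (\<sigma>.ext (subst f (a i))) (Cst (\<tau> i))" for i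
      unfolding \<tau>mev \<sigma>.ext_subst F_def .
    have "\<sigma>.ext (subst f (a i)) * Var j = \<sigma>.ext (subst f (a j)) * Var i"
      using arg_cong[OF inv[of i j], of \<sigma>.ext] unfolding \<sigma>.ext.hom_mult \<sigma>.ext_Var .
    from inverse_relation[OF cong cong this zv reg] show ?thesis .
  qed
  \<comment> \<open>Locally the equations of \<open>\<tau>\<close> multiply \<open>w\<close> into
    \<open>(u, v)\<close>. Where \<open>w\<close> does not vanish, it serves as the multiplier
    itself. Where it does, the point lies in \<open>V(I)\<close>, and the local complete
    intersection property makes one of \<open>u\<close>, \<open>v\<close>, \<open>w\<close>
    redundant.\<close>
  have local: "\<exists>z. z \<notin> q \<and> z * (?\<Lambda> i j * w) \<in> ?U" if q: "q \<in> Proj" for q i j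
  proof (cases "?U \<subseteq> q")
    case False
    then obtain z where z: "z \<in> ?U" "z \<notin> q" by blast
    then show ?thesis using mul_scale[OF U z(1)] by blast
  next
    case Uq: True
    then have uvq: "u \<in> q" "v \<in> q" by (auto intro: subsetD mul.span_base)
    have pow: "z' ^ e * z ^ e \<notin> q" if "z \<notin> q" "z' \<notin> q" for z z'
      using that Proj_power_iff[OF q] Proj_mult_iff[OF q] by blast
    show ?thesis
    proof (cases "w \<in> q")
      case False
      have "w ^ e * w ^ e * (?\<Lambda> i j * w) \<in> ?U"
        by (rule key[of w v 0 u v w, OF _ _ Fk]) (simp_all add: mult.commute)
      then show ?thesis using pow[OF False False] by blast
    next
      case wq: True
      have S: "mul.subspace q" by (rule Proj_subspace[OF q])
      have Fq: "F i \<in> q" for i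
        unfolding Fk[of i] by (intro mul.subspace_add[OF S] mul.subspace_scale[OF S] uvq wq)
      let ?q = "{G. \<sigma>.ext G \<in> q}"
      obtain F1 F2 z0 where z0: "F1 \<in> mul.span (range f)" "F2 \<in> mul.span (range f)" "z0 \<notin> ?q" "\<And>i. z0 * f i \<in> mul.span {F1, F2}"
        using locally_ci_two_generators[OF ci f \<sigma>.Proj_contraction[OF q]] Fq unfolding F_def by blast
      let ?Z = "\<sigma>.ext z0" and ?E = "mul.span {\<sigma>.ext F1, \<sigma>.ext F2}"
      have E: "mul.subspace ?E" by (rule mul.subspace_span)
      have ZF: "?Z * F i \<in> ?E" for i
        using \<sigma>.ext_span_pair[OF z0(4)[of i]] unfolding F_def \<sigma>.ext.hom_mult .
      have Zw: "?Z * w \<in> ?E"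
        using mul.subspace_scale[OF E ZF[of s], of "Cst (inverse (P s))"] unfolding w_def by (simp only: mult_ac)
      have Zt: "?Z * t i \<in> ?E" for i
        using mul.subspace_diff[OF E ZF[of i] mul.subspace_scale[OF E Zw, of "Cst (P i)"]] unfolding t_def
        by (simp only: right_diff_distrib mult_ac)
      have comb: "\<exists>a b c. \<sigma>.ext G = a * u + b * v + c * w" if "G \<in> mul.span (range f)" for G
      proof -
        from that obtain g where "G = (\<Sum>i\<in>UNIV. g i * f i)" unfolding span_range by (elim CollectE exE conjE)
        then have "\<sigma>.ext G = (\<Sum>i\<in>UNIV. \<sigma>.ext (g i) * (Cst (\<kappa>1 i) * u + Cst (\<kappa>2 i) * v + Cst (P i) * w))"
          by (simp add: \<sigma>.ext.hom_sum \<sigma>.ext.hom_mult F_def[symmetric] Fk)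
        then show ?thesis unfolding sum_combination by blast
      qed
      obtain a1 a2 a3 where F1: "\<sigma>.ext F1 = a1 * u + a2 * v + a3 * w" using comb[OF z0(1)] by blast
      obtain b1 b2 b3 where F2: "\<sigma>.ext F2 = b1 * u + b2 * v + b3 * w" using comb[OF z0(2)] by blast
      have "\<exists>z. z \<notin> q \<and> (z * w \<in> ?U \<or> z * v \<in> mul.span {u, w} \<or> z * u \<in> mul.span {v, w})"
      proof (rule redundant_generator[OF S _ _ _ _ Zw F1 F2])
        show "?Z \<notin> q" using z0(3) by simp
        show "?Z * u \<in> ?E" "?Z * v \<in> ?E" unfolding u_def v_def by (rule Zt)+
        show "x \<in> q \<or> y \<in> q" if "x * y \<in> q" for x y using that Proj_mult_iff[OF q] by blast
      qed
      then obtain z where z: "z \<notin> q" "z * w \<in> ?U \<or> z * v \<in> mul.span {u, w} \<or> z * u \<in> mul.span {v, w}" by blast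
      from z(2) consider "z * w \<in> ?U" | \<alpha> \<beta> where "z * v = \<alpha> * u + \<beta> * w" | \<alpha> \<beta> where "z * u = \<alpha> * v + \<beta> * w"
        unfolding in_span_pair by blast
      then show ?thesis
      proof cases
        case 1
        from mul.subspace_scale[OF U this, of "?\<Lambda> i j"] have "z * (?\<Lambda> i j * w) \<in> ?U" by (simp only: mult_ac)
        then show ?thesis using z(1) by blast
      next
        case (2 \<alpha> \<beta>)
        obtain z' where z': "z' \<notin> q" "\<And>x. u dvd w * x \<Longrightarrow> u dvd z' * x"
          using local_regularity[OF q z(1) 2 u0 unit] by blast
        show ?thesis using key[OF 2 z'(2) Fk, of i j] pow[OF z(1) z'(1)] by blast
      next
        case (3 \<alpha> \<beta>)
        obtain z' where z': "z' \<notin> q" "\<And>x. v dvd w * x \<Longrightarrow> v dvd z' * x"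
          using local_regularity[OF q z(1) 3 v0 unit] by blast
        have "F i = Cst (\<kappa>2 i) * v + Cst (\<kappa>1 i) * u + Cst (P i) * w" for i unfolding Fk[of i] by (simp only: add_ac)
        from key[OF 3 z'(2) this, of i j] show ?thesis using pow[OF z(1) z'(1)] unfolding insert_commute[of v u] by blast
      qed
    qed
  qed
  obtain i0 where "subst f (a i0) \<noteq> 0" using nz by blast
  then have \<tau>0: "\<tau> i0 \<noteq> 0" unfolding \<tau>_def by simp
  have "\<exists>N. \<forall>n\<ge>N. forms n \<subseteq> colon ?U (?\<Lambda> i0 j * w)" for j
  proof (rule forms_subset_if_Vplus_empty)
    have "homog (Suc 0) (?\<Lambda> i0 j)" by (intro homog_diff homog_Cst_mult homog_Var)
    from homog_mult[OF this hw] show "graded_ideal (colon ?U (?\<Lambda> i0 j * w))"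
      by (rule graded_colon[OF graded_span_pair[OF hu hv]])
    fix q assume q: "q \<in> (Proj :: (3, (3, 'k) mpol fract) mpol set set)"
    then obtain z where "z \<notin> q" "z * (?\<Lambda> i0 j * w) \<in> ?U" using local by blast
    then show "\<not> colon ?U (?\<Lambda> i0 j * w) \<subseteq> q" unfolding colon_def by (auto simp: mult.commute)
  qed
  then obtain N where N: "\<And>j n. n \<ge> N j \<Longrightarrow> forms n \<subseteq> colon ?U (?\<Lambda> i0 j * w)" by metis
  define M where "M = (\<Sum>j\<in>UNIV. N j)"
  have J: "mul.subspace ?J" using graded_spec_ideal[of P s, OF Ps hF] by (simp add: graded_ideal_def)
  have J1: "hfun ?J (Suc n) \<le> 1" if "n \<ge> M" for n
  proof (rule hfun_le_1[of ?J \<tau> i0, OF J \<tau>0])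
    fix j y assume "y \<in> (forms n :: (3, (3, 'k) mpol fract) mpol set)"
    moreover have "N j \<le> M" unfolding M_def by (rule member_le_sum) auto
    ultimately have "?\<Lambda> i0 j * w * y \<in> ?U" using N[of j n] that unfolding colon_def by auto
    from mul.subspace_scale[OF U this, of "Cst (P s)"] have "F s * (?\<Lambda> i0 j * y) \<in> ?U"
      unfolding Fsw by (simp only: mult_ac)
    then show "?\<Lambda> i0 j * y \<in> ?J"
      unfolding colon_point_ideal[of P s, OF Ps, symmetric] PU colon_def by simp
  qed
  \<comment> \<open>The lower bound for \<open>(u, v)\<close>, valid even with a common factor,
    splits into the Hilbert function of \<open>I\<close> and that of the fibre, and the latter is at
    most one.\<close>
  have "d * d \<le> hfun (mul.span (range f)) n + 1" if "n \<ge> Suc M + d + d" for n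
  proof -
    define m where "m = n - d - d"
    have n: "n = m + d + d" and m: "m + d \<ge> Suc M" using that unfolding m_def by auto
    have "d * d \<le> hfun ?U (m + d + d)" by (rule hfun_pair_ge(1)[OF hu u0 hv v0])
    also have "\<dots> = hfun (mul.span (range f)) n + hfun ?J (m + d)"
      unfolding PU[symmetric] hfun_point_ideal[of P s F d "m + d", OF Ps Fs hF] bdF n ..
    also have "hfun ?J (m + d) \<le> 1"
    proof -
      have "m + d = Suc (m + d - 1)" "m + d - 1 \<ge> M" using m by auto
      then show ?thesis using J1[of "m + d - 1"] by (simp only:)
    qed
    finally show ?thesis by simp
  qed
  then show ?thesis by blast
qed

section \<open>Splitting off the greatest common divisor, and the decisive inequality\<close>

lemma rel_prime_if_common_units:
  fixes a b :: "(3, 'k::field) mpol"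
  assumes "a \<noteq> 0" and unit: "\<And>g. g dvd a \<Longrightarrow> g dvd b \<Longrightarrow> g dvd 1"
  shows "rel_prime a b"
proof -
  obtain g a' b' where g: "a = g * a'" "b = g * b'" "rel_prime a' b'" using gcd_factorisation[of a b] assms(1) by blast
  have g0: "g \<noteq> 0" using assms(1) g by auto
  have "g dvd 1" by (rule unit[unfolded g(1,2)]) (rule dvd_triv_left)+
  then obtain g' where g': "1 = g * g'" by (rule dvdE)
  show ?thesis
    unfolding rel_prime_def
  proof (intro allI impI)
    fix y assume "a dvd b * y"
    then obtain t where "g * b' * y = g * a' * t" unfolding g(1,2) by (rule dvdE)
    then have "g * (b' * y) = g * (a' * t)" unfolding mult.assoc .
    then have "b' * y = a' * t" using g0 by simp
    then have "a' dvd y" by (rule rel_primeD[OF g(3) dvdI])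
    then obtain r where r: "y = a' * r" by (rule dvdE)
    have "y = (g * g') * (a' * r)" unfolding g'[symmetric] r by simp
    also have "\<dots> = a * (g' * r)" unfolding g(1) by (simp only: mult_ac)
    finally show "a dvd y" by (rule dvdI)
  qed
qed

lemma span_mult_image: "mul.span ((*) h ` E) = (*) h ` mul.span (E :: 'a::comm_ring_1 set)"
proof (rule antisym)
  have S: "mul.subspace ((*) h ` mul.span E)"
  proof (rule mul.subspaceI)
    show "0 \<in> (*) h ` mul.span E" using mul.span_zero by (intro image_eqI[of _ _ 0]) auto
    show "x + y \<in> (*) h ` mul.span E" if "x \<in> (*) h ` mul.span E" "y \<in> (*) h ` mul.span E" for x y
      using that by (elim imageE) (simp add: distrib_left[symmetric] mul.span_add)
    show "c * x \<in> (*) h ` mul.span E" if "x \<in> (*) h ` mul.span E" for c x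
      using that by (elim imageE) (simp add: mult.left_commute[of c] mul.span_scale)
  qed
  show "mul.span ((*) h ` E) \<subseteq> (*) h ` mul.span E"
    by (intro mul.span_minimal[OF _ S] image_mono mul.span_superset)
  have "mul.subspace {y. h * y \<in> mul.span ((*) h ` E)}"
    by (rule mul.subspaceI) (auto simp: distrib_left mult.left_commute intro: mul.span_add mul.span_scale mul.span_zero)
  then have "mul.span E \<subseteq> {y. h * y \<in> mul.span ((*) h ` E)}"
    by (intro mul.span_minimal) (auto intro: mul.span_base)
  then show "(*) h ` mul.span E \<subseteq> mul.span ((*) h ` E)" by blast
qed

text \<open>\<open>cc (n + e) - cc n\<close> is the Hilbert function of the curve
  \<open>h = 0\<close>; the identity is written with sums to stay within the natural
  numbers.\<close>

lemma hfun_mult_image: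
  fixes h :: "(3, 'k::field) mpol"
  assumes h: "homog e h" "h \<noteq> 0"
  shows "hfun ((*) h ` A) (n + e) + cc n = cc (n + e) + hfun A n"
proof -
  have "(*) h ` A \<inter> forms (n + e) = (*) h ` (A \<inter> forms n)"
  proof (intro antisym subsetI)
    fix y assume y: "y \<in> (*) h ` A \<inter> forms (n + e)"
    then obtain x where x: "y = h * x" "x \<in> A" by blast
    show "y \<in> (*) h ` (A \<inter> forms n)"
    proof (cases "x = 0")
      case True then show ?thesis using x by (intro image_eqI[of _ _ 0]) (auto simp: forms_def)
    next
      case False
      then have "h * x \<noteq> 0" "homog (n + e) (h * x)" using h(2) y x(1) by (auto simp: forms_def)
      then obtain i j where ij: "homog i h" "homog j x" "i + j = n + e" using homog_factors by blast
      then have "j = n" using homog_unique[OF ij(1) h] by simp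
      then show ?thesis using x ij(2) by (auto simp: forms_def)
    qed
  next
    fix y assume "y \<in> (*) h ` (A \<inter> forms n)"
    then show "y \<in> (*) h ` A \<inter> forms (n + e)"
      using homog_mult[OF h(1)] unfolding add.commute[of n e] by (auto simp: forms_def)
  qed
  then have "mvs.dim ((*) h ` A \<inter> forms (n + e)) = mvs.dim (A \<inter> forms n)"
    using dim_mult_image[OF h(2)] by simp
  then show ?thesis using hfun_dim[of "(*) h ` A" "n + e"] hfun_dim[of A n] unfolding dim_forms_3 by linarith
qed

text \<open>\<open>h\<close> is a homogeneous common divisor of maximal degree. If \<open>g\<close>
  divides all the cofactors, \<open>h * g\<close> divides the nonzero form \<open>t p\<close> and is
  therefore homogeneous; maximality leaves degree 0 for \<open>g\<close>.\<close>

lemma exists_homogeneous_gcd: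
  fixes t :: "'i::finite \<Rightarrow> (3, 'k::field) mpol"
  assumes t: "\<And>i. homog d (t i)" "t p \<noteq> 0"
  shows "\<exists>h e k. homog e h \<and> h \<noteq> 0 \<and> e \<le> d \<and> (\<forall>i. t i = h * k i \<and> homog (d - e) (k i)) \<and>
    (\<forall>g. (\<forall>i. g dvd k i) \<longrightarrow> g dvd 1)"
proof -
  define E where "E = {e. \<exists>h. homog e h \<and> h \<noteq> 0 \<and> (\<forall>i. h dvd t i)}"
  have le: "e \<le> d" if "e \<in> E" for e
  proof -
    from that obtain h where h: "homog e h" "h \<noteq> 0" "h dvd t p" unfolding E_def by blast
    obtain e' where "e' \<le> d" "homog e' h" using homog_dvd[OF h(3) t] by blast
    then show ?thesis using homog_unique[OF h(1) _ h(2)] by blast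
  qed
  have fin: "finite E" using le by (intro finite_subset[of E "{..d}"]) auto
  have "0 \<in> E" unfolding E_def by (intro CollectI exI[of _ 1]) simp
  then have "Max E \<in> E" using fin by (intro Max_in) auto
  then obtain h where h: "homog (Max E) h" "h \<noteq> 0" "\<And>i. h dvd t i" unfolding E_def by blast
  obtain k where k: "\<And>i. t i = h * k i" using h(3) unfolding dvd_def by metis
  let ?e = "Max E"
  have ed: "?e \<le> d" using le \<open>Max E \<in> E\<close> .
  have hk: "homog (d - ?e) (k i)" for i
  proof (cases "k i = 0")
    case False
    then have "h * k i \<noteq> 0" "homog d (h * k i)" using h(2) t(1)[of i] unfolding k by auto
    then obtain i' j' where ij: "homog i' h" "homog j' (k i)" "i' + j' = d" using homog_factors by blast
    then have "j' = d - ?e" using homog_unique[OF ij(1) h(1,2)] by simp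
    then show ?thesis using ij(2) by simp
  qed simp
  have "g dvd 1" if g: "\<And>i. g dvd k i" for g
  proof -
    have dvd: "h * g dvd t i" for i unfolding k by (intro mult_dvd_mono dvd_refl g)
    then obtain e' where e': "homog e' (h * g)" using homog_dvd[OF dvd t] by blast
    have nz: "h * g \<noteq> 0" using dvd[of p] t(2) by auto
    obtain i j where ij: "homog i h" "homog j g" "i + j = e'" using homog_factors[OF e' nz] by blast
    have "e' \<in> E" unfolding E_def using e' nz dvd by blast
    then have "e' \<le> ?e" using fin by simp
    then have "j = 0" using ij(3) homog_unique[OF ij(1) h(1,2)] by simp
    then show ?thesis using homog_0_unit[of g] ij(2) nz by auto
  qed
  then show ?thesis using h(1,2) ed k hk by blast
qed

text \<open>All three forms have degree \<open>a\<close>, so comparing components in that degree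
  cuts the multipliers down to constants.\<close>

lemma span_pair_constants:
  fixes u v y :: "(3, 'k::field) mpol"
  assumes "homog a u" "homog a v" "homog a y" "y \<in> mul.span {u, v}"
  shows "\<exists>\<alpha> \<beta>. y = Cst \<alpha> * u + Cst \<beta> * v"
proof -
  obtain \<alpha> \<beta> where "y = u * \<alpha> + v * \<beta>" using assms(4) unfolding in_span_pair by (metis mult.commute)
  then have "hcomp a y = u * hcomp 0 \<alpha> + v * hcomp 0 \<beta>"
    unfolding \<open>y = u * \<alpha> + v * \<beta>\<close> hcomp_add hcomp_homog_mult[OF assms(1)] hcomp_homog_mult[OF assms(2)] by simp
  moreover have "hcomp a y = y" using hcomp_homog[OF assms(3), of a] by simp
  moreover obtain c c' where "hcomp 0 \<alpha> = Cst c" "hcomp 0 \<beta> = Cst c'" using homog_0_iff_Cst homog_hcomp by metis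
  ultimately show ?thesis by (metis mult.commute)
qed

text \<open>For \<open>e = 0\<close> the right-hand side is at least 6; otherwise
  \<open>a = e = 1\<close> and \<open>\<delta> = 0\<close>. Here \<open>\<nu> \<ge> 1\<close> is
  indispensable: these values with \<open>\<nu> = 0\<close> satisfy all the other
  conditions.\<close>

lemma final_numerics:
  fixes a e \<delta> :: nat and \<nu> :: int
  assumes "a \<ge> 1" "\<nu> \<ge> 1" "\<delta> + a * e \<le> 1" "2 * int \<delta> = (\<nu> - int e + 2) * (\<nu> - int e + 1)"
  shows False
proof (cases "e = 0")
  case True
  have "6 \<le> (\<nu> + 2) * (\<nu> + 1)" using mult_mono[of 3 "\<nu> + 2" 2 "\<nu> + 1"] assms(2) by simp
  then show False using assms(3,4) True by simp
next
  case False
  then have "a * e \<ge> 1" using assms(1) by simp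
  then have *: "\<delta> = 0" "a * e = 1" using assms(3) by linarith+
  then have "e = 1" by simp
  then show False using assms(2,4) unfolding * \<open>e = 1\<close> by auto
qed

text \<open>The quadratic expression is twice the Hilbert polynomial of the fibre over
  \<open>x\<close>, which consists of a curve of degree \<open>e\<close> and a residual part of
  length \<open>\<delta>\<close>. The last clause says that at \<open>\<nu>\<close> this polynomial
  differs from that of the plane.\<close>

lemma residual_hilbert_function:
  fixes f :: "4 \<Rightarrow> (3, 'k::field) mpol" and x :: "4 \<Rightarrow> 'l::field" and \<nu> :: int
  assumes \<sigma>: "field_hom (\<sigma> :: 'k \<Rightarrow> 'l)" and inf: "infinite (UNIV :: 'l set)"
    and f: "\<And>i. homog d (f i)" and ci: "locally_ci (fideal f)"
    and bd: "\<And>n. hfun (mul.span (range f)) n \<le> B"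
    and a: "\<And>i. homog \<epsilon> (b i)" and nz: "\<exists>i. subst f (b i) \<noteq> 0"
    and inv: "\<And>i j. subst f (b i) * Var j = subst f (b j) * Var i"
    and x: "x s0 \<noteq> 0" and \<nu>: "\<nu> \<ge> nu0 d f" "\<nu> \<ge> 1"
  shows "\<exists>e \<delta> :: int. \<exists>N. (\<forall>n\<ge>N. 2 * int (hfun (spec_ideal x (\<lambda>i. field_hom.ext \<sigma> (f i))) n) =
      (int n + 2) * (int n + 1) - (int n - e + 2) * (int n - e + 1) + 2 * \<delta>) \<and>
    2 * \<delta> \<noteq> (\<nu> - e + 2) * (\<nu> - e + 1)"
proof -
  interpret \<sigma>: field_hom \<sigma> by (rule \<sigma>)
  define F where "F i = \<sigma>.ext (f i)" for i
  let ?J = "spec_ideal x F"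
  have hF: "homog d (F i)" for i unfolding F_def using f by simp
  show ?thesis
  proof (cases "\<exists>s. x s \<noteq> 0 \<and> F s \<noteq> 0")
    \<comment> \<open>A form \<open>F s0\<close> with \<open>x s0 \<noteq> 0\<close> vanishes, so
      the colon ideal by it is the whole ring: the fibre is empty, with
      \<open>e = \<delta> = 0\<close>.\<close>
    case False
    then have "F s0 = 0" using x by blast
    then have "?J = UNIV"
      using graded_point_ideal[of x s0 d F, OF x hF] mul.subspace_0[of "point_ideal x F"]
      unfolding colon_point_ideal[of x s0, OF x, symmetric] colon_def graded_ideal_def by auto
    then have "hfun ?J n = 0" for n by (subst hfun_eq_0_iff) auto
    moreover have "(\<nu> + 2) * (\<nu> + 1) \<noteq> 0" using \<nu>(2) by auto
    ultimately show ?thesis unfolding F_def[symmetric]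
      by (intro exI[of _ 0]) simp
  next
    case True
    then obtain s where s: "x s \<noteq> 0" "F s \<noteq> 0" by blast
    have np: False if "\<And>i. F i = Cst (\<alpha> i) * p + Cst (\<beta> i) * q" for \<alpha> \<beta> p q
    proof -
      have "\<not> (\<exists>p q \<alpha> \<beta>. \<forall>i. F i = Cst (\<alpha> i) * p + Cst (\<beta> i) * q)"
      proof (rule not_in_pencil[of \<epsilon> b "\<lambda>i. \<sigma>.ext (subst f (b i))" \<sigma>])
        show "\<sigma>.ext (subst f (b i)) = mev (\<lambda>c. Cst (\<sigma> c)) F (b i)" for i
          unfolding \<sigma>.ext_subst F_def ..
        show "\<sigma>.ext (subst f (b i)) * Var j = \<sigma>.ext (subst f (b j)) * Var i" for i j
          using arg_cong[OF inv[of i j], of \<sigma>.ext] unfolding \<sigma>.ext.hom_mult \<sigma>.ext_Var .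
      qed (use a nz in auto)
      then show False using that by blast
    qed
    define t where "t i = F i - Cst (x i / x s) * F s" for i
    have Ft: "F i = t i + Cst (x i / x s) * F s" for i unfolding t_def by simp
    have ts: "t s = 0" unfolding t_def using s(1) by simp
    have ht: "homog d (t i)" for i unfolding t_def by (intro homog_diff homog_Cst_mult hF)
    have "\<exists>p. t p \<noteq> 0"
    proof (rule ccontr)
      assume "\<not> ?thesis"
      then have "F i = Cst (x i / x s) * F s + Cst 0 * 0" for i using Ft[of i] by simp
      then show False by (rule np)
    qed
    then obtain p where p: "t p \<noteq> 0" ..
    obtain h e k where h: "homog e h" "h \<noteq> 0" "e \<le> d" and k: "\<And>i. t i = h * k i" "\<And>i. homog (d - e) (k i)"
      and kunit: "\<And>g. (\<And>i. g dvd k i) \<Longrightarrow> g dvd 1"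
      using exists_homogeneous_gcd[of d t p, OF ht p] by blast
    define a where "a = d - e"
    have dae: "d = a + e" using h(3) unfolding a_def by simp
    have hk: "homog a (k i)" for i unfolding a_def by (rule k(2))
    \<comment> \<open>For \<open>a = 0\<close> the cofactors are constants, and all
      \<open>F i\<close> would lie in the pencil of \<open>h\<close> and \<open>F s\<close>.\<close>
    have a1: "a \<ge> 1"
    proof (rule ccontr)
      assume "\<not> a \<ge> 1"
      then have "a = 0" by simp
      have "\<exists>c. k i = Cst c" for i using hk[of i] unfolding \<open>a = 0\<close> homog_0_iff_Cst .
      then obtain c where "\<And>i. k i = Cst (c i)" by metis
      then have "F i = Cst (c i) * h + Cst (x i / x s) * F s" for i using Ft[of i] k(1)[of i] by (simp add: mult.commute)
      then show False by (rule np)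
    qed
    have "p \<noteq> s" using p ts by auto
    obtain q r where qr: "UNIV = {s, p, q, r}" "q \<noteq> r" "q \<noteq> s" "q \<noteq> p" "r \<noteq> s" "r \<noteq> p"
      by (rule four_elements[OF \<open>p \<noteq> s\<close>[symmetric]])
    have ks: "k s = 0" using ts k(1)[of s] h(2) by simp
    have kp: "k p \<noteq> 0" using p k(1)[of p] by auto
    \<comment> \<open>As \<open>k s = 0\<close>, the other three cofactors have no common factor; a
      general combination of two of them is then coprime to the third.\<close>
    have "\<exists>c. rel_prime (k p) (k q + Cst c * k r)"
    proof (rule exists_rel_prime_combination[OF inf kp])
      fix g assume g: "g dvd k p" "g dvd k q" "g dvd k r"
      have "g dvd k i" for i
      proof -
        have "i = s \<or> i = p \<or> i = q \<or> i = r" using qr(1) by blast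
        then show ?thesis using g ks by auto
      qed
      then show "g dvd 1" by (rule kunit)
    qed
    then obtain c where c: "rel_prime (k p) (k q + Cst c * k r)" ..
    define u where "u = k p"
    define v where "v = k q + Cst c * k r"
    have rp: "rel_prime u v" and hu: "homog a u" and hv: "homog a v" and u0: "u \<noteq> 0"
      using c kp hk unfolding u_def v_def by (auto intro!: homog_add homog_Cst_mult)
    have v0: "v \<noteq> 0"
    proof
      assume "v = 0"
      then have "u dvd v * 1" by simp
      then have "u dvd 1" by (rule rel_primeD[OF rp])
      then obtain a' where "a' \<le> 0" "homog a' u" using homog_dvd[of u 1 0] by auto
      then show False using homog_unique[OF hu _ u0] a1 by auto
    qed
    let ?K = "mul.span {k p, k q, k r}"
    have K: "mul.subspace ?K" by (rule mul.subspace_span)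
    have gK: "graded_ideal ?K" by (intro graded_span) (use hk in auto)
    have kK: "k i \<in> ?K" for i
    proof -
      have "i = s \<or> i = p \<or> i = q \<or> i = r" using qr(1) by blast
      then show ?thesis using ks mul.span_zero by (auto intro: mul.span_base)
    qed
    have uK: "u \<in> ?K" and vK: "v \<in> ?K"
      unfolding u_def v_def by (intro mul.subspace_add[OF K] mul.subspace_scale[OF K] kK)+
    have UK: "point_ideal x F = (*) h ` ?K"
    proof -
      have "- {s} = {p, q, r}" using qr \<open>p \<noteq> s\<close> by blast
      then have "t ` (- {s}) = (*) h ` {k p, k q, k r}" by (simp add: k(1))
      then show ?thesis unfolding point_ideal_eq_span[of x s, OF s(1)] t_def[symmetric] span_mult_image[symmetric] by (simp only:)
    qed
    have bdF: "hfun (mul.span (range F)) n = hfun (mul.span (range f)) n" for n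
      unfolding F_def by (rule \<sigma>.hfun_ext[OF f])
    \<comment> \<open>A common factor of \<open>h\<close> and \<open>F s\<close> would divide all
      the \<open>F i\<close>, against the boundedness of the Hilbert function of \<open>I\<close>.
      Coprimality lets \<open>h\<close> be pulled out of the colon ideal.\<close>
    have "rel_prime h (F s)"
    proof (rule rel_prime_if_common_units[OF h(2)])
      fix g assume g: "g dvd h" "g dvd F s"
      show "g dvd 1"
      proof (rule common_divisor_unit[of d F s B])
        show "g dvd F i" for i unfolding Ft[of i] k(1) by (intro dvd_add dvd_mult2 dvd_mult g)
      qed (use hF s bdF bd in auto)
    qed
    then have JK: "?J = (*) h ` colon ?K (F s)"
    proof -
      assume rph: "rel_prime h (F s)"
      show ?thesis
      proof (intro antisym subsetI)
        fix y assume "y \<in> ?J"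
        then have "F s * y \<in> (*) h ` ?K" unfolding colon_point_ideal[of x s, OF s(1), symmetric] UK colon_def by simp
        then obtain z where z: "F s * y = h * z" "z \<in> ?K" by blast
        then have "h dvd y" by (intro rel_primeD[OF rph dvdI])
        then obtain y' where y': "y = h * y'" by (rule dvdE)
        have "h * (F s * y') = h * z" using z(1) unfolding y' by (simp only: mult_ac)
        then have "F s * y' = z" using h(2) by simp
        then show "y \<in> (*) h ` colon ?K (F s)" unfolding y' colon_def using z(2) by (intro imageI) simp
      next
        fix y assume "y \<in> (*) h ` colon ?K (F s)"
        then obtain y' where y': "y = h * y'" "F s * y' \<in> ?K" unfolding colon_def by blast
        have "F s * y = h * (F s * y')" unfolding y'(1) by (simp only: mult_ac)
        then have "F s * y \<in> (*) h ` ?K" using y'(2) by (rule image_eqI)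
        then show "y \<in> ?J" unfolding colon_point_ideal[of x s, OF s(1), symmetric] UK colon_def by simp
      qed
    qed
    let ?I = "mul.span (range F)" and ?m = "\<nu> - int e"
    have I: "mul.subspace ?I" by (rule mul.subspace_span)
    have tI: "t i \<in> ?I" for i
      unfolding t_def by (intro mul.subspace_diff[OF I] mul.subspace_scale[OF I] mul.span_base rangeI)
    have hI: "h * y \<in> ?I" if "y \<in> mul.span (insert (F s) ?K)" for y
    proof -
      have "(*) h ` insert (F s) {k p, k q, k r} \<subseteq> ?I"
        using tI mul.subspace_scale[OF I mul.span_base[of "F s" "range F"], of h] unfolding k(1) by auto
      then have "mul.span ((*) h ` insert (F s) {k p, k q, k r}) \<subseteq> ?I" by (rule mul.span_minimal[OF _ I])
      then show ?thesis using that unfolding span_mult_image span_insert_span by blast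
    qed
    obtain N \<delta> where \<delta>: "\<And>n. n \<ge> N \<Longrightarrow> hfun (colon ?K (F s)) n = \<delta>" "2 * int \<delta> \<le> (?m + 2) * (?m + 1)"
      "2 * int \<delta> = (?m + 2) * (?m + 1) \<Longrightarrow> \<forall>t\<in>?K. t \<in> mul.span {u, v}"
    \<comment> \<open>With \<open>m = \<nu> - e\<close> and \<open>j = 2a - 3 - m\<close>, the form
      \<open>h * y\<close> has degree \<open>e + j = 2d - 3 - \<nu>\<close>. By
      \<open>\<nu> \<ge> nu0 d f\<close> this is below the initial degree of the saturation, so
      \<open>h * y\<close> vanishes.\<close>
    proof (rule residual_bound[OF inf hu u0 hv v0 rp a1 gK uK vK hF s(2), of ?m])
      fix j y N
      assume j: "int j + ?m = 2 * int a - 3" and y: "homog j y"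
        "\<And>\<mu>. mdeg \<mu> = N \<Longrightarrow> mon \<mu> * y \<in> mul.span (insert (F s) ?K)"
      have "h * y = 0"
      proof (rule \<sigma>.form_zero_descent[of _ "e + j" N f d])
        show "h * y \<in> forms (e + j)" using homog_mult[OF h(1) y(1)] by (simp add: forms_def)
        show "mon \<mu> * (h * y) \<in> mul.span (range (\<lambda>i. \<sigma>.ext (f i)))" if "mdeg \<mu> = N" for \<mu>
        proof -
          have "h * (mon \<mu> * y) \<in> ?I" by (rule hI[OF y(2)[OF that]])
          then show ?thesis unfolding F_def by (simp only: mult.left_commute)
        qed
        fix z :: "(3, 'k) mpol"
        assume z: "z \<in> forms (e + j)" "\<And>m. mdeg m = N \<Longrightarrow> mon m * z \<in> mul.span (range f)"
        show "z = 0"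
        proof (rule saturation_form_zero[OF mul.subspace_span z(2)])
          show "homog (e + j) z" using z(1) by (simp add: forms_def)
          show "e + j < indeg (saturation (mul.span (range f)))"
            using \<nu>(1) j dae unfolding nu0_def fideal_def genideal_class_ring by linarith
        qed
      qed (rule f)
      then show "y = 0" using h(2) by simp
    qed (blast)
    have hJ: "hfun ?J (n + e) + cc n = cc (n + e) + \<delta>" if "n \<ge> N" for n
      unfolding JK using hfun_mult_image[OF h(1,2), of "colon ?K (F s)" n] \<delta>(1)[OF that] by simp
    have "2 * int (hfun ?J n) = (int n + 2) * (int n + 1) - (int n - int e + 2) * (int n - int e + 1) + 2 * int \<delta>" if "n \<ge> N + e" for n
    proof -
      define n' where "n' = n - e"
      have n': "n = n' + e" "n' \<ge> N" using that unfolding n'_def by auto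
      have "2 * int (hfun ?J n) + 2 * int (cc n') = 2 * int (cc n) + 2 * int \<delta>" using hJ[OF n'(2)] unfolding n'(1) by linarith
      then show ?thesis unfolding int_choose_2 unfolding n'(1) by simp
    qed
    moreover have "2 * int \<delta> \<noteq> (?m + 2) * (?m + 1)"
    proof
      assume eq: "2 * int \<delta> = (?m + 2) * (?m + 1)"
      then have Kuv: "\<And>t. t \<in> ?K \<Longrightarrow> t \<in> mul.span {u, v}" using \<delta>(3) by blast
      have KE: "?K = mul.span {u, v}"
        using mul.span_minimal[OF _ K, of "{u, v}"] uK vK Kuv by blast
      obtain \<alpha> \<beta> where kr: "k r = Cst \<alpha> * u + Cst \<beta> * v" using span_pair_constants[OF hu hv hk Kuv[OF kK]] by blast
      \<comment> \<open>Rearranges \<open>k r = \<alpha> k_p + \<beta> (k_q + c k_r)\<close>. The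
        relation is nontrivial: for \<open>\<beta> = 0\<close> the coefficient of \<open>k r\<close>
        is 1.\<close>
      define g where "g i = (if i = p then - \<alpha> else if i = q then - \<beta> else if i = r then 1 - \<beta> * c else 0)" for i
      have gk: "(\<Sum>i\<in>UNIV. Cst (g i) * k i) = 0"
        using qr \<open>p \<noteq> s\<close> kr unfolding qr(1) g_def u_def v_def
        by (simp add: ks Cst_diff Cst_uminus Cst_mult algebra_simps)
      have gt: "(\<Sum>i\<in>UNIV. Cst (g i) * t i) = 0"
      proof -
        have "(\<Sum>i\<in>UNIV. Cst (g i) * t i) = h * (\<Sum>i\<in>UNIV. Cst (g i) * k i)"
          unfolding k(1) sum_distrib_left by (simp only: mult.left_commute)
        then show ?thesis unfolding gk by simp
      qed
      \<comment> \<open>The correction at \<open>s\<close> absorbs the multiples of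
        \<open>F s\<close> inside the \<open>t i\<close>, so that a relation among the
        \<open>t i\<close> becomes one among the \<open>F i\<close>.\<close>
      define g' where "g' i = g i + (if i = s then - (\<Sum>j\<in>UNIV. g j * (x j / x s)) else 0)" for i
      have g'F: "(\<Sum>i\<in>UNIV. Cst (g' i) * F i) = 0"
      proof -
        have "(\<Sum>i\<in>UNIV. Cst (g' i) * F i) = (\<Sum>i\<in>UNIV. Cst (g i) * F i) + (\<Sum>i\<in>UNIV. (if i = s then Cst (- (\<Sum>j\<in>UNIV. g j * (x j / x s))) else 0) * F i)"
          unfolding g'_def by (simp add: Cst_add distrib_right sum.distrib if_distrib[of Cst] cong: if_cong)
        also have "(\<Sum>i\<in>UNIV. (if i = s then Cst (- (\<Sum>j\<in>UNIV. g j * (x j / x s))) else 0) * F i) = - (\<Sum>j\<in>UNIV. Cst (g j) * (Cst (x j / x s) * F s))"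
          unfolding sum_delta_mult(1) Cst_uminus Cst_sum Cst_mult by (simp add: sum_distrib_right mult.assoc)
        also have "(\<Sum>i\<in>UNIV. Cst (g i) * F i) = (\<Sum>i\<in>UNIV. Cst (g i) * t i) + (\<Sum>i\<in>UNIV. Cst (g i) * (Cst (x i / x s) * F s))"
          unfolding sum.distrib[symmetric] distrib_left[symmetric] Ft[symmetric] ..
        finally show ?thesis unfolding gt by simp
      qed
      have "\<exists>j. g' j \<noteq> 0"
      proof (cases "\<beta> = 0")
        case True then show ?thesis using qr by (intro exI[of _ r]) (simp add: g'_def g_def)
      next
        case False then show ?thesis using qr by (intro exI[of _ q]) (simp add: g'_def g_def)
      qed
      then obtain j where j: "g' j \<noteq> 0" ..
      \<comment> \<open>The dependence descends to \<open>k\<close>, where the bound on the degree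
        of \<open>V(I)\<close> for planar images applies.\<close>
      obtain \<rho> where \<rho>: "\<rho> j \<noteq> 0" "(\<Sum>i\<in>UNIV. Cst (\<rho> i) * f i) = 0"
        using \<sigma>.linear_relation_descent[of g' f j] g'F j unfolding F_def by blast
      obtain M where M: "\<And>n. n \<ge> M \<Longrightarrow> d * d \<le> hfun (mul.span (range f)) n + 1"
        using degree_bound_planar[OF f ci bd assms(6) nz inv \<rho>(2,1)] by blast
      define n where "n = M + N"
      have 1: "hfun (point_ideal x F) (n + e + a + a + e) + cc (n + e + a + a) = cc (n + e + a + a + e) + a * a"
        unfolding UK hfun_mult_image[OF h(1,2)] KE hfun_pair_ge(2)[OF hu u0 hv v0 rp] ..
      have 2: "hfun (point_ideal x F) (n + a + e + d) = hfun (mul.span (range f)) (n + a + e + d) + hfun ?J (n + a + e)"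
        unfolding hfun_point_ideal[of x s F d, OF s hF] bdF ..
      have 3: "hfun ?J (n + a + e) + cc (n + a) = cc (n + a + e) + \<delta>" by (rule hJ) (simp add: n_def)
      have 4: "int (cc (n + a + (a + e) + e)) - int (cc (n + a + (a + e))) - int (cc (n + a + e)) + int (cc (n + a)) = int (a + e) * int e"
        by (rule second_difference)
      have 5: "d * d \<le> hfun (mul.span (range f)) (n + a + e + d) + 1" by (rule M) (simp add: n_def)
      have i: "n + a + e + d = n + e + a + a + e" "n + a + (a + e) + e = n + e + a + a + e" "n + a + (a + e) = n + e + a + a"
        unfolding dae by simp_all
      \<comment> \<open>Writing \<open>deg I\<close> for the value in large degrees, the identities
        above give \<open>deg I = d e + a\<^sup>2 - \<delta>\<close>. With \<open>d = a + e\<close>,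
        the bound \<open>deg I \<ge> d\<^sup>2 - 1\<close> becomes
        \<open>\<delta> + a e \<le> 1\<close>.\<close>
      have "int (d * d) = int (a + e) * int e + int a * int e + int (a * a)" unfolding dae by (simp add: algebra_simps)
      then have "int \<delta> + int a * int e \<le> 1"
        using 1 2 3 4 5 unfolding i by linarith
      then have "\<delta> + a * e \<le> 1" by (metis of_nat_add of_nat_mult of_nat_1 of_nat_le_iff)
      then show False by (rule final_numerics[OF a1 \<nu>(2) _ eq])
    qed
    ultimately show ?thesis unfolding F_def[symmetric] by blast
  qed
qed

section \<open>The residue field at a point\<close>

text \<open>The data \<open>f\<close>, \<open>d\<close> and \<open>\<nu>\<close> are bound inside,
  so that this is a property of the prime alone and a prime can be chosen that depends only on
  \<open>'k\<close>.\<close>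

definition exceptional :: "(4, 'k::field) mpol set \<Rightarrow> bool"
  where "exceptional p \<longleftrightarrow> p \<in> Proj \<and> (\<exists>f d \<nu>. (\<forall>i. homog d (f i)) \<and> birational_onto f (image_closure f) \<and>
    finite (Vplus (fideal f)) \<and> locally_ci (fideal f) \<and> \<nu> \<ge> nu0 d f \<and> \<nu> \<ge> 1 \<and>
    poly (HP_fibre f p) (of_int \<nu>) = of_int (\<nu> + 2) gchoose 2)"

text \<open>A type cannot depend on a prime, but the residue field at one fixed exceptional prime can be made a type.\<close>

definition bad_prime :: "(4, 'k::field) mpol set"
  where "bad_prime = (if \<exists>p :: (4, 'k) mpol set. exceptional p then SOME p. exceptional p else {0})"

lemma exceptional_bad_prime: "exceptional (p :: (4, 'k::field) mpol set) \<Longrightarrow> exceptional (bad_prime :: (4, 'k) mpol set)"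
  unfolding bad_prime_def by (auto intro: someI)

text \<open>The default \<open>{0}\<close> is prime too, so the quotient is a domain
  unconditionally, as the class instances below require.\<close>

lemma bad_prime_prime:
  shows "mul.subspace (bad_prime :: (4, 'k::field) mpol set)" (is ?A) and "(1 :: (4, 'k) mpol) \<notin> bad_prime" (is ?B)
    and "(a :: (4, 'k) mpol) * b \<in> bad_prime \<longleftrightarrow> a \<in> bad_prime \<or> b \<in> bad_prime" (is ?C)
proof -
  have "?A \<and> ?B \<and> ?C"
  proof (cases "\<exists>p :: (4, 'k) mpol set. exceptional p")
    case True
    then have "(bad_prime :: (4, 'k) mpol set) \<in> Proj" using exceptional_bad_prime by (auto simp: exceptional_def)
    then show ?thesis using Proj_subspace Proj_one Proj_mult_iff by blast
  next
    case False
    then have eq: "bad_prime = {0 :: (4, 'k) mpol}" unfolding bad_prime_def by (rule if_not_P)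
    show ?thesis unfolding eq by (simp add: mul.subspace_single_0)
  qed
  then show ?A ?B ?C by blast+
qed

lemma bad_prime_closed:
  fixes a b :: "(4, 'k::field) mpol"
  shows "0 \<in> (bad_prime :: (4, 'k) mpol set)" "a \<in> bad_prime \<Longrightarrow> b \<in> bad_prime \<Longrightarrow> a + b \<in> bad_prime"
    "a \<in> bad_prime \<Longrightarrow> - a \<in> bad_prime" "a \<in> bad_prime \<Longrightarrow> b * a \<in> bad_prime" "a \<in> bad_prime \<Longrightarrow> a * b \<in> bad_prime"
  using mul.subspace_0[OF bad_prime_prime(1)] mul.subspace_add[OF bad_prime_prime(1)] mul.subspace_neg[OF bad_prime_prime(1)]
    mul.subspace_scale[OF bad_prime_prime(1)] mul_scale[OF bad_prime_prime(1)] by blast+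

quotient_type (overloaded) 'k residue_dom = "(4, 'k::field) mpol" / "\<lambda>a b. a - b \<in> bad_prime"
proof (rule equivpI)
  show "reflp (\<lambda>a b :: (4, 'k) mpol. a - b \<in> bad_prime)" by (rule reflpI) (simp add: bad_prime_closed)
  show "symp (\<lambda>a b :: (4, 'k) mpol. a - b \<in> bad_prime)"
    by (rule sympI) (use bad_prime_closed(3) in fastforce)
  show "transp (\<lambda>a b :: (4, 'k) mpol. a - b \<in> bad_prime)"
    by (rule transpI) (use bad_prime_closed(2) in fastforce)
qed

instantiation residue_dom :: (field) comm_ring_1
begin

lift_definition zero_residue_dom :: "'a residue_dom" is 0 .
lift_definition one_residue_dom :: "'a residue_dom" is 1 .
lift_definition plus_residue_dom :: "'a residue_dom \<Rightarrow> 'a residue_dom \<Rightarrow> 'a residue_dom" is "(+)"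
  subgoal for a b c d using bad_prime_closed(2)[of "a - b" "c - d"] by (simp add: algebra_simps) done
lift_definition uminus_residue_dom :: "'a residue_dom \<Rightarrow> 'a residue_dom" is uminus
  subgoal for a b using bad_prime_closed(3)[of "a - b"] by simp done
lift_definition minus_residue_dom :: "'a residue_dom \<Rightarrow> 'a residue_dom \<Rightarrow> 'a residue_dom" is "(-)"
  subgoal for a b c d using bad_prime_closed(2)[OF _ bad_prime_closed(3), of "a - b" "c - d"] by (simp add: algebra_simps) done
lift_definition times_residue_dom :: "'a residue_dom \<Rightarrow> 'a residue_dom \<Rightarrow> 'a residue_dom" is "(*)"
  subgoal for a b c d
    using bad_prime_closed(2)[OF bad_prime_closed(4)[of "c - d" a] bad_prime_closed(4)[of "a - b" d]] by (simp add: algebra_simps) done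

instance
proof
  fix a b c :: "'a residue_dom"
  show "a * b * c = a * (b * c)" by transfer (simp add: bad_prime_closed mult.assoc)
  show "a * b = b * a" by transfer (simp add: bad_prime_closed mult.commute)
  show "1 * a = a" by transfer (simp add: bad_prime_closed)
  show "a + b + c = a + (b + c)" by transfer (simp add: bad_prime_closed add.assoc)
  show "a + b = b + a" by transfer (simp add: bad_prime_closed add.commute)
  show "0 + a = a" by transfer (simp add: bad_prime_closed)
  show "- a + a = 0" by transfer (simp add: bad_prime_closed)
  show "a - b = a + - b" by transfer (simp add: bad_prime_closed)
  show "(a + b) * c = a * c + b * c" by transfer (simp add: bad_prime_closed distrib_right)
  show "(0 :: 'a residue_dom) \<noteq> 1" by transfer (use bad_prime_prime(2) bad_prime_closed(3) in fastforce)
qed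

end

instance residue_dom :: (field) idom
proof
  fix a b :: "'a residue_dom"
  show "a \<noteq> 0 \<Longrightarrow> b \<noteq> 0 \<Longrightarrow> a * b \<noteq> 0" by transfer (simp add: bad_prime_prime(3))
qed

definition cls :: "(4, 'k::field) mpol \<Rightarrow> 'k residue_dom"
  where "cls = abs_residue_dom"

lemma cls_eq_0_iff [simp]: "cls a = 0 \<longleftrightarrow> a \<in> bad_prime"
  unfolding cls_def zero_residue_dom.abs_eq by (simp add: residue_dom.abs_eq_iff)

lemma cls_hom: "cls 0 = 0" "cls 1 = 1" "cls (a + b) = cls a + cls b" "cls (a * b) = cls a * cls b" "cls (- a) = - cls a"
  unfolding cls_def zero_residue_dom.abs_eq one_residue_dom.abs_eq plus_residue_dom.abs_eq times_residue_dom.abs_eq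
    uminus_residue_dom.abs_eq by (rule refl)+

lemma cls_surj: "\<exists>a. cls a = c"
  unfolding cls_def by (induction c rule: residue_dom.abs_induct) (rule exI, rule refl)

text \<open>The reduction map from the local ring to its residue field. The choice is restricted to
  denominators outside the prime, since other representations could reduce to a zero
  denominator.\<close>

definition eval_residue :: "(4, 'k::field) mpol fract \<Rightarrow> 'k residue_dom fract"
  where "eval_residue r = (let ab = SOME ab. r = Fract (fst ab) (snd ab) \<and> snd ab \<notin> bad_prime in Fract (cls (fst ab)) (cls (snd ab)))"

lemma eval_residue_Fract:
  assumes b: "b \<notin> bad_prime"
  shows "eval_residue (Fract a b) = Fract (cls a) (cls b)"
proof -
  let ?P = "\<lambda>ab. Fract a b = Fract (fst ab) (snd ab) \<and> snd ab \<notin> bad_prime"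
  define ab where "ab = (SOME ab. ?P ab)"
  have "?P ab" unfolding ab_def by (rule someI[of ?P "(a, b)"]) (simp add: b)
  then have ab: "Fract a b = Fract (fst ab) (snd ab)" "snd ab \<notin> bad_prime" by blast+
  have nz: "b \<noteq> 0" "snd ab \<noteq> 0" using b ab(2) bad_prime_closed(1) by auto
  then have "a * snd ab = fst ab * b" using ab(1) by (simp add: eq_fract)
  then have "cls a * cls (snd ab) = cls (fst ab) * cls b" unfolding cls_hom(4)[symmetric] by simp
  then have "Fract (cls a) (cls b) = Fract (cls (fst ab)) (cls (snd ab))" using b ab(2) by (simp add: eq_fract)
  then show ?thesis unfolding eval_residue_def ab_def[symmetric] Let_def by simp
qed

lemma local_ring_simps:
  "carrier (local_ring p) = {Fract a b | a b. b \<notin> p}" "(\<otimes>\<^bsub>local_ring p\<^esub>) = (*)" "(\<oplus>\<^bsub>local_ring p\<^esub>) = (+)"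
  "\<one>\<^bsub>local_ring p\<^esub> = 1" "\<zero>\<^bsub>local_ring p\<^esub> = 0"
  by (simp_all add: local_ring_def)

abbreviation bad_ring :: "(4, 'k::field) mpol fract ring"
  where "bad_ring \<equiv> local_ring bad_prime"

lemma bad_ring_closed:
  assumes "x \<in> carrier bad_ring" "y \<in> carrier bad_ring"
  shows "x + y \<in> carrier bad_ring" "x * y \<in> carrier bad_ring" "- x \<in> carrier bad_ring"
    "eval_residue (x + y) = eval_residue x + eval_residue y" "eval_residue (x * y) = eval_residue x * eval_residue y"
proof -
  obtain a b c d where x: "x = Fract a b" "b \<notin> bad_prime" and y: "y = Fract c d" "d \<notin> bad_prime"
    using assms unfolding local_ring_simps by blast
  have nz: "b \<noteq> 0" "d \<noteq> 0" and bd: "b * d \<notin> bad_prime" using x y bad_prime_closed(1) by (auto simp: bad_prime_prime(3))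
  have s: "x + y = Fract (a * d + c * b) (b * d)" and m: "x * y = Fract (a * c) (b * d)" and u: "- x = Fract (- a) b"
    unfolding x y by (rule add_fract[OF nz], rule mult_fract, rule minus_fract)
  show "x + y \<in> carrier bad_ring" "x * y \<in> carrier bad_ring" "- x \<in> carrier bad_ring"
    unfolding s m u local_ring_simps using bd x(2) by blast+
  have cz: "cls b \<noteq> 0" "cls d \<noteq> 0" using x(2) y(2) by simp_all
  show "eval_residue (x + y) = eval_residue x + eval_residue y"
    unfolding s eval_residue_Fract[OF bd] unfolding x(1) y(1) eval_residue_Fract[OF x(2)] eval_residue_Fract[OF y(2)] cls_hom add_fract[OF cz] ..
  show "eval_residue (x * y) = eval_residue x * eval_residue y"
    unfolding m eval_residue_Fract[OF bd] unfolding x(1) y(1) eval_residue_Fract[OF x(2)] eval_residue_Fract[OF y(2)] cls_hom mult_fract ..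
qed

lemma bad_ring_const: "Fract a 1 \<in> carrier bad_ring"
  unfolding local_ring_simps using bad_prime_prime(2) by blast

lemma bad_ring_0_1: "0 \<in> carrier bad_ring" "1 \<in> carrier bad_ring"
  using bad_ring_const[of 0] bad_ring_const[of 1] unfolding Zero_fract_def One_fract_def .

lemma bad_ring_cring: "cring (bad_ring :: (4, 'k::field) mpol fract ring)"
proof (rule cringI)
  show "abelian_group (bad_ring :: (4, 'k) mpol fract ring)"
  proof (rule abelian_groupI)
    fix x :: "(4, 'k) mpol fract" assume x: "x \<in> carrier bad_ring"
    show "\<exists>y\<in>carrier bad_ring. y \<oplus>\<^bsub>bad_ring\<^esub> x = \<zero>\<^bsub>bad_ring\<^esub>"
      using bad_ring_closed(3)[OF x x] by (intro bexI[of _ "- x"]) (simp_all add: local_ring_simps(2-))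
  qed (simp_all only: local_ring_simps(2-) bad_ring_closed bad_ring_0_1 add_ac add_0_right add_0_left)
  show "comm_monoid (bad_ring :: (4, 'k) mpol fract ring)"
    by (rule comm_monoidI) (simp_all only: local_ring_simps(2-) bad_ring_closed bad_ring_0_1 mult_ac mult_1_left mult_1_right)
qed (simp_all only: local_ring_simps(2-) distrib_right)

lemma class_ring_cring: "cring (class_ring :: 'a::comm_ring_1 ring)"
proof (rule cringI)
  show "abelian_group (class_ring :: 'a ring)"
    by (rule abelian_groupI) (auto simp: add_ac intro: exI[of _ "- x" for x])
  show "comm_monoid (class_ring :: 'a ring)"
    by (rule comm_monoidI) (auto simp: mult_ac)
qed (simp add: distrib_right)

lemma eval_residue_hom: "ring_hom_ring bad_ring class_ring (eval_residue :: _ \<Rightarrow> 'k::field residue_dom fract)"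
proof (rule ring_hom_ringI2)
  show "ring (bad_ring :: (4, 'k) mpol fract ring)" "ring (class_ring :: 'k residue_dom fract ring)"
    using bad_ring_cring class_ring_cring cring.axioms(1) by blast+
  have "eval_residue 1 = (1 :: 'k residue_dom fract)"
    unfolding One_fract_def eval_residue_Fract[OF bad_prime_prime(2)] cls_hom ..
  then show "(eval_residue :: _ \<Rightarrow> 'k residue_dom fract) \<in> Ring.ring_hom bad_ring class_ring"
    by (intro ring_hom_memI) (simp_all add: local_ring_simps(2-) bad_ring_closed)
qed

lemma eval_residue_surj: "eval_residue ` carrier bad_ring = (UNIV :: 'k::field residue_dom fract set)"
proof (intro equalityI subset_UNIV subsetI)
  fix r :: "'k residue_dom fract"
  obtain A B where r: "r = Fract A B" "B \<noteq> 0" by (cases r)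
  obtain a b where ab: "cls a = A" "cls b = B" using cls_surj by metis
  then have b: "b \<notin> bad_prime" using r(2) by auto
  have "eval_residue (Fract a b) = r" unfolding eval_residue_Fract[OF b] r(1) ab ..
  moreover have "Fract a b \<in> carrier bad_ring" unfolding local_ring_simps using b by blast
  ultimately show "r \<in> eval_residue ` carrier bad_ring" by blast
qed

text \<open>Exhibits the ideal that \<open>kappa\<close> divides by as a kernel, so that the
  homomorphism theorem identifies \<open>kappa\<close> with a field that is a type.\<close>

lemma kernel_eval_residue: "a_kernel bad_ring class_ring eval_residue = local_max (bad_prime :: (4, 'k::field) mpol set)"
proof -
  interpret h: ring_hom_ring "bad_ring :: (4, 'k) mpol fract ring" class_ring eval_residue by (rule eval_residue_hom)
  let ?E = "(\<lambda>a. Fract a 1) ` (bad_prime :: (4, 'k) mpol set)"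
  have E: "?E \<subseteq> carrier bad_ring" using bad_ring_const by blast
  show ?thesis unfolding local_max_def
  proof
    show "Idl\<^bsub>bad_ring\<^esub> ?E \<subseteq> a_kernel bad_ring class_ring eval_residue"
    proof (rule h.R.genideal_minimal[OF h.kernel_is_ideal])
      show "?E \<subseteq> a_kernel bad_ring class_ring eval_residue"
      proof (rule image_subsetI)
        fix a :: "(4, 'k) mpol" assume "a \<in> bad_prime"
        then have "eval_residue (Fract a 1) = 0"
          unfolding eval_residue_Fract[OF bad_prime_prime(2)] Zero_fract_def by (simp add: eq_fract cls_hom)
        then show "Fract a 1 \<in> a_kernel bad_ring class_ring eval_residue"
          unfolding a_kernel_def' using bad_ring_const[of a] by simp
      qed
    qed
    show "a_kernel bad_ring class_ring eval_residue \<subseteq> Idl\<^bsub>bad_ring\<^esub> ?E"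
    proof
      fix x :: "(4, 'k) mpol fract" assume "x \<in> a_kernel bad_ring class_ring eval_residue"
      then have x: "x \<in> carrier bad_ring" "eval_residue x = 0" unfolding a_kernel_def' by simp_all
      then obtain a b where ab: "x = Fract a b" "b \<notin> bad_prime" unfolding local_ring_simps by blast
      have "Fract (cls a) (cls b) = 0" using x(2) unfolding ab(1) eval_residue_Fract[OF ab(2)] .
      then have "cls a = 0" using ab(2) by (simp add: Zero_fract_def eq_fract)
      then have "a \<in> bad_prime" by (rule cls_eq_0_iff[THEN iffD1])
      then have "Fract a 1 \<in> Idl\<^bsub>bad_ring\<^esub> ?E" by (intro subsetD[OF h.R.genideal_self[OF E]] imageI)
      moreover have "Fract 1 b \<in> carrier bad_ring" unfolding local_ring_simps using ab(2) by blast
      ultimately have "Fract a 1 \<otimes>\<^bsub>bad_ring\<^esub> Fract 1 b \<in> Idl\<^bsub>bad_ring\<^esub> ?E"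
        by (intro ideal.I_r_closed[OF h.R.genideal_ideal[OF E]])
      then show "x \<in> Idl\<^bsub>bad_ring\<^esub> ?E" unfolding ab(1) local_ring_simps mult_fract by simp
    qed
  qed
qed

abbreviation bad_kappa :: "(4, 'k::field) mpol fract set ring"
  where "bad_kappa \<equiv> kappa bad_prime"

definition residue :: "(4, 'k::field) mpol fract set \<Rightarrow> 'k residue_dom fract"
  where "residue = (\<lambda>U. the_elem (eval_residue ` U))"

lemma residue_iso: "(residue :: _ \<Rightarrow> 'k::field residue_dom fract) \<in> ring_iso bad_kappa class_ring"
  unfolding residue_def kappa_def kernel_eval_residue[symmetric]
  by (rule ring_hom_ring.FactRing_iso_set[OF eval_residue_hom]) (simp add: eval_residue_surj)

lemma residue_to_kappa:
  fixes r :: "(4, 'k::field) mpol"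
  shows "to_kappa bad_prime r \<in> carrier bad_kappa" "residue (to_kappa bad_prime r) = to_fract (cls r)"
proof -
  interpret h: ring_hom_ring "bad_ring :: (4, 'k) mpol fract ring" class_ring eval_residue by (rule eval_residue_hom)
  interpret I: ideal "local_max bad_prime" "bad_ring :: (4, 'k) mpol fract ring"
    unfolding kernel_eval_residue[symmetric] by (rule h.kernel_is_ideal)
  have c: "Fract r 1 \<in> carrier bad_ring" by (rule bad_ring_const)
  show "to_kappa bad_prime r \<in> carrier bad_kappa"
    unfolding to_kappa_def kappa_def FactRing_def using h.R.a_rcosetsI[OF I.a_subset c] by simp
  have "eval_residue y = eval_residue (Fract r 1)" if "y \<in> to_kappa bad_prime r" for y
  proof -
    from that[unfolded to_kappa_def a_r_coset_def'] obtain z where z: "z \<in> local_max bad_prime" "y = z + Fract r 1"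
      unfolding local_ring_simps(3) by (elim UN_E singletonE)
    have "z \<in> a_kernel bad_ring class_ring eval_residue" unfolding kernel_eval_residue by (rule z(1))
    then have "z \<in> carrier bad_ring" "eval_residue z = 0" unfolding a_kernel_def' by simp_all
    then show ?thesis unfolding z(2) using bad_ring_closed(4)[OF _ c] by simp
  qed
  moreover have "Fract r 1 \<in> to_kappa bad_prime r" unfolding to_kappa_def by (rule I.a_rcos_self[OF c])
  ultimately have "eval_residue ` to_kappa bad_prime r = {eval_residue (Fract r 1)}" by blast
  then show "residue (to_kappa bad_prime r) = to_fract (cls r)"
    unfolding residue_def eval_residue_Fract[OF bad_prime_prime(2)] cls_hom to_fract_def by simp
qed

lemma bad_kappa_cring: "cring (bad_kappa :: (4, 'k::field) mpol fract set ring)"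
proof -
  interpret h: ring_hom_ring "bad_ring :: (4, 'k) mpol fract ring" class_ring eval_residue by (rule eval_residue_hom)
  show ?thesis unfolding kappa_def kernel_eval_residue[symmetric]
    by (rule ideal.quotient_is_cring[OF h.kernel_is_ideal bad_ring_cring])
qed

section \<open>Fibres as base changes\<close>

text \<open>The module axioms of \<open>V\<close> are pulled back along the injective semilinear map
  \<open>T\<close>, so none has to be verified inside a tensor product. \<open>K\<close> is a field
  because it is isomorphic to one.\<close>

lemma vectorspace_dim_transport:
  fixes K :: "('a, 'b) ring_scheme" and V :: "('a, 'v, 'c) module_scheme"
    and \<theta> :: "'a \<Rightarrow> 'l::field" and T :: "'v \<Rightarrow> (3, 'l) mpol"
  assumes K: "cring K" and \<theta>: "\<theta> \<in> ring_iso K class_ring"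
    and V: "\<And>v w. v \<in> carrier V \<Longrightarrow> w \<in> carrier V \<Longrightarrow> v \<oplus>\<^bsub>V\<^esub> w \<in> carrier V" "\<zero>\<^bsub>V\<^esub> \<in> carrier V"
      "\<And>a v. a \<in> carrier K \<Longrightarrow> v \<in> carrier V \<Longrightarrow> a \<odot>\<^bsub>V\<^esub> v \<in> carrier V"
    and inj: "inj_on T (carrier V)"
    and T: "\<And>v w. v \<in> carrier V \<Longrightarrow> w \<in> carrier V \<Longrightarrow> T (v \<oplus>\<^bsub>V\<^esub> w) = T v + T w" "T \<zero>\<^bsub>V\<^esub> = 0"
      "\<And>a v. a \<in> carrier K \<Longrightarrow> v \<in> carrier V \<Longrightarrow> T (a \<odot>\<^bsub>V\<^esub> v) = Cst (\<theta> a) * T v"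
    and fd: "fin_dim (T ` carrier V)"
  shows "vectorspace.dim K V = mvs.dim (T ` carrier V)"
proof -
  interpret K: cring K by (rule K)
  have hom: "\<theta> (a \<otimes>\<^bsub>K\<^esub> b) = \<theta> a * \<theta> b" "\<theta> (a \<oplus>\<^bsub>K\<^esub> b) = \<theta> a + \<theta> b" if "a \<in> carrier K" "b \<in> carrier K" for a b
    using ring_iso_memE(2,3)[OF \<theta> that] by simp_all
  have one: "\<theta> \<one>\<^bsub>K\<^esub> = 1" using ring_iso_memE(4)[OF \<theta>] by simp
  have zero: "\<theta> \<zero>\<^bsub>K\<^esub> = 0" using hom(2)[OF K.zero_closed K.zero_closed] unfolding K.l_zero[OF K.zero_closed]
    by (metis add_cancel_right_right)
  have bij: "bij_betw \<theta> (carrier K) UNIV" using ring_iso_memE(5)[OF \<theta>] by simp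
  have \<theta>inj: "a = b" if "\<theta> a = \<theta> b" "a \<in> carrier K" "b \<in> carrier K" for a b
    using bij that by (auto simp: bij_betw_def inj_on_def)
  have \<theta>surj: "\<exists>a\<in>carrier K. \<theta> a = l" for l
    using bij unfolding bij_betw_def by (metis UNIV_I imageE)
  have F: "field K"
  proof (rule K.cring_fieldI2)
    show "\<zero>\<^bsub>K\<^esub> \<noteq> \<one>\<^bsub>K\<^esub>" using zero one by auto
    fix a assume a: "a \<in> carrier K" "a \<noteq> \<zero>\<^bsub>K\<^esub>"
    then have nz: "\<theta> a \<noteq> 0" using \<theta>inj[of a "\<zero>\<^bsub>K\<^esub>"] zero by auto
    obtain b where b: "b \<in> carrier K" "\<theta> b = inverse (\<theta> a)" using \<theta>surj by blast
    have "\<theta> (a \<otimes>\<^bsub>K\<^esub> b) = \<theta> \<one>\<^bsub>K\<^esub>" using hom(1)[OF a(1) b(1)] b(2) nz one by simp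
    then have "a \<otimes>\<^bsub>K\<^esub> b = \<one>\<^bsub>K\<^esub>" using a(1) b(1) by (intro \<theta>inj) auto
    then show "\<exists>b\<in>carrier K. a \<otimes>\<^bsub>K\<^esub> b = \<one>\<^bsub>K\<^esub>" using b(1) by blast
  qed
  have Tinj: "v = w" if "T v = T w" "v \<in> carrier V" "w \<in> carrier V" for v w
    using inj that by (auto simp: inj_on_def)
  have "module K V"
  proof (rule moduleI[OF K])
    show "abelian_group V"
    proof (rule abelian_groupI)
      fix v assume v: "v \<in> carrier V"
      obtain a where a: "a \<in> carrier K" "\<theta> a = - 1" using \<theta>surj by blast
      have "T (a \<odot>\<^bsub>V\<^esub> v \<oplus>\<^bsub>V\<^esub> v) = T \<zero>\<^bsub>V\<^esub>"
        using T(1)[OF V(3)[OF a(1) v] v] T(3)[OF a(1) v] a(2) by (simp add: T(2) Cst_uminus)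
      then have "a \<odot>\<^bsub>V\<^esub> v \<oplus>\<^bsub>V\<^esub> v = \<zero>\<^bsub>V\<^esub>" by (rule Tinj) (intro V a v)+
      then show "\<exists>w\<in>carrier V. w \<oplus>\<^bsub>V\<^esub> v = \<zero>\<^bsub>V\<^esub>" using V(3)[OF a(1) v] by blast
    next
      fix u v w assume "u \<in> carrier V" "v \<in> carrier V" "w \<in> carrier V"
      then show "u \<oplus>\<^bsub>V\<^esub> v \<oplus>\<^bsub>V\<^esub> w = u \<oplus>\<^bsub>V\<^esub> (v \<oplus>\<^bsub>V\<^esub> w)" by (intro Tinj V) (simp_all add: T V add_ac)
    next
      fix u v assume "u \<in> carrier V" "v \<in> carrier V"
      then show "u \<oplus>\<^bsub>V\<^esub> v = v \<oplus>\<^bsub>V\<^esub> u" by (intro Tinj V) (simp_all add: T V add_ac)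
    next
      fix v assume "v \<in> carrier V"
      then show "\<zero>\<^bsub>V\<^esub> \<oplus>\<^bsub>V\<^esub> v = v" by (intro Tinj V) (simp_all add: T V)
    qed (rule V, assumption+, rule V)
    fix a b v w assume a: "a \<in> carrier K" and b: "b \<in> carrier K" and v: "v \<in> carrier V" and w: "w \<in> carrier V"
    show "(a \<oplus>\<^bsub>K\<^esub> b) \<odot>\<^bsub>V\<^esub> v = a \<odot>\<^bsub>V\<^esub> v \<oplus>\<^bsub>V\<^esub> b \<odot>\<^bsub>V\<^esub> v"
      by (rule Tinj) (simp_all add: T V a b v hom Cst_add distrib_right)
    show "a \<odot>\<^bsub>V\<^esub> (v \<oplus>\<^bsub>V\<^esub> w) = a \<odot>\<^bsub>V\<^esub> v \<oplus>\<^bsub>V\<^esub> a \<odot>\<^bsub>V\<^esub> w"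
      by (rule Tinj) (simp_all add: T V a v w distrib_left)
    show "(a \<otimes>\<^bsub>K\<^esub> b) \<odot>\<^bsub>V\<^esub> v = a \<odot>\<^bsub>V\<^esub> (b \<odot>\<^bsub>V\<^esub> v)"
      by (rule Tinj) (simp_all add: T V a b v hom Cst_mult mult.assoc)
  next
    fix v assume v: "v \<in> carrier V"
    show "\<one>\<^bsub>K\<^esub> \<odot>\<^bsub>V\<^esub> v = v" by (rule Tinj) (simp_all add: T V v one)
  qed (rule V)
  then interpret V: vectorspace K V by (intro vectorspace.intro F)
  have comb: "T (V.lincomb a A) = (\<Sum>v\<in>A. Cst (\<theta> (a v)) * T v)"
    if "finite A" "A \<subseteq> carrier V" "a \<in> A \<rightarrow> carrier K" for a A
    using that
  proof (induction A rule: finite_induct)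
    case empty then show ?case by (simp add: V.lincomb_def T)
  next
    case (insert v A)
    have *: "a v \<in> carrier K" "v \<in> carrier V" "A \<subseteq> carrier V" "a \<in> A \<rightarrow> carrier K" using insert.prems by auto
    have "V.lincomb a (insert v A) = a v \<odot>\<^bsub>V\<^esub> v \<oplus>\<^bsub>V\<^esub> V.lincomb a A"
      unfolding V.lincomb_def using insert.hyps * by (intro V.finsum_insert) (auto intro!: V(3))
    then show ?case using T(1)[OF V(3)[OF *(1,2)] V.lincomb_closed[OF *(3,4)]] T(3)[OF *(1,2)] insert * by simp
  qed
  have span: "T ` V.span A = mvs.span (T ` A)" if A: "finite A" "A \<subseteq> carrier V" for A
  proof
    show "T ` V.span A \<subseteq> mvs.span (T ` A)"
    proof (rule image_subsetI)
      fix y assume "y \<in> V.span A"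
      then obtain a B where B: "y = V.lincomb a B" "finite B" "B \<subseteq> A" "a \<in> B \<rightarrow> carrier K" unfolding V.span_def by blast
      have "T y = (\<Sum>v\<in>B. Cst (\<theta> (a v)) * T v)" unfolding B(1) using B A by (intro comb) auto
      then show "T y \<in> mvs.span (T ` A)" using B(3) by (simp only:) (intro mvs.span_sum mvs.span_scale mvs.span_base imageI, blast)
    qed
    show "mvs.span (T ` A) \<subseteq> T ` V.span A"
    proof
      fix y assume y: "y \<in> mvs.span (T ` A)"
      have "inj_on T A" using inj A(2) by (rule inj_on_subset)
      obtain u where "y = (\<Sum>w\<in>T ` A. Cst (u w) * w)"
        using y A(1) unfolding mvs.span_finite[OF finite_imageI[OF A(1)]] by auto
      then have u: "y = (\<Sum>v\<in>A. Cst (u (T v)) * T v)" by (simp add: sum.reindex[OF \<open>inj_on T A\<close>])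
      obtain a where a: "\<And>l. a l \<in> carrier K" "\<And>l. \<theta> (a l) = l" using \<theta>surj by metis
      have "T (V.lincomb (\<lambda>v. a (u (T v))) A) = y" unfolding u using comb[OF A, of "\<lambda>v. a (u (T v))"] a by simp
      moreover have "V.lincomb (\<lambda>v. a (u (T v))) A \<in> V.span A" unfolding V.span_def using A(1) a(1) by blast
      ultimately show "y \<in> T ` V.span A" by blast
    qed
  qed
  have gen: "V.span A = carrier V \<longleftrightarrow> mvs.span (T ` A) = T ` carrier V" if A: "finite A" "A \<subseteq> carrier V" for A
  proof -
    have "V.span A \<subseteq> carrier V" using V.span_is_subset2[OF A(2)] .
    then show ?thesis unfolding span[OF A, symmetric] using inj_on_image_eq_iff[OF inj _ subset_refl, of "V.span A"] by simp
  qed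
  have SV: "mvs.subspace (T ` carrier V)"
  proof -
    show ?thesis
    proof (rule mvs.subspaceI)
      show "0 \<in> T ` carrier V" using T(2) V(2) by force
      show "y + z \<in> T ` carrier V" if "y \<in> T ` carrier V" "z \<in> T ` carrier V" for y z
        using that by (auto simp: T(1)[symmetric] V)
      show "Cst c * y \<in> T ` carrier V" if y: "y \<in> T ` carrier V" for c y
      proof -
        obtain a where "a \<in> carrier K" "\<theta> a = c" using \<theta>surj by blast
        then show ?thesis using y by (auto simp: T(3)[symmetric] V)
      qed
    qed
  qed
  \<comment> \<open>\<open>V.dim\<close> is the least size of a finite spanning set. The preimage of
    a basis attains the asserted value, and images of spanning sets bound it from below.\<close>
  let ?P = "\<lambda>m. \<exists>A. finite A \<and> card A = m \<and> A \<subseteq> carrier V \<and> V.span A = carrier V"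
  show ?thesis unfolding V.dim_def
  proof (rule Least_equality)
    obtain B where B: "B \<subseteq> T ` carrier V" "mvs.independent B" "T ` carrier V \<subseteq> mvs.span B" "card B = mvs.dim (T ` carrier V)"
      using mvs.basis_exists by blast
    have fB: "finite B" by (rule fin_dim_finite_independent[OF fd B(2,1)])
    obtain A where A: "A \<subseteq> carrier V" "B = T ` A" "inj_on T A" using B(1) by (meson inj inj_on_subset subset_imageE)
    have fA: "finite A" using fB A(2,3) by (simp add: finite_image_iff)
    have "mvs.span B = T ` carrier V" using B(1,3) mvs.span_minimal[OF B(1) SV] by blast
    then show "?P (mvs.dim (T ` carrier V))"
      using gen[OF fA A(1)] A fA B(4) card_image[OF A(3)] by auto
  next
    fix m assume "?P m"
    then obtain A where A: "finite A" "card A = m" "A \<subseteq> carrier V" "V.span A = carrier V" by blast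
    then have "mvs.span (T ` A) = T ` carrier V" using gen by blast
    then have "mvs.dim (T ` carrier V) \<le> card (T ` A)" using A(1) by (intro mvs.dim_le_card) auto
    then show "mvs.dim (T ` carrier V) \<le> m" using card_image_le[OF A(1), of T] A(2) by simp
  qed
qed

text \<open>The additive extension of \<open>w\<close> to the free abelian group, with values in a
  ring; the map out of the tensor product is obtained from it.\<close>

definition frag_sum :: "('a \<Rightarrow> 'r::comm_ring_1) \<Rightarrow> ('a \<Rightarrow>\<^sub>0 int) \<Rightarrow> 'r"
  where "frag_sum w t = (\<Sum>k\<in>Poly_Mapping.keys t. of_int (Poly_Mapping.lookup t k) * w k)"

lemma frag_sum_superset:
  assumes "finite S" "Poly_Mapping.keys t \<subseteq> S"
  shows "frag_sum w t = (\<Sum>k\<in>S. of_int (Poly_Mapping.lookup t k) * w k)"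
  unfolding frag_sum_def using assms by (intro sum.mono_neutral_left) (auto simp: in_keys_iff)

lemma frag_sum_diff: "frag_sum w (s - t) = frag_sum w s - frag_sum w t"
proof -
  let ?S = "Poly_Mapping.keys s \<union> Poly_Mapping.keys t"
  have k: "finite ?S" "Poly_Mapping.keys (s - t) \<subseteq> ?S" by (auto simp: in_keys_iff lookup_minus)
  show ?thesis
    unfolding frag_sum_superset[OF k] frag_sum_superset[OF k(1) Un_upper1] frag_sum_superset[OF k(1) Un_upper2]
    by (simp add: lookup_minus sum_subtractf left_diff_distrib)
qed

lemma frag_sum_0: "frag_sum w 0 = 0" by (simp add: frag_sum_def)

lemma frag_sum_of: "frag_sum w (frag_of k) = w k" by (simp add: frag_sum_def)

lemma frag_sum_uminus: "frag_sum w (- t) = - frag_sum w t"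
  using frag_sum_diff[of w 0 t] by (simp add: frag_sum_0)

lemma frag_sum_add: "frag_sum w (s + t) = frag_sum w s + frag_sum w t"
  using frag_sum_diff[of w s "- t"] by (simp add: frag_sum_uminus)

lemma frag_sum_sum: "frag_sum w (sum s A) = (\<Sum>a\<in>A. frag_sum w (s a))"
  by (induction A rule: infinite_finite_induct) (simp_all add: frag_sum_0 frag_sum_add)

lemma map_Cst_hom_eval:
  fixes r :: "('v::finite, 'k::field) mpol" and x :: "'v \<Rightarrow> 'l::field"
  assumes \<sigma>: "field_hom (\<sigma> :: 'k \<Rightarrow> 'l)"
  shows "mev (field_hom.ext \<sigma>) (\<lambda>i. Cst (x i)) (Poly_Mapping.map Cst r) = (Cst (mev \<sigma> x r) :: ('w::finite, 'l) mpol)"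
proof -
  interpret \<sigma>: field_hom \<sigma> by (rule \<sigma>)
  interpret C: comm_ring_hom "Cst :: 'l \<Rightarrow> ('w, 'l) mpol" by (rule comm_ring_hom_Cst)
  have coef: "coef (Poly_Mapping.map Cst r) m = (Cst (coef r m) :: ('w, 'k) mpol)" for m
    by (simp add: Poly_Mapping.map.rep_eq when_def)
  have "Poly_Mapping.keys (Poly_Mapping.map Cst r :: ('v, ('w, 'k) mpol) mpol) \<subseteq> Poly_Mapping.keys r"
    using coef by (auto simp: in_keys_iff)
  from \<sigma>.ext.mev_superset[OF finite_keys this] show ?thesis
    unfolding coef \<sigma>.ext_Cst mev_def by (simp add: C.hom_sum C.hom_mult C.hom_prod C.hom_power)
qed

text \<open>Separates the factor from \<open>R\<close>, which the tensor relations move to the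
  residue field, from the monomial in the \<open>s_j\<close>.\<close>

lemma poly_coefficient_expansion:
  fixes b :: "(4, (3, 'k::field) mpol) mpol"
  shows "b = (\<Sum>m\<in>Poly_Mapping.keys b. \<Sum>\<alpha>\<in>Poly_Mapping.keys (coef b m).
    Poly_Mapping.map Cst (Poly_Mapping.single m (coef (coef b m) \<alpha>)) * Cst (mon \<alpha>))"
proof -
  have "(\<Sum>\<alpha>\<in>Poly_Mapping.keys (coef b m). Poly_Mapping.map Cst (Poly_Mapping.single m (coef (coef b m) \<alpha>)) * Cst (mon \<alpha>))
      = Poly_Mapping.single m (coef b m)" for m
  proof -
    have "Poly_Mapping.map Cst (Poly_Mapping.single m (coef (coef b m) \<alpha>)) * (Cst (mon \<alpha>) :: (4, (3, 'k) mpol) mpol) =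
        Poly_Mapping.single m 1 * Cst (Cst (coef (coef b m) \<alpha>) * mon \<alpha>)" for \<alpha>
      by (simp add: Cst_def mult_single)
    then have "(\<Sum>\<alpha>\<in>Poly_Mapping.keys (coef b m). Poly_Mapping.map Cst (Poly_Mapping.single m (coef (coef b m) \<alpha>)) * Cst (mon \<alpha>))
        = mon m * (Cst (\<Sum>\<alpha>\<in>Poly_Mapping.keys (coef b m). Cst (coef (coef b m) \<alpha>) * mon \<alpha>) :: (4, (3, 'k) mpol) mpol)"
      by (simp add: Cst_sum sum_distrib_left)
    also have "\<dots> = Poly_Mapping.single m (coef b m)" unfolding mono_decomp[symmetric] by (simp add: Cst_def mult_single)
    finally show ?thesis .
  qed
  moreover have "b = (\<Sum>m\<in>Poly_Mapping.keys b. Poly_Mapping.single m (coef b m))"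
    using mono_decomp[of b] by (simp add: Cst_def mult_single)
  ultimately show ?thesis by (simp only:)
qed

definition res_const :: "'k::field \<Rightarrow> 'k residue_dom fract"
  where "res_const c = to_fract (cls (Cst c))"

definition res_point :: "4 \<Rightarrow> 'k::field residue_dom fract"
  where "res_point i = to_fract (cls (Var i))"

lemma comm_ring_hom_res: "comm_ring_hom (\<lambda>r :: (4, 'k::field) mpol. to_fract (cls r))"
  by unfold_locales (simp_all add: cls_hom)

lemma field_hom_res_const: "field_hom res_const"
  unfolding res_const_def by unfold_locales (simp_all add: cls_hom Cst_add Cst_mult)

section \<open>The fibre in degree \<open>n\<close>: normal forms in the tensor product\<close>

context
  fixes f :: "4 \<Rightarrow> (3, 'k::field) mpol" and d n :: nat and j :: 4
  assumes f: "\<And>i. homog d (f i)" and j: "Var j \<notin> (bad_prime :: (4, 'k) mpol set)"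
begin

interpretation \<sigma>: field_hom res_const by (rule field_hom_res_const)

lemma res_eq_mev: "to_fract (cls r) = mev res_const res_point r"
proof (rule mpol_hom_eq[of "\<lambda>r. to_fract (cls r)" "mev res_const res_point" r])
  show "comm_ring_hom (mev res_const res_point)" by (rule \<sigma>.comm_ring_hom_mev)
  show "to_fract (cls (Cst c)) = mev res_const res_point (Cst c)" for c unfolding \<sigma>.mev_Cst res_const_def ..
  show "to_fract (cls (Var i)) = mev res_const res_point (Var i)" for i unfolding \<sigma>.mev_Var res_point_def ..
qed (rule comm_ring_hom_res)

lemma res_point_j: "res_point j \<noteq> (0 :: 'k residue_dom fract)"
  unfolding res_point_def using j by simp

abbreviation "FF \<equiv> \<lambda>i. \<sigma>.ext (f i)"
abbreviation "JJ \<equiv> spec_ideal res_point FF"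

text \<open>Restriction to the fibre over the point: together with the scalars of the second tensor
  factor it induces the map from the tensor product to polynomials modulo \<open>JJ\<close>.\<close>

definition fib :: "(4, (3, 'k) mpol) mpol \<Rightarrow> (3, 'k residue_dom fract) mpol"
  where "fib = mev \<sigma>.ext (\<lambda>i. Cst (res_point i))"

interpretation fib: comm_ring_hom fib
  unfolding fib_def by (rule \<sigma>.ext.comm_ring_hom_mev)

lemma fib_map: "fib (Poly_Mapping.map Cst r) = Cst (to_fract (cls r))"
  unfolding fib_def map_Cst_hom_eval[OF field_hom_res_const] res_eq_mev ..

lemma fib_Cst: "fib (Cst g) = \<sigma>.ext g" unfolding fib_def by (rule \<sigma>.ext.mev_Cst)

lemma fib_linear: "fib (\<Sum>i\<in>UNIV. Cst (g i) * Var i) = (\<Sum>i\<in>UNIV. Cst (res_point i) * \<sigma>.ext (g i))"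
  unfolding fib.hom_sum fib.hom_mult fib_Cst unfolding fib_def \<sigma>.ext.mev_Var by (simp only: mult.commute)

lemma fib_homog: "(\<And>m. homog n (coef b m)) \<Longrightarrow> homog n (fib b)"
  unfolding fib_def mev_def
proof (rule homog_sum)
  fix m assume "\<And>m. homog n (coef b m)"
  then have "homog n (\<sigma>.ext (coef b m))" by simp
  moreover have "homog 0 (\<Prod>i\<in>UNIV. Cst (res_point i) ^ Poly_Mapping.lookup m i)"
  proof -
    have "homog 0 (Cst (res_point i) ^ Poly_Mapping.lookup m i)" for i
      using homog_power[OF homog_Cst, of "Poly_Mapping.lookup m i" "res_point i"] by simp
    from homog_prod[of UNIV "\<lambda>_. 0", OF this] show ?thesis by simp
  qed
  ultimately show "homog n (\<sigma>.ext (coef b m) * (\<Prod>i\<in>UNIV. Cst (res_point i) ^ Poly_Mapping.lookup m i))"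
    using homog_mult by fastforce
qed

lemma gJ: "graded_ideal JJ"
  by (rule graded_spec_ideal[of res_point j d]) (use res_point_j f in auto)

lemma sJ: "mul.subspace JJ" using gJ by (simp add: graded_ideal_def)

lemma sI: "mul.subspace (sym_ideal f)" by (simp add: sym_ideal_def genideal_class_ring)

lemma fib_sym_ideal: "b \<in> sym_ideal f \<Longrightarrow> fib b \<in> JJ"
proof -
  have "mul.subspace {b. fib b \<in> JJ}"
    by (rule mul.subspaceI)
      (auto simp: fib.hom_add fib.hom_mult fib.hom_zero intro: mul.subspace_0[OF sJ] mul.subspace_add[OF sJ] mul.subspace_scale[OF sJ])
  moreover have "fib (\<Sum>i\<in>UNIV. Cst (g i) * Var i) \<in> JJ" if "(\<Sum>i\<in>UNIV. g i * f i) = 0" for g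
  proof -
    have "(\<Sum>i\<in>UNIV. \<sigma>.ext (g i) * FF i) = 0"
      using arg_cong[OF that, of \<sigma>.ext] by (simp add: \<sigma>.ext.hom_sum \<sigma>.ext.hom_mult \<sigma>.ext.hom_zero)
    then show ?thesis unfolding fib_linear spec_ideal_def
      by (intro CollectI exI[of _ "\<lambda>i. \<sigma>.ext (g i)"] conjI refl)
  qed
  ultimately have "sym_ideal f \<subseteq> {b. fib b \<in> JJ}"
    unfolding sym_ideal_def genideal_class_ring by (intro mul.span_minimal) auto
  then show "b \<in> sym_ideal f \<Longrightarrow> fib b \<in> JJ" by blast
qed

abbreviation "M \<equiv> sym_alg f"
abbreviation "K \<equiv> (bad_kappa :: (4, 'k) mpol fract set ring)"
abbreviation "\<rho> \<equiv> (to_kappa bad_prime :: (4, 'k) mpol \<Rightarrow> _)"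
abbreviation "cl b \<equiv> sym_ideal f +>\<^bsub>class_ring\<^esub> b"
abbreviation "G \<equiv> free_Abelian_group (carrier M \<times> carrier K)"
abbreviation "H \<equiv> tensor_sub class_ring M K \<rho>"

lemma ideal_sym: "ideal (sym_ideal f) class_ring"
  using sI by (simp add: ideal_class_ring_iff)

lemma cl_iff: "z \<in> cl b \<longleftrightarrow> z - b \<in> sym_ideal f"
  unfolding a_r_coset_def' by (auto simp: algebra_simps intro: bexI[of _ "z - b"])

lemma cl_eq: "cl b = cl c \<longleftrightarrow> b - c \<in> sym_ideal f"
proof
  assume "cl b = cl c"
  moreover have "b \<in> cl b" unfolding cl_iff using mul.subspace_0[OF sI] by simp
  ultimately show "b - c \<in> sym_ideal f" unfolding cl_iff[symmetric] by simp
next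
  assume bc: "b - c \<in> sym_ideal f"
  have "z - b \<in> sym_ideal f \<longleftrightarrow> z - c \<in> sym_ideal f" for z
    using mul.subspace_add[OF sI _ bc, of "z - b"] mul.subspace_diff[OF sI _ bc, of "z - c"] by auto
  then show "cl b = cl c" using cl_iff by blast
qed

lemma M_simps: "carrier M = range cl" "cl a \<oplus>\<^bsub>M\<^esub> cl b = cl (a + b)" "r \<odot>\<^bsub>M\<^esub> cl b = cl (Poly_Mapping.map Cst r * b)"
proof -
  interpret I: ideal "sym_ideal f" class_ring by (rule ideal_sym)
  have h: "(+>\<^bsub>class_ring\<^esub>) (sym_ideal f) \<in> Ring.ring_hom class_ring (class_ring Quot sym_ideal f)" by (rule I.rcos_ring_hom)
  show "carrier M = range cl" by (auto simp: sym_alg_def Let_def FactRing_def A_RCOSETS_def' a_r_coset_def)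
  show "cl a \<oplus>\<^bsub>M\<^esub> cl b = cl (a + b)" using ring_hom_add[OF h, of a b] by (simp add: sym_alg_def Let_def)
  show "r \<odot>\<^bsub>M\<^esub> cl b = cl (Poly_Mapping.map Cst r * b)"
    using ring_hom_mult[OF h, of "Poly_Mapping.map Cst r" b] by (simp add: sym_alg_def Let_def)
qed

definition rep :: "(4, (3, 'k) mpol) mpol set \<Rightarrow> (4, (3, 'k) mpol) mpol"
  where "rep U = (SOME b. U = cl b)"

lemma rep_cl: "rep (cl b) - b \<in> sym_ideal f"
  unfolding cl_eq[symmetric] rep_def by (rule someI[of "\<lambda>c. cl b = cl c", symmetric]) simp

lemma theta: "residue (a \<otimes>\<^bsub>K\<^esub> b) = residue a * residue b" "residue (a \<oplus>\<^bsub>K\<^esub> b) = residue a + residue b"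
  if "a \<in> carrier K" "b \<in> carrier K" for a b
  using ring_iso_memE(2,3)[OF residue_iso that] by simp_all

interpretation K: cring K by (rule bad_kappa_cring)

definition unres :: "'k residue_dom fract \<Rightarrow> (4, 'k) mpol fract set"
  where "unres l = inv_into (carrier K) residue l"

lemma unres: "unres l \<in> carrier K" "residue (unres l) = l" "a \<in> carrier K \<Longrightarrow> unres (residue a) = a"
proof -
  have b: "bij_betw residue (carrier K) UNIV" using ring_iso_memE(5)[OF residue_iso] by simp
  then have im: "l \<in> residue ` carrier K" for l by (simp add: bij_betw_def)
  show "unres l \<in> carrier K" "residue (unres l) = l" unfolding unres_def by (rule inv_into_into[OF im], rule f_inv_into_f[OF im])
  show "a \<in> carrier K \<Longrightarrow> unres (residue a) = a" unfolding unres_def using b by (intro inv_into_f_f) (auto simp: bij_betw_def)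
qed

lemma unres_add: "unres (l + l') = unres l \<oplus>\<^bsub>K\<^esub> unres l'"
  using unres(3)[OF K.a_closed[OF unres(1) unres(1)], of l l'] by (simp add: theta unres(1,2))

lemma unres_0: "unres 0 = \<zero>\<^bsub>K\<^esub>"
proof -
  have "residue \<zero>\<^bsub>K\<^esub> = residue \<zero>\<^bsub>K\<^esub> + residue \<zero>\<^bsub>K\<^esub>"
    using theta(2)[OF K.zero_closed K.zero_closed] unfolding K.l_zero[OF K.zero_closed] .
  then have "residue \<zero>\<^bsub>K\<^esub> = 0" by (metis add_cancel_right_right)
  then show ?thesis using unres(3)[OF K.zero_closed] by simp
qed

lemma frag_diff_closed:
  "u \<in> carrier (free_Abelian_group S) \<Longrightarrow> v \<in> carrier (free_Abelian_group S) \<Longrightarrow> u - v \<in> carrier (free_Abelian_group S)"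
  using keys_diff[of u v] by auto

lemma M_closed: "x \<in> carrier M \<Longrightarrow> y \<in> carrier M \<Longrightarrow> x \<oplus>\<^bsub>M\<^esub> y \<in> carrier M" "x \<in> carrier M \<Longrightarrow> r \<odot>\<^bsub>M\<^esub> x \<in> carrier M"
  by (auto simp: M_simps)

lemma rels_G: "tensor_rels class_ring M K \<rho> \<subseteq> carrier G"
  unfolding tensor_rels_def
  by (auto intro!: frag_diff_closed K.a_closed K.m_closed M_closed residue_to_kappa(1) simp del: carrier_free_Abelian_group_iff)

lemma H_subgroup: "subgroup H G"
  unfolding tensor_sub_def by (rule group.generate_is_subgroup[OF group_free_Abelian_group rels_G])

lemma H_closed: "0 \<in> H" "u \<in> H \<Longrightarrow> v \<in> H \<Longrightarrow> u + v \<in> H" "u \<in> H \<Longrightarrow> - u \<in> H" "u \<in> H \<Longrightarrow> u \<in> carrier G"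
proof -
  show "0 \<in> H" using subgroup.one_closed[OF H_subgroup] by simp
  show "u \<in> H \<Longrightarrow> v \<in> H \<Longrightarrow> u + v \<in> H" using subgroup.m_closed[OF H_subgroup] by simp
  show G: "u \<in> H \<Longrightarrow> u \<in> carrier G" using subgroup.subset[OF H_subgroup] by blast
  then show "u \<in> H \<Longrightarrow> - u \<in> H" using subgroup.m_inv_closed[OF H_subgroup, of u] by simp
qed

lemma H_induct [consumes 1, case_names zero rel minus add]:
  assumes "u \<in> H" "P 0" "\<And>u. u \<in> tensor_rels class_ring M K \<rho> \<Longrightarrow> P u" "\<And>u. u \<in> tensor_rels class_ring M K \<rho> \<Longrightarrow> P (- u)"
    "\<And>u v. P u \<Longrightarrow> P v \<Longrightarrow> P (u + v)"
  shows "P u"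
  using assms(1) unfolding tensor_sub_def
proof (induction rule: generate.induct)
  case (inv h)
  then have "h \<in> carrier G" using rels_G by blast
  then have "inv\<^bsub>G\<^esub> h = - h" by (intro inv_free_Abelian_group) (simp only: carrier_free_Abelian_group_iff)
  then show ?case using assms(4)[OF inv] by simp
qed (use assms in simp_all)

lemma rel_1: "a \<in> carrier K \<Longrightarrow> frag_of (cl (b + c), a) - frag_of (cl b, a) - frag_of (cl c, a) \<in> H"
  unfolding tensor_sub_def
  by (rule generate.incl) (unfold tensor_rels_def, intro UnI1 CollectI exI[of _ "cl b"] exI[of _ "cl c"] exI[of _ a], simp add: M_simps)

lemma rel_2: "a \<in> carrier K \<Longrightarrow> a' \<in> carrier K \<Longrightarrow> frag_of (cl b, a \<oplus>\<^bsub>K\<^esub> a') - frag_of (cl b, a) - frag_of (cl b, a') \<in> H"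
  unfolding tensor_sub_def
  by (rule generate.incl) (unfold tensor_rels_def, intro UnI1 UnI2 CollectI exI[of _ "cl b"] exI[of _ a] exI[of _ a'], simp add: M_simps)

lemma rel_3: "a \<in> carrier K \<Longrightarrow> frag_of (cl (Poly_Mapping.map Cst r * b), a) - frag_of (cl b, \<rho> r \<otimes>\<^bsub>K\<^esub> a) \<in> H"
  unfolding tensor_sub_def
  by (rule generate.incl) (unfold tensor_rels_def, intro UnI2 CollectI exI[of _ r] exI[of _ "cl b"] exI[of _ a], simp add: M_simps)

lemma rels_cases:
  assumes "u \<in> tensor_rels class_ring M K \<rho>"
  obtains (1) b c a where "a \<in> carrier K" "u = frag_of (cl (b + c), a) - frag_of (cl b, a) - frag_of (cl c, a)"
  | (2) b a a' where "a \<in> carrier K" "a' \<in> carrier K" "u = frag_of (cl b, a \<oplus>\<^bsub>K\<^esub> a') - frag_of (cl b, a) - frag_of (cl b, a')"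
  | (3) r b a where "a \<in> carrier K" "u = frag_of (cl (Poly_Mapping.map Cst r * b), a) - frag_of (cl b, \<rho> r \<otimes>\<^bsub>K\<^esub> a)"
proof -
  from assms[unfolded tensor_rels_def M_simps(1)] consider
    x y a where "u = frag_of (x \<oplus>\<^bsub>M\<^esub> y, a) - frag_of (x, a) - frag_of (y, a)" "x \<in> range cl" "y \<in> range cl" "a \<in> carrier K"
  | x a b where "u = frag_of (x, a \<oplus>\<^bsub>K\<^esub> b) - frag_of (x, a) - frag_of (x, b)" "x \<in> range cl" "a \<in> carrier K" "b \<in> carrier K"
  | r x a where "u = frag_of (r \<odot>\<^bsub>M\<^esub> x, a) - frag_of (x, \<rho> r \<otimes>\<^bsub>K\<^esub> a)" "x \<in> range cl" "a \<in> carrier K"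
    by (elim UnE CollectE exE conjE) metis+
  then show ?thesis
  proof cases
    case (1 x y a)
    from 1(2,3) obtain b c where "x = cl b" "y = cl c" by blast
    then show ?thesis using that(1)[OF 1(4), of b c] 1(1) M_simps(2) by simp
  next
    case (2 x a b)
    from 2(2) obtain c where "x = cl c" by blast
    then show ?thesis using that(2)[OF 2(3,4), of c] 2(1) by simp
  next
    case (3 r x a)
    from 3(2) obtain c where "x = cl c" by blast
    then show ?thesis using that(3)[OF 3(3), of r c] 3(1) M_simps(3) by simp
  qed
qed

lemma frag_cl_0: "a \<in> carrier K \<Longrightarrow> frag_of (cl 0, a) \<in> H"
  using H_closed(3)[OF rel_1[of a 0 0]] by simp

lemma frag_0: "frag_of (cl b, \<zero>\<^bsub>K\<^esub>) \<in> H"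
  using H_closed(3)[OF rel_2[OF K.zero_closed K.zero_closed, of b]] by simp

text \<open>The candidate for an inverse on forms of degree \<open>n\<close>: each monomial is sent
  to its class, paired with its coefficient. It is additive only modulo \<open>H\<close>.\<close>

definition unfib :: "(3, 'k residue_dom fract) mpol \<Rightarrow> ((4, (3, 'k) mpol) mpol set \<times> (4, 'k) mpol fract set \<Rightarrow>\<^sub>0 int)"
  where "unfib y = (\<Sum>\<alpha>\<in>{\<alpha>. mdeg \<alpha> = n}. frag_of (cl (Cst (mon \<alpha>)), unres (coef y \<alpha>)))"

lemma H_sum: "(\<And>i. i \<in> A \<Longrightarrow> u i \<in> H) \<Longrightarrow> sum u A \<in> H"
  by (induction A rule: infinite_finite_induct) (simp_all add: H_closed)

lemma unfib_add: "unfib (y + z) - unfib y - unfib z \<in> H"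
  unfolding unfib_def sum_subtractf[symmetric] lookup_add unres_add by (intro H_sum rel_2 unres(1))

lemma unfib_0: "unfib 0 \<in> H"
  unfolding unfib_def by (intro H_sum) (simp add: unres_0 frag_0)

lemma unfib_mon:
  assumes "mdeg \<alpha> = n"
  shows "unfib (Cst l * mon \<alpha>) - frag_of (cl (Cst (mon \<alpha>)), unres l) \<in> H"
proof -
  let ?A = "{\<alpha> :: 3 \<Rightarrow>\<^sub>0 nat. mdeg \<alpha> = n}"
  have "unfib (Cst l * mon \<alpha>) = frag_of (cl (Cst (mon \<alpha>)), unres (coef (Cst l * mon \<alpha>) \<alpha>)) +
      (\<Sum>\<beta>\<in>?A - {\<alpha>}. frag_of (cl (Cst (mon \<beta>)), unres (coef (Cst l * mon \<alpha>) \<beta>)))"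
    unfolding unfib_def using assms by (intro sum.remove[OF finite_mdeg]) simp
  moreover have "(\<Sum>\<beta>\<in>?A - {\<alpha>}. frag_of (cl (Cst (mon \<beta>)), unres (coef (Cst l * mon \<alpha>) \<beta>))) \<in> H"
    by (intro H_sum) (auto simp: lookup_single unres_0 frag_0)
  ultimately show ?thesis by (simp add: lookup_single)
qed

lemma H_trans: "u - v \<in> H \<Longrightarrow> v - w \<in> H \<Longrightarrow> u - w \<in> H"
  using H_closed(2)[of "u - v" "v - w"] by simp

lemma H_sym: "u - v \<in> H \<Longrightarrow> v - u \<in> H"
  using H_closed(3)[of "u - v"] by simp

text \<open>Every generator with first entry the class of \<open>b\<close> has the normal form given
  by its image in the fibre. The property is additive in \<open>b\<close>, so it need be checked
  only on members of \<open>R\<close> times monomials of degree \<open>n\<close>.\<close>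

definition good :: "(4, (3, 'k) mpol) mpol \<Rightarrow> bool"
  where "good b \<longleftrightarrow> (\<forall>a\<in>carrier K. frag_of (cl b, a) - unfib (fib b * Cst (residue a)) \<in> H)"

lemma good_0: "good 0"
  unfolding good_def fib.hom_zero
  using H_closed(2)[OF frag_cl_0 H_closed(3)[OF unfib_0]] by simp

lemma good_add:
  assumes "good b" "good c"
  shows "good (b + c)"
  unfolding good_def
proof
  fix a assume a: "a \<in> carrier K"
  let ?y = "fib b * Cst (residue a)" and ?z = "fib c * Cst (residue a)"
  have 1: "frag_of (cl b, a) - unfib ?y \<in> H" "frag_of (cl c, a) - unfib ?z \<in> H" using assms a unfolding good_def by blast+
  have "(frag_of (cl (b + c), a) - frag_of (cl b, a) - frag_of (cl c, a)) + ((frag_of (cl b, a) - unfib ?y) + (frag_of (cl c, a) - unfib ?z))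
      + - (unfib (?y + ?z) - unfib ?y - unfib ?z) \<in> H"
    by (intro H_closed rel_1 unfib_add 1 a)
  then show "frag_of (cl (b + c), a) - unfib (fib (b + c) * Cst (residue a)) \<in> H"
    unfolding fib.hom_add distrib_right by (simp add: algebra_simps)
qed

lemma good_sum: "(\<And>i. i \<in> A \<Longrightarrow> good (b i)) \<Longrightarrow> good (sum b A)"
  by (induction A rule: infinite_finite_induct) (simp_all add: good_0 good_add)

lemma good_mon:
  assumes "mdeg \<alpha> = n"
  shows "good (Poly_Mapping.map Cst r * Cst (mon \<alpha>))"
  unfolding good_def
proof
  fix a assume a: "a \<in> carrier K"
  let ?l = "residue (\<rho> r \<otimes>\<^bsub>K\<^esub> a)"
  have "fib (Poly_Mapping.map Cst r * Cst (mon \<alpha>)) * Cst (residue a) = Cst ?l * mon \<alpha>"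
    unfolding fib.hom_mult fib_map fib_Cst \<sigma>.ext_mon theta(1)[OF residue_to_kappa(1) a] residue_to_kappa(2) Cst_mult
    by (simp only: mult_ac)
  moreover have "unfib (Cst ?l * mon \<alpha>) - frag_of (cl (Cst (mon \<alpha>)), \<rho> r \<otimes>\<^bsub>K\<^esub> a) \<in> H"
    using unfib_mon[OF assms, of ?l] unfolding unres(3)[OF K.m_closed[OF residue_to_kappa(1) a]] .
  ultimately show "frag_of (cl (Poly_Mapping.map Cst r * Cst (mon \<alpha>)), a) - unfib (fib (Poly_Mapping.map Cst r * Cst (mon \<alpha>)) * Cst (residue a)) \<in> H"
    using H_trans[OF rel_3[OF a] H_sym] by simp
qed

lemma good_homog:
  assumes "\<And>m. homog n (coef b m)"
  shows "good b"
  by (subst poly_coefficient_expansion, intro good_sum good_mon) (use assms in \<open>auto simp: homog_def\<close>)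

text \<open>By \<open>spec_ideal_forms\<close> it is enough to treat specialised syzygies of degree
  \<open>n\<close> over \<open>k\<close>. Such a syzygy is the image of a generator of
  \<open>sym_ideal\<close>, whose class is zero, and that generator is \<open>good\<close>.\<close>

lemma unfib_JJ:
  assumes "y \<in> JJ \<inter> forms n"
  shows "unfib y \<in> H"
proof -
  let ?W = "{\<Sum>i\<in>UNIV. Cst (res_point i) * \<sigma>.ext (g i) | g. (\<Sum>i\<in>UNIV. g i * f i) = 0 \<and> (\<forall>i. homog n (g i))}"
  have "y \<in> mvs.span ?W" using assms unfolding \<sigma>.spec_ideal_forms[of d f res_point j, OF f res_point_j] .
  then show ?thesis
  proof (induction rule: mvs.span_induct_alt)
    case base show ?case by (rule unfib_0)
  next
    case (step c w y)
    then obtain g where g: "w = (\<Sum>i\<in>UNIV. Cst (res_point i) * \<sigma>.ext (g i))" "(\<Sum>i\<in>UNIV. g i * f i) = 0" "\<And>i. homog n (g i)" by blast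
    let ?b = "\<Sum>i\<in>UNIV. Cst (g i) * Var i"
    have "homog n (coef ?b m)" for m
      unfolding lookup_sum Var_def Cst_def mult_single by (intro homog_sum) (use g(3) in \<open>auto simp: lookup_single when_def\<close>)
    then have "good ?b" by (rule good_homog)
    then have b: "frag_of (cl ?b, unres c) - unfib (w * Cst c) \<in> H"
      unfolding good_def fib_linear g(1)[symmetric] using unres(1)[of c] unres(2)[of c] by auto
    have "?b - 0 \<in> sym_ideal f"
      unfolding sym_ideal_def genideal_class_ring diff_zero by (intro mul.span_base CollectI exI conjI) (rule refl, rule g(2))
    then have "cl ?b = cl 0" by (rule cl_eq[THEN iffD2])
    from H_closed(2)[OF frag_cl_0[OF unres(1)[of c]] H_closed(3)[OF b[unfolded this]]]
    have "unfib (w * Cst c) \<in> H" by simp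
    then have "(unfib (w * Cst c + y) - unfib (w * Cst c) - unfib y) + (unfib (w * Cst c) + unfib y) \<in> H"
      using step by (intro H_closed unfib_add)
    then show ?case by (simp add: mult.commute)
  qed
qed

abbreviation "N \<equiv> sym_part f n"
abbreviation "sm \<equiv> \<lambda>c. frag_extend (\<lambda>(x, a). frag_of (x :: (4, (3, 'k) mpol) mpol set, c \<otimes>\<^bsub>K\<^esub> a))"

lemma N_iff: "N = {cl b | b. \<forall>m. homog n (coef b m)}"
  by (simp add: sym_part_def)

lemma free_mono: "carrier (free_Abelian_group (N \<times> carrier K)) \<subseteq> carrier G"
proof
  fix t assume "t \<in> carrier (free_Abelian_group (N \<times> carrier K))"
  then have "Poly_Mapping.keys t \<subseteq> N \<times> carrier K" by simp
  also have "N \<times> carrier K \<subseteq> carrier M \<times> carrier K" unfolding N_iff M_simps by (intro Sigma_mono) blast+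
  finally show "t \<in> carrier G" by simp
qed

text \<open>Makes the scalar multiplication of \<open>base_change\<close>, a union over
  representatives, well defined on cosets.\<close>

lemma m_H:
  assumes c: "c \<in> carrier K" and "u \<in> H"
  shows "sm c u \<in> H"
proof -
  have rel: "sm c u \<in> H" if "u \<in> tensor_rels class_ring M K \<rho>" for u
    using that
  proof (cases rule: rels_cases)
    case (1 b b' a)
    then show ?thesis using rel_1[OF K.m_closed[OF c 1(1)]] by (simp add: frag_extend_diff)
  next
    case (2 b a a')
    then show ?thesis using rel_2[OF K.m_closed[OF c 2(1)] K.m_closed[OF c 2(2)]] by (simp add: frag_extend_diff K.r_distr c)
  next
    case (3 r b a)
    have "c \<otimes>\<^bsub>K\<^esub> (\<rho> r \<otimes>\<^bsub>K\<^esub> a) = \<rho> r \<otimes>\<^bsub>K\<^esub> (c \<otimes>\<^bsub>K\<^esub> a)"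
      by (rule K.m_lcomm[OF c residue_to_kappa(1) 3(1)])
    then show ?thesis using rel_3[OF K.m_closed[OF c 3(1)]] 3 by (simp add: frag_extend_diff)
  qed
  from \<open>u \<in> H\<close> show ?thesis
    by (induction rule: H_induct) (simp_all add: rel H_closed frag_extend_minus frag_extend_add)
qed

lemma coset_iff: "u \<in> H #>\<^bsub>G\<^esub> t \<longleftrightarrow> u - t \<in> H"
  unfolding r_coset_def by (auto simp: algebra_simps intro: bexI[of _ "u - t"])

lemma coset_eq:
  assumes "u - v \<in> H"
  shows "H #>\<^bsub>G\<^esub> u = H #>\<^bsub>G\<^esub> v"
proof (rule Set.set_eqI)
  fix z show "z \<in> H #>\<^bsub>G\<^esub> u \<longleftrightarrow> z \<in> H #>\<^bsub>G\<^esub> v"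
    unfolding coset_iff using H_trans[OF _ assms, of z] H_trans[OF _ H_sym[OF assms], of z] by blast
qed

lemma free_induct [consumes 1, case_names zero diff single]:
  assumes "t \<in> carrier (free_Abelian_group S)" "P 0"
    "\<And>s t. s \<in> carrier (free_Abelian_group S) \<Longrightarrow> t \<in> carrier (free_Abelian_group S) \<Longrightarrow> P s \<Longrightarrow> P t \<Longrightarrow> P (s - t)"
    "\<And>k. k \<in> S \<Longrightarrow> P (frag_of k)"
  shows "P t"
  using assms by (intro free_Abelian_group_induct[of t S P]) simp_all

text \<open>\<open>fib\<close> and \<open>unfib\<close> induce inverse maps between the fibre in
  degree \<open>n\<close> and the forms of degree \<open>n\<close> modulo \<open>JJ\<close>; the
  latter quotient is realised by the projection \<open>\<pi>\<close>.\<close>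

lemma fibre_dim: "vectorspace.dim K (fibre_part f bad_prime n) = hfun JJ n"
proof -
  obtain \<pi> :: "(3, 'k residue_dom fract) mpol \<Rightarrow> (3, 'k residue_dom fract) mpol"
    where \<pi>: "Vector_Spaces.linear mscale mscale \<pi>" "\<forall>y\<in>forms n. \<pi> y = 0 \<longleftrightarrow> y \<in> JJ \<inter> forms n"
    "\<pi> ` forms n \<subseteq> forms n" "mvs.dim (\<pi> ` forms n) = mvs.dim (forms n :: (3, 'k residue_dom fract) mpol set) - mvs.dim (JJ \<inter> forms n)"
    using exists_projection[OF subspace_part[OF sJ, of n] Int_lower2 subspace_forms fin_dim_forms] by (elim exE conjE) (rule that; assumption)
  interpret \<pi>: Vector_Spaces.linear mscale mscale \<pi> by (rule \<pi>(1))
  \<comment> \<open>Passing to the component of degree \<open>n\<close> first makes the map vanish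
    on the whole of \<open>JJ\<close>, not only on its part of degree \<open>n\<close>.\<close>
  define \<phi> where "\<phi> y = \<pi> (hcomp n y)" for y
  have \<phi>_add: "\<phi> (y + z) = \<phi> y + \<phi> z" for y z unfolding \<phi>_def hcomp_add by (rule \<pi>.add)
  have \<phi>_scale: "\<phi> (Cst c * y) = Cst c * \<phi> y" for c y unfolding \<phi>_def hcomp_Cst_mult by (rule \<pi>.scale)
  have \<phi>_0: "\<phi> 0 = 0" using \<phi>_scale[of 0 0] by simp
  have \<phi>_diff: "\<phi> (y - z) = \<phi> y - \<phi> z" for y z using \<phi>_add[of "y - z" z] by simp
  have \<phi>_J: "\<phi> y = 0" if "y \<in> JJ" for y
  proof -
    have "hcomp n y \<in> JJ" using gJ that unfolding graded_ideal_def by blast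
    then show ?thesis using \<pi>(2) unfolding \<phi>_def by (simp add: forms_def)
  qed
  have \<phi>_form: "\<phi> y = \<pi> y" if "y \<in> forms n" for y
    using hcomp_homog[of n y n] that unfolding \<phi>_def by (simp add: forms_def)
  \<comment> \<open>\<open>rep\<close> picks a representative of the class; the value does not
    depend on it because \<open>fib\<close> sends \<open>sym_ideal\<close> into
    \<open>JJ\<close>.\<close>
  define w where "w k = \<phi> (fib (rep (fst k)) * Cst (residue (snd k)))" for k
  have w: "w (cl b, a) = \<phi> (fib b * Cst (residue a))" for b a
  proof -
    have "fib (rep (cl b)) - fib b \<in> JJ" using fib_sym_ideal[OF rep_cl[of b]] by (simp add: fib.hom_minus)
    then have "\<phi> ((fib (rep (cl b)) - fib b) * Cst (residue a)) = 0" by (intro \<phi>_J mul_scale[OF sJ])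
    then show ?thesis unfolding w_def by (simp add: left_diff_distrib \<phi>_diff)
  qed
  define \<tau> where "\<tau> = frag_sum w"
  note \<tau>_simps = frag_sum_add[of w, folded \<tau>_def] frag_sum_diff[of w, folded \<tau>_def] frag_sum_0[of w, folded \<tau>_def]
    frag_sum_of[of w, folded \<tau>_def] frag_sum_uminus[of w, folded \<tau>_def]
  have \<tau>_rel: "\<tau> u = 0" if "u \<in> tensor_rels class_ring M K \<rho>" for u
    using that
  proof (cases rule: rels_cases)
    case (1 b c a)
    then show ?thesis by (simp add: \<tau>_simps w fib.hom_add distrib_right \<phi>_add)
  next
    case (2 b a a')
    then show ?thesis by (simp add: \<tau>_simps w theta Cst_add distrib_left \<phi>_add)
  next
    case (3 r b a)
    have "fib (Poly_Mapping.map Cst r * b) * Cst (residue a) = fib b * Cst (residue (\<rho> r \<otimes>\<^bsub>K\<^esub> a))"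
      unfolding fib.hom_mult fib_map theta(1)[OF residue_to_kappa(1) 3(1)] residue_to_kappa(2) Cst_mult by (simp only: mult_ac)
    then show ?thesis unfolding 3(2) \<tau>_simps w by simp
  qed
  have \<tau>_H: "\<tau> u = 0" if "u \<in> H" for u
    using that by (induction rule: H_induct) (simp_all add: \<tau>_simps \<tau>_rel)
  let ?G' = "free_Abelian_group (N \<times> carrier K)"
  \<comment> \<open>Both the kernel and the image of \<open>\<tau>\<close> are read off from this:
    modulo \<open>H\<close> every element is some \<open>unfib y\<close>, and \<open>\<tau>\<close>
    sees exactly \<open>y\<close> modulo \<open>JJ\<close>.\<close>
  have normal: "\<exists>y\<in>forms n. t - unfib y \<in> H \<and> \<tau> t = \<phi> y" if "t \<in> carrier ?G'" for t
    using that
  proof (induction t rule: free_induct)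
    case zero
    show ?case using H_closed(3)[OF unfib_0] by (intro bexI[of _ 0]) (simp_all add: \<tau>_simps \<phi>_0 forms_def)
  next
    case (diff s t)
    then obtain y z where y: "y \<in> forms n" "s - unfib y \<in> H" "\<tau> s = \<phi> y" and z: "z \<in> forms n" "t - unfib z \<in> H" "\<tau> t = \<phi> z" by blast
    have "(s - unfib y) + - (t - unfib z) + (unfib (y - z + z) - unfib (y - z) - unfib z) \<in> H"
      by (intro H_closed unfib_add y z)
    then have "(s - t) - unfib (y - z) \<in> H" by (simp add: algebra_simps)
    moreover have "y - z \<in> forms n" using y(1) z(1) by (simp add: forms_def homog_diff)
    ultimately show ?case using y(3) z(3) by (intro bexI[of _ "y - z"]) (simp_all add: \<tau>_simps \<phi>_diff)
  next
    case (single k)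
    then obtain b a where k: "k = (cl b, a)" "\<And>m. homog n (coef b m)" "a \<in> carrier K" unfolding N_iff by blast
    have "fib b * Cst (residue a) \<in> forms n"
      using homog_mult[OF fib_homog[OF k(2)] homog_Cst] by (simp add: forms_def)
    moreover have "frag_of k - unfib (fib b * Cst (residue a)) \<in> H" using good_homog[OF k(2)] k(3) unfolding good_def k(1) by blast
    ultimately show ?case unfolding k(1) by (intro bexI[of _ "fib b * Cst (residue a)"]) (simp_all add: \<tau>_simps w)
  qed
  have ker: "t \<in> H" if "t \<in> carrier ?G'" "\<tau> t = 0" for t
  proof -
    from normal[OF that(1)] obtain y where y: "y \<in> forms n" "t - unfib y \<in> H" "\<tau> t = \<phi> y" by blast
    then have "y \<in> JJ \<inter> forms n" using \<pi>(2) \<phi>_form that(2) by simp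
    from H_closed(2)[OF y(2) unfib_JJ[OF this]] show ?thesis by simp
  qed
  have surj: "unfib y \<in> carrier ?G'" "\<tau> (unfib y) = \<pi> y" if y: "y \<in> forms n" for y
  proof -
    have "cl (Cst (mon \<alpha>)) \<in> N" if "mdeg \<alpha> = n" for \<alpha>
    proof -
      have "homog n (coef (Cst (mon \<alpha>) :: (4, (3, 'k) mpol) mpol) m)" for m
        using homog_single[of \<alpha> "1 :: 'k"] that by (simp add: Cst_def lookup_single when_def)
      then show ?thesis unfolding N_iff by blast
    qed
    then show "unfib y \<in> carrier ?G'"
      unfolding unfib_def by (intro sum_closed_free_Abelian_group) (simp add: unres(1))
    let ?A = "{\<alpha> :: 3 \<Rightarrow>\<^sub>0 nat. mdeg \<alpha> = n}"
    have "\<tau> (unfib y) = (\<Sum>\<alpha>\<in>?A. \<phi> (mon \<alpha> * Cst (coef y \<alpha>)))"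
      unfolding unfib_def \<tau>_def frag_sum_sum frag_sum_of w fib_Cst \<sigma>.ext_mon unres(2) ..
    also have "\<dots> = \<phi> (\<Sum>\<alpha>\<in>?A. mon \<alpha> * Cst (coef y \<alpha>))"
      using finite_mdeg[of n] by (induction rule: finite_induct) (simp_all add: \<phi>_0 \<phi>_add)
    also have "(\<Sum>\<alpha>\<in>?A. mon \<alpha> * Cst (coef y \<alpha>)) = y"
    proof -
      have "(\<Sum>\<alpha>\<in>Poly_Mapping.keys y. Cst (coef y \<alpha>) * mon \<alpha>) = (\<Sum>\<alpha>\<in>?A. Cst (coef y \<alpha>) * mon \<alpha>)"
        using y by (intro sum.mono_neutral_left finite_mdeg) (auto simp: forms_def homog_def in_keys_iff)
      then show ?thesis unfolding mono_decomp[of y, symmetric] by (simp only: mult.commute)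
    qed
    finally show "\<tau> (unfib y) = \<pi> y" unfolding \<phi>_form[OF y] .
  qed
  define T where "T C = \<tau> (SOME t. t \<in> C)" for C
  have T: "T (H #>\<^bsub>G\<^esub> t) = \<tau> t" for t
  proof -
    have "t \<in> H #>\<^bsub>G\<^esub> t" unfolding coset_iff by (simp add: H_closed)
    then have "(SOME t'. t' \<in> H #>\<^bsub>G\<^esub> t) - t \<in> H" unfolding coset_iff[symmetric] by (rule someI)
    from \<tau>_H[OF this] show ?thesis unfolding T_def \<tau>_simps by simp
  qed
  have \<tau>_m: "\<tau> (sm c t) = Cst (residue c) * \<tau> t" if c: "c \<in> carrier K" and "t \<in> carrier G" for c t
    using that(2)
  proof (induction t rule: free_induct)
    case (single k)
    then obtain b a where k: "k = (cl b, a)" "a \<in> carrier K" unfolding M_simps by blast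
    have "fib b * Cst (residue (c \<otimes>\<^bsub>K\<^esub> a)) = Cst (residue c) * (fib b * Cst (residue a))"
      unfolding theta(1)[OF c k(2)] Cst_mult by (simp only: mult_ac)
    then have "\<phi> (fib b * Cst (residue (c \<otimes>\<^bsub>K\<^esub> a))) = Cst (residue c) * \<phi> (fib b * Cst (residue a))"
      unfolding \<phi>_scale[symmetric] by (rule arg_cong)
    then show ?case unfolding k(1) by (simp add: \<tau>_simps w)
  qed (simp_all add: \<tau>_simps frag_extend_diff right_diff_distrib)
  have m_G': "sm c t \<in> carrier ?G'" if c: "c \<in> carrier K" and "t \<in> carrier ?G'" for c t
    using that(2)
  proof (induction t rule: free_induct)
    case (diff s t)
    then show ?case unfolding frag_extend_diff by (intro frag_diff_closed)
  next
    case (single k)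
    then obtain U a where "k = (U, a)" "U \<in> N" "a \<in> carrier K" by (cases k) simp
    then show ?case by (simp add: K.m_closed c del: carrier_free_Abelian_group_iff)
  qed simp
  let ?V = "fibre_part f bad_prime n"
  have V: "carrier ?V = {H #>\<^bsub>G\<^esub> t | t. t \<in> carrier ?G'}" "\<zero>\<^bsub>?V\<^esub> = H" "\<And>u v. u \<oplus>\<^bsub>?V\<^esub> v = u <#>\<^bsub>G\<^esub> v"
    "\<And>c U. c \<odot>\<^bsub>?V\<^esub> U = (\<Union>t\<in>U. H #>\<^bsub>G\<^esub> sm c t)"
    by (simp_all add: fibre_part_def base_change_def base_change_part_def Let_def FactGroup_def del: carrier_free_Abelian_group_iff)
  have V_zero: "\<zero>\<^bsub>?V\<^esub> = H #>\<^bsub>G\<^esub> 0" unfolding V by (auto simp: coset_iff)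
  have V_add: "(H #>\<^bsub>G\<^esub> s) \<oplus>\<^bsub>?V\<^esub> (H #>\<^bsub>G\<^esub> t) = H #>\<^bsub>G\<^esub> (s + t)" if "s \<in> carrier ?G'" "t \<in> carrier ?G'" for s t
    using normal.rcos_sum[OF comm_group.subgroup_imp_normal[OF abelian_free_Abelian_group H_subgroup], of s t] that free_mono
    unfolding V mult_free_Abelian_group by blast
  have V_smult: "c \<odot>\<^bsub>?V\<^esub> (H #>\<^bsub>G\<^esub> t) = H #>\<^bsub>G\<^esub> sm c t" if c: "c \<in> carrier K" for c t
  proof -
    have "H #>\<^bsub>G\<^esub> sm c t' = H #>\<^bsub>G\<^esub> sm c t" if "t' \<in> H #>\<^bsub>G\<^esub> t" for t'
      using m_H[OF c that[unfolded coset_iff]] unfolding frag_extend_diff by (rule coset_eq)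
    moreover have "t \<in> H #>\<^bsub>G\<^esub> t" unfolding coset_iff by (simp add: H_closed)
    ultimately show ?thesis unfolding V by blast
  qed
  have G'_add: "s + t \<in> carrier ?G'" if "s \<in> carrier ?G'" "t \<in> carrier ?G'" for s t
    using that Poly_Mapping.keys_add[of s t] by auto
  have im: "T ` carrier ?V = \<pi> ` forms n"
  proof (intro equalityI subsetI)
    fix z assume "z \<in> T ` carrier ?V"
    then obtain t where t: "t \<in> carrier ?G'" "z = \<tau> t" unfolding V using T by blast
    then show "z \<in> \<pi> ` forms n" using normal[OF t(1)] \<phi>_form by auto
  next
    fix z assume "z \<in> \<pi> ` forms n"
    then obtain y where y: "y \<in> forms n" "z = \<pi> y" by blast
    then show "z \<in> T ` carrier ?V" unfolding V using surj[OF y(1)] T by (intro image_eqI[of _ _ "H #>\<^bsub>G\<^esub> unfib y"]) auto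
  qed
  have "vectorspace.dim K ?V = mvs.dim (T ` carrier ?V)"
  proof (rule vectorspace_dim_transport[OF bad_kappa_cring residue_iso])
    show "fin_dim (T ` carrier ?V)" unfolding im by (rule fin_dim_mono[OF fin_dim_forms \<pi>(3)])
    show "\<zero>\<^bsub>?V\<^esub> \<in> carrier ?V" unfolding V_zero unfolding V by (intro CollectI exI[of _ 0]) simp
    show "T \<zero>\<^bsub>?V\<^esub> = 0" unfolding V_zero T by (simp add: \<tau>_simps)
    show "inj_on T (carrier ?V)"
    proof (rule inj_onI)
      fix C D assume "C \<in> carrier ?V" "D \<in> carrier ?V" and eq: "T C = T D"
      then obtain s t where st: "C = H #>\<^bsub>G\<^esub> s" "s \<in> carrier ?G'" "D = H #>\<^bsub>G\<^esub> t" "t \<in> carrier ?G'" unfolding V by blast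
      have "\<tau> (s - t) = 0" using eq unfolding st(1,3) T by (simp add: \<tau>_simps)
      then have "s - t \<in> H" using frag_diff_closed[OF st(2,4)] by (intro ker)
      then show "C = D" unfolding st by (rule coset_eq)
    qed
  next
    fix C D assume "C \<in> carrier ?V" "D \<in> carrier ?V"
    then obtain s t where st: "C = H #>\<^bsub>G\<^esub> s" "s \<in> carrier ?G'" "D = H #>\<^bsub>G\<^esub> t" "t \<in> carrier ?G'" unfolding V by blast
    show "C \<oplus>\<^bsub>?V\<^esub> D \<in> carrier ?V" unfolding st(1,3) V_add[OF st(2,4)] unfolding V using G'_add[OF st(2,4)] by blast
    show "T (C \<oplus>\<^bsub>?V\<^esub> D) = T C + T D" unfolding st(1,3) V_add[OF st(2,4)] T by (simp add: \<tau>_simps)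
  next
    fix c C assume c: "c \<in> carrier K" and "C \<in> carrier ?V"
    then obtain t where t: "C = H #>\<^bsub>G\<^esub> t" "t \<in> carrier ?G'" unfolding V by blast
    show "c \<odot>\<^bsub>?V\<^esub> C \<in> carrier ?V" unfolding t(1) V_smult[OF c] unfolding V using m_G'[OF c t(2)] by blast
    show "T (c \<odot>\<^bsub>?V\<^esub> C) = Cst (residue c) * T C"
      unfolding t(1) V_smult[OF c] T using free_mono t(2) by (intro \<tau>_m[OF c]) blast
  qed
  then show ?thesis unfolding im \<pi>(4) hfun_def .
qed

end

hide_const (open) FF JJ M K \<rho> cl G H N sm rep good fib unfib unres

section \<open>Hilbert polynomials and the conclusion\<close>

lemma hilbert_poly_eqI:
  assumes "\<And>n. n \<ge> N \<Longrightarrow> poly Q (of_nat n) = of_nat (h n)"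
  shows "hilbert_poly h = Q"
  unfolding hilbert_poly_def
proof (rule the_equality)
  show "\<forall>\<^sub>F n in sequentially. poly Q (of_nat n) = of_nat (h n)"
    using assms unfolding eventually_sequentially by blast
  fix P :: "rat poly" assume "\<forall>\<^sub>F n in sequentially. poly P (of_nat n) = of_nat (h n)"
  then obtain N' where N': "\<And>n. n \<ge> N' \<Longrightarrow> poly P (of_nat n) = of_nat (h n)" unfolding eventually_sequentially by blast
  have "of_nat ` {max N N'..} \<subseteq> {x. poly (P - Q) x = 0}" using assms N' by auto
  moreover have "infinite (of_nat ` {max N N'..} :: rat set)"
    by (simp add: finite_image_iff inj_on_def infinite_Ici)
  ultimately have "infinite {x. poly (P - Q) x = 0}" using finite_subset by blast
  then have "P - Q = 0" using poly_roots_finite by blast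
  then show "P = Q" by simp
qed

text \<open>Provides an infinite extension of a residue field that may be finite: the powers of the
  variable are distinct.\<close>

lemma infinite_fract_poly: "infinite (UNIV :: 'a::field poly fract set)"
proof -
  have "inj (\<lambda>n. to_fract (monom (1 :: 'a) n))" by (rule injI) (simp add: monom_eq_iff')
  then have "infinite (range (\<lambda>n. to_fract (monom (1 :: 'a) n)))" by (simp add: finite_image_iff)
  then show ?thesis using finite_subset[OF subset_UNIV] by blast
qed

lemma field_hom_to_fract_const: "field_hom (\<lambda>c :: 'a::field. to_fract [:c:])"
proof unfold_locales
  fix x y :: 'a
  show "to_fract [:x + y:] = to_fract [:x:] + to_fract [:y:]" unfolding to_fract_add[symmetric] by simp
  show "to_fract [:x * y:] = to_fract [:x:] * to_fract [:y:]" unfolding to_fract_mult[symmetric] by simp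
qed (simp_all add: pCons_one)

lemma field_hom_comp: "field_hom \<sigma> \<Longrightarrow> field_hom \<tau> \<Longrightarrow> field_hom (\<lambda>c. \<tau> (\<sigma> c))"
proof -
  assume "field_hom \<sigma>" "field_hom \<tau>"
  then interpret \<sigma>: field_hom \<sigma> + \<tau>: field_hom \<tau> .
  show ?thesis by unfold_locales (simp_all add: \<sigma>.hom_add \<tau>.hom_add \<sigma>.hom_mult \<tau>.hom_mult)
qed

text \<open>The residue field is enlarged to rational functions over it, so that general members
  exist; \<open>hfun_spec_ideal_ext\<close> shows that this leaves the Hilbert function of the fibre
  unchanged.\<close>

lemma hilbert_polynomial_avoids_plane:
  fixes f :: "4 \<Rightarrow> (3, 'k::field) mpol" and \<nu> :: int
  assumes f: "\<And>i. homog d (f i)" and bir: "birational_onto f (image_closure f)"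
    and fin: "finite (Vplus (fideal f))" and ci: "locally_ci (fideal f)" and \<nu>: "\<nu> \<ge> nu0 d f" "\<nu> \<ge> 1"
    and j: "Var j \<notin> (bad_prime :: (4, 'k) mpol set)"
  shows "poly (HP_fibre f bad_prime) (of_int \<nu>) \<noteq> of_int (\<nu> + 2) gchoose 2"
proof -
  have I: "fideal f = mul.span (range f)" by (simp add: fideal_def genideal_class_ring)
  have fin': "finite {p \<in> Proj. mul.span (range f) \<subseteq> p}" using fin unfolding Vplus_def I .
  obtain B where B: "\<And>n. hfun (mul.span (range f)) n \<le> B"
    using hfun_bounded_if_Vplus_finite[OF graded_range[OF f] fin'] by blast
  obtain b \<epsilon> where b: "\<And>i. homog \<epsilon> (b i)" "\<exists>i. subst f (b i) \<noteq> 0" "\<And>i j. subst f (b i) * Var j = subst f (b j) * Var (i :: 3)"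
    using bir unfolding birational_onto_def by blast
  define \<tau> :: "'k residue_dom fract \<Rightarrow> 'k residue_dom fract poly fract" where "\<tau> c = to_fract [:c:]" for c
  have \<tau>: "field_hom \<tau>" unfolding \<tau>_def by (rule field_hom_to_fract_const)
  interpret \<tau>: field_hom \<tau> by (rule \<tau>)
  have xj: "res_point j \<noteq> (0 :: 'k residue_dom fract)" by (rule res_point_j[OF f j])
  then have "\<tau> (res_point j) \<noteq> 0" by simp
  from residual_hilbert_function[where \<sigma> = "\<lambda>c. \<tau> (res_const c)" and f = f and d = d and B = B and \<epsilon> = \<epsilon> and b = b
      and x = "\<lambda>i. \<tau> (res_point i)" and ?s0.0 = j and \<nu> = \<nu>, OF field_hom_comp[OF field_hom_res_const \<tau>] infinite_fract_poly f ci B b this \<nu>]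
  obtain e \<delta> :: int and N where N: "\<forall>n\<ge>N. 2 * int (hfun (spec_ideal (\<lambda>i. \<tau> (res_point i))
        (\<lambda>i. field_hom.ext (\<lambda>c. \<tau> (res_const c)) (f i))) n) =
      (int n + 2) * (int n + 1) - (int n - e + 2) * (int n - e + 1) + 2 * \<delta>"
    and ne: "2 * \<delta> \<noteq> (\<nu> - e + 2) * (\<nu> - e + 1)" by (elim exE conjE) (rule that; assumption)
  let ?h = "\<lambda>n. hfun (spec_ideal res_point (\<lambda>i. field_hom.ext res_const (f i))) n"
  \<comment> \<open>The Hilbert polynomial has a factor one half, so its values are compared after
    doubling, as integers.\<close>
  define Q :: "rat poly" where "Q = smult (1 / 2) ([:2, 1:] * [:1, 1:] - [:2 - of_int e, 1:] * [:1 - of_int e, 1:]) + [:of_int \<delta>:]"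
  have Q: "2 * poly Q (of_int z) = of_int ((z + 2) * (z + 1) - (z - e + 2) * (z - e + 1) + 2 * \<delta>)" for z
  proof -
    have "2 * ((1 / 2) * A + D) = A + 2 * D" for A D :: rat by simp
    then have "2 * poly Q (of_int z) =
        ((2 + of_int z) * (1 + of_int z) - (2 - of_int e + of_int z) * (1 - of_int e + of_int z)) + 2 * of_int \<delta>"
      unfolding Q_def poly_add poly_smult poly_diff poly_mult by simp
    also have "\<dots> = of_int ((2 + z) * (1 + z) - (2 - e + z) * (1 - e + z) + 2 * \<delta>)" by simp
    also have "(2 + z) * (1 + z) - (2 - e + z) * (1 - e + z) = (z + 2) * (z + 1) - (z - e + 2) * (z - e + 1)"
      by (simp add: algebra_simps)
    finally show ?thesis .
  qed
  have "poly Q (of_nat n) = of_nat (?h n)" if "n \<ge> N" for n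
  proof -
    have eq: "hfun (spec_ideal (\<lambda>i. \<tau> (res_point i)) (\<lambda>i. field_hom.ext (\<lambda>c. \<tau> (res_const c)) (f i))) n = ?h n"
      by (rule hfun_spec_ideal_ext[of res_const \<tau> d f res_point j, OF field_hom_res_const \<tau> f xj])
    have "2 * int (?h n) = (int n + 2) * (int n + 1) - (int n - e + 2) * (int n - e + 1) + 2 * \<delta>"
      using N[rule_format, OF that] unfolding eq .
    then have "2 * poly Q (of_int (int n)) = of_int (2 * int (?h n))" unfolding Q by simp
    then show ?thesis by simp
  qed
  then have "hilbert_poly ?h = Q" by (rule hilbert_poly_eqI)
  then have HP: "HP_fibre f bad_prime = Q" unfolding HP_fibre_def fibre_dim[OF f j] .
  have "2 * (of_int (\<nu> + 2) gchoose 2 :: rat) = of_int ((\<nu> + 2) * (\<nu> + 1))"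
    by (simp add: gbinomial_prod_rev numeral_2_eq_2 algebra_simps)
  moreover have "2 * poly Q (of_int \<nu>) \<noteq> of_int ((\<nu> + 2) * (\<nu> + 1))" unfolding Q of_int_eq_iff using ne by simp
  ultimately show ?thesis unfolding HP by auto
qed

theorem theorem15:
  fixes f :: "4 \<Rightarrow> (3, 'k::field) mpol" and d :: nat and \<nu> :: int
  assumes "\<And>i. homog d (f i)"
    and "is_surface (image_closure f)"
    and "birational_onto f (image_closure f)"
    and "finite (Vplus (fideal f))"
    and "locally_ci (fideal f)"
    and "\<nu> \<ge> nu0 d f"
    and "\<nu> \<ge> 1"
  shows "{p \<in> (Proj :: (4, 'k) mpol set set).
      poly (HP_fibre f p) (of_int \<nu>) = poly (HP_plane TYPE('k)) (of_int \<nu>) \<and>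
      poly (HP_plane TYPE('k)) (of_int \<nu>) = of_int (\<nu> + 2) gchoose 2} = {}"
proof (rule ccontr)
  assume "\<not> ?thesis"
  then obtain p :: "(4, 'k) mpol set" where p: "p \<in> Proj" "poly (HP_fibre f p) (of_int \<nu>) = of_int (\<nu> + 2) gchoose 2"
    by auto
  then have "exceptional p" unfolding exceptional_def using assms by blast
  then have "exceptional (bad_prime :: (4, 'k) mpol set)" by (rule exceptional_bad_prime)
  \<comment> \<open>The chosen prime need not be \<open>p\<close>, nor its forms, degree and
    \<open>\<nu>'\<close> the given ones; the contradiction is drawn from the chosen data
    alone.\<close>
  then obtain f' :: "4 \<Rightarrow> (3, 'k) mpol" and d' \<nu>' where *: "(bad_prime :: (4, 'k) mpol set) \<in> Proj" "\<And>i. homog d' (f' i)"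
    "birational_onto f' (image_closure f')" "finite (Vplus (fideal f'))" "locally_ci (fideal f')" "\<nu>' \<ge> nu0 d' f'" "\<nu>' \<ge> 1"
    "poly (HP_fibre f' bad_prime) (of_int \<nu>') = of_int (\<nu>' + 2) gchoose 2"
    unfolding exceptional_def by blast
  obtain j where "Var j \<notin> (bad_prime :: (4, 'k) mpol set)" using *(1) unfolding Proj_iff by blast
  from hilbert_polynomial_avoids_plane[OF *(2-7) this] show False using *(8) by contradiction
qed

end
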